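(* There exist absolute constants $c_5,c_6>0$ such that for every $n\ge2$ and every $j\in\{1,\dots,n-1\}$ the following holds for all sufficiently small $\varepsilon>0$: i) If $P_\varepsilon\subset D_n$ is a simplicial polytope such that $V_j(D_n)-V_j(P_\varepsilon)\le\varepsilon$, then $$f_k(P_\varepsilon)\ge c_5\left(\frac{j\,V_j(D_n)}{2\varepsilon}\right)^{\frac{n-1}{2}}\ln n\qquad\text{for all }k\in\{0,\dots,\lfloor n/2\rfloor\}.$$ For $k\in\{0,1\}$ this bound holds even if $P_\varepsilon$ is not simplicial. ii) If $P_\varepsilon\supset D_n$ is a simplicial polytope such that $V_j(P_\varepsilon)-V_j(D_n)\le\varepsilon$, then $$f_k(P_\varepsilon)\ge c_6\left(\frac{j\,V_j(D_n)}{2\varepsilon}\right)^{\frac{n-1}{2}}\ln n\qquad\text{for all }k\in\{\lfloor 3(n-1)/4\rfloor,\dots,n-1\}.$$ For $k\in\{n-2,n-1\}$ this bound holds even if $P_\varepsilon$ is not simplicial.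
   Context: $D_n$ is the closed Euclidean unit ball in $\mathbb{R}^n$ and $|\cdot|$ is volume. The intrinsic volumes $V_0,\dots,V_n$ of a compact convex set $K\subset\mathbb{R}^n$ are defined by Steiner's formula $|K+rD_n|=\sum_{j=0}^n r^j|D_j|V_{n-j}(K)$ for all $r\ge0$. Polytopes are convex polytopes in $\mathbb{R}^n$, and $f_k(P)$ denotes the number of $k$-dimensional faces of $P$. "Absolute constant" means independent of $n,j,k,\varepsilon$; the threshold for "sufficiently small $\varepsilon$" may depend on $n$ and $j$. *)

theory Defs
  imports "HOL-Analysis.Analysis" "HOL-Analysis.Finite_Function_Topology"
begin

text \<open>
  The constants of the theorem are uniform in the dimension, so all the spaces \<open>\<real>\<^sup>n\<close> have to live in one
  type.  We use finitely supported real sequences, a \<^class>\<open>real_vector\<close> in the library, and take \<open>\<real>\<^sup>n\<close> to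
  be the sequences supported in \<open>{..<n}\<close>.  Thus \<^const>\<open>polytope\<close>, \<^const>\<open>face_of\<close>, \<^const>\<open>affine_dependent\<close> are
  available, but \<^const>\<open>aff_dim\<close>, \<^const>\<open>simplex\<close> and \<^const>\<open>lborel\<close>, which need \<^class>\<open>euclidean_space\<close>, are not.
  The library \<^const>\<open>norm\<close> on this type is the \<open>\<ell>\<^sub>1\<close> norm and is not used.
\<close>

definition Rn :: "nat \<Rightarrow> (nat \<Rightarrow>\<^sub>0 real) set" where
  "Rn n = {x. Poly_Mapping.keys x \<subseteq> {..<n}}"

definition unit_ball :: "nat \<Rightarrow> (nat \<Rightarrow>\<^sub>0 real) set" where
  "unit_ball n = {x \<in> Rn n. sqrt (\<Sum>i<n. (Poly_Mapping.lookup x i)\<^sup>2) \<le> 1}"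

text \<open>
  Lebesgue measure on \<open>\<real>\<^sup>n\<close>, as a product measure on extensional functions.  For \<open>n = 0\<close> this is the
  counting measure on the one-point space \<open>\<real>\<^sup>0\<close>, so that \<open>volume 0 (unit_ball 0) = 1\<close>.
\<close>

definition volume :: "nat \<Rightarrow> (nat \<Rightarrow>\<^sub>0 real) set \<Rightarrow> real" where
  "volume n A = measure (Pi\<^sub>M {..<n} (\<lambda>_. lborel))
     ((\<lambda>x. restrict (Poly_Mapping.lookup x) {..<n}) ` A)"

definition parallel_body :: "nat \<Rightarrow> (nat \<Rightarrow>\<^sub>0 real) set \<Rightarrow> real \<Rightarrow> (nat \<Rightarrow>\<^sub>0 real) set" where
  "parallel_body n K r = {x + r *\<^sub>R y | x y. x \<in> K \<and> y \<in> unit_ball n}"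

text \<open>
  Steiner's formula determines \<open>V 0, \<dots>, V n\<close> for compact convex \<open>K \<subseteq> \<real>\<^sup>n\<close>, because the coefficients of
  a polynomial function on \<open>[0,\<infinity>)\<close> are unique and all \<open>volume i (unit_ball i)\<close> are positive.
\<close>

definition steiner :: "nat \<Rightarrow> (nat \<Rightarrow>\<^sub>0 real) set \<Rightarrow> (nat \<Rightarrow> real) \<Rightarrow> bool" where
  "steiner n K V \<longleftrightarrow> (\<forall>r\<ge>0. volume n (parallel_body n K r) =
     (\<Sum>i=0..n. r ^ i * volume i (unit_ball i) * V (n - i)))"

definition intrinsic_volume :: "nat \<Rightarrow> nat \<Rightarrow> (nat \<Rightarrow>\<^sub>0 real) set \<Rightarrow> real" where
  "intrinsic_volume n j K = (THE v. \<exists>V. steiner n K V \<and> V j = v)"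

text \<open>The analogue of \<open>aff_dim S = int k\<close>.\<close>

definition has_aff_dim :: "'a::real_vector set \<Rightarrow> nat \<Rightarrow> bool" where
  "has_aff_dim S k \<longleftrightarrow>
     (\<exists>B. affine hull B = affine hull S \<and> \<not> affine_dependent B \<and> card B = k + 1)"

definition face_number :: "nat \<Rightarrow> 'a::real_vector set \<Rightarrow> nat" where
  "face_number k P = card {F. F face_of P \<and> has_aff_dim F k}"

text \<open>
  All proper faces are simplices; the empty face is the hull of \<open>C = {}\<close>.
\<close>

definition simplicial :: "'a::real_vector set \<Rightarrow> bool" where
  "simplicial P \<longleftrightarrow>
     (\<forall>F. F face_of P \<and> F \<noteq> P \<longrightarrow>
        (\<exists>C. finite C \<and> \<not> affine_dependent C \<and> F = convex hull C))"

end

theory Submission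
  imports Defs "HOL-Probability.Probability"
begin

text \<open>Let \<open>U\<close> be the uniform distribution on the ball.  For independent \<open>u\<^sub>1, u\<^sub>2, \<dots>\<close> with law \<open>U\<close> the
  zonotopes \<open>(1/M) \<Sum> [0, u\<^sub>l]\<close> converge, up to translation, to a ball of radius \<open>beta n\<close>.  Expanding the expected volume
  of \<open>K + (r/M) \<Sum> [0, u\<^sub>l]\<close> in \<open>r\<close> therefore proves Steiner's formula and identifies \<open>V\<^sub>n\<^sub>-\<^sub>i K\<close>, up to a constant depending on \<open>n\<close> and
  \<open>i\<close>, with the mean \<open>Phi n i K\<close> of the volume of the projection of \<open>K\<close> orthogonal to \<open>u\<^sub>1, \<dots>, u\<^sub>i\<close>, weighted by
  the volume spanned by \<open>u\<^sub>1, \<dots>, u\<^sub>i\<close>.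

  Averaging Lebesgue measure on these orthogonal complements gives a rotation-invariant measure \<open>LM n i\<close> on \<open>\<real>\<^sup>n\<close> that
  agrees with \<open>Phi n i\<close> on balls.  If \<open>P = conv S\<close> lies in the ball, the projections of \<open>P\<close> miss every point \<open>x\<close> with
  \<open>h\<^sub>P(x) < \<bar>x\<bar>\<^sup>2\<close>, so the deficit of \<open>P\<close> is at least the \<open>LM\<close>-measure of the points of the ball that are in no cap around a
  point of \<open>S\<close>.  By invariance the share of a cap in a thin shell is the same for \<open>LM\<close> and for volume, and
  \<open>card S\<close> caps are too few to fill the outer shells unless \<open>card S\<close> is as large as claimed; the factor \<open>ln n\<close> is far below the
  \<open>\<surd>n\<close> gained from the ratio of the volumes of balls of dimensions \<open>n\<close> and \<open>n - 1\<close>.  The circumscribed case is the same, with facet normals in place of vertices.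

  The bounds for the other faces compare \<open>f\<^sub>k\<close> with the number of vertices or of facets: each vertex lies on an
  edge, each facet contains a ridge, the simplices with \<open>i < n/2\<close> vertices inside a facet extend in at least as many ways as they can be
  shortened, and a generic vector \<open>u\<close> tells the facets of a simplicial polytope apart by the vertices with
  positive coefficient in the expansion of \<open>u\<close>.\<close>

text \<open>The bound contains \<open>1/\<epsilon>\<close> to the power \<open>(n-1)/2\<close>, so a
  constant factor lost in the deficit would cost a factor exponential in \<open>n\<close>; the
  deficit is needed up to \<open>1 + O(1/n)\<close>. This is why a single shell is not enough. If
  the bounds for the shares of the caps of depth \<open>t0\<close> add up to at most 1, those for
  depth \<open>t \<le> t0\<close> add up to at most \<open>(t/t0)^((n-1)/2)\<close>, whose mean over
  \<open>t\<close> is only \<open>2/(n+1)\<close>. The \<open>6 n\<close> shells form a Riemann sum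
  for this mean, and \<open>yM n\<close> bounds what is lost. The constant \<open>exp (- 6)\<close>
  pays for the power \<open>(n-1)/2\<close> of these corrections. Zonotopes are chosen because
  adding a segment changes the volume by one projected volume, which translation invariance alone
  proves: no bases of subspaces and no measure on a Grassmannian occur, and reflections carry all of
  the rotation invariance. Facets are studied as vertices of the polar body, which needs the origin
  inside \<open>P\<close>. That is automatic if \<open>P\<close> contains the ball; for inscribed
  \<open>P\<close> it follows from a small deficit and is one source of the threshold for
  \<open>\<epsilon>\<close>.\<close>

type_synonym vec = "nat \<Rightarrow>\<^sub>0 real"

abbreviation lk :: "vec \<Rightarrow> nat \<Rightarrow> real" where "lk \<equiv> Poly_Mapping.lookup"

section \<open>Inner product, Euclidean norm and compactness in \<open>Rn n\<close>\<close>

definition ip :: "nat \<Rightarrow> vec \<Rightarrow> vec \<Rightarrow> real" where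
  "ip n x y = (\<Sum>i<n. lk x i * lk y i)"

definition nrm :: "nat \<Rightarrow> vec \<Rightarrow> real" where
  "nrm n x = sqrt (ip n x x)"

lemma lk_scaleR [simp]: "lk (r *\<^sub>R x) i = r * lk x i"
proof -
  have "finite {i. r *\<^sub>R lk x i \<noteq> 0}"
    by (rule finite_subset[OF _ finite_keys[of x]]) (auto simp: in_keys_iff)
  then show ?thesis
    by (simp add: scaleR_poly_mapping_def Abs_poly_mapping_inverse)
qed

lemma lk_minus [simp]: "lk (x - y) i = lk x i - lk y i"
  by (simp add: lookup_minus)

lemma lk_add [simp]: "lk (x + y) i = lk x i + lk y i"
  by (simp add: lookup_add)

lemma lk_sum: "lk (sum f A) i = (\<Sum>a\<in>A. lk (f a) i)"
  by (induction A rule: infinite_finite_induct) auto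

lemma Rn_iff: "x \<in> Rn n \<longleftrightarrow> (\<forall>i\<ge>n. lk x i = 0)"
  by (auto simp: Rn_def in_keys_iff subset_iff) (meson not_le)

lemma subspace_Rn [simp]: "subspace (Rn n)"
  by (auto simp: subspace_def Rn_iff)

lemma Rn_0 [simp]: "0 \<in> Rn n" by (simp add: Rn_iff)
lemma Rn_add [intro, simp]: "x \<in> Rn n \<Longrightarrow> y \<in> Rn n \<Longrightarrow> x + y \<in> Rn n" by (simp add: Rn_iff)
lemma Rn_diff [intro, simp]: "x \<in> Rn n \<Longrightarrow> y \<in> Rn n \<Longrightarrow> x - y \<in> Rn n" by (simp add: Rn_iff)
lemma Rn_minus [intro, simp]: "x \<in> Rn n \<Longrightarrow> - x \<in> Rn n" by (simp add: Rn_iff)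
lemma Rn_scale [intro, simp]: "x \<in> Rn n \<Longrightarrow> r *\<^sub>R x \<in> Rn n" by (simp add: Rn_iff)
lemma Rn_sum [intro]: "(\<And>a. a \<in> A \<Longrightarrow> f a \<in> Rn n) \<Longrightarrow> sum f A \<in> Rn n"
  by (simp add: subspace_sum)

lemma convex_Rn [simp]: "convex (Rn n)"
  by (simp add: subspace_imp_convex)

lemma Rn_eqI: "x \<in> Rn n \<Longrightarrow> y \<in> Rn n \<Longrightarrow> (\<And>i. i < n \<Longrightarrow> lk x i = lk y i) \<Longrightarrow> x = y"
  by (rule poly_mapping_eqI) (metis Rn_iff not_le)

lemma ip_add_left [simp]: "ip n (x + y) z = ip n x z + ip n y z"
  by (simp add: ip_def ring_distribs sum.distrib)
lemma ip_add_right [simp]: "ip n z (x + y) = ip n z x + ip n z y"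
  by (simp add: ip_def ring_distribs sum.distrib)
lemma ip_diff_left [simp]: "ip n (x - y) z = ip n x z - ip n y z"
  by (simp add: ip_def ring_distribs sum_subtractf)
lemma ip_diff_right [simp]: "ip n z (x - y) = ip n z x - ip n z y"
  by (simp add: ip_def ring_distribs sum_subtractf)
lemma ip_scale_left [simp]: "ip n (r *\<^sub>R x) z = r * ip n x z"
  by (simp add: ip_def sum_distrib_left mult_ac)
lemma ip_scale_right [simp]: "ip n z (r *\<^sub>R x) = r * ip n z x"
  by (simp add: ip_def sum_distrib_left mult_ac)
lemma ip_zero_left [simp]: "ip n 0 z = 0" by (simp add: ip_def)
lemma ip_zero_right [simp]: "ip n z 0 = 0" by (simp add: ip_def)
lemma ip_minus_left [simp]: "ip n (- x) z = - ip n x z"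
  by (simp add: ip_def sum_negf)
lemma ip_minus_right [simp]: "ip n z (- x) = - ip n z x"
  by (simp add: ip_def sum_negf)
lemma ip_sym: "ip n x y = ip n y x"
  by (simp add: ip_def mult.commute)
lemma ip_sum_left: "ip n (sum f A) z = (\<Sum>a\<in>A. ip n (f a) z)"
  by (induction A rule: infinite_finite_induct) auto
lemma ip_sum_right: "ip n z (sum f A) = (\<Sum>a\<in>A. ip n z (f a))"
  by (induction A rule: infinite_finite_induct) auto

lemma nrm_L2: "nrm n x = L2_set (lk x) {..<n}"
  by (simp add: nrm_def ip_def L2_set_def power2_eq_square)

lemma ip_self_ge0 [simp]: "0 \<le> ip n x x"
  by (simp add: ip_def sum_nonneg)

lemma nrm_ge0 [simp]: "0 \<le> nrm n x"
  by (simp add: nrm_def)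

lemma nrm_sq: "(nrm n x)\<^sup>2 = ip n x x"
  by (simp add: nrm_def)

lemma ip_self_eq: "ip n x x = (nrm n x)\<^sup>2"
  by (simp add: nrm_def)

lemma ip_self_0: "x \<in> Rn n \<Longrightarrow> ip n x x = 0 \<longleftrightarrow> x = 0"
proof
  assume x: "x \<in> Rn n" "ip n x x = 0"
  then have "\<forall>i<n. lk x i = 0"
    unfolding ip_def by (subst (asm) sum_nonneg_eq_0_iff) auto
  then show "x = 0" using x by (intro Rn_eqI[of _ n]) auto
qed simp

lemma ip_self_pos: "x \<in> Rn n \<Longrightarrow> x \<noteq> 0 \<Longrightarrow> ip n x x > 0"
  using ip_self_0[of x n] ip_self_ge0[of n x] by linarith

lemma nrm_0 [simp]: "nrm n 0 = 0" by (simp add: nrm_def)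

lemma nrm_pos: "x \<in> Rn n \<Longrightarrow> x \<noteq> 0 \<Longrightarrow> nrm n x > 0"
  by (simp add: nrm_def ip_self_pos)

lemma nrm_scale [simp]: "nrm n (r *\<^sub>R x) = \<bar>r\<bar> * nrm n x"
  by (simp add: nrm_def real_sqrt_mult flip: mult.assoc power2_eq_square)

lemma nrm_minus [simp]: "nrm n (- x) = nrm n x"
  by (simp add: nrm_def)

lemma nrm_triangle: "nrm n (x + y) \<le> nrm n x + nrm n y"
proof -
  have "lk (x + y) = (\<lambda>i. lk x i + lk y i)" by auto
  then show ?thesis by (simp only: nrm_L2 L2_set_triangle_ineq)
qed

lemma nrm_triangle_diff: "nrm n (x - y) \<le> nrm n x + nrm n y"
  using nrm_triangle[of n x "-y"] by simp

lemma ip_cauchy_abs: "\<bar>ip n x y\<bar> \<le> nrm n x * nrm n y"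
proof -
  have "\<bar>ip n x y\<bar> \<le> (\<Sum>i<n. \<bar>lk x i\<bar> * \<bar>lk y i\<bar>)"
    unfolding ip_def by (rule order_trans[OF sum_abs]) (simp add: abs_mult)
  also have "\<dots> \<le> nrm n x * nrm n y"
    unfolding nrm_L2 by (rule L2_set_mult_ineq)
  finally show ?thesis .
qed

lemma ip_cauchy: "ip n x y \<le> nrm n x * nrm n y"
  using ip_cauchy_abs[of n x y] by linarith

lemma unit_ball_iff: "x \<in> unit_ball n \<longleftrightarrow> x \<in> Rn n \<and> nrm n x \<le> 1"
  by (simp add: unit_ball_def nrm_def ip_def power2_eq_square)

lemma abs_lk_le_norm: "\<bar>lk x i\<bar> \<le> norm x"
proof -
  have "\<bar>lk x i\<bar> = (if i \<in> Poly_Mapping.keys x then \<bar>lk x i\<bar> else 0)"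
    by (auto simp: in_keys_iff)
  also have "\<dots> \<le> (\<Sum>k\<in>Poly_Mapping.keys x. \<bar>lk x k\<bar>)"
    by (auto intro!: member_le_sum sum_nonneg)
  also have "\<dots> = norm x"
    by (simp add: norm_poly_mapping_def dist_poly_mapping_def)
  finally show ?thesis .
qed

lemma bounded_linear_lk: "bounded_linear (\<lambda>x. lk x i)"
  by (rule bounded_linear_intro[where K=1]) (auto simp: abs_lk_le_norm)

lemma continuous_on_lk [continuous_intros]:
  "continuous_on S f \<Longrightarrow> continuous_on S (\<lambda>x. lk (f x) i)"
  by (rule bounded_linear.continuous_on[OF bounded_linear_lk])

lemma continuous_on_ip [continuous_intros]:
  "continuous_on S f \<Longrightarrow> continuous_on S g \<Longrightarrow> continuous_on S (\<lambda>x. ip n (f x) (g x))"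
  unfolding ip_def by (intro continuous_intros)

lemma continuous_on_nrm [continuous_intros]:
  "continuous_on S f \<Longrightarrow> continuous_on S (\<lambda>x. nrm n (f x))"
  unfolding nrm_def by (intro continuous_intros)

definition bas :: "nat \<Rightarrow> vec" where "bas i = Poly_Mapping.single i 1"

lemma lk_bas [simp]: "lk (bas i) k = (if i = k then 1 else 0)"
  by (simp add: bas_def lookup_single when_def)

lemma bas_Rn [simp]: "i < n \<Longrightarrow> bas i \<in> Rn n"
  by (simp add: Rn_iff)

definition emb :: "nat \<Rightarrow> (nat \<Rightarrow> real) \<Rightarrow> vec" where
  "emb n f = (\<Sum>i<n. f i *\<^sub>R bas i)"

lemma lk_emb [simp]: "lk (emb n f) i = (if i < n then f i else 0)"
proof -
  have "lk (emb n f) i = (\<Sum>k<n. if k = i then f k else 0)"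
    by (simp add: emb_def lk_sum if_distrib cong: if_cong)
  then show ?thesis by (simp add: sum.delta)
qed

lemma emb_Rn [simp]: "emb n f \<in> Rn n"
  by (simp add: Rn_iff)

lemma emb_lk: "x \<in> Rn n \<Longrightarrow> emb n (lk x) = x"
  by (rule Rn_eqI[of _ n]) auto

lemma ip_bas [simp]: "i < n \<Longrightarrow> ip n x (bas i) = lk x i"
proof -
  assume "i < n"
  have "ip n x (bas i) = (\<Sum>k<n. if k = i then lk x k else 0)"
    unfolding ip_def by (intro sum.cong) auto
  then show ?thesis using \<open>i < n\<close> by (simp add: sum.delta)
qed

lemma abs_lk_le_nrm: "i < n \<Longrightarrow> \<bar>lk x i\<bar> \<le> nrm n x"
  using ip_cauchy_abs[of n x "bas i"] by (simp add: nrm_def[of n "bas i"])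

text \<open>This comparison with the l1 norm lets boundedness and finite nets found in the metric of
  the type be read in terms of \<open>nrm\<close>.\<close>

lemma nrm_le_norm: "nrm n x \<le> norm x"
proof (cases "n = 0")
  case True then show ?thesis by (simp add: nrm_def ip_def)
next
  case False
  have "nrm n x \<le> (\<Sum>i<n. \<bar>lk x i\<bar>)" unfolding nrm_L2 by (rule L2_set_le_sum_abs)
  also have "\<dots> = (\<Sum>i\<in>{..<n} \<inter> Poly_Mapping.keys x. \<bar>lk x i\<bar>)"
    by (rule sum.mono_neutral_right) (auto simp: in_keys_iff)
  also have "\<dots> \<le> (\<Sum>i\<in>Poly_Mapping.keys x. \<bar>lk x i\<bar>)"
    by (rule sum_mono2) auto
  also have "\<dots> = norm x"
    by (simp add: norm_poly_mapping_def dist_poly_mapping_def)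
  finally show ?thesis .
qed

text \<open>The whole type is infinite-dimensional, so closed bounded sets need not be compact. The
  box is built one coordinate at a time as a continuous image of a product with an interval; it
  yields Heine-Borel inside \<open>Rn n\<close>.\<close>

lemma compact_box: "compact (emb n ` (PiE {..<n} (\<lambda>_. {-c..c})))"
proof (induction n)
  case 0
  have "emb 0 ` (PiE {..<0} (\<lambda>_. {-c..c})) = {0}"
    by (auto simp: emb_def)
  then show ?case by simp
next
  case (Suc n)
  let ?B = "emb n ` (PiE {..<n} (\<lambda>_. {-c..c}))"
  have eq: "emb (Suc n) ` (PiE {..<Suc n} (\<lambda>_. {-c..c})) = (\<lambda>(x, t). x + t *\<^sub>R bas n) ` (?B \<times> {-c..c})"
    (is "?L = ?R")
  proof
    show "?L \<subseteq> ?R"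
    proof
      fix x assume "x \<in> ?L"
      then obtain f where f: "f \<in> PiE {..<Suc n} (\<lambda>_. {-c..c})" "x = emb (Suc n) f" by auto
      let ?f = "restrict f {..<n}"
      have "x = emb n ?f + f n *\<^sub>R bas n" using f by (simp add: emb_def)
      moreover have "?f \<in> PiE {..<n} (\<lambda>_. {-c..c})" "f n \<in> {-c..c}"
        using f by (auto simp: PiE_iff)
      ultimately show "x \<in> ?R" by (intro image_eqI[of _ _ "(emb n ?f, f n)"]) auto
    qed
    show "?R \<subseteq> ?L"
    proof
      fix x assume "x \<in> ?R"
      then obtain f t where f: "f \<in> PiE {..<n} (\<lambda>_. {-c..c})" "t \<in> {-c..c}" "x = emb n f + t *\<^sub>R bas n" by auto
      let ?f = "f(n := t)"
      have "(\<Sum>i<n. ?f i *\<^sub>R bas i) = (\<Sum>i<n. f i *\<^sub>R bas i)" by (intro sum.cong) auto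
      then have "x = emb (Suc n) ?f" using f by (simp add: emb_def)
      moreover have "?f \<in> PiE {..<Suc n} (\<lambda>_. {-c..c})"
        using f by (auto simp: PiE_iff extensional_def)
      ultimately show "x \<in> ?L" by blast
    qed
  qed
  show ?case unfolding eq case_prod_unfold
    by (intro compact_continuous_image compact_Times Suc continuous_intros) auto
qed

lemma closed_Rn [simp]: "closed (Rn n)"
proof -
  have "Rn n = (\<Inter>i\<in>{n..}. {x. lk x i = 0})" by (auto simp: Rn_iff)
  moreover have "closed {x. lk x i = 0}" for i
    by (intro closed_Collect_eq continuous_intros)
  ultimately show ?thesis by auto
qed

lemma compact_Rn:
  assumes "closed S" "S \<subseteq> Rn n" "\<And>x. x \<in> S \<Longrightarrow> nrm n x \<le> c"
  shows "compact S"
proof -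
  have "S \<subseteq> emb n ` (PiE {..<n} (\<lambda>_. {-c..c}))"
  proof
    fix x assume x: "x \<in> S"
    then have "\<bar>lk x i\<bar> \<le> c" if "i < n" for i
      using abs_lk_le_nrm[OF that, of x] assms(3)[of x] by linarith
    then have "restrict (lk x) {..<n} \<in> PiE {..<n} (\<lambda>_. {-c..c})" by (auto simp: abs_le_iff minus_le_iff)
    moreover have "x = emb n (restrict (lk x) {..<n})"
      using x assms by (intro Rn_eqI[of _ n]) auto
    ultimately show "x \<in> emb n ` (PiE {..<n} (\<lambda>_. {-c..c}))" by blast
  qed
  then show ?thesis
    using compact_Int_closed[OF compact_box[of n c] assms(1)] by (simp add: Int_absorb1)
qed

definition cb :: "nat \<Rightarrow> real \<Rightarrow> vec set" where
  "cb n r = {x \<in> Rn n. nrm n x \<le> r}"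

lemma unit_ball_cb: "unit_ball n = cb n 1"
  by (auto simp: unit_ball_iff cb_def)

lemma closed_cb [simp]: "closed (cb n r)"
proof -
  have "cb n r = Rn n \<inter> {x. nrm n x \<le> r}" by (auto simp: cb_def)
  moreover have "closed {x. nrm n x \<le> r}" by (intro closed_Collect_le continuous_intros)
  ultimately show ?thesis by (metis closed_Int closed_Rn)
qed

lemma compact_cb [simp]: "compact (cb n r)"
  by (rule compact_Rn[of _ n r]) (simp, auto simp: cb_def)

lemma convex_cb [simp]: "convex (cb n r)"
proof (rule convexI)
  fix x y u v assume a: "x \<in> cb n r" "y \<in> cb n r" "(0::real) \<le> u" "0 \<le> v" "u + v = 1"
  have "nrm n (u *\<^sub>R x + v *\<^sub>R y) \<le> u * nrm n x + v * nrm n y"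
    using nrm_triangle[of n "u *\<^sub>R x" "v *\<^sub>R y"] a by simp
  also have "\<dots> \<le> u * r + v * r" using a by (intro add_mono mult_left_mono) (auto simp: cb_def)
  also have "\<dots> = r" using a by (metis distrib_right mult_1)
  finally show "u *\<^sub>R x + v *\<^sub>R y \<in> cb n r" using a by (simp add: cb_def)
qed

text \<open>Projection onto the orthogonal complement of \<open>u\<close>; for \<open>u = 0\<close> it is the identity.\<close>

definition pr :: "nat \<Rightarrow> vec \<Rightarrow> vec \<Rightarrow> vec" where
  "pr n u x = x - (ip n x u / ip n u u) *\<^sub>R u"

lemma pr_Rn [simp, intro]: "u \<in> Rn n \<Longrightarrow> x \<in> Rn n \<Longrightarrow> pr n u x \<in> Rn n"
  by (auto simp: pr_def)

lemma pr_add: "pr n u (x + y) = pr n u x + pr n u y"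
  by (simp add: pr_def add_divide_distrib algebra_simps)

lemma pr_scale: "pr n u (r *\<^sub>R x) = r *\<^sub>R pr n u x"
  by (simp add: pr_def algebra_simps)

lemma linear_pr: "linear (pr n u)"
  by (rule linearI) (simp_all add: pr_add pr_scale)

lemma pr_self: "u \<in> Rn n \<Longrightarrow> pr n u u = 0"
  by (cases "u = 0") (auto simp: pr_def ip_self_0)

lemma ip_pr: "u \<in> Rn n \<Longrightarrow> ip n (pr n u x) u = 0"
  by (cases "u = 0") (auto simp: pr_def ip_self_0)

lemma pr_orth: "ip n x u = 0 \<Longrightarrow> pr n u x = x"
  by (simp add: pr_def)

lemma pr_idem: "u \<in> Rn n \<Longrightarrow> pr n u (pr n u x) = pr n u x"
  by (simp add: pr_orth ip_pr)

lemma ip_pr_adj: "ip n (pr n u x) y = ip n x (pr n u y)"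
  by (simp add: pr_def ip_sym[of n u y])

lemma nrm_pr_le: "u \<in> Rn n \<Longrightarrow> nrm n (pr n u x) \<le> nrm n x"
proof -
  assume u: "u \<in> Rn n"
  have "(nrm n (pr n u x))\<^sup>2 = ip n x (pr n u x)"
    using ip_pr_adj[of n u x "pr n u x"] pr_idem[OF u] by (simp add: nrm_sq)
  also have "\<dots> \<le> nrm n x * nrm n (pr n u x)" by (rule ip_cauchy)
  finally have "nrm n (pr n u x) * nrm n (pr n u x) \<le> nrm n x * nrm n (pr n u x)"
    by (simp add: power2_eq_square)
  then show ?thesis
    by (metis mult_le_cancel_right not_le nrm_ge0 order.trans order_less_le)
qed

lemma pr_scale_dir: "s \<noteq> 0 \<Longrightarrow> pr n (s *\<^sub>R u) x = pr n u x"
  by (simp add: pr_def)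

lemma continuous_on_pr [continuous_intros]: "continuous_on S (pr n u)"
  unfolding pr_def[abs_def] divide_inverse by (intro continuous_intros)

text \<open>The normal \<open>w\<close> points from the nearest point \<open>p\<close> of
  \<open>C\<close> to \<open>x\<close>; a point of \<open>C\<close> beyond the hyperplane through
  \<open>p\<close> would allow a step from \<open>p\<close> towards it that comes closer to
  \<open>x\<close>.\<close>

lemma separation:
  assumes C: "compact C" "convex C" "C \<subseteq> Rn n" "C \<noteq> {}" and x: "x \<in> Rn n" "x \<notin> C"
  obtains w b where "w \<in> Rn n" "w \<noteq> 0" "\<And>y. y \<in> C \<Longrightarrow> ip n y w \<le> b" "b < ip n x w"
proof -
  have "continuous_on C (\<lambda>y. ip n (y - x) (y - x))" by (intro continuous_intros)
  then obtain p where p: "p \<in> C" "\<And>y. y \<in> C \<Longrightarrow> ip n (p - x) (p - x) \<le> ip n (y - x) (y - x)"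
    using continuous_attains_inf[OF C(1,4)] by blast
  define w where "w = x - p"
  have w: "w \<in> Rn n" "w \<noteq> 0" using p x C by (auto simp: w_def)
  have "ip n y w \<le> ip n p w" if y: "y \<in> C" for y
  proof (rule ccontr)
    assume "\<not> ip n y w \<le> ip n p w"
    then have pos: "ip n (y - p) w > 0" by simp
    let ?q = "ip n (y - p) (y - p)"
    have qn: "?q \<ge> 0" by (rule ip_self_ge0)
    \<comment> \<open>Chosen so that the quadratic term \<open>t * ?q\<close> stays below twice the
      linear gain, while \<open>t \<le> 1\<close> keeps the point in \<open>C\<close>.\<close>
    define t where "t = min 1 (ip n (y - p) w / (?q + 1))"
    have t: "0 < t" "t \<le> 1" using pos qn by (auto simp: t_def intro!: divide_pos_pos)
    have "t * (?q + 1) \<le> ip n (y - p) w"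
    proof -
      have "t * (?q+1) \<le> ip n (y - p) w / (?q + 1) * (?q + 1)"
        using qn by (intro mult_right_mono) (auto simp: t_def)
      then show ?thesis using qn by simp
    qed
    then have tq: "t * ?q < 2 * ip n (y - p) w" using pos t by (simp add: distrib_left)
    have "(1 - t) *\<^sub>R p + t *\<^sub>R y \<in> C"
      using C(2) p(1) y t by (auto simp: convex_def)
    from p(2)[OF this]
    have "ip n w w \<le> ip n (t *\<^sub>R (y - p) - w) (t *\<^sub>R (y - p) - w)"
      by (simp add: w_def algebra_simps)
    also have "\<dots> = t * (t * ?q) - 2 * t * ip n (y - p) w + ip n w w"
      by (simp add: algebra_simps ip_sym[of n w y] ip_sym[of n w p])
    finally have "2 * t * ip n (y - p) w \<le> t * (t * ?q)" by simp
    then have "t * (2 * ip n (y - p) w) \<le> t * (t * ?q)" by (simp only: mult_ac)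
    then have "2 * ip n (y - p) w \<le> t * ?q" using t by simp
    with tq show False by simp
  qed
  moreover have "ip n p w < ip n x w"
    using ip_self_pos[OF w] by (simp add: w_def)
  ultimately show ?thesis using that w by blast
qed

section \<open>Borel measurability of maps into \<open>Rn n\<close>\<close>

abbreviation rb :: "nat \<Rightarrow> vec measure" where "rb n \<equiv> restrict_space borel (Rn n)"

lemma space_rb [simp]: "space (rb n) = Rn n"
  by (simp add: space_restrict_space)

lemma sets_rb_closed: "closed C \<Longrightarrow> C \<subseteq> Rn n \<Longrightarrow> C \<in> sets (rb n)"
  by (subst sets_restrict_space_iff) (auto intro: borel_closed)

lemma Rn_sets_rb [simp]: "Rn n \<in> sets (rb n)"
  using sets.top[of "rb n"] by simp

text \<open>\<open>emb n\<close> is continuous for the product topology on all functions, whose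
  Borel sets are those of the infinite product measure space. A tuple on \<open>{..<n}\<close> is
  first padded with zeros to get there.\<close>

lemma emb_borel: "emb n \<in> PiM {..<n} (\<lambda>_. lborel) \<rightarrow>\<^sub>M borel"
proof -
  have 1: "(\<lambda>f i. if i < n then f i else (0::real)) \<in> PiM {..<n} (\<lambda>_. lborel) \<rightarrow>\<^sub>M PiM UNIV (\<lambda>_. borel)"
  proof (rule measurable_PiM_single')
    fix i :: nat
    show "(\<lambda>f. if i < n then f i else (0::real)) \<in> borel_measurable (PiM {..<n} (\<lambda>_. lborel))"
      by (cases "i < n") auto
  qed auto
  have 2: "emb n \<in> PiM UNIV (\<lambda>_. borel :: real measure) \<rightarrow>\<^sub>M borel"
  proof -
    have "continuous_on UNIV (emb n)"
      unfolding emb_def[abs_def] by (intro continuous_intros continuous_on_product_coordinates)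
    then have "emb n \<in> borel_measurable borel" by (rule borel_measurable_continuous_onI)
    then show ?thesis
      by (subst measurable_cong_sets[OF sets_PiM_equal_borel refl])
  qed
  have "emb n = emb n \<circ> (\<lambda>f i. if i < n then f i else (0::real))"
    by (auto simp: emb_def fun_eq_iff)
  then show ?thesis using measurable_comp[OF 1 2] by simp
qed

lemma emb_measurable: "emb n \<in> PiM {..<n} (\<lambda>_. lborel) \<rightarrow>\<^sub>M rb n"
  by (rule measurable_restrict_space2) (auto intro: emb_borel)

lemma lk_measurable_rb [measurable]: "(\<lambda>x. lk x k) \<in> borel_measurable (rb n)"
  by (intro measurable_restrict_space1 borel_measurable_continuous_onI continuous_intros)

text \<open>Such a map is its coordinate tuple followed by \<open>emb n\<close>. So measurability
  for the Borel sets of the type reduces to finitely many real functions.\<close>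

lemma measurable_rbI:
  assumes "\<And>x. x \<in> space M \<Longrightarrow> f x \<in> Rn n"
    and "\<And>k. k < n \<Longrightarrow> (\<lambda>x. lk (f x) k) \<in> borel_measurable M"
  shows "f \<in> M \<rightarrow>\<^sub>M rb n"
proof -
  have "(\<lambda>x. \<lambda>k\<in>{..<n}. lk (f x) k) \<in> M \<rightarrow>\<^sub>M PiM {..<n} (\<lambda>_. lborel)"
    by (rule measurable_restrict) (use assms in auto)
  then have m: "(\<lambda>x. emb n (\<lambda>k\<in>{..<n}. lk (f x) k)) \<in> M \<rightarrow>\<^sub>M rb n"
    by (rule measurable_compose[OF _ emb_measurable])
  have e: "emb n (\<lambda>k\<in>{..<n}. lk (f x) k) = f x" if "x \<in> space M" for x
    using assms(1)[OF that] by (intro Rn_eqI[of _ n]) auto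
  show ?thesis
    using m by (subst measurable_cong[OF e[symmetric]])
qed

lemma measurable_rb_Rn: "f \<in> M \<rightarrow>\<^sub>M rb n \<Longrightarrow> x \<in> space M \<Longrightarrow> f x \<in> Rn n"
  using measurable_space[of f M "rb n" x] by simp

lemma measurable_lk: "f \<in> M \<rightarrow>\<^sub>M rb n \<Longrightarrow> (\<lambda>x. lk (f x) k) \<in> borel_measurable M"
  by (rule measurable_compose[OF _ lk_measurable_rb])

lemma ip_measurable [measurable]:
  "f \<in> M \<rightarrow>\<^sub>M rb n \<Longrightarrow> g \<in> M \<rightarrow>\<^sub>M rb n \<Longrightarrow> (\<lambda>x. ip n (f x) (g x)) \<in> borel_measurable M"
  unfolding ip_def by (intro borel_measurable_sum borel_measurable_times measurable_lk)

lemma nrm_measurable [measurable]: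
  "f \<in> M \<rightarrow>\<^sub>M rb n \<Longrightarrow> (\<lambda>x. nrm n (f x)) \<in> borel_measurable M"
  unfolding nrm_def by measurable

lemma add_measurable_rb [measurable]:
  "f \<in> M \<rightarrow>\<^sub>M rb n \<Longrightarrow> g \<in> M \<rightarrow>\<^sub>M rb n \<Longrightarrow> (\<lambda>x. f x + g x) \<in> M \<rightarrow>\<^sub>M rb n"
  using measurable_rb_Rn[of f M n] measurable_rb_Rn[of g M n]
  by (intro measurable_rbI) (auto intro!: measurable_lk borel_measurable_add)

lemma diff_measurable_rb [measurable]:
  "f \<in> M \<rightarrow>\<^sub>M rb n \<Longrightarrow> g \<in> M \<rightarrow>\<^sub>M rb n \<Longrightarrow> (\<lambda>x. f x - g x) \<in> M \<rightarrow>\<^sub>M rb n"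
  using measurable_rb_Rn[of f M n] measurable_rb_Rn[of g M n]
  by (intro measurable_rbI) (auto intro!: measurable_lk borel_measurable_diff)

lemma scale_measurable_rb [measurable]:
  "c \<in> borel_measurable M \<Longrightarrow> g \<in> M \<rightarrow>\<^sub>M rb n \<Longrightarrow> (\<lambda>x. c x *\<^sub>R g x) \<in> M \<rightarrow>\<^sub>M rb n"
  using measurable_rb_Rn[of g M n]
  by (intro measurable_rbI) (auto intro!: measurable_lk borel_measurable_times)

lemma pr_measurable_rb [measurable]:
  "f \<in> M \<rightarrow>\<^sub>M rb n \<Longrightarrow> g \<in> M \<rightarrow>\<^sub>M rb n \<Longrightarrow> (\<lambda>x. pr n (f x) (g x)) \<in> M \<rightarrow>\<^sub>M rb n"
  unfolding pr_def
  by (intro diff_measurable_rb scale_measurable_rb borel_measurable_divide ip_measurable)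

lemma const_measurable_rb: "a \<in> Rn n \<Longrightarrow> (\<lambda>x. a) \<in> M \<rightarrow>\<^sub>M rb n"
  by simp

lemma id_measurable_rb: "(\<lambda>x. x) \<in> rb n \<rightarrow>\<^sub>M rb n"
  by simp

section \<open>Lebesgue measure\<close>

definition leb :: "nat \<Rightarrow> vec measure" where
  "leb n = distr (PiM {..<n} (\<lambda>_. lborel)) (rb n) (emb n)"

lemma sets_leb [simp, measurable_cong]: "sets (leb n) = sets (rb n)" by (simp add: leb_def)
lemma space_leb [simp]: "space (leb n) = Rn n" by (simp add: leb_def)

lemma emeasure_leb: "A \<in> sets (rb n) \<Longrightarrow>
  emeasure (leb n) A = emeasure (PiM {..<n} (\<lambda>_. lborel)) (emb n -` A \<inter> space (PiM {..<n} (\<lambda>_. lborel)))"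
  by (simp add: leb_def emeasure_distr emb_measurable)

lemma volume_leb:
  assumes "A \<in> sets (rb n)" shows "volume n A = measure (leb n) A"
proof -
  have A: "A \<subseteq> Rn n" using sets.sets_into_space[OF assms] by simp
  have "(\<lambda>x. restrict (lk x) {..<n}) ` A = emb n -` A \<inter> space (PiM {..<n} (\<lambda>_. lborel))"
  proof (intro set_eqI iffI)
    fix f assume "f \<in> (\<lambda>x. restrict (lk x) {..<n}) ` A"
    then obtain x where x: "x \<in> A" "f = restrict (lk x) {..<n}" by auto
    then have "emb n f = x" using A by (intro Rn_eqI[of _ n]) auto
    then show "f \<in> emb n -` A \<inter> space (PiM {..<n} (\<lambda>_. lborel))" using x by (auto simp: space_PiM)
  next
    fix f assume f: "f \<in> emb n -` A \<inter> space (PiM {..<n} (\<lambda>_. lborel))"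
    then have "f = restrict (lk (emb n f)) {..<n}" by (auto simp: space_PiM fun_eq_iff PiE_iff extensional_def)
    then show "f \<in> (\<lambda>x. restrict (lk x) {..<n}) ` A" using f by blast
  qed
  then show ?thesis using emeasure_leb[OF assms] by (simp add: volume_def measure_def)
qed

interpretation lp: product_sigma_finite "\<lambda>_::nat. lborel :: real measure"
  by standard

text \<open>Product measures are determined on boxes, where the claim is one-dimensional translation
  invariance in each coordinate.\<close>

lemma leb_translate:
  assumes a: "a \<in> Rn n" and A: "A \<in> sets (rb n)"
  shows "emeasure (leb n) {x \<in> Rn n. x + a \<in> A} = emeasure (leb n) A"
proof -
  let ?P = "PiM {..<n} (\<lambda>_. lborel :: real measure)"
  let ?t = "\<lambda>f. \<lambda>i\<in>{..<n}. f i + lk a i"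
  have t: "?t \<in> ?P \<rightarrow>\<^sub>M ?P"
    by (intro measurable_restrict) auto
  have "distr ?P ?P ?t = ?P"
  proof (rule lp.PiM_eqI)
    fix B assume B: "\<And>i. i \<in> {..<n} \<Longrightarrow> B i \<in> sets (lborel :: real measure)"
    have sb: "(\<lambda>y. y + lk a i) -` B i \<in> sets borel" if "i < n" for i
    proof -
      have "(\<lambda>y. y + lk a i) \<in> borel_measurable borel" by simp
      from measurable_sets[OF this, of "B i"] B that show ?thesis by simp
    qed
    have "emeasure (distr ?P ?P ?t) (Pi\<^sub>E {..<n} B) = emeasure ?P (?t -` (Pi\<^sub>E {..<n} B) \<inter> space ?P)"
      using t B by (intro emeasure_distr) (auto intro!: sets_PiM_I_finite)
    also have "?t -` (Pi\<^sub>E {..<n} B) \<inter> space ?P = Pi\<^sub>E {..<n} (\<lambda>i. (\<lambda>y. y + lk a i) -` B i)"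
      by (auto simp: space_PiM PiE_iff)
    also have "emeasure ?P \<dots> = (\<Prod>i<n. emeasure lborel ((\<lambda>y. y + lk a i) -` B i))"
      using sb by (intro lp.emeasure_PiM) auto
    also have "\<dots> = (\<Prod>i<n. emeasure lborel (B i))"
    proof (intro prod.cong refl)
      fix i assume i: "i \<in> {..<n}"
      have "emeasure lborel (B i) = emeasure (distr lborel borel ((+) (lk a i))) (B i)"
        using lborel_distr_plus[of "lk a i"] by simp
      also have "\<dots> = emeasure lborel ((\<lambda>y. y + lk a i) -` B i)"
        using B[OF i] by (subst emeasure_distr) (auto simp: vimage_def add.commute)
      finally show "emeasure lborel ((\<lambda>y. y + lk a i) -` B i) = emeasure lborel (B i)" ..
    qed
    finally show "emeasure (distr ?P ?P ?t) (Pi\<^sub>E {..<n} B) = (\<Prod>i<n. emeasure lborel (B i))" .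
  qed auto
  note inv = this
  let ?X = "emb n -` A \<inter> space ?P"
  have X: "?X \<in> sets ?P" using A emb_measurable by (rule measurable_sets[rotated])
  have st: "{x \<in> Rn n. x + a \<in> A} \<in> sets (rb n)"
  proof -
    have "(\<lambda>x. x + a) \<in> rb n \<rightarrow>\<^sub>M rb n"
      by (intro add_measurable_rb const_measurable_rb a) simp
    from measurable_sets[OF this A] show ?thesis by (simp add: vimage_def Int_def conj_commute)
  qed
  have "emeasure (leb n) A = emeasure (distr ?P ?P ?t) ?X" unfolding inv using A by (simp add: emeasure_leb)
  also have "\<dots> = emeasure ?P (?t -` ?X \<inter> space ?P)"
    using t X by (rule emeasure_distr)
  also have "?t -` ?X \<inter> space ?P = emb n -` {x \<in> Rn n. x + a \<in> A} \<inter> space ?P"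
  proof -
    have "emb n (?t f) = emb n f + a" for f
      using a by (intro Rn_eqI[of _ n]) auto
    then show ?thesis by (auto simp: space_PiM)
  qed
  also have "emeasure ?P \<dots> = emeasure (leb n) {x \<in> Rn n. x + a \<in> A}"
    using st by (simp add: emeasure_leb)
  finally show ?thesis ..
qed

lemma cb_sub: "cb n r \<subseteq> Rn n" by (auto simp: cb_def)

lemma cb_mono: "r \<le> s \<Longrightarrow> cb n r \<subseteq> cb n s" by (auto simp: cb_def)

lemma cb_sets [simp, measurable]: "cb n r \<in> sets (rb n)"
  by (simp add: sets_rb_closed cb_sub)

lemma emeasure_leb_cb: "r > 0 \<Longrightarrow> emeasure (leb n) (cb n r) = ennreal (unit_ball_vol (real n) * r ^ n)"
proof -
  assume r: "r > 0"
  have "emb n -` cb n r \<inter> space (PiM {..<n} (\<lambda>_. lborel)) =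
      {f. sqrt (\<Sum>i\<in>{..<n}. (f i)\<^sup>2) \<le> r} \<inter> space (PiM {..<n} (\<lambda>_. lborel))"
    by (auto simp: cb_def nrm_def ip_def power2_eq_square)
  then show ?thesis
    using emeasure_cball_aux[of "{..<n}" r] r
    by (subst emeasure_leb) auto
qed

lemma compact_in_cb:
  assumes "compact K" "K \<subseteq> Rn n" obtains r where "r > 0" "K \<subseteq> cb n r"
proof -
  obtain r where r: "\<And>x. x \<in> K \<Longrightarrow> norm x \<le> r" using compact_imp_bounded[OF assms(1)] bounded_iff by blast
  have "K \<subseteq> cb n (max r 1)"
    using assms r by (auto simp: cb_def) (meson le_max_iff_disj nrm_le_norm order_trans)
  then show ?thesis using that[of "max r 1"] by simp
qed

text \<open>The measures produced by slicing are only invariant along a subspace \<open>E\<close>.\<close>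

locale tim =
  fixes n :: nat and \<mu> :: "vec measure" and E :: "vec set"
  assumes sets_mu [measurable_cong]: "sets \<mu> = sets (rb n)"
    and E: "E \<subseteq> Rn n" "subspace E"
    and trans: "\<And>a A. a \<in> E \<Longrightarrow> A \<in> sets (rb n) \<Longrightarrow> emeasure \<mu> {x \<in> Rn n. x + a \<in> A} = emeasure \<mu> A"
    and fin: "\<And>r. emeasure \<mu> (cb n r) < \<infinity>"
begin

lemma space_mu [simp]: "space \<mu> = Rn n"
  using sets_eq_imp_space_eq[OF sets_mu] by simp

lemma emeasure_compact: "compact K \<Longrightarrow> K \<subseteq> Rn n \<Longrightarrow> emeasure \<mu> K < \<infinity>"
proof -
  assume "compact K" "K \<subseteq> Rn n"
  then obtain r where "K \<subseteq> cb n r" by (rule compact_in_cb)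
  then have "emeasure \<mu> K \<le> emeasure \<mu> (cb n r)" by (intro emeasure_mono) (auto simp: sets_mu)
  then show ?thesis using fin[of r] by (rule le_less_trans)
qed

lemma sigma_finite: "sigma_finite_measure \<mu>"
proof
  show "\<exists>A. countable A \<and> A \<subseteq> sets \<mu> \<and> \<Union>A = space \<mu> \<and> (\<forall>a\<in>A. emeasure \<mu> a \<noteq> \<infinity>)"
  proof (intro exI conjI ballI)
    show "countable (range (\<lambda>k::nat. cb n (real k)))" by simp
    show "range (\<lambda>k::nat. cb n (real k)) \<subseteq> sets \<mu>" by (auto simp: sets_mu)
    show "\<Union>(range (\<lambda>k::nat. cb n (real k))) = space \<mu>"
      by (auto simp: cb_def) (rule real_arch_simple)
    fix a assume "a \<in> range (\<lambda>k::nat. cb n (real k))"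
    then show "emeasure \<mu> a \<noteq> \<infinity>" using fin by (auto simp: less_top)
  qed
qed

end

lemma tim_leb: "tim n (leb n) (Rn n)"
proof
  fix r :: real
  have "emeasure (leb n) (cb n r) \<le> emeasure (leb n) (cb n (max r 1))"
    by (intro emeasure_mono cb_mono) auto
  also have "\<dots> < \<infinity>" by (subst emeasure_leb_cb) auto
  finally show "emeasure (leb n) (cb n r) < \<infinity>" .
qed (auto intro: leb_translate)

text \<open>Uniqueness of translation-invariant measures: both sides equal the integral of
  \<open>1\<^sub>A(x) 1\<^sub>B(x + y)\<close> against \<open>\<mu> \<otimes> \<nu>\<close>.\<close>

lemma weil:
  assumes m: "tim n \<mu> (Rn n)" and v: "tim n \<nu> (Rn n)"
    and A [measurable]: "A \<in> sets (rb n)" and B [measurable]: "B \<in> sets (rb n)"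
  shows "emeasure \<mu> A * emeasure \<nu> B = emeasure \<mu> B * emeasure \<nu> {x \<in> Rn n. - x \<in> A}"
proof -
  interpret m: tim n \<mu> "Rn n" by fact
  interpret v: tim n \<nu> "Rn n" by fact
  interpret pair_sigma_finite \<mu> \<nu>
    by (rule pair_sigma_finite.intro[OF m.sigma_finite v.sigma_finite])
  have [measurable]: "(\<lambda>z. fst z) \<in> \<mu> \<Otimes>\<^sub>M \<nu> \<rightarrow>\<^sub>M rb n" "(\<lambda>z. snd z) \<in> \<mu> \<Otimes>\<^sub>M \<nu> \<rightarrow>\<^sub>M rb n"
    using measurable_fst[of \<mu> \<nu>] measurable_snd[of \<mu> \<nu>]
    by (simp_all add: m.sets_mu v.sets_mu cong: measurable_cong_sets)
  have pm: "{z \<in> space (\<mu> \<Otimes>\<^sub>M \<nu>). P z} \<in> sets (\<mu> \<Otimes>\<^sub>M \<nu>) \<Longrightarrow> (\<lambda>(x,y). indicator {z. P z} (x,y) :: ennreal) \<in> borel_measurable (\<mu> \<Otimes>\<^sub>M \<nu>)" for P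
    by (subst measurable_cong[where g="indicator {z \<in> space (\<mu> \<Otimes>\<^sub>M \<nu>). P z}"]) (auto simp: indicator_def)
  let ?f = "\<lambda>(x,y). indicator {z. fst z \<in> A \<and> fst z + snd z \<in> B} (x,y) :: ennreal"
  let ?g = "\<lambda>(x,y). indicator {z. fst z - snd z \<in> A \<and> fst z \<in> B} (x,y) :: ennreal"
  have f: "?f \<in> borel_measurable (\<mu> \<Otimes>\<^sub>M \<nu>)" by (rule pm) measurable
  have g: "?g \<in> borel_measurable (\<mu> \<Otimes>\<^sub>M \<nu>)" by (rule pm) measurable
  have AB: "A \<subseteq> Rn n" "B \<subseteq> Rn n"
    using sets.sets_into_space[OF A] sets.sets_into_space[OF B] by auto
  have sh: "{x \<in> Rn n. x + a \<in> C} \<in> sets (rb n)" "{x \<in> Rn n. x - a \<in> C} \<in> sets (rb n)" "{x \<in> Rn n. a - x \<in> C} \<in> sets (rb n)" "{x \<in> Rn n. a + x \<in> C} \<in> sets (rb n)"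
    if [measurable]: "C \<in> sets (rb n)" and a: "a \<in> Rn n" for a C
  proof -
    note [measurable] = const_measurable_rb[OF a]
    have "{x \<in> space (rb n). x + a \<in> C} \<in> sets (rb n)" by measurable
    then show "{x \<in> Rn n. x + a \<in> C} \<in> sets (rb n)" unfolding space_rb .
    have "{x \<in> space (rb n). x - a \<in> C} \<in> sets (rb n)" by measurable
    then show "{x \<in> Rn n. x - a \<in> C} \<in> sets (rb n)" unfolding space_rb .
    have "{x \<in> space (rb n). a - x \<in> C} \<in> sets (rb n)" by measurable
    then show "{x \<in> Rn n. a - x \<in> C} \<in> sets (rb n)" unfolding space_rb .
    have "{x \<in> space (rb n). a + x \<in> C} \<in> sets (rb n)" by measurable
    then show "{x \<in> Rn n. a + x \<in> C} \<in> sets (rb n)" unfolding space_rb .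
  qed
  have "emeasure \<mu> A * emeasure \<nu> B = (\<integral>\<^sup>+x. indicator A x * emeasure \<nu> B \<partial>\<mu>)"
    by (subst nn_integral_multc) (auto simp: m.sets_mu A)
  also have "\<dots> = (\<integral>\<^sup>+x. \<integral>\<^sup>+y. ?f (x,y) \<partial>\<nu> \<partial>\<mu>)"
  proof (rule nn_integral_cong)
    fix x assume x: "x \<in> space \<mu>"
    have "emeasure \<nu> B = emeasure \<nu> {y \<in> Rn n. y + x \<in> B}" using v.trans[of x B] x by simp
    also have "\<dots> = (\<integral>\<^sup>+y. indicator {y \<in> Rn n. y + x \<in> B} y \<partial>\<nu>)"
      using x sh(1)[OF B] by (simp add: v.sets_mu)
    finally have e: "emeasure \<nu> B = (\<integral>\<^sup>+y. indicator {y \<in> Rn n. y + x \<in> B} y \<partial>\<nu>)" .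
    show "indicator A x * emeasure \<nu> B = (\<integral>\<^sup>+y. ?f (x,y) \<partial>\<nu>)"
      unfolding e
      by (cases "x \<in> A") (auto simp: indicator_def add.commute intro!: nn_integral_cong)
  qed
  also have "\<dots> = (\<integral>\<^sup>+y. \<integral>\<^sup>+x. ?f (x,y) \<partial>\<mu> \<partial>\<nu>)"
    by (rule Fubini[OF f, symmetric])
  also have "\<dots> = (\<integral>\<^sup>+y. \<integral>\<^sup>+x. ?g (x,y) \<partial>\<mu> \<partial>\<nu>)"
  proof (rule nn_integral_cong)
    fix y assume y: "y \<in> space \<nu>"
    let ?S = "{x \<in> Rn n. x - y \<in> A \<and> x \<in> B}"
    have S: "?S \<in> sets (rb n)"
    proof -
      have "?S = {x \<in> Rn n. x - y \<in> A} \<inter> B" using AB by auto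
      then show ?thesis using sh(2)[OF A] y by simp
    qed
    have "(\<integral>\<^sup>+x. ?g (x,y) \<partial>\<mu>) = (\<integral>\<^sup>+x. indicator ?S x \<partial>\<mu>)"
      by (rule nn_integral_cong) (auto simp: indicator_def)
    also have "\<dots> = emeasure \<mu> ?S" using S by (simp add: m.sets_mu)
    also have "\<dots> = emeasure \<mu> {x \<in> Rn n. x + y \<in> ?S}" using m.trans[of y ?S] S y by simp
    also have "\<dots> = (\<integral>\<^sup>+x. indicator {x \<in> Rn n. x + y \<in> ?S} x \<partial>\<mu>)"
      using sh(1)[OF S, of y] y by (subst nn_integral_indicator) (simp_all only: m.sets_mu v.space_mu)
    also have "\<dots> = (\<integral>\<^sup>+x. ?f (x,y) \<partial>\<mu>)"
      using y by (intro nn_integral_cong) (auto simp: indicator_def)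
    finally show "(\<integral>\<^sup>+x. ?f (x,y) \<partial>\<mu>) = (\<integral>\<^sup>+x. ?g (x,y) \<partial>\<mu>)" ..
  qed
  also have "\<dots> = (\<integral>\<^sup>+x. \<integral>\<^sup>+y. ?g (x,y) \<partial>\<nu> \<partial>\<mu>)"
    by (rule Fubini[OF g])
  also have "\<dots> = (\<integral>\<^sup>+x. indicator B x * emeasure \<nu> {x \<in> Rn n. - x \<in> A} \<partial>\<mu>)"
  proof (rule nn_integral_cong)
    fix x assume x: "x \<in> space \<mu>"
    have nA: "{x \<in> Rn n. - x \<in> A} \<in> sets (rb n)" using sh(3)[OF A, of 0] by simp
    have "emeasure \<nu> {x \<in> Rn n. - x \<in> A} = emeasure \<nu> {y \<in> Rn n. y + (- x) \<in> {x \<in> Rn n. - x \<in> A}}"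
      using v.trans[of "- x" "{x \<in> Rn n. - x \<in> A}"] nA x by simp
    also have "{y \<in> Rn n. y + (- x) \<in> {x \<in> Rn n. - x \<in> A}} = {y \<in> Rn n. x - y \<in> A}"
      using x by auto
    also have "emeasure \<nu> {y \<in> Rn n. x - y \<in> A} = (\<integral>\<^sup>+y. indicator {y \<in> Rn n. x - y \<in> A} y \<partial>\<nu>)"
      using x sh(3)[OF A] by (simp add: v.sets_mu)
    finally have e: "emeasure \<nu> {x \<in> Rn n. - x \<in> A} = (\<integral>\<^sup>+y. indicator {y \<in> Rn n. x - y \<in> A} y \<partial>\<nu>)" .
    show "(\<integral>\<^sup>+y. ?g (x,y) \<partial>\<nu>) = indicator B x * emeasure \<nu> {x \<in> Rn n. - x \<in> A}"
      unfolding e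
      by (cases "x \<in> B") (auto simp: indicator_def intro!: nn_integral_cong)
  qed
  also have "\<dots> = emeasure \<mu> B * emeasure \<nu> {x \<in> Rn n. - x \<in> A}"
    by (subst nn_integral_multc) (auto simp: m.sets_mu B)
  finally show ?thesis .
qed

abbreviation vol :: "nat \<Rightarrow> vec set \<Rightarrow> real" where "vol n \<equiv> measure (leb n)"

lemma vol_cb: "r > 0 \<Longrightarrow> vol n (cb n r) = unit_ball_vol (real n) * r ^ n"
  by (simp add: measure_def emeasure_leb_cb)

text \<open>The image of Lebesgue measure under \<open>f\<close> is again translation invariant,
  because \<open>f\<close> is additive, and has the same value on the unit ball. Comparing both
  measures with the ball in \<open>weil\<close> makes them equal up to
  \<open>x \<mapsto> - x\<close>, and \<open>weil\<close> also shows that this map preserves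
  Lebesgue measure.\<close>

lemma isometry_leb:
  assumes f: "\<And>x y. x \<in> Rn n \<Longrightarrow> y \<in> Rn n \<Longrightarrow> f (x + y) = f x + f y"
    "\<And>x. x \<in> Rn n \<Longrightarrow> f x \<in> Rn n" "\<And>x. x \<in> Rn n \<Longrightarrow> f (f x) = x" "\<And>x. x \<in> Rn n \<Longrightarrow> nrm n (f x) = nrm n x"
    and fm [measurable]: "f \<in> rb n \<rightarrow>\<^sub>M rb n" and A [measurable]: "A \<in> sets (rb n)"
  shows "emeasure (leb n) {x \<in> Rn n. f x \<in> A} = emeasure (leb n) A"
proof -
  interpret l: tim n "leb n" "Rn n" by (rule tim_leb)
  define \<nu> where "\<nu> = distr (leb n) (rb n) f"
  have pre: "{x \<in> Rn n. f x \<in> C} \<in> sets (rb n)" if [measurable]: "C \<in> sets (rb n)" for C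
  proof -
    have "{x \<in> space (rb n). f x \<in> C} \<in> sets (rb n)" by measurable
    then show ?thesis unfolding space_rb .
  qed
  have em: "emeasure \<nu> C = emeasure (leb n) {x \<in> Rn n. f x \<in> C}" if "C \<in> sets (rb n)" for C
  proof -
    have "f -` C \<inter> space (leb n) = {x \<in> Rn n. f x \<in> C}" by auto
    then show ?thesis using that fm by (simp only: \<nu>_def emeasure_distr measurable_cong_sets[OF sets_leb refl])
  qed
  have cbf: "{x \<in> Rn n. f x \<in> cb n r} = cb n r" for r
    using f(2,4) by (auto simp: cb_def)
  have nt: "tim n \<nu> (Rn n)"
  proof
    show "sets \<nu> = sets (rb n)" by (simp add: \<nu>_def)
    fix r show "emeasure \<nu> (cb n r) < \<infinity>" using l.fin[of r] by (simp add: em cbf)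
  next
    fix a C assume a: "a \<in> Rn n" and C [measurable]: "C \<in> sets (rb n)"
    note [measurable] = const_measurable_rb[OF a]
    have s: "{x \<in> space (rb n). x + a \<in> C} \<in> sets (rb n)" by measurable
    have "{x \<in> Rn n. f x \<in> {x \<in> Rn n. x + a \<in> C}} = {x \<in> Rn n. f x + a \<in> C}"
      using f(2) by auto
    then have "emeasure \<nu> {x \<in> Rn n. x + a \<in> C} = emeasure (leb n) {x \<in> Rn n. f x + a \<in> C}"
      by (simp only: em[OF s[unfolded space_rb]])
    also have "{x \<in> Rn n. f x + a \<in> C} = {x \<in> Rn n. x + f a \<in> {x \<in> Rn n. f x \<in> C}}"
      using a f by auto
    also have "emeasure (leb n) \<dots> = emeasure (leb n) {x \<in> Rn n. f x \<in> C}"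
      using pre[OF C] a f(2) by (intro leb_translate) auto
    finally show "emeasure \<nu> {x \<in> Rn n. x + a \<in> C} = emeasure \<nu> C" using em[OF C] by simp
  qed simp_all
  let ?B = "cb n 1"
  let ?k = "unit_ball_vol (real n)"
  have k: "emeasure (leb n) ?B = ennreal ?k" "emeasure \<nu> ?B = ennreal ?k" "ennreal ?k \<noteq> 0" "ennreal ?k \<noteq> \<infinity>"
    using unit_ball_vol_pos[of "real n"] by (simp_all add: emeasure_leb_cb em cbf del: unit_ball_vol_pos)
  have canc: "x * ennreal ?k = ennreal ?k * y \<Longrightarrow> x = y" for x y
  proof -
    assume "x * ennreal ?k = ennreal ?k * y"
    then have "ennreal ?k * x = ennreal ?k * y" by (simp only: mult.commute)
    then show "x = y" using k(3,4) unfolding ennreal_mult_cancel_left by auto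
  qed
  have nA: "{x \<in> Rn n. - x \<in> A} \<in> sets (rb n)"
  proof -
    note [measurable] = const_measurable_rb[OF Rn_0]
    have "{x \<in> space (rb n). 0 - x \<in> A} \<in> sets (rb n)" by measurable
    then show ?thesis unfolding space_rb diff_0 .
  qed
  have "emeasure (leb n) A = emeasure (leb n) {x \<in> Rn n. - x \<in> A}"
    by (rule canc[OF weil[OF tim_leb tim_leb A cb_sets[of n 1], unfolded k(1)]])
  moreover have "emeasure (leb n) A = emeasure \<nu> {x \<in> Rn n. - x \<in> A}"
    by (rule canc[OF weil[OF tim_leb nt A cb_sets[of n 1], unfolded k(1,2)]])
  moreover have "emeasure (leb n) {x \<in> Rn n. - x \<in> A} = emeasure \<nu> A"
  proof -
    have "{x \<in> Rn n. - x \<in> {x \<in> Rn n. - x \<in> A}} = A"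
      using sets.sets_into_space[OF A] by auto
    then show ?thesis using canc[OF weil[OF tim_leb nt nA cb_sets[of n 1], unfolded k(1,2)]] by simp
  qed
  ultimately show ?thesis using em[OF A] by simp
qed

section \<open>Volumes of sums with segments\<close>

definition body :: "nat \<Rightarrow> vec set \<Rightarrow> bool" where
  "body n K \<longleftrightarrow> compact K \<and> convex K \<and> K \<subseteq> Rn n \<and> K \<noteq> {}"

text \<open>Minkowski sum of \<open>K\<close> and the segment from 0 to \<open>u\<close>.\<close>

definition swp :: "vec set \<Rightarrow> vec \<Rightarrow> vec set" where
  "swp K u = {x + t *\<^sub>R u |x t. x \<in> K \<and> 0 \<le> t \<and> t \<le> 1}"

lemma body_sets: "body n K \<Longrightarrow> K \<in> sets (rb n)"
  by (auto simp: body_def intro!: sets_rb_closed compact_imp_closed)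

lemma swp_image: "swp K u = (\<lambda>(x, t). x + t *\<^sub>R u) ` (K \<times> {0..1})"
  by (force simp: swp_def)

lemma swp_sup: "K \<subseteq> swp K u"
  by (force simp: swp_def)

lemma swp_0 [simp]: "swp K 0 = K"
  by (force simp: swp_def)

lemma swp_comm: "swp (swp K u) v = swp (swp K v) u"
proof -
  have "swp (swp K u) v \<subseteq> swp (swp K v) u" for u v
  proof
    fix y assume "y \<in> swp (swp K u) v"
    then obtain x s t where x: "x \<in> K" "0 \<le> s" "s \<le> 1" "0 \<le> t" "t \<le> 1" "y = (x + s *\<^sub>R u) + t *\<^sub>R v"
      by (auto simp: swp_def)
    have "x + t *\<^sub>R v \<in> swp K v" using x by (auto simp: swp_def)
    moreover have "y = (x + t *\<^sub>R v) + s *\<^sub>R u" using x by (simp add: algebra_simps)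
    ultimately show "y \<in> swp (swp K v) u" using x unfolding swp_def[of "swp K v"] by blast
  qed
  then show ?thesis by blast
qed

lemma body_swp: assumes K: "body n K" and u: "u \<in> Rn n" shows "body n (swp K u)"
  unfolding body_def
proof (intro conjI)
  show "compact (swp K u)" unfolding swp_image case_prod_unfold
    using K by (intro compact_continuous_image compact_Times continuous_intros) (auto simp: body_def)
  show "swp K u \<subseteq> Rn n" using K u by (auto simp: body_def swp_def)
  show "swp K u \<noteq> {}" using K swp_sup[of K u] by (auto simp: body_def simp del: swp_0)
  show "convex (swp K u)"
  proof (rule convexI)
    fix x y a b assume "x \<in> swp K u" "y \<in> swp K u" and ab: "(0::real) \<le> a" "0 \<le> b" "a + b = 1"
    then obtain p s q t where p: "x = p + s *\<^sub>R u" "p \<in> K" "0 \<le> s" "s \<le> 1"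
      and q: "y = q + t *\<^sub>R u" "q \<in> K" "0 \<le> t" "t \<le> 1" by (auto simp: swp_def)
    have "a *\<^sub>R x + b *\<^sub>R y = (a *\<^sub>R p + b *\<^sub>R q) + (a * s + b * t) *\<^sub>R u"
      by (simp add: p q algebra_simps)
    moreover have "a *\<^sub>R p + b *\<^sub>R q \<in> K" using K p q ab by (auto simp: body_def convex_def)
    moreover have "0 \<le> a * s + b * t" using ab p q by simp
    moreover have "a * s + b * t \<le> a * 1 + b * 1" using ab p q by (intro add_mono mult_left_mono) auto
    ultimately show "a *\<^sub>R x + b *\<^sub>R y \<in> swp K u" using ab unfolding swp_def by auto
  qed
qed

lemma linear_image_swp: "linear f \<Longrightarrow> f ` swp K u = swp (f ` K) (f u)"
proof -
  assume f: "linear f"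
  have e: "f (x + t *\<^sub>R u) = f x + t *\<^sub>R f u" for x t
    using f by (simp add: linear_add linear_scale)
  show ?thesis unfolding swp_image
    by (auto simp: e image_iff) (metis atLeastAtMost_iff)+
qed

lemma body_pr: "body n K \<Longrightarrow> u \<in> Rn n \<Longrightarrow> body n (pr n u ` K)"
  unfolding body_def
  by (auto intro!: compact_continuous_image continuous_on_pr convex_linear_image linear_pr)

section \<open>One sweep: the volume gained is the volume of the projection\<close>

definition slab :: "nat \<Rightarrow> vec \<Rightarrow> vec set" where
  "slab n u = {x \<in> Rn n. 0 \<le> ip n x u \<and> ip n x u < ip n u u}"

text \<open>Plays the role of \<open>\<mu>\<close> on the orthogonal complement of \<open>u\<close>, scaled by the length of \<open>u\<close>: the slab is a
  fundamental domain for translation by \<open>u\<close>, which keeps the construction free of bases of subspaces.\<close>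

definition sm :: "nat \<Rightarrow> vec measure \<Rightarrow> vec \<Rightarrow> vec measure" where
  "sm n \<mu> u = distr (density \<mu> (indicator (slab n u))) (rb n) (pr n u)"

lemma pred_le_real: "f \<in> borel_measurable M \<Longrightarrow> g \<in> borel_measurable M \<Longrightarrow> Measurable.pred M (\<lambda>x. f x \<le> (g x :: real))"
  unfolding pred_def by (rule borel_measurable_le)

lemma pred_less_real: "f \<in> borel_measurable M \<Longrightarrow> g \<in> borel_measurable M \<Longrightarrow> Measurable.pred M (\<lambda>x. f x < (g x :: real))"
  unfolding pred_def by (rule borel_measurable_less)

lemma Rn_Collect_sets:
  assumes "Measurable.pred (rb n) P" shows "{x \<in> Rn n. P x} \<in> sets (rb n)"
  using assms unfolding pred_def space_rb .

lemma slab_sets: "u \<in> Rn n \<Longrightarrow> slab n u \<in> sets (rb n)"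
  unfolding slab_def
  by (intro Rn_Collect_sets pred_intros_logic pred_less_real pred_le_real ip_measurable
      borel_measurable_const id_measurable_rb const_measurable_rb) auto

lemma pr_fix_measurable: "u \<in> Rn n \<Longrightarrow> pr n u \<in> rb n \<rightarrow>\<^sub>M rb n"
  by (intro pr_measurable_rb const_measurable_rb id_measurable_rb)

lemma emeasure_sm:
  assumes s: "sets \<mu> = sets (rb n)" and u: "u \<in> Rn n" and A: "A \<in> sets (rb n)"
  shows "emeasure (sm n \<mu> u) A = emeasure \<mu> {x \<in> slab n u. pr n u x \<in> A}"
proof -
  have sp: "space \<mu> = Rn n" using sets_eq_imp_space_eq[OF s] by simp
  have pm: "pr n u \<in> density \<mu> (indicator (slab n u)) \<rightarrow>\<^sub>M rb n"
    using pr_fix_measurable[OF u] by (simp only: measurable_density_eq1 measurable_cong_sets[OF s refl])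
  have pA: "pr n u -` A \<inter> Rn n \<in> sets \<mu>"
    using measurable_sets[OF pr_fix_measurable[OF u] A] by (simp only: s space_rb)
  have "emeasure (sm n \<mu> u) A = emeasure (density \<mu> (indicator (slab n u))) (pr n u -` A \<inter> Rn n)"
    unfolding sm_def by (subst emeasure_distr[OF pm A]) (simp only: space_density sp)
  also have "\<dots> = emeasure \<mu> (slab n u \<inter> (pr n u -` A \<inter> Rn n))"
    using pA slab_sets[OF u] by (intro emeasure_restricted) (simp_all only: s)
  also have "slab n u \<inter> (pr n u -` A \<inter> Rn n) = {x \<in> slab n u. pr n u x \<in> A}"
    by (auto simp: slab_def)
  finally show ?thesis .
qed

lemma slab_pre_sets:
  assumes u: "u \<in> Rn n" and A: "A \<in> sets (rb n)"
  shows "{x \<in> slab n u. pr n u x \<in> A} \<in> sets (rb n)"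
proof -
  have "{x \<in> slab n u. pr n u x \<in> A} = slab n u \<inter> (pr n u -` A \<inter> space (rb n))"
    by (auto simp: slab_def)
  then show ?thesis using slab_sets[OF u] measurable_sets[OF pr_fix_measurable[OF u] A] by simp
qed

lemma measure_sm:
  assumes s: "sets \<mu> = sets (rb n)" and u: "u \<in> Rn n" and A: "A \<in> sets (rb n)"
  shows "measure (sm n \<mu> u) A = measure \<mu> {x \<in> slab n u. pr n u x \<in> A}"
  unfolding measure_def emeasure_sm[OF assms] ..

lemma slab_decomp:
  assumes u: "u \<in> Rn n" "u \<noteq> 0" shows "x = pr n u x + (ip n x u / ip n u u) *\<^sub>R u"
  by (simp add: pr_def)

text \<open>Translations orthogonal to \<open>u\<close> preserve the slab and commute with the
  projection, so exactly this part of \<open>E\<close> is kept. Finiteness holds because a point of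
  the slab is within \<open>nrm n u\<close> of its projection.\<close>

lemma tim_sm:
  assumes t: "tim n \<mu> E" and u: "u \<in> E"
  shows "tim n (sm n \<mu> u) {a \<in> E. ip n a u = 0}"
proof -
  interpret tim n \<mu> E by fact
  have un: "u \<in> Rn n" using u E by auto
  note em = emeasure_sm[OF sets_mu un]
  show ?thesis
  proof
    show "sets (sm n \<mu> u) = sets (rb n)" by (simp add: sm_def)
    show "{a \<in> E. ip n a u = 0} \<subseteq> Rn n" using E by auto
    show "subspace {a \<in> E. ip n a u = 0}" using E by (auto simp: subspace_def)
    fix r
    have "{x \<in> slab n u. pr n u x \<in> cb n r} \<subseteq> cb n (r + nrm n u)"
    proof
      fix x assume x: "x \<in> {x \<in> slab n u. pr n u x \<in> cb n r}"
      then have u0: "u \<noteq> 0" by (auto simp: slab_def)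
      have q: "ip n u u > 0" using ip_self_pos[OF un u0] .
      have "\<bar>ip n x u / ip n u u\<bar> \<le> 1" using x q by (auto simp: slab_def divide_le_eq)
      then have "nrm n ((ip n x u / ip n u u) *\<^sub>R u) \<le> 1 * nrm n u"
        unfolding nrm_scale by (intro mult_right_mono) auto
      then have "nrm n x \<le> r + nrm n u"
        using slab_decomp[OF un u0, of x] nrm_triangle[of n "pr n u x" "(ip n x u / ip n u u) *\<^sub>R u"] x
        by (auto simp: cb_def)
      then show "x \<in> cb n (r + nrm n u)" using x by (auto simp: cb_def slab_def)
    qed
    then have "emeasure (sm n \<mu> u) (cb n r) \<le> emeasure \<mu> (cb n (r + nrm n u))"
      unfolding em[OF cb_sets] by (intro emeasure_mono) (auto simp only: sets_mu cb_sets)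
    then show "emeasure (sm n \<mu> u) (cb n r) < \<infinity>" using fin by (rule le_less_trans)
  next
    fix a A assume a: "a \<in> {a \<in> E. ip n a u = 0}" and A: "A \<in> sets (rb n)"
    have an: "a \<in> Rn n" using a E by auto
    have s: "{x \<in> Rn n. x + a \<in> A} \<in> sets (rb n)"
    proof -
      have "(\<lambda>x. x + a) \<in> rb n \<rightarrow>\<^sub>M rb n"
        by (intro add_measurable_rb const_measurable_rb an id_measurable_rb)
      from measurable_sets[OF this A] show ?thesis unfolding space_rb vimage_def Int_def by (simp only: mem_Collect_eq conj_commute)
    qed
    have "emeasure (sm n \<mu> u) {x \<in> Rn n. x + a \<in> A} = emeasure \<mu> {x \<in> slab n u. pr n u x \<in> {x \<in> Rn n. x + a \<in> A}}"
      by (rule em[OF s])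
    also have "{x \<in> slab n u. pr n u x \<in> {x \<in> Rn n. x + a \<in> A}} = {x \<in> Rn n. x + a \<in> {x \<in> slab n u. pr n u x \<in> A}}"
      using a an un by (auto simp: slab_def pr_add pr_orth)
    also have "emeasure \<mu> \<dots> = emeasure \<mu> {x \<in> slab n u. pr n u x \<in> A}"
      using a by (intro trans slab_pre_sets un A) auto
    also have "\<dots> = emeasure (sm n \<mu> u) A" by (rule em[OF A, symmetric])
    finally show "emeasure (sm n \<mu> u) {x \<in> Rn n. x + a \<in> A} = emeasure (sm n \<mu> u) A" .
  qed
qed

text \<open>On the line \<open>x + t u\<close> let \<open>\<beta>\<close> be the last parameter in
  \<open>K\<close>. By convexity the sweep adds the half-open interval from \<open>\<beta>\<close>
  (excluded) to \<open>\<beta> + 1\<close> (included), which contains one integer,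
  \<open>\<lfloor>\<beta>\<rfloor> + 1\<close>.\<close>

lemma unique_lift:
  assumes K: "body n K" and u: "u \<in> Rn n" "u \<noteq> 0" and x: "x \<in> Rn n" "pr n u x \<in> pr n u ` K"
  shows "\<exists>z::int. \<forall>z'::int. x + of_int z' *\<^sub>R u \<in> swp K u - K \<longleftrightarrow> z' = z"
proof -
  define q where "q = ip n u u"
  have q: "q > 0" using ip_self_pos[OF u] by (simp add: q_def)
  let ?F = "K \<inter> {k. pr n u k - pr n u x = 0}"
  have "closed {k. pr n u k - pr n u x = 0}"
    by (intro closed_Collect_eq continuous_intros)
  then have "compact ?F" using K by (intro compact_Int_closed) (auto simp: body_def)
  moreover have "?F \<noteq> {}" using x by auto
  moreover have "continuous_on ?F (\<lambda>k. ip n k u)" by (intro continuous_intros)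
  ultimately obtain k0 where "k0 \<in> ?F" and mx: "\<And>k. k \<in> ?F \<Longrightarrow> ip n k u \<le> ip n k0 u"
    using continuous_attains_sup[of ?F "\<lambda>k. ip n k u"] by blast
  then have k0: "k0 \<in> K" "pr n u k0 = pr n u x" by auto
  define \<beta> where "\<beta> = (ip n k0 u - ip n x u) / q"
  have xb: "x + \<beta> *\<^sub>R u = k0"
    using k0(2) by (simp add: \<beta>_def pr_def q_def diff_divide_distrib algebra_simps)
  have prl: "pr n u (x + t *\<^sub>R u) = pr n u x" for t
    by (simp add: pr_add pr_scale pr_self u)
  have le: "t \<le> \<beta>" if "x + t *\<^sub>R u \<in> K" for t
  proof -
    have "ip n x u + t * q \<le> ip n k0 u" using mx[of "x + t *\<^sub>R u"] that prl by (simp add: q_def)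
    then show ?thesis using q by (simp add: \<beta>_def pos_le_divide_eq)
  qed
  have iff: "x + t *\<^sub>R u \<in> swp K u - K \<longleftrightarrow> \<beta> < t \<and> t \<le> \<beta> + 1" for t
  proof
    assume a: "\<beta> < t \<and> t \<le> \<beta> + 1"
    have "x + t *\<^sub>R u = k0 + (t - \<beta>) *\<^sub>R u" by (simp flip: xb add: algebra_simps)
    then have "x + t *\<^sub>R u \<in> swp K u" using k0 a unfolding swp_def by (auto intro!: exI[of _ k0] exI[of _ "t - \<beta>"])
    then show "x + t *\<^sub>R u \<in> swp K u - K" using le[of t] a by auto
  next
    assume a: "x + t *\<^sub>R u \<in> swp K u - K"
    then obtain k s where k: "x + t *\<^sub>R u = k + s *\<^sub>R u" "k \<in> K" "0 \<le> s" "s \<le> 1"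
      by (auto simp: swp_def)
    have kx: "k = x + (t - s) *\<^sub>R u" using k(1) by (simp add: algebra_simps)
    have b: "t - s \<le> \<beta>" using le[of "t - s"] k kx by simp
    have "\<beta> < t"
    proof (rule ccontr)
      assume "\<not> \<beta> < t"
      then have tb: "t \<le> \<beta>" by simp
      have "x + t *\<^sub>R u \<in> K"
      proof (cases "\<beta> = t - s")
        case True
        then have "s = 0" using tb k by simp
        then show ?thesis using k by simp
      next
        case False
        \<comment> \<open>\<open>k\<close> has parameter \<open>t - s\<close> and \<open>k0\<close>
          has parameter \<open>\<beta>\<close>; \<open>t\<close> lies between them, at the fraction
          \<open>l\<close>.\<close>
        define l where "l = s / (\<beta> - t + s)"
        have d: "\<beta> - t + s > 0" using False b by simp
        have l: "0 \<le> l" "l \<le> 1" "l * (\<beta> - t + s) = s" using d tb k by (auto simp: l_def)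
        have "(1 - l) *\<^sub>R k + l *\<^sub>R k0 \<in> K"
          using K k k0 l by (auto simp: body_def convex_def)
        moreover have "(1 - l) *\<^sub>R k + l *\<^sub>R k0 = x + (t - s + l * (\<beta> - t + s)) *\<^sub>R u"
          unfolding kx xb[symmetric] by (simp add: algebra_simps)
        ultimately show ?thesis using l by simp
      qed
      then show False using a by simp
    qed
    then show "\<beta> < t \<and> t \<le> \<beta> + 1" using b k by simp
  qed
  show ?thesis
  proof (intro exI allI)
    fix z' :: int
    show "x + of_int z' *\<^sub>R u \<in> swp K u - K \<longleftrightarrow> z' = \<lfloor>\<beta>\<rfloor> + 1"
      unfolding iff by linarith
  qed
qed

lemma lift_pr:
  assumes "u \<in> Rn n" "x + t *\<^sub>R u \<in> swp K u" shows "pr n u x \<in> pr n u ` K"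
proof -
  obtain k s where k: "x + t *\<^sub>R u = k + s *\<^sub>R u" "k \<in> K" using assms by (auto simp: swp_def)
  have "pr n u (x + t *\<^sub>R u) = pr n u (k + s *\<^sub>R u)" using k by simp
  then have "pr n u x = pr n u k" by (simp add: pr_add pr_scale pr_self assms)
  then show ?thesis using k by auto
qed

text \<open>The swept part is cut along the translates of the slab by integer multiples of
  \<open>u\<close>, and each piece is moved back into the slab. By \<open>unique_lift\<close> the
  moved pieces are disjoint and fill the part of the slab that lies over the projection of
  \<open>K\<close>.\<close>

lemma (in tim) one_step_em:
  assumes K: "body n K" and u: "u \<in> E" "u \<noteq> 0"
  shows "emeasure \<mu> (swp K u - K) = emeasure \<mu> {x \<in> slab n u. pr n u x \<in> pr n u ` K}"
proof -
  have un: "u \<in> Rn n" using u E by auto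
  define q where "q = ip n u u"
  have q: "q > 0" using ip_self_pos[OF un u(2)] by (simp add: q_def)
  define X where "X = swp K u - K"
  define Z where "Z z = {x \<in> Rn n. of_int z * q \<le> ip n x u \<and> ip n x u < (of_int z + 1) * q}" for z :: int
  define Y where "Y z = {x \<in> Rn n. x + of_int z *\<^sub>R u \<in> X \<inter> Z z}" for z :: int
  have Xs: "X \<in> sets (rb n)" unfolding X_def
    using body_sets[OF K] body_sets[OF body_swp[OF K un]] by auto
  have XR: "X \<subseteq> Rn n" using sets.sets_into_space[OF Xs] by simp
  have Zs: "Z z \<in> sets (rb n)" for z unfolding Z_def
    by (intro Rn_Collect_sets pred_intros_logic pred_less_real pred_le_real ip_measurable
      borel_measurable_const id_measurable_rb const_measurable_rb un)
  have XZ: "X \<inter> Z z \<in> sets (rb n)" for z using Xs Zs by auto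
  have Ys: "Y z \<in> sets (rb n)" for z
  proof -
    have "(\<lambda>x. x + of_int z *\<^sub>R u) \<in> rb n \<rightarrow>\<^sub>M rb n"
      by (intro add_measurable_rb const_measurable_rb Rn_scale un id_measurable_rb)
    from measurable_sets[OF this XZ[of z]] show ?thesis unfolding space_rb vimage_def Int_def Y_def
      by (simp only: mem_Collect_eq conj_commute)
  qed
  have su: "of_int z *\<^sub>R u \<in> E" for z :: int using E u by (simp add: subspace_scale)
  have inZ: "x \<in> Z z \<longleftrightarrow> z = \<lfloor>ip n x u / q\<rfloor>" if "x \<in> Rn n" for x z
  proof -
    have "z = \<lfloor>ip n x u / q\<rfloor> \<longleftrightarrow> of_int z \<le> ip n x u / q \<and> ip n x u / q < of_int z + 1" by linarith
    then show ?thesis using that q by (simp add: Z_def pos_le_divide_eq pos_divide_less_eq)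
  qed
  have Yeq: "Y z = {x \<in> slab n u. x + of_int z *\<^sub>R u \<in> X}" for z
  proof -
    have "x + of_int z *\<^sub>R u \<in> Z z \<longleftrightarrow> x \<in> slab n u" if "x \<in> Rn n" for x
      using that un by (auto simp: Z_def slab_def q_def algebra_simps)
    then show ?thesis by (auto simp: Y_def slab_def)
  qed
  have UX: "X = (\<Union>z. X \<inter> Z z)" 
  proof
    show "X \<subseteq> (\<Union>z. X \<inter> Z z)"
    proof
      fix x assume x: "x \<in> X"
      then have "x \<in> Z \<lfloor>ip n x u / q\<rfloor>" using XR inZ[of x] by auto
      then show "x \<in> (\<Union>z. X \<inter> Z z)" using x by blast
    qed
  qed auto
  have dX: "disjoint_family (\<lambda>z. X \<inter> Z z)"
    unfolding disjoint_family_on_def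
  proof (intro ballI impI equals0I)
    fix z z' x assume z: "z \<noteq> z'" and x: "x \<in> (X \<inter> Z z) \<inter> (X \<inter> Z z')"
    then have "x \<in> Rn n" using XR by auto
    from inZ[OF this, of z] inZ[OF this, of z'] show False using z x by auto
  qed
  have ul: "\<exists>z::int. \<forall>z'::int. x + of_int z' *\<^sub>R u \<in> X \<longleftrightarrow> z' = z" if "x \<in> slab n u" "pr n u x \<in> pr n u ` K" for x
    unfolding X_def using that by (intro unique_lift[OF K un u(2)]) (auto simp: slab_def)
  have lp: "pr n u x \<in> pr n u ` K" if "x + of_int z *\<^sub>R u \<in> X" for x and z :: int
    using that lift_pr[OF un] by (auto simp: X_def)
  have UY: "{x \<in> slab n u. pr n u x \<in> pr n u ` K} = (\<Union>z. Y z)"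
  proof (intro set_eqI iffI)
    fix x assume "x \<in> {x \<in> slab n u. pr n u x \<in> pr n u ` K}"
    then have x: "x \<in> slab n u" "pr n u x \<in> pr n u ` K" by auto
    obtain z0 :: int where "\<forall>z'::int. x + of_int z' *\<^sub>R u \<in> X \<longleftrightarrow> z' = z0" using ul[OF x] ..
    then have "x + of_int z0 *\<^sub>R u \<in> X" by simp
    then show "x \<in> (\<Union>z. Y z)" using x(1) unfolding Yeq by auto
  next
    fix x assume "x \<in> (\<Union>z. Y z)"
    then obtain z where "x \<in> slab n u" "x + of_int z *\<^sub>R u \<in> X" unfolding Yeq by auto
    then show "x \<in> {x \<in> slab n u. pr n u x \<in> pr n u ` K}" using lp by auto
  qed
  have dY: "disjoint_family Y"
    unfolding disjoint_family_on_def
  proof (intro ballI impI equals0I)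
    fix z z' x assume z: "z \<noteq> z'" "x \<in> Y z \<inter> Y z'"
    then obtain z0 where "\<forall>z'::int. x + of_int z' *\<^sub>R u \<in> X \<longleftrightarrow> z' = z0"
      using ul[of x] lp[of x z] by (auto simp: Yeq)
    then show False using z by (auto simp: Yeq)
  qed
  have "emeasure \<mu> X = (\<integral>\<^sup>+z. emeasure \<mu> (X \<inter> Z z) \<partial>count_space UNIV)"
    by (subst UX, rule emeasure_UN_countable) (auto simp only: sets_mu XZ dX countableI_type)
  also have "\<dots> = (\<integral>\<^sup>+z. emeasure \<mu> (Y z) \<partial>count_space UNIV)"
    by (intro nn_integral_cong) (simp only: Y_def trans[OF su XZ])
  also have "\<dots> = emeasure \<mu> (\<Union>z. Y z)"
    by (rule emeasure_UN_countable[symmetric]) (auto simp only: sets_mu Ys dY countableI_type)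
  finally show ?thesis unfolding UY X_def .
qed

lemma (in tim) one_step:
  assumes K: "body n K" and u: "u \<in> E"
  shows "measure \<mu> (swp K u) = measure \<mu> K + measure (sm n \<mu> u) (pr n u ` K)"
proof (cases "u = 0")
  case True
  have "slab n 0 = {}" by (auto simp: slab_def)
  then show ?thesis using measure_sm[OF sets_mu, of 0 "pr n 0 ` K"] body_sets[OF body_pr[OF K, of 0]] True by simp
next
  case False
  have un: "u \<in> Rn n" using u E by auto
  have f: "emeasure \<mu> (swp K u) \<noteq> \<infinity>"
    using emeasure_compact[of "swp K u"] body_swp[OF K un] by (auto simp: body_def)
  have "measure \<mu> (swp K u - K) = measure \<mu> (swp K u) - measure \<mu> K"
    using f body_sets[OF K] body_sets[OF body_swp[OF K un]] swp_sup[of K u]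
    by (intro measure_Diff) (auto simp only: sets_mu)
  moreover have "measure \<mu> (swp K u - K) = measure (sm n \<mu> u) (pr n u ` K)"
    using one_step_em[OF K u False] measure_sm[OF sets_mu un body_sets[OF body_pr[OF K un]]]
    by (simp add: measure_def)
  ultimately show ?thesis by simp
qed

text \<open>For \<open>\<mu>\<close> Lebesgue measure this is the volume of the projection of \<open>K\<close> orthogonal to the vectors of the list, times
  the volume of the parallelotope that they span.\<close>

primrec W :: "vec measure \<Rightarrow> vec list \<Rightarrow> vec set \<Rightarrow> real" where
  "W \<mu> [] K = measure \<mu> K"
| "W \<mu> (u # us) K = W \<mu> us (swp K u) - W \<mu> us K"

text \<open>Gram-Schmidt in recursive form. For vectors in \<open>Rn n\<close>, \<open>chi\<close>
  says that the component of \<open>x\<close> in their span lies in the half-open box whose edges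
  are the orthogonalised vectors, and it is never true if the vectors are dependent;
  \<open>pj\<close> is the orthogonal projection onto the complement of the span.\<close>

function (sequential) chi :: "nat \<Rightarrow> vec list \<Rightarrow> vec \<Rightarrow> bool" where
  "chi n [] x = True"
| "chi n (u # us) x = (0 \<le> ip n x u \<and> ip n x u < ip n u u \<and> chi n (map (pr n u) us) (pr n u x))"
  by pat_completeness auto
termination by (relation "Wellfounded.measure (\<lambda>(n, us, x). length us)") auto

function (sequential) pj :: "nat \<Rightarrow> vec list \<Rightarrow> vec \<Rightarrow> vec" where
  "pj n [] x = x"
| "pj n (u # us) x = pj n (map (pr n u) us) (pr n u x)"
  by pat_completeness auto
termination by (relation "Wellfounded.measure (\<lambda>(n, us, x). length us)") auto

text \<open>\<open>chi\<close> and \<open>pj\<close> recurse on \<open>map (pr n u) us\<close>,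
  which is as long as \<open>us\<close> but is another list, so structural induction does not reach
  it.\<close>

lemma list_length_induct [case_names Nil Cons]:
  assumes "P []" "\<And>u us. (\<And>vs. length vs = length us \<Longrightarrow> P vs) \<Longrightarrow> P (u # us)"
  shows "P us"
proof (induction "length us" arbitrary: us)
  case (Suc k)
  then obtain u vs where e: "us = u # vs" "length vs = k" by (cases us) auto
  show ?case unfolding e(1)
  proof (rule assms(2), goal_cases)
    case (1 ws)
    then show ?case using Suc.hyps(1)[of ws] e(2) by simp
  qed
qed (simp add: assms(1))

text \<open>The vectors of the list will be random, hence functions \<open>F l\<close> of the
  parameter. The family has to be arbitrary since each recursion step replaces its members by their
  projections.\<close>

lemma pj_measurable:
  "(\<And>l. l \<in> set ls \<Longrightarrow> F l \<in> M \<rightarrow>\<^sub>M rb n) \<Longrightarrow> g \<in> M \<rightarrow>\<^sub>M rb n \<Longrightarrow>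
    (\<lambda>x. pj n (map (\<lambda>l. F l x) ls) (g x)) \<in> M \<rightarrow>\<^sub>M rb n"
proof (induction ls arbitrary: F g)
  case (Cons l ls)
  have "(\<lambda>x. pj n (map (\<lambda>k. pr n (F l x) (F k x)) ls) (pr n (F l x) (g x))) \<in> M \<rightarrow>\<^sub>M rb n"
    by (rule Cons.IH) (auto intro!: pr_measurable_rb Cons.prems)
  then show ?case by (simp add: comp_def)
qed simp

lemma chi_measurable:
  "(\<And>l. l \<in> set ls \<Longrightarrow> F l \<in> M \<rightarrow>\<^sub>M rb n) \<Longrightarrow> g \<in> M \<rightarrow>\<^sub>M rb n \<Longrightarrow>
    Measurable.pred M (\<lambda>x. chi n (map (\<lambda>l. F l x) ls) (g x))"
proof (induction ls arbitrary: F g)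
  case (Cons l ls)
  have "Measurable.pred M (\<lambda>x. chi n (map (\<lambda>k. pr n (F l x) (F k x)) ls) (pr n (F l x) (g x)))"
    by (rule Cons.IH) (auto intro!: pr_measurable_rb Cons.prems)
  moreover have "F l \<in> M \<rightarrow>\<^sub>M rb n" using Cons.prems by auto
  ultimately show ?case
    by (auto simp: comp_def intro!: pred_intros_logic pred_less_real pred_le_real ip_measurable Cons.prems)
qed simp

lemma pj_Rn: "set us \<subseteq> Rn n \<Longrightarrow> x \<in> Rn n \<Longrightarrow> pj n us x \<in> Rn n"
proof (induction us arbitrary: x rule: list_length_induct)
  case (Cons u us)
  show ?case unfolding pj.simps
    by (rule Cons.IH) (use Cons.prems in auto)
qed simp

lemma body_pj: "set us \<subseteq> Rn n \<Longrightarrow> body n K \<Longrightarrow> body n (pj n us ` K)"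
proof (induction us arbitrary: K rule: list_length_induct)
  case (Cons u us)
  have "body n (pj n (map (pr n u) us) ` pr n u ` K)"
    using Cons.prems by (intro Cons.IH body_pr) auto
  then show ?case by (simp add: image_image)
qed simp

definition cyl :: "nat \<Rightarrow> vec list \<Rightarrow> vec set \<Rightarrow> vec set" where
  "cyl n us A = {x \<in> Rn n. chi n us x \<and> pj n us x \<in> A}"

lemma cyl_sets: assumes us: "set us \<subseteq> Rn n" and A: "A \<in> sets (rb n)" shows "cyl n us A \<in> sets (rb n)"
proof -
  have 1: "(\<lambda>x. pj n (map (\<lambda>l. l) us) x) \<in> rb n \<rightarrow>\<^sub>M rb n"
    using us by (intro pj_measurable const_measurable_rb id_measurable_rb) auto
  have 2: "Measurable.pred (rb n) (\<lambda>x. chi n (map (\<lambda>l. l) us) x)"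
    using us by (intro chi_measurable const_measurable_rb id_measurable_rb) auto
  have "cyl n us A = {x \<in> Rn n. chi n us x} \<inter> (pj n us -` A \<inter> space (rb n))"
    by (auto simp: cyl_def)
  moreover have "pj n us -` A \<inter> space (rb n) \<in> sets (rb n)"
    using measurable_sets[OF 1 A] by simp
  moreover have "{x \<in> Rn n. chi n us x} \<in> sets (rb n)"
    using Rn_Collect_sets[OF 2] by simp
  ultimately show ?thesis by simp
qed

text \<open>Sweeps commute, and the projection of a sweep is a sweep of the projection. Therefore
  the difference along \<open>u\<close> can be pulled through all the others and evaluated first, by
  \<open>one_step\<close>.\<close>

lemma W_sm:
  assumes t: "tim n \<mu> E" and u: "u \<in> E"
  shows "set us \<subseteq> Rn n \<Longrightarrow> body n K \<Longrightarrow>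
    W (sm n \<mu> u) (map (pr n u) us) (pr n u ` K) = W \<mu> us (swp K u) - W \<mu> us K"
proof (induction us arbitrary: K)
  case Nil
  interpret tim n \<mu> E by fact
  show ?case using one_step[OF Nil(2) u] by simp
next
  case (Cons v us)
  have v: "v \<in> Rn n" using Cons.prems by simp
  have "swp (pr n u ` K) (pr n u v) = pr n u ` swp K v"
    by (simp add: linear_image_swp linear_pr)
  then show ?case
    using Cons.IH[of K] Cons.IH[of "swp K v"] Cons.prems body_swp[OF _ v, of K]
    by (simp add: swp_comm[of K u v])
qed

text \<open>Each vector replaces the measure by \<open>sm\<close> and everything else by its
  projection; unfolding these measures gives the cylinder. In particular \<open>W\<close> is
  nonnegative, which its form as an alternating sum hides.\<close>

theorem W_formula:
  "tim n \<mu> E \<Longrightarrow> set us \<subseteq> E \<Longrightarrow> body n K \<Longrightarrow> W \<mu> us K = measure \<mu> (cyl n us (pj n us ` K))"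
proof (induction us arbitrary: \<mu> E K rule: list_length_induct)
  case Nil
  then show ?case by (auto simp: cyl_def body_def Int_absorb1 intro!: arg_cong[where f="measure \<mu>"])
next
  case (Cons u us)
  interpret tim n \<mu> E by (rule Cons.prems)
  have u: "u \<in> E" "u \<in> Rn n" and us: "set us \<subseteq> E" "set us \<subseteq> Rn n" using Cons.prems E by auto
  let ?vs = "map (pr n u) us"
  let ?E = "{a \<in> E. ip n a u = 0}"
  have vs: "set ?vs \<subseteq> ?E" 
  proof
    fix y assume "y \<in> set ?vs"
    then obtain v where v: "v \<in> set us" "y = pr n u v" by auto
    have "y \<in> E" unfolding v pr_def using us u E v by (intro subspace_diff subspace_scale) auto
    then show "y \<in> ?E" using v ip_pr[OF u(2)] by simp
  qed
  have vsn: "set ?vs \<subseteq> Rn n" using us u by auto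
  have "W \<mu> (u # us) K = W (sm n \<mu> u) ?vs (pr n u ` K)"
    using W_sm[OF Cons.prems(1) u(1) us(2) Cons.prems(3)] by simp
  also have "\<dots> = measure (sm n \<mu> u) (cyl n ?vs (pj n ?vs ` (pr n u ` K)))"
    by (rule Cons.IH[OF _ tim_sm[OF Cons.prems(1) u(1)] vs body_pr[OF Cons.prems(3) u(2)]]) simp
  also have "\<dots> = measure \<mu> {x \<in> slab n u. pr n u x \<in> cyl n ?vs (pj n ?vs ` (pr n u ` K))}"
    by (intro measure_sm sets_mu u cyl_sets vsn body_sets[OF body_pj] body_pr Cons.prems)
  also have "{x \<in> slab n u. pr n u x \<in> cyl n ?vs (pj n ?vs ` (pr n u ` K))} = cyl n (u # us) (pj n (u # us) ` K)"
    using u by (auto simp: slab_def cyl_def image_image)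
  finally show ?case .
qed

text \<open>Cauchy's equation for a monotone function: squeezing \<open>m * s\<close> between
  consecutive integers leaves an error of at most \<open>f 1 / m\<close> for every
  \<open>m\<close>.\<close>

lemma additive_nonneg_linear:
  fixes f :: "real \<Rightarrow> real"
  assumes add: "\<And>s t. 0 \<le> s \<Longrightarrow> 0 \<le> t \<Longrightarrow> f (s + t) = f s + f t"
    and nn: "\<And>s. 0 \<le> s \<Longrightarrow> 0 \<le> f s" and s: "0 \<le> s"
  shows "f s = s * f 1"
proof -
  have mono: "f a \<le> f b" if "0 \<le> a" "a \<le> b" for a b
    using add[of a "b - a"] nn[of "b - a"] that by simp
  have mult: "f (real k * a) = real k * f a" if "0 \<le> a" for k a
  proof (induction k)
    case 0 show ?case using add[of 0 0] by simp
  next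
    case (Suc k)
    have "f (real (Suc k) * a) = f (real k * a + a)" by (simp add: algebra_simps)
    also have "\<dots> = f (real k * a) + f a" using that by (intro add) auto
    finally show ?case using Suc by (simp add: algebra_simps)
  qed
  have b: "real m * \<bar>f s - s * f 1\<bar> \<le> f 1" for m
  proof -
    let ?k = "nat \<lfloor>real m * s\<rfloor>"
    have k: "real ?k \<le> real m * s" "real m * s \<le> real (Suc ?k)" using s by (auto, linarith)
    have "real ?k * f 1 \<le> real m * f s" using mono[OF _ k(1)] mult[of 1 ?k] mult[of s m] s by simp
    moreover have "real m * f s \<le> real (Suc ?k) * f 1"
      using mono[OF _ k(2)] mult[of 1 "Suc ?k"] mult[of s m] s by (simp del: of_nat_Suc)
    moreover have "real ?k * f 1 \<le> (real m * s) * f 1" "(real m * s) * f 1 \<le> real (Suc ?k) * f 1"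
      using k nn[of 1] by (auto intro!: mult_right_mono simp del: of_nat_Suc)
    ultimately have "\<bar>real m * f s - real m * s * f 1\<bar> \<le> f 1" by (simp add: algebra_simps abs_le_iff)
    moreover have "real m * f s - real m * s * f 1 = real m * (f s - s * f 1)" by (simp add: algebra_simps)
    ultimately show ?thesis by (simp add: abs_mult)
  qed
  have "\<not> \<bar>f s - s * f 1\<bar> > 0"
  proof
    assume "\<bar>f s - s * f 1\<bar> > 0"
    then obtain m where "f 1 < real m * \<bar>f s - s * f 1\<bar>" using reals_Archimedean3 by blast
    then show False using b[of m] by simp
  qed
  then show ?thesis by simp
qed

section \<open>Volume of a Minkowski sum with a zonotope\<close>

lemma swp_swp_dir:
  assumes "0 \<le> s" "0 \<le> t" shows "swp (swp K (s *\<^sub>R u)) (t *\<^sub>R u) = swp K ((s + t) *\<^sub>R u)"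
proof (cases "s + t = 0")
  case True
  then have "s = 0" "t = 0" using assms by auto
  then show ?thesis by simp
next
  case False
  show ?thesis
  proof (intro set_eqI iffI)
    fix y assume "y \<in> swp (swp K (s *\<^sub>R u)) (t *\<^sub>R u)"
    then obtain x a b where x: "x \<in> K" "0 \<le> a" "a \<le> 1" "0 \<le> b" "b \<le> 1" "y = (x + a *\<^sub>R s *\<^sub>R u) + b *\<^sub>R t *\<^sub>R u"
      by (auto simp: swp_def)
    let ?c = "(a * s + b * t) / (s + t)"
    have "a * s + b * t \<le> 1 * s + 1 * t" using x assms by (intro add_mono mult_right_mono) auto
    then have "0 \<le> ?c" "?c \<le> 1" using x assms False by (auto simp: divide_le_eq)
    moreover have "y = x + ?c *\<^sub>R (s + t) *\<^sub>R u" using x False by (simp flip: scaleR_left_distrib)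
    ultimately show "y \<in> swp K ((s + t) *\<^sub>R u)" using x unfolding swp_def by blast
  next
    fix y assume "y \<in> swp K ((s + t) *\<^sub>R u)"
    then obtain x c where x: "x \<in> K" "0 \<le> c" "c \<le> 1" "y = x + c *\<^sub>R (s + t) *\<^sub>R u" by (auto simp: swp_def)
    have "y = (x + c *\<^sub>R s *\<^sub>R u) + c *\<^sub>R t *\<^sub>R u" using x by (simp add: scaleR_left_distrib scaleR_right_distrib)
    moreover have "x + c *\<^sub>R s *\<^sub>R u \<in> swp K (s *\<^sub>R u)" using x unfolding swp_def by blast
    ultimately show "y \<in> swp (swp K (s *\<^sub>R u)) (t *\<^sub>R u)" using x unfolding swp_def[of "swp K _"] by blast
  qed
qed

text \<open>The increment is additive in \<open>s\<close> because a sweep along \<open>s u\<close>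
  does not change the projection along \<open>u\<close>, and it is nonnegative by
  \<open>one_step\<close>; so it is linear.\<close>

lemma (in tim) measure_swp_scale:
  assumes K: "body n K" and u: "u \<in> E" and s: "0 \<le> s"
  shows "measure \<mu> (swp K (s *\<^sub>R u)) = measure \<mu> K + s * (measure \<mu> (swp K u) - measure \<mu> K)"
proof -
  have un: "u \<in> Rn n" using u E by auto
  define f where "f s = measure \<mu> (swp K (s *\<^sub>R u)) - measure \<mu> K" for s
  have su: "r *\<^sub>R u \<in> E" for r using u E by (simp add: subspace_scale)
  have f1: "f t = measure (sm n \<mu> (t *\<^sub>R u)) (pr n (t *\<^sub>R u) ` K)" for t
    using one_step[OF K su, of t] by (simp add: f_def)
  have "f s = s * f 1"
  proof (rule additive_nonneg_linear[OF _ _ s])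
    fix s :: real show "0 \<le> f s" by (simp add: f1)
  next
    fix s t :: real assume st: "0 \<le> s" "0 \<le> t"
    show "f (s + t) = f s + f t"
    proof (cases "t = 0")
      case True then show ?thesis by (simp add: f_def)
    next
      case False
      have p0: "pr n (t *\<^sub>R u) (s *\<^sub>R u) = 0" using False un by (simp add: pr_scale_dir pr_scale pr_self)
      have "measure \<mu> (swp K ((s + t) *\<^sub>R u)) = measure \<mu> (swp (swp K (s *\<^sub>R u)) (t *\<^sub>R u))"
        using st by (simp add: swp_swp_dir)
      also have "\<dots> = measure \<mu> (swp K (s *\<^sub>R u)) + measure (sm n \<mu> (t *\<^sub>R u)) (pr n (t *\<^sub>R u) ` swp K (s *\<^sub>R u))"
        by (rule one_step[OF body_swp[OF K] su]) (use un in auto)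
      also have "pr n (t *\<^sub>R u) ` swp K (s *\<^sub>R u) = pr n (t *\<^sub>R u) ` K"
        by (simp add: linear_image_swp[OF linear_pr] p0)
      also have "measure (sm n \<mu> (t *\<^sub>R u)) (pr n (t *\<^sub>R u) ` K) = f t" by (rule f1[symmetric])
      finally show ?thesis by (simp add: f_def)
    qed
  qed
  then show ?thesis by (simp add: f_def)
qed

lemma W_swp_scale:
  assumes t: "tim n \<mu> E"
  shows "set vs \<subseteq> E \<Longrightarrow> body n K \<Longrightarrow> u \<in> E \<Longrightarrow> 0 \<le> s \<Longrightarrow>
    W \<mu> vs (swp K (s *\<^sub>R u)) = W \<mu> vs K + s * W \<mu> (u # vs) K"
proof (induction vs arbitrary: K)
  case Nil
  then show ?case using tim.measure_swp_scale[OF t, of K u s] by simp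
next
  case (Cons v vs)
  interpret tim n \<mu> E by (rule t)
  have v: "v \<in> Rn n" using Cons.prems E by auto
  have bv: "body n (swp K v)" using Cons.prems v by (simp add: body_swp)
  show ?case
    using Cons.IH[of K] Cons.IH[OF _ bv] Cons.prems
    by (simp add: swp_comm[of K "s *\<^sub>R u" v] swp_comm[of K u v] algebra_simps)
qed

text \<open>Minkowski sum of \<open>K\<close> and the zonotope generated by the segments from 0 to
  \<open>s u\<close>.\<close>

primrec zon :: "real \<Rightarrow> vec list \<Rightarrow> vec set \<Rightarrow> vec set" where
  "zon s [] K = K"
| "zon s (u # us) K = zon s us (swp K (s *\<^sub>R u))"

lemma zon_append: "zon s (us @ vs) K = zon s vs (zon s us K)"
  by (induction us arbitrary: K) auto

lemma body_zon: "set us \<subseteq> Rn n \<Longrightarrow> body n K \<Longrightarrow> body n (zon s us K)"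
  by (induction us arbitrary: K) (auto intro: body_swp)

text \<open>The measure is affine in the length of each segment; expanding the product of these
  affine dependences gives one term for every choice of segments, as for mixed volumes.\<close>

lemma W_zon:
  assumes t: "tim n \<mu> E" and s: "0 \<le> s"
  shows "set us \<subseteq> E \<Longrightarrow> body n K \<Longrightarrow>
    measure \<mu> (zon s us K) = (\<Sum>vs\<leftarrow>List.subseqs us. s ^ length vs * W \<mu> vs K)"
proof (induction us arbitrary: K)
  case (Cons u us)
  interpret tim n \<mu> E by (rule t)
  have u: "u \<in> E" "u \<in> Rn n" and us: "set us \<subseteq> E" using Cons.prems E by auto
  have "measure \<mu> (zon s (u # us) K) = (\<Sum>vs\<leftarrow>List.subseqs us. s ^ length vs * W \<mu> vs (swp K (s *\<^sub>R u)))"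
    using Cons.IH[OF us body_swp[OF Cons.prems(2), of "s *\<^sub>R u"]] u by simp
  also have "\<dots> = (\<Sum>vs\<leftarrow>List.subseqs us. s ^ length (u # vs) * W \<mu> (u # vs) K + s ^ length vs * W \<mu> vs K)"
  proof (intro arg_cong[where f=sum_list] map_cong refl)
    fix vs assume "vs \<in> set (List.subseqs us)"
    then have "set vs \<in> Pow (set us)" using subseqs_powset[of us] by blast
    then have "set vs \<subseteq> E" using us by auto
    then show "s ^ length vs * W \<mu> vs (swp K (s *\<^sub>R u)) = s ^ length (u # vs) * W \<mu> (u # vs) K + s ^ length vs * W \<mu> vs K"
      using W_swp_scale[OF t _ Cons.prems(2) u(1) s] by (simp add: algebra_simps del: W.simps)
  qed
  finally show ?case by (simp add: Let_def sum_list_addf comp_def del: W.simps)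
qed simp

lemma W_nonneg: "tim n \<mu> E \<Longrightarrow> set us \<subseteq> E \<Longrightarrow> body n K \<Longrightarrow> 0 \<le> W \<mu> us K"
  using W_formula[of n \<mu> E us K] by simp

lemma zon_cb:
  assumes s: "0 \<le> s"
  shows "set us \<subseteq> Rn n \<Longrightarrow> K \<subseteq> cb n r \<Longrightarrow> zon s us K \<subseteq> cb n (r + s * (\<Sum>u\<leftarrow>us. nrm n u))"
proof (induction us arbitrary: K r)
  case (Cons u us)
  have "swp K (s *\<^sub>R u) \<subseteq> cb n (r + s * nrm n u)"
  proof
    fix x assume "x \<in> swp K (s *\<^sub>R u)"
    then obtain k t where k: "k \<in> K" "0 \<le> t" "t \<le> 1" "x = k + t *\<^sub>R s *\<^sub>R u" by (auto simp: swp_def)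
    have "nrm n x \<le> nrm n k + nrm n (t *\<^sub>R s *\<^sub>R u)" unfolding k by (rule nrm_triangle)
    also have "nrm n (t *\<^sub>R s *\<^sub>R u) = t * (s * nrm n u)" using k s by simp
    also have "\<dots> \<le> 1 * (s * nrm n u)" using k s by (intro mult_right_mono) auto
    finally show "x \<in> cb n (r + s * nrm n u)" using k Cons.prems by (auto simp: cb_def)
  qed
  from Cons.IH[OF _ this] Cons.prems show ?case by (simp add: algebra_simps)
qed simp

lemma member_le_sum_list_real:
  fixes f :: "'a \<Rightarrow> real"
  shows "x \<in> set xs \<Longrightarrow> (\<And>y. y \<in> set xs \<Longrightarrow> 0 \<le> f y) \<Longrightarrow> f x \<le> (\<Sum>y\<leftarrow>xs. f y)"
proof (induction xs)
  case (Cons a xs)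
  have "0 \<le> (\<Sum>y\<leftarrow>xs. f y)" using Cons.prems by (intro sum_list_nonneg) auto
  moreover have "0 \<le> f a" using Cons.prems by simp
  ultimately show ?case using Cons.IH Cons.prems by (cases "x = a") (auto intro: add_increasing)
qed simp

text \<open>The term \<open>s ^ length us * W\<close> is at most the volume of a set inside a ball
  of radius \<open>O(s)\<close>, hence at most \<open>s ^ n * C\<close>. For more than
  \<open>n\<close> vectors, letting \<open>s\<close> grow leaves only \<open>W = 0\<close>.\<close>

lemma W_vanish:
  assumes us: "set us \<subseteq> Rn n" and K: "body n K" and len: "length us > n"
  shows "W (leb n) us K = 0"
proof -
  note t = tim_leb[of n]
  interpret tim n "leb n" "Rn n" by (rule t)
  obtain r where r: "r > 0" "K \<subseteq> cb n r" using K compact_in_cb[of K n] by (auto simp: body_def)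
  define R where "R = (\<Sum>u\<leftarrow>us. nrm n u)"
  have R: "R \<ge> 0" unfolding R_def by (intro sum_list_nonneg) auto
  define C where "C = unit_ball_vol (real n) * (r + R) ^ n"
  have W0: "W (leb n) us K \<ge> 0" by (rule W_nonneg[OF t us K])
  have "s * W (leb n) us K \<le> C" if s: "s \<ge> 1" for s
  proof -
    have s0: "0 \<le> s" using s by simp
    have mem: "us \<in> set (List.subseqs us)" by (simp add: subseqs_refl)
    have nn: "0 \<le> s ^ length vs * W (leb n) vs K" if "vs \<in> set (List.subseqs us)" for vs
    proof -
      have "set vs \<in> Pow (set us)" using that subseqs_powset[of us] by blast
      then show ?thesis using s0 us by (intro mult_nonneg_nonneg W_nonneg[OF t _ K]) auto
    qed
    have "s ^ length us * W (leb n) us K \<le> (\<Sum>vs\<leftarrow>List.subseqs us. s ^ length vs * W (leb n) vs K)"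
      by (rule member_le_sum_list_real[OF mem nn])
    also have "\<dots> = vol n (zon s us K)" by (rule W_zon[OF t s0 us K, symmetric])
    also have "\<dots> \<le> vol n (cb n (r + s * R))"
    proof (rule measure_mono_fmeasurable)
      show "zon s us K \<subseteq> cb n (r + s * R)" using zon_cb[OF s0 us r(2)] by (simp add: R_def)
      show "zon s us K \<in> sets (leb n)" using body_sets[OF body_zon[OF us K]] by (simp only: sets_mu)
      show "cb n (r + s * R) \<in> fmeasurable (leb n)" using fin by (auto simp: fmeasurable_def sets_mu)
    qed
    also have "\<dots> = unit_ball_vol (real n) * (r + s * R) ^ n"
      using r R s by (intro vol_cb) (auto intro: add_pos_nonneg)
    also have "\<dots> \<le> unit_ball_vol (real n) * (s * (r + R)) ^ n"
      using r R s mult_right_mono[of 1 s r] by (intro mult_left_mono power_mono) (auto simp: algebra_simps)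
    also have "\<dots> = s ^ n * C" by (simp add: C_def power_mult_distrib)
    finally have le: "s ^ length us * W (leb n) us K \<le> s ^ n * C" .
    have "s ^ n * (s * W (leb n) us K) = s ^ Suc n * W (leb n) us K" by simp
    also have "\<dots> \<le> s ^ length us * W (leb n) us K"
      using s len W0 by (intro mult_right_mono power_increasing) auto
    also note le
    finally show ?thesis using s by simp
  qed
  then have b: "real m * W (leb n) us K \<le> C" if "m \<ge> 1" for m :: nat using that by simp
  have "\<not> W (leb n) us K > 0"
  proof
    assume "W (leb n) us K > 0"
    then obtain m where m: "C < real m * W (leb n) us K" using reals_Archimedean3 by blast
    moreover have "real m * W (leb n) us K \<le> real (Suc m) * W (leb n) us K"
      using W0 by (intro mult_right_mono) auto
    ultimately show False using b[of "Suc m"] by simp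
  qed
  then show ?thesis using W0 by simp
qed

text \<open>The support function. It is additive under Minkowski sums and, by
  \<open>separation\<close>, determines a body.\<close>

definition hs :: "nat \<Rightarrow> vec set \<Rightarrow> vec \<Rightarrow> real" where
  "hs n K w = (SUP x\<in>K. ip n x w)"

lemma hs_attained: assumes "body n K" obtains k where "k \<in> K" "hs n K w = ip n k w" "\<And>x. x \<in> K \<Longrightarrow> ip n x w \<le> ip n k w"
proof -
  have "continuous_on K (\<lambda>x. ip n x w)" by (intro continuous_intros)
  then obtain k where k: "k \<in> K" "\<And>x. x \<in> K \<Longrightarrow> ip n x w \<le> ip n k w"
    using continuous_attains_sup[of K "\<lambda>x. ip n x w"] assms by (auto simp: body_def)
  have "hs n K w = ip n k w" unfolding hs_def
    by (rule cSup_eq_maximum) (use k in auto)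
  then show ?thesis using that k by blast
qed

lemma hs_upper: "body n K \<Longrightarrow> x \<in> K \<Longrightarrow> ip n x w \<le> hs n K w"
  using hs_attained[of n K w] by metis

lemma hs_swp:
  assumes K: "body n K" and u: "u \<in> Rn n"
  shows "hs n (swp K u) w = hs n K w + max 0 (ip n u w)"
proof -
  obtain k where k: "k \<in> K" "hs n K w = ip n k w" "\<And>x. x \<in> K \<Longrightarrow> ip n x w \<le> ip n k w"
    using hs_attained[OF K] by metis
  let ?t = "if ip n u w \<ge> 0 then 1 else 0 :: real"
  show ?thesis unfolding hs_def[of n "swp K u"]
  proof (rule cSup_eq_maximum)
    have "k + ?t *\<^sub>R u \<in> swp K u" using k unfolding swp_def by (intro CollectI exI[of _ k] exI[of _ ?t]) auto
    moreover have "ip n (k + ?t *\<^sub>R u) w = hs n K w + max 0 (ip n u w)" using k by auto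
    ultimately show "hs n K w + max 0 (ip n u w) \<in> (\<lambda>x. ip n x w) ` swp K u" by (metis image_eqI)
  next
    fix y assume "y \<in> (\<lambda>x. ip n x w) ` swp K u"
    then obtain x t where x: "x \<in> K" "0 \<le> t" "t \<le> 1" "y = ip n x w + t * ip n u w" by (auto simp: swp_def)
    have "t * ip n u w \<le> t * max 0 (ip n u w)" using x by (intro mult_left_mono) auto
    also have "\<dots> \<le> 1 * max 0 (ip n u w)" using x by (intro mult_right_mono) auto
    finally show "y \<le> hs n K w + max 0 (ip n u w)" using x k by fastforce
  qed
qed

lemma hs_zon:
  "set us \<subseteq> Rn n \<Longrightarrow> body n K \<Longrightarrow> 0 \<le> s \<Longrightarrow> hs n (zon s us K) w = hs n K w + s * (\<Sum>u\<leftarrow>us. max 0 (ip n u w))"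
proof (induction us arbitrary: K)
  case (Cons u us)
  have b: "body n (swp K (s *\<^sub>R u))" using Cons.prems by (intro body_swp) auto
  have "max 0 (s * ip n u w) = s * max 0 (ip n u w)" using Cons.prems by (simp add: max_def zero_le_mult_iff mult_le_0_iff) 
  then show ?case using Cons.IH[OF _ b] Cons.prems hs_swp[OF Cons.prems(2), of "s *\<^sub>R u" w] by (simp add: algebra_simps)
qed simp

section \<open>Measurability of the volume of a random zonotope\<close>

definition Qn :: "nat \<Rightarrow> vec set" where "Qn n = emb n ` (PiE {..<n} (\<lambda>_. \<rat>))"

lemma countable_Qn: "countable (Qn n)"
  unfolding Qn_def by (intro countable_image countable_PiE) (auto simp: countable_rat)

lemma Qn_Rn: "Qn n \<subseteq> Rn n"
  unfolding Qn_def using emb_Rn by blast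

lemma Qn_dense: assumes w: "w \<in> Rn n" and e: "e > 0"
  obtains q where "q \<in> Qn n" "nrm n (q - w) \<le> real n * e"
proof -
  have "\<exists>q\<in>\<rat>. \<bar>q - lk w i\<bar> \<le> e" for i
  proof -
    obtain r where "r \<in> \<rat>" "lk w i < r" "r < lk w i + e" using Rats_dense_in_real[of "lk w i" "lk w i + e"] e by auto
    then show ?thesis by (intro bexI[of _ r]) (auto simp: abs_le_iff)
  qed
  then obtain q where q: "\<And>i. q i \<in> \<rat>" "\<And>i. \<bar>q i - lk w i\<bar> \<le> e" by metis
  let ?q = "emb n (restrict q {..<n})"
  have "?q \<in> Qn n" using q by (auto simp: Qn_def)
  moreover have "nrm n (?q - w) \<le> (\<Sum>i<n. \<bar>lk (?q - w) i\<bar>)" unfolding nrm_L2 by (rule L2_set_le_sum_abs)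
  moreover have "\<dots> \<le> (\<Sum>i<n. e)" using q by (intro sum_mono) auto
  ultimately show ?thesis using that by fastforce
qed

text \<open>By density countably many half-spaces cut out \<open>K\<close>, which turns membership
  in a random body into a countable conjunction of measurable conditions.\<close>

lemma body_mem_iff:
  assumes K: "body n K" and x: "x \<in> Rn n"
  shows "x \<in> K \<longleftrightarrow> (\<forall>w\<in>Qn n. ip n x w \<le> hs n K w)"
proof
  assume "x \<in> K" then show "\<forall>w\<in>Qn n. ip n x w \<le> hs n K w" using hs_upper[OF K] by auto
next
  assume h: "\<forall>w\<in>Qn n. ip n x w \<le> hs n K w"
  show "x \<in> K"
  proof (rule ccontr)
    assume nx: "x \<notin> K"
    obtain w b where w: "w \<in> Rn n" "\<And>y. y \<in> K \<Longrightarrow> ip n y w \<le> b" "b < ip n x w"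
      using separation[of K n x] K x nx unfolding body_def by metis
    obtain r where r: "r > 0" "K \<subseteq> cb n r" using K compact_in_cb[of K n] by (auto simp: body_def)
    \<comment> \<open>Replacing \<open>w\<close> by a point of \<open>Qn n\<close> at distance at
      most \<open>n * e\<close> changes the gap between \<open>x\<close> and \<open>K\<close> by at
      most half of it.\<close>
    define e where "e = (ip n x w - b) / (2 * (real n + 1) * (r + nrm n x + 1))"
    have pos: "(real n + 1) * (r + nrm n x + 1) > 0" using r by (intro mult_pos_pos) (auto intro: add_pos_nonneg add_nonneg_pos)
    have "2 * (real n + 1) * (r + nrm n x + 1) > 0" using pos by (simp only: mult.assoc)
    then have e: "e > 0" unfolding e_def using w by (intro divide_pos_pos) auto
    obtain q where q: "q \<in> Qn n" "nrm n (q - w) \<le> real n * e" using Qn_dense[OF w(1) e] by metis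
    obtain k where k: "k \<in> K" "hs n K q = ip n k q" using hs_attained[OF K, of q] by metis
    have "ip n x q \<le> ip n k q" using h q k by auto
    moreover have "ip n x q = ip n x w + ip n x (q - w)" "ip n k q = ip n k w + ip n k (q - w)" by auto
    moreover have "ip n k w \<le> b" using w k by auto
    moreover have "ip n (k - x) (q - w) \<le> (r + nrm n x) * (real n * e)"
    proof -
      have "ip n (k - x) (q - w) \<le> nrm n (k - x) * nrm n (q - w)" by (rule ip_cauchy)
      also have "\<dots> \<le> (r + nrm n x) * (real n * e)"
        using nrm_triangle_diff[of n k x] r k q by (intro mult_mono) (auto simp: cb_def)
      finally show ?thesis .
    qed
    moreover have "ip n (k - x) (q - w) = ip n k (q - w) - ip n x (q - w)" by (rule ip_diff_left)
    ultimately have "ip n x w - b \<le> (r + nrm n x) * (real n * e)" by linarith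
    also have "\<dots> \<le> (r + nrm n x + 1) * ((real n + 1) * e)"
      using r e by (intro mult_mono) auto
    also have "\<dots> = (real n + 1) * (r + nrm n x + 1) * e" by (simp add: mult_ac)
    also have "\<dots> = (ip n x w - b) / 2"
    proof -
      have "P * (c / (2 * P)) = c / 2" if "P > 0" for P c :: real using that by simp
      from this[OF pos] show ?thesis unfolding e_def by (simp only: mult.assoc)
    qed
    finally show False using w by simp
  qed
qed

text \<open>The support function of the sum is an explicit function of the random vectors, so the
  pairs of a parameter and a point of the sum form a measurable set by \<open>body_mem_iff\<close>;
  the volumes are the measures of its sections.\<close>

lemma vol_zon_measurable:
  assumes F: "\<And>l. l \<in> set ls \<Longrightarrow> F l \<in> M \<rightarrow>\<^sub>M rb n" and K: "body n K" and s: "0 \<le> s"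
  shows "(\<lambda>\<omega>. vol n (zon s (map (\<lambda>l. F l \<omega>) ls) K)) \<in> borel_measurable M"
proof -
  interpret tim n "leb n" "Rn n" by (rule tim_leb)
  interpret sf: sigma_finite_measure "leb n" by (rule sigma_finite)
  let ?Z = "\<lambda>\<omega>. zon s (map (\<lambda>l. F l \<omega>) ls) K"
  have FR: "set (map (\<lambda>l. F l \<omega>) ls) \<subseteq> Rn n" if "\<omega> \<in> space M" for \<omega>
    using measurable_rb_Rn[OF F that] by auto
  have snd: "snd \<in> M \<Otimes>\<^sub>M leb n \<rightarrow>\<^sub>M rb n"
    using measurable_snd[of M "leb n"] by (simp only: measurable_cong_sets[OF refl sets_leb])
  have Fm: "(\<lambda>z. F l (fst z)) \<in> M \<Otimes>\<^sub>M leb n \<rightarrow>\<^sub>M rb n" if "l \<in> set ls" for l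
    by (rule measurable_compose[OF measurable_fst F[OF that]])
  let ?S = "{z \<in> space (M \<Otimes>\<^sub>M leb n). \<forall>w\<in>Qn n. ip n (snd z) w \<le> hs n K w + s * (\<Sum>l\<leftarrow>ls. max 0 (ip n (F l (fst z)) w))}"
  have sm: "(\<lambda>z. \<Sum>l\<leftarrow>ls. max 0 (ip n (F l (fst z)) w)) \<in> borel_measurable (M \<Otimes>\<^sub>M leb n)" if w: "w \<in> Rn n" for w
    using Fm
  proof (induction ls)
    case (Cons l ls)
    have "(\<lambda>z. max 0 (ip n (F l (fst z)) w)) \<in> borel_measurable (M \<Otimes>\<^sub>M leb n)"
      by (intro borel_measurable_max borel_measurable_const ip_measurable const_measurable_rb w Cons.prems) auto
    then show ?case using Cons by (auto intro!: borel_measurable_add)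
  qed simp
  have Sm: "?S \<in> sets (M \<Otimes>\<^sub>M leb n)"
  proof (rule sets.sets_Collect_countable_All'[OF _ countable_Qn])
    fix w assume "w \<in> Qn n"
    then have w: "w \<in> Rn n" using Qn_Rn by auto
    show "{z \<in> space (M \<Otimes>\<^sub>M leb n). ip n (snd z) w \<le> hs n K w + s * (\<Sum>l\<leftarrow>ls. max 0 (ip n (F l (fst z)) w))} \<in> sets (M \<Otimes>\<^sub>M leb n)"
      by (intro borel_measurable_le borel_measurable_add borel_measurable_times borel_measurable_const sm[OF w] ip_measurable snd const_measurable_rb w)
  qed
  have eq: "Pair \<omega> -` ?S = ?Z \<omega>" if o: "\<omega> \<in> space M" for \<omega>
  proof -
    have b: "body n (?Z \<omega>)" by (rule body_zon[OF FR[OF o] K])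
    have "x \<in> ?Z \<omega> \<longleftrightarrow> (\<forall>w\<in>Qn n. ip n x w \<le> hs n K w + s * (\<Sum>l\<leftarrow>ls. max 0 (ip n (F l \<omega>) w)))" if "x \<in> Rn n" for x
      using body_mem_iff[OF b that] hs_zon[OF FR[OF o] K s] by (simp add: comp_def)
    then show ?thesis using o b by (auto simp: space_pair_measure body_def)
  qed
  have "(\<lambda>\<omega>. emeasure (leb n) (Pair \<omega> -` ?S)) \<in> borel_measurable M"
    by (rule sf.measurable_emeasure_Pair[OF Sm])
  then have "(\<lambda>\<omega>. enn2real (emeasure (leb n) (Pair \<omega> -` ?S))) \<in> borel_measurable M" by simp
  then show ?thesis
    by (rule measurable_cong[THEN iffD1, rotated]) (simp only: eq measure_def)
qed

text \<open>Unfolding \<open>W\<close> turns a vector of \<open>ls\<close> into one more sweep of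
  the body; \<open>ms\<close> collects these sweeps so that the induction goes through.\<close>

lemma W_measurable_gen:
  assumes K: "body n K"
  shows "(\<And>l. l \<in> set ls \<union> set ms \<Longrightarrow> F l \<in> M \<rightarrow>\<^sub>M rb n) \<Longrightarrow>
   (\<lambda>\<omega>. W (leb n) (map (\<lambda>l. F l \<omega>) ls) (zon 1 (map (\<lambda>l. F l \<omega>) ms) K)) \<in> borel_measurable M"
proof (induction ls arbitrary: ms)
  case Nil
  then show ?case using vol_zon_measurable[of ms F M n K 1] K by simp
next
  case (Cons l ls)
  have "(\<lambda>\<omega>. W (leb n) (map (\<lambda>l. F l \<omega>) ls) (zon 1 (map (\<lambda>l. F l \<omega>) (ms @ [l])) K)) \<in> borel_measurable M"
    by (rule Cons.IH) (use Cons.prems in auto)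
  moreover have "(\<lambda>\<omega>. W (leb n) (map (\<lambda>l. F l \<omega>) ls) (zon 1 (map (\<lambda>l. F l \<omega>) ms) K)) \<in> borel_measurable M"
    by (rule Cons.IH) (use Cons.prems in auto)
  ultimately show ?case by (simp add: zon_append)
qed

lemma W_measurable:
  assumes K: "body n K" and F: "\<And>l. l \<in> set ls \<Longrightarrow> F l \<in> M \<rightarrow>\<^sub>M rb n"
  shows "(\<lambda>\<omega>. W (leb n) (map (\<lambda>l. F l \<omega>) ls) K) \<in> borel_measurable M"
proof -
  have "(\<lambda>\<omega>. W (leb n) (map (\<lambda>l. F l \<omega>) ls) (zon 1 (map (\<lambda>l. F l \<omega>) []) K)) \<in> borel_measurable M"
    by (rule W_measurable_gen[OF K]) (use F in auto)
  then show ?thesis by (simp only: list.map zon.simps)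
qed

text \<open>\<open>W (leb n) us K\<close> is one of the nonnegative terms in \<open>W_zon\<close>
  with \<open>s = 1\<close>. The bound makes the random \<open>W\<close> integrable.\<close>

lemma W_bound:
  assumes us: "set us \<subseteq> cb n 1" and K: "body n K" "K \<subseteq> cb n r" "0 \<le> r"
  shows "W (leb n) us K \<le> unit_ball_vol (real n) * (r + real (length us) + 1) ^ n"
proof -
  note t = tim_leb[of n]
  interpret tim n "leb n" "Rn n" by (rule t)
  have usR: "set us \<subseteq> Rn n" using us cb_sub by blast
  have mem: "us \<in> set (List.subseqs us)" by (simp add: subseqs_refl)
  have nn: "0 \<le> 1 ^ length vs * W (leb n) vs K" if "vs \<in> set (List.subseqs us)" for vs
  proof -
    have "set vs \<in> Pow (set us)" using that subseqs_powset[of us] by blast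
    then show ?thesis using usR by (intro mult_nonneg_nonneg W_nonneg[OF t _ K(1)]) auto
  qed
  have "W (leb n) us K \<le> (\<Sum>vs\<leftarrow>List.subseqs us. 1 ^ length vs * W (leb n) vs K)"
    using member_le_sum_list_real[OF mem nn] by simp
  also have "\<dots> = vol n (zon 1 us K)" by (rule W_zon[OF t _ usR K(1), symmetric]) simp
  also have "\<dots> \<le> vol n (cb n (r + real (length us) + 1))"
  proof (rule measure_mono_fmeasurable)
    have "(\<Sum>u\<leftarrow>us. nrm n u) \<le> real (length us)"
      using us by (induction us) (auto simp: cb_def)
    then have "cb n (r + 1 * (\<Sum>u\<leftarrow>us. nrm n u)) \<subseteq> cb n (r + real (length us) + 1)" by (intro cb_mono) simp
    then show "zon 1 us K \<subseteq> cb n (r + real (length us) + 1)" using zon_cb[OF _ usR K(2), of 1] by simp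
    show "zon 1 us K \<in> sets (leb n)" using body_sets[OF body_zon[OF usR K(1)]] by (simp only: sets_mu)
    show "cb n (r + real (length us) + 1) \<in> fmeasurable (leb n)" using fin by (auto simp: fmeasurable_def sets_mu)
  qed
  also have "\<dots> = unit_ball_vol (real n) * (r + real (length us) + 1) ^ n"
    using K by (intro vol_cb) simp
  finally show ?thesis .
qed

lemma sum_list_subseqs_length:
  fixes g :: "nat \<Rightarrow> real"
  shows "(\<Sum>vs\<leftarrow>List.subseqs us. g (length vs)) = (\<Sum>i\<le>length us. real (length us choose i) * g i)"
proof (induction us arbitrary: g)
  case (Cons u us)
  let ?m = "length us"
  have "(\<Sum>vs\<leftarrow>List.subseqs (u # us). g (length vs)) = (\<Sum>vs\<leftarrow>List.subseqs us. g (Suc (length vs))) + (\<Sum>vs\<leftarrow>List.subseqs us. g (length vs))"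
    by (simp add: Let_def comp_def)
  also have "\<dots> = (\<Sum>i\<le>?m. real (?m choose i) * g (Suc i)) + (\<Sum>i\<le>?m. real (?m choose i) * g i)"
    using Cons.IH[of "\<lambda>i. g (Suc i)"] Cons.IH[of g] by simp
  also have "(\<Sum>i\<le>?m. real (?m choose i) * g i) = (\<Sum>i\<le>Suc ?m. real (?m choose i) * g i)"
    by (simp add: binomial_eq_0)
  also have "\<dots> = g 0 + (\<Sum>i\<le>?m. real (?m choose Suc i) * g (Suc i))"
    by (subst sum.atMost_Suc_shift) simp
  also have "(\<Sum>i\<le>?m. real (?m choose i) * g (Suc i)) + (g 0 + (\<Sum>i\<le>?m. real (?m choose Suc i) * g (Suc i)))
     = g 0 + (\<Sum>i\<le>?m. real (Suc ?m choose Suc i) * g (Suc i))"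
    by (simp add: sum.distrib algebra_simps)
  also have "\<dots> = (\<Sum>i\<le>Suc ?m. real (Suc ?m choose i) * g i)"
    by (subst sum.atMost_Suc_shift) simp
  finally show ?case by simp
qed simp

section \<open>Random zonotopes and Steiner's formula\<close>

text \<open>The ball instead of the sphere, because this law is just normalised Lebesgue measure,
  with reflection invariance and boundedness inherited.\<close>

definition U :: "nat \<Rightarrow> vec measure" where "U n = uniform_measure (leb n) (cb n 1)"

abbreviation PP :: "nat \<Rightarrow> nat \<Rightarrow> (nat \<Rightarrow> vec) measure" where
  "PP n M \<equiv> PiM {..<M} (\<lambda>_. U n)"

definition Phi :: "nat \<Rightarrow> nat \<Rightarrow> vec set \<Rightarrow> real" where
  "Phi n i K = (\<integral>\<omega>. W (leb n) (map \<omega> [0..<i]) K \<partial>PP n i)"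

lemma sets_U [simp]: "sets (U n) = sets (rb n)" by (simp add: U_def)
lemma space_U [simp]: "space (U n) = Rn n" by (simp add: U_def)

lemma cb1_em: "emeasure (leb n) (cb n 1) = ennreal (unit_ball_vol (real n))"
  using emeasure_leb_cb[of 1 n] by simp

lemma cb1_em_pos: "emeasure (leb n) (cb n 1) \<noteq> 0" "emeasure (leb n) (cb n 1) \<noteq> \<infinity>"
proof -
  have "unit_ball_vol (real n) > 0" by simp
  then show "emeasure (leb n) (cb n 1) \<noteq> 0" unfolding cb1_em by (metis ennreal_eq_0_iff not_le)
  show "emeasure (leb n) (cb n 1) \<noteq> \<infinity>" unfolding cb1_em by simp
qed

lemma prob_U: "prob_space (U n)"
  unfolding U_def using cb1_em_pos by (rule prob_space_uniform_measure)

lemma prob_PP: "prob_space (PP n M)"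
  by (rule prob_space_PiM) (rule prob_U)

lemma emeasure_U: "A \<in> sets (rb n) \<Longrightarrow> emeasure (U n) A = emeasure (leb n) (cb n 1 \<inter> A) / emeasure (leb n) (cb n 1)"
  unfolding U_def by (rule emeasure_uniform_measure) (simp_all only: sets_leb cb_sets)

lemma AE_U: "AE u in U n. u \<in> cb n 1"
  unfolding U_def by (rule AE_uniform_measureI) (simp_all only: sets_leb cb_sets, simp)

lemma measurable_U: "(\<lambda>u. u) \<in> U n \<rightarrow>\<^sub>M rb n"
  by (rule measurable_ident_sets) simp

lemma PP_component: "k < M \<Longrightarrow> (\<lambda>\<omega>. \<omega> k) \<in> PP n M \<rightarrow>\<^sub>M rb n"
proof -
  assume "k < M"
  then have "(\<lambda>\<omega>. \<omega> k) \<in> PP n M \<rightarrow>\<^sub>M U n" by (intro measurable_component_singleton) auto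
  then show ?thesis by (simp only: measurable_cong_sets[OF refl sets_U])
qed

lemma AE_PP: "AE \<omega> in PP n M. \<forall>k<M. \<omega> k \<in> cb n 1"
proof -
  have "AE \<omega> in PP n M. \<omega> k \<in> cb n 1" if "k < M" for k
    using that by (intro AE_PiM_component[of "{..<M}" "\<lambda>_. U n" k] prob_U AE_U) auto
  then have "AE \<omega> in PP n M. \<forall>k\<in>{..<M}. \<omega> k \<in> cb n 1"
    by (intro AE_finite_allI) auto
  then show ?thesis by (rule AE_mp) (rule AE_I2, auto)
qed

lemma space_PP: "\<omega> \<in> space (PP n M) \<Longrightarrow> k < M \<Longrightarrow> \<omega> k \<in> Rn n"
  using measurable_rb_Rn[OF PP_component] .

lemma W_PP:
  assumes K: "body n K" and xs: "set xs \<subseteq> {..<M}"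
  shows W_PP_measurable: "(\<lambda>\<omega>. W (leb n) (map \<omega> xs) K) \<in> borel_measurable (PP n M)"
    and W_PP_integrable: "integrable (PP n M) (\<lambda>\<omega>. W (leb n) (map \<omega> xs) K)"
    and W_PP_nonneg: "\<And>\<omega>. \<omega> \<in> space (PP n M) \<Longrightarrow> 0 \<le> W (leb n) (map \<omega> xs) K"
proof -
  show m: "(\<lambda>\<omega>. W (leb n) (map \<omega> xs) K) \<in> borel_measurable (PP n M)"
    using xs by (intro W_measurable[OF K, of xs "\<lambda>l \<omega>. \<omega> l"] PP_component) auto
  show nn: "0 \<le> W (leb n) (map \<omega> xs) K" if "\<omega> \<in> space (PP n M)" for \<omega>
    using space_PP[OF that] xs by (intro W_nonneg[OF tim_leb _ K]) auto
  interpret prob_space "PP n M" by (rule prob_PP)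
  obtain r where r: "r > 0" "K \<subseteq> cb n r" using K compact_in_cb[of K n] by (auto simp: body_def)
  let ?C = "unit_ball_vol (real n) * (r + real (length xs) + 1) ^ n"
  show "integrable (PP n M) (\<lambda>\<omega>. W (leb n) (map \<omega> xs) K)"
  proof (rule integrable_const_bound[OF _ m])
    show "AE \<omega> in PP n M. norm (W (leb n) (map \<omega> xs) K) \<le> ?C"
      using AE_PP
    proof (rule AE_mp, intro AE_I2 impI)
      fix \<omega> assume o: "\<omega> \<in> space (PP n M)" "\<forall>k<M. \<omega> k \<in> cb n 1"
      have "W (leb n) (map \<omega> xs) K \<le> unit_ball_vol (real n) * (r + real (length (map \<omega> xs)) + 1) ^ n"
        using o xs r by (intro W_bound K) auto
      then show "norm (W (leb n) (map \<omega> xs) K) \<le> ?C" using nn[OF o(1)] by simp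
    qed
  qed
qed

lemma Phi_nonneg: "body n K \<Longrightarrow> 0 \<le> Phi n i K"
  unfolding Phi_def by (intro integral_nonneg_AE AE_I2 W_PP_nonneg) auto

lemma Phi_vanish: assumes K: "body n K" and i: "i > n" shows "Phi n i K = 0"
proof -
  have "Phi n i K = (\<integral>\<omega>. 0 \<partial>PP n i)"
    unfolding Phi_def
  proof (rule Bochner_Integration.integral_cong[OF refl])
    fix \<omega> assume "\<omega> \<in> space (PP n i)"
    from space_PP[OF this] show "W (leb n) (map \<omega> [0..<i]) K = 0"
      using i by (intro W_vanish K) auto
  qed
  then show ?thesis by simp
qed

text \<open>The coordinates are independent with the same law, so a list of distinct indices matters
  only through its length.\<close>

lemma integral_W_reindex:
  assumes K: "body n K" and xs: "set xs \<subseteq> {..<M}" "distinct xs"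
  shows "(\<integral>\<omega>. W (leb n) (map \<omega> xs) K \<partial>PP n M) = Phi n (length xs) K"
proof -
  let ?m = "length xs"
  let ?g = "\<lambda>\<omega>. \<lambda>k\<in>{..<?m}. \<omega> (xs ! k)"
  have d: "distr (PP n M) (PP n ?m) ?g = PP n ?m"
  proof (rule distr_PiM_reindex)
    show "inj_on ((!) xs) {..<?m}" using xs(2) by (simp add: inj_on_nth)
    show "(!) xs \<in> {..<?m} \<rightarrow> {..<M}" using xs(1) nth_mem by blast
  qed (rule prob_U)
  have gm: "?g \<in> PP n M \<rightarrow>\<^sub>M PP n ?m"
  proof (rule measurable_restrict)
    fix k assume "k \<in> {..<?m}"
    then have "xs ! k < M" using xs(1) nth_mem by fastforce
    then show "(\<lambda>\<omega>. \<omega> (xs ! k)) \<in> PP n M \<rightarrow>\<^sub>M U n" by (intro measurable_component_singleton) auto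
  qed
  have "Phi n ?m K = (\<integral>\<omega>. W (leb n) (map \<omega> [0..<?m]) K \<partial>distr (PP n M) (PP n ?m) ?g)"
    unfolding Phi_def d ..
  also have "\<dots> = (\<integral>\<omega>. W (leb n) (map (?g \<omega>) [0..<?m]) K \<partial>PP n M)"
    by (rule integral_distr[OF gm]) (rule W_PP_measurable[OF K], auto)
  also have "\<dots> = (\<integral>\<omega>. W (leb n) (map \<omega> xs) K \<partial>PP n M)"
  proof -
    have e: "map (?g \<omega>) [0..<?m] = map \<omega> xs" for \<omega> by (rule nth_equalityI) auto
    show ?thesis unfolding e ..
  qed
  finally show ?thesis by simp
qed

lemma subseqs_map: "List.subseqs (map f xs) = map (map f) (List.subseqs xs)"
  by (induction xs) (auto simp: Let_def)

lemma integral_sum_list: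
  fixes f :: "'b \<Rightarrow> 'a \<Rightarrow> real"
  shows "(\<And>x. x \<in> set xs \<Longrightarrow> integrable M (f x)) \<Longrightarrow>
    integrable M (\<lambda>\<omega>. \<Sum>x\<leftarrow>xs. f x \<omega>) \<and> (\<integral>\<omega>. (\<Sum>x\<leftarrow>xs. f x \<omega>) \<partial>M) = (\<Sum>x\<leftarrow>xs. \<integral>\<omega>. f x \<omega> \<partial>M)"
proof (induction xs)
  case (Cons a xs)
  then have "integrable M (f a)" "integrable M (\<lambda>\<omega>. \<Sum>x\<leftarrow>xs. f x \<omega>)"
    "(\<integral>\<omega>. (\<Sum>x\<leftarrow>xs. f x \<omega>) \<partial>M) = (\<Sum>x\<leftarrow>xs. \<integral>\<omega>. f x \<omega> \<partial>M)" by auto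
  then show ?case by simp
qed simp

text \<open>Linearity of expectation applied to \<open>W_zon\<close>: the \<open>M choose i\<close>
  sublists of length \<open>i\<close> all contribute \<open>Phi n i K\<close>.\<close>

lemma expect_zon:
  assumes K: "body n K" and s: "0 \<le> s"
  shows "integrable (PP n M) (\<lambda>\<omega>. vol n (zon s (map \<omega> [0..<M]) K))"
    and "(\<integral>\<omega>. vol n (zon s (map \<omega> [0..<M]) K) \<partial>PP n M) = (\<Sum>i\<le>M. real (M choose i) * (s ^ i * Phi n i K))"
proof -
  let ?S = "List.subseqs [0..<M]"
  have S: "distinct xs" "set xs \<subseteq> {..<M}" if "xs \<in> set ?S" for xs
  proof -
    show "distinct xs" using subseqs_distinctD[OF that] by simp
    have "set xs \<in> Pow (set [0..<M])" using that subseqs_powset[of "[0..<M]"] by blast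
    then show "set xs \<subseteq> {..<M}" by auto
  qed
  have eq: "vol n (zon s (map \<omega> [0..<M]) K) = (\<Sum>xs\<leftarrow>?S. s ^ length xs * W (leb n) (map \<omega> xs) K)"
    if "\<omega> \<in> space (PP n M)" for \<omega>
  proof -
    have "set (map \<omega> [0..<M]) \<subseteq> Rn n" using space_PP[OF that] by auto
    from W_zon[OF tim_leb s this K] show ?thesis by (simp add: subseqs_map comp_def)
  qed
  have int: "integrable (PP n M) (\<lambda>\<omega>. s ^ length xs * W (leb n) (map \<omega> xs) K)" if "xs \<in> set ?S" for xs
    using W_PP_integrable[OF K S(2)[OF that]] by simp
  note L = integral_sum_list[of ?S "PP n M" "\<lambda>xs \<omega>. s ^ length xs * W (leb n) (map \<omega> xs) K", OF int]
  show "integrable (PP n M) (\<lambda>\<omega>. vol n (zon s (map \<omega> [0..<M]) K))"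
    by (rule Bochner_Integration.integrable_cong[THEN iffD1, OF refl _ L[THEN conjunct1]]) (simp_all only: eq)
  have "(\<integral>\<omega>. vol n (zon s (map \<omega> [0..<M]) K) \<partial>PP n M) = (\<integral>\<omega>. (\<Sum>xs\<leftarrow>?S. s ^ length xs * W (leb n) (map \<omega> xs) K) \<partial>PP n M)"
    by (rule Bochner_Integration.integral_cong[OF refl]) (simp only: eq)
  also have "\<dots> = (\<Sum>xs\<leftarrow>?S. \<integral>\<omega>. s ^ length xs * W (leb n) (map \<omega> xs) K \<partial>PP n M)"
    using L by simp
  also have "\<dots> = (\<Sum>xs\<leftarrow>?S. s ^ length xs * Phi n (length xs) K)"
    by (intro arg_cong[where f=sum_list] map_cong refl) (simp add: integral_W_reindex[OF K S(2) S(1)])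
  also have "\<dots> = (\<Sum>i\<le>length [0..<M]. real (length [0..<M] choose i) * (s ^ i * Phi n i K))"
    by (rule sum_list_subseqs_length)
  finally show "(\<integral>\<omega>. vol n (zon s (map \<omega> [0..<M]) K) \<partial>PP n M) = (\<Sum>i\<le>M. real (M choose i) * (s ^ i * Phi n i K))"
    by simp
qed

text \<open>Reflection in the hyperplane orthogonal to \<open>v\<close>; the identity if \<open>v = 0\<close>.\<close>

definition rf :: "nat \<Rightarrow> vec \<Rightarrow> vec \<Rightarrow> vec" where
  "rf n v x = x - (2 * ip n x v / ip n v v) *\<^sub>R v"

lemma rf_Rn: "v \<in> Rn n \<Longrightarrow> x \<in> Rn n \<Longrightarrow> rf n v x \<in> Rn n"
  by (auto simp: rf_def)

lemma rf_add: "rf n v (x + y) = rf n v x + rf n v y"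
  by (simp add: rf_def add_divide_distrib algebra_simps)

lemma rf_diff: "rf n v (x - y) = rf n v x - rf n v y"
  by (simp add: rf_def diff_divide_distrib algebra_simps)

lemma rf_scale: "rf n v (r *\<^sub>R x) = r *\<^sub>R rf n v x"
  by (simp add: rf_def algebra_simps)

lemma rf_ip: assumes "v \<in> Rn n" shows "ip n (rf n v x) (rf n v y) = ip n x y"
proof (cases "v = 0")
  case True then show ?thesis by (simp add: rf_def)
next
  case False
  have "ip n v v \<noteq> 0" using ip_self_pos[OF assms False] by simp
  then show ?thesis by (simp add: rf_def ip_sym[of n v y])
qed

lemma rf_nrm: "v \<in> Rn n \<Longrightarrow> nrm n (rf n v x) = nrm n x"
  by (simp add: nrm_def rf_ip)

lemma rf_rf: assumes "v \<in> Rn n" shows "rf n v (rf n v x) = x"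
proof (cases "v = 0")
  case True then show ?thesis by (simp add: rf_def)
next
  case False
  have "ip n v v \<noteq> 0" using ip_self_pos[OF assms False] by simp
  then have "2 * ip n (rf n v x) v / ip n v v = - (2 * ip n x v / ip n v v)" by (simp add: rf_def field_simps)
  then have "rf n v (rf n v x) = rf n v x + (2 * ip n x v / ip n v v) *\<^sub>R v"
    by (simp add: rf_def[of n v "rf n v x"])
  then show ?thesis by (simp add: rf_def)
qed

lemma rf_measurable: "v \<in> Rn n \<Longrightarrow> f \<in> M \<rightarrow>\<^sub>M rb n \<Longrightarrow> (\<lambda>x. rf n v (f x)) \<in> M \<rightarrow>\<^sub>M rb n"
  unfolding rf_def
  by (intro diff_measurable_rb scale_measurable_rb borel_measurable_divide borel_measurable_times borel_measurable_const
      ip_measurable const_measurable_rb)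

text \<open>The mirror is the perpendicular bisector of \<open>a\<close> and \<open>b\<close>.
  Single reflections thus act transitively on spheres, which is all the rotation invariance used
  below.\<close>

lemma rf_maps:
  assumes "a \<in> Rn n" "b \<in> Rn n" "nrm n a = nrm n b" shows "rf n (a - b) a = b"
proof (cases "a = b")
  case True then show ?thesis by (simp add: rf_def)
next
  case False
  have "ip n a a = ip n b b" using assms(3) by (simp add: ip_self_eq)
  then have "2 * ip n a (a - b) = ip n (a - b) (a - b)" by (simp add: ip_sym[of n b a])
  moreover have "ip n (a - b) (a - b) > 0" using assms False by (intro ip_self_pos) auto
  ultimately have e: "2 * ip n a (a - b) / ip n (a - b) (a - b) = 1" by (metis divide_self less_irrefl)
  show ?thesis unfolding rf_def e by simp
qed

lemma leb_rf: "v \<in> Rn n \<Longrightarrow> A \<in> sets (rb n) \<Longrightarrow> emeasure (leb n) {x \<in> Rn n. rf n v x \<in> A} = emeasure (leb n) A"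
  by (rule isometry_leb) (auto simp only: rf_add rf_Rn rf_rf rf_nrm intro!: rf_measurable id_measurable_rb)

lemma rf_pre_sets: assumes "v \<in> Rn n" "A \<in> sets (rb n)" shows "{x \<in> Rn n. rf n v x \<in> A} \<in> sets (rb n)"
proof -
  have "(\<lambda>x. rf n v x) -` A \<inter> space (rb n) \<in> sets (rb n)"
    by (rule measurable_sets[OF rf_measurable[OF assms(1) id_measurable_rb] assms(2)])
  moreover have "(\<lambda>x. rf n v x) -` A \<inter> space (rb n) = {x \<in> Rn n. rf n v x \<in> A}" by auto
  ultimately show ?thesis by simp
qed

lemma U_rf: assumes v: "v \<in> Rn n" shows "distr (U n) (U n) (rf n v) = U n"
proof (rule measure_eqI)
  fix A assume "A \<in> sets (distr (U n) (U n) (rf n v))"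
  then have A: "A \<in> sets (rb n)" by simp
  have m: "rf n v \<in> U n \<rightarrow>\<^sub>M U n"
    using rf_measurable[OF v measurable_U] by (simp only: measurable_cong_sets[OF refl sets_U])
  have "emeasure (distr (U n) (U n) (rf n v)) A = emeasure (U n) {x \<in> Rn n. rf n v x \<in> A}"
    using A by (subst emeasure_distr[OF m]) (auto intro!: arg_cong[where f="emeasure (U n)"])
  also have "\<dots> = emeasure (leb n) (cb n 1 \<inter> {x \<in> Rn n. rf n v x \<in> A}) / emeasure (leb n) (cb n 1)"
    by (rule emeasure_U[OF rf_pre_sets[OF v A]])
  also have "cb n 1 \<inter> {x \<in> Rn n. rf n v x \<in> A} = {x \<in> Rn n. rf n v x \<in> cb n 1 \<inter> A}"
    using v by (auto simp: cb_def rf_nrm rf_Rn)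
  also have "emeasure (leb n) \<dots> = emeasure (leb n) (cb n 1 \<inter> A)"
    using A by (intro leb_rf v sets.Int cb_sets)
  finally show "emeasure (distr (U n) (U n) (rf n v)) A = emeasure (U n) A"
    using emeasure_U[OF A] by simp
qed simp

text \<open>The support function of the centred zonotope \<open>(1/M) \<Sum> [- u\<^sub>l/2, u\<^sub>l/2]\<close> at a unit vector tends to \<open>beta n\<close>.\<close>

definition beta :: "nat \<Rightarrow> real" where
  "beta n = (\<integral>u. \<bar>ip n u (bas 0)\<bar> \<partial>U n) / 2"

lemma ip_U_measurable: "t \<in> Rn n \<Longrightarrow> (\<lambda>u. \<bar>ip n u t\<bar>) \<in> borel_measurable (U n)"
  by (intro borel_measurable_abs ip_measurable measurable_U const_measurable_rb)

lemma nrm_bas: "i < n \<Longrightarrow> nrm n (bas i) = 1"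
  by (simp add: nrm_def)

lemma beta_unit:
  assumes n: "n \<ge> 1" and t: "t \<in> Rn n" "nrm n t = 1"
  shows "(\<integral>u. \<bar>ip n u t\<bar> \<partial>U n) = 2 * beta n"
proof -
  let ?v = "bas 0 - t"
  have v: "?v \<in> Rn n" using t n by auto
  have b: "bas 0 \<in> Rn n" using n by simp
  have rt: "rf n ?v (bas 0) = t" by (rule rf_maps) (use t n b nrm_bas in auto)
  have m: "rf n ?v \<in> U n \<rightarrow>\<^sub>M U n"
    using rf_measurable[OF v measurable_U] by (simp only: measurable_cong_sets[OF refl sets_U])
  have "(\<integral>u. \<bar>ip n u t\<bar> \<partial>U n) = (\<integral>u. \<bar>ip n u t\<bar> \<partial>distr (U n) (U n) (rf n ?v))"
    by (simp only: U_rf[OF v])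
  also have "\<dots> = (\<integral>u. \<bar>ip n (rf n ?v u) t\<bar> \<partial>U n)"
    by (rule integral_distr[OF m ip_U_measurable[OF t(1)]])
  also have "\<dots> = (\<integral>u. \<bar>ip n u (bas 0)\<bar> \<partial>U n)"
    using rf_ip[OF v, of _ "bas 0"] unfolding rt by simp
  finally show ?thesis by (simp add: beta_def)
qed

text \<open>Otherwise almost every point of the ball would lie in the hyperplane where coordinate 0
  vanishes, a null set. Positivity is needed to rescale by \<open>beta n\<close>.\<close>

lemma beta_pos: assumes n: "n \<ge> 1" shows "beta n > 0"
proof -
  interpret prob_space "U n" by (rule prob_U)
  have b: "bas 0 \<in> Rn n" using n by simp
  let ?f = "\<lambda>u. \<bar>ip n u (bas 0)\<bar>"
  have int: "integrable (U n) ?f"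
  proof (rule integrable_const_bound[of _ 1])
    show "AE u in U n. norm \<bar>ip n u (bas 0)\<bar> \<le> 1"
      using AE_U
    proof (rule AE_mp, intro AE_I2 impI)
      fix u assume "u \<in> cb n 1"
      then show "norm \<bar>ip n u (bas 0)\<bar> \<le> 1" using ip_cauchy_abs[of n u "bas 0"] n by (simp add: cb_def nrm_bas)
    qed
  qed (rule ip_U_measurable[OF b])
  have nn: "beta n \<ge> 0" unfolding beta_def by simp
  have "beta n \<noteq> 0"
  proof
    assume "beta n = 0"
    then have "(\<integral>u. ?f u \<partial>U n) = 0" by (simp add: beta_def)
    then have ae: "AE u in U n. ?f u = 0"
      using integral_nonneg_eq_0_iff_AE[OF int] by auto
    let ?Z = "{x \<in> Rn n. lk x 0 \<in> {0}}"
    have Zs: "?Z \<in> sets (rb n)"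
    proof -
      have "(\<lambda>x. lk x 0) -` {0} \<inter> space (rb n) \<in> sets (rb n)"
        by (rule measurable_sets[OF lk_measurable_rb]) simp
      moreover have "(\<lambda>x. lk x 0) -` {0} \<inter> space (rb n) = ?Z" by auto
      ultimately show ?thesis by simp
    qed
    have "emeasure (leb n) ?Z = emeasure (PiM {..<n} (\<lambda>_. lborel)) (PiE {..<n} (\<lambda>i. if i = 0 then {0} else (UNIV :: real set)))"
    proof -
      have e: "emb n -` ?Z \<inter> space (PiM {..<n} (\<lambda>_. lborel)) = PiE {..<n} (\<lambda>i. if i = 0 then {0} else (UNIV :: real set))"
      proof (intro set_eqI)
        fix f :: "nat \<Rightarrow> real"
        have "f \<in> emb n -` ?Z \<inter> space (PiM {..<n} (\<lambda>_. lborel)) \<longleftrightarrow> f 0 = 0 \<and> f \<in> extensional {..<n}"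
          using n by (simp add: space_PiM PiE_def)
        also have "\<dots> \<longleftrightarrow> f \<in> PiE {..<n} (\<lambda>i. if i = 0 then {0} else (UNIV :: real set))"
          unfolding PiE_iff using n by (force split: if_splits)
        finally show "f \<in> emb n -` ?Z \<inter> space (PiM {..<n} (\<lambda>_. lborel)) \<longleftrightarrow> f \<in> PiE {..<n} (\<lambda>i. if i = 0 then {0} else (UNIV :: real set))" .
      qed
      show ?thesis unfolding emeasure_leb[OF Zs] e ..
    qed
    also have "\<dots> = (\<Prod>i<n. emeasure lborel (if i = 0 then {0} else (UNIV :: real set)))"
      by (rule lp.emeasure_PiM) auto
    also have "\<dots> = 0" using n by (intro prod_zero) (auto intro!: bexI[of _ 0])
    finally have Z0: "emeasure (leb n) ?Z = 0" .
    have "AE u in U n. u \<in> ?Z"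
      using ae by (rule AE_mp) (rule AE_I2, use n in auto)
    then have "emeasure (U n) ?Z = 1" using Zs by (intro emeasure_eq_1_AE) auto
    moreover have "emeasure (U n) ?Z = emeasure (leb n) (cb n 1 \<inter> ?Z) / emeasure (leb n) (cb n 1)"
      by (rule emeasure_U[OF Zs])
    moreover have "emeasure (leb n) (cb n 1 \<inter> ?Z) \<le> emeasure (leb n) ?Z"
      using Zs by (intro emeasure_mono) auto
    ultimately show False using Z0 by simp
  qed
  then show ?thesis using nn by simp
qed

section \<open>Parallel bodies compared with zonotopes through support functions\<close>

lemma hs_le_subset:
  assumes A: "body n A" and B: "body n B" and h: "\<And>w. w \<in> Rn n \<Longrightarrow> hs n A w \<le> hs n B w"
  shows "A \<subseteq> B"
proof
  fix x assume x: "x \<in> A"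
  show "x \<in> B"
  proof (rule ccontr)
    assume nx: "x \<notin> B"
    have "x \<in> Rn n" using A x by (auto simp: body_def)
    then obtain w b where w: "w \<in> Rn n" "\<And>y. y \<in> B \<Longrightarrow> ip n y w \<le> b" "b < ip n x w"
      using separation[of B n x] B nx unfolding body_def by metis
    obtain k where k: "k \<in> B" "hs n B w = ip n k w" using hs_attained[OF B, of w] by metis
    have "ip n x w \<le> hs n A w" by (rule hs_upper[OF A x])
    then show False using h[OF w(1)] w(2)[OF k(1)] w(3) k(2) by simp
  qed
qed

lemma par_image: "parallel_body n K r = (\<lambda>(x, y). x + r *\<^sub>R y) ` (K \<times> cb n 1)"
  by (force simp: parallel_body_def unit_ball_cb)

lemma cb_zero: "0 \<le> r \<Longrightarrow> 0 \<in> cb n r" by (simp add: cb_def)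

lemma body_cb: "0 \<le> r \<Longrightarrow> body n (cb n r)"
  using cb_zero[of r n] by (auto simp: body_def cb_sub[THEN subsetD])

lemma body_par: assumes K: "body n K" shows "body n (parallel_body n K r)"
  unfolding body_def
proof (intro conjI)
  show "compact (parallel_body n K r)" unfolding par_image case_prod_unfold
    using K by (intro compact_continuous_image compact_Times continuous_intros) (auto simp: body_def)
  show "parallel_body n K r \<subseteq> Rn n"
    unfolding par_image using K cb_sub[of n 1] by (auto simp: body_def)
  show "parallel_body n K r \<noteq> {}" using K cb_zero[of 1 n] by (auto simp: par_image body_def)
  show "convex (parallel_body n K r)"
  proof (rule convexI)
    fix x y a b assume x: "x \<in> parallel_body n K r" and y: "y \<in> parallel_body n K r" and ab: "(0::real) \<le> a" "0 \<le> b" "a + b = 1"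
    obtain p s where p: "x = p + r *\<^sub>R s" "p \<in> K" "s \<in> cb n 1" using x unfolding par_image by auto
    obtain q t where q: "y = q + r *\<^sub>R t" "q \<in> K" "t \<in> cb n 1" using y unfolding par_image by auto
    have "a *\<^sub>R x + b *\<^sub>R y = (a *\<^sub>R p + b *\<^sub>R q) + r *\<^sub>R (a *\<^sub>R s + b *\<^sub>R t)"
      by (simp add: p q algebra_simps)
    moreover have "a *\<^sub>R p + b *\<^sub>R q \<in> K" using K p q ab by (auto simp: body_def convex_def)
    moreover have "a *\<^sub>R s + b *\<^sub>R t \<in> cb n 1" using convex_cb[of n 1] p q ab unfolding convex_def by blast
    ultimately show "a *\<^sub>R x + b *\<^sub>R y \<in> parallel_body n K r" unfolding par_image by force
  qed
qed

lemma hs_par: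
  assumes K: "body n K" and r: "0 \<le> r" and w: "w \<in> Rn n"
  shows "hs n (parallel_body n K r) w = hs n K w + r * nrm n w"
proof -
  obtain k where k: "k \<in> K" "hs n K w = ip n k w" "\<And>x. x \<in> K \<Longrightarrow> ip n x w \<le> ip n k w"
    using hs_attained[OF K] by metis
  let ?v = "(1 / nrm n w) *\<^sub>R w"
  have vw: "?v \<in> cb n 1" "ip n ?v w = nrm n w"
    using w by (auto simp: cb_def ip_self_eq power2_eq_square)
  show ?thesis unfolding hs_def[of n "parallel_body n K r"]
  proof (rule cSup_eq_maximum)
    have "k + r *\<^sub>R ?v \<in> parallel_body n K r" using k vw unfolding par_image by force
    moreover have "ip n (k + r *\<^sub>R ?v) w = hs n K w + r * nrm n w"
      by (simp only: ip_add_left ip_scale_left[of n r "?v"] vw(2) k(2))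
    ultimately show "hs n K w + r * nrm n w \<in> (\<lambda>x. ip n x w) ` parallel_body n K r" by (metis image_eqI)
  next
    fix y assume "y \<in> (\<lambda>x. ip n x w) ` parallel_body n K r"
    then obtain x t where x: "x \<in> K" "t \<in> cb n 1" "y = ip n x w + r * ip n t w" unfolding par_image by auto
    have "ip n t w \<le> nrm n t * nrm n w" by (rule ip_cauchy)
    also have "\<dots> \<le> 1 * nrm n w" using x by (intro mult_right_mono) (auto simp: cb_def)
    finally have "r * ip n t w \<le> r * nrm n w" using r by (intro mult_left_mono) auto
    then show "y \<le> hs n K w + r * nrm n w" using x k by fastforce
  qed
qed

lemma body_translate:
  assumes Z: "body n Z" and a: "a \<in> Rn n"
  shows "body n ((\<lambda>x. x - a) ` Z)" and "vol n ((\<lambda>x. x - a) ` Z) = vol n Z"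
    and "hs n ((\<lambda>x. x - a) ` Z) w = hs n Z w - ip n a w"
proof -
  show "body n ((\<lambda>x. x - a) ` Z)"
    using Z a by (auto simp: body_def intro!: compact_continuous_image continuous_intros convex_translation_subtract)
  have "(\<lambda>x. x - a) ` Z = {x \<in> Rn n. x + a \<in> Z}"
  proof (intro set_eqI iffI)
    fix x assume "x \<in> {x \<in> Rn n. x + a \<in> Z}"
    then have "x + a \<in> Z" by simp
    then show "x \<in> (\<lambda>x. x - a) ` Z" by (rule rev_image_eqI) simp
  qed (use Z a in \<open>auto simp: body_def\<close>)
  then show "vol n ((\<lambda>x. x - a) ` Z) = vol n Z"
    using leb_translate[OF a body_sets[OF Z]] by (simp add: measure_def)
  obtain k where k: "k \<in> Z" "hs n Z w = ip n k w" "\<And>x. x \<in> Z \<Longrightarrow> ip n x w \<le> ip n k w"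
    using hs_attained[OF Z] by metis
  show "hs n ((\<lambda>x. x - a) ` Z) w = hs n Z w - ip n a w"
    unfolding hs_def[of n "(\<lambda>x. x - a) ` Z"]
  proof (rule cSup_eq_maximum)
    have "ip n (k - a) w = hs n Z w - ip n a w" using k by simp
    then show "hs n Z w - ip n a w \<in> (\<lambda>x. ip n x w) ` (\<lambda>x. x - a) ` Z" using k(1) by (metis image_eqI)
  qed (use k in auto)
qed

lemma vol_mono: "body n A \<Longrightarrow> body n B \<Longrightarrow> A \<subseteq> B \<Longrightarrow> vol n A \<le> vol n B"
proof -
  assume a: "body n A" "body n B" "A \<subseteq> B"
  have "emeasure (leb n) B < \<infinity>" using a by (intro tim.emeasure_compact[OF tim_leb]) (auto simp: body_def)
  then have "B \<in> fmeasurable (leb n)" using body_sets[OF a(2)] by (intro fmeasurableI) (auto simp only: sets_leb)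
  then show ?thesis using a body_sets[OF a(1)] by (intro measure_mono_fmeasurable) (auto simp only: sets_leb)
qed

text \<open>The support function of the centred zonotope differs from
  \<open>beta n * nrm n w\<close> by at most \<open>\<eta> * nrm n w\<close>; both sides are doubled
  here.\<close>

definition good :: "nat \<Rightarrow> nat \<Rightarrow> real \<Rightarrow> (nat \<Rightarrow> vec) \<Rightarrow> bool" where
  "good n M \<eta> \<omega> \<longleftrightarrow> (\<forall>w\<in>Rn n. \<bar>(\<Sum>l<M. \<bar>ip n (\<omega> l) w\<bar>) / real M - 2 * beta n * nrm n w\<bar> \<le> 2 * \<eta> * nrm n w)"

text \<open>Since \<open>max 0 x = (\<bar>x\<bar> + x) / 2\<close>, translating by half the sum of
  the generators, the vector \<open>a\<close>, centres the zonotope and keeps the volume. Both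
  inclusions are then inequalities between support functions.\<close>

lemma good_sandwich:
  assumes K: "body n K" and o: "\<And>l. l < M \<Longrightarrow> \<omega> l \<in> Rn n" and M: "M \<ge> 1" and g: "good n M \<eta> \<omega>"
    and r: "0 \<le> r" and e: "0 < \<eta>" "\<eta> < beta n"
  shows "vol n (parallel_body n K (r * (beta n - \<eta>))) \<le> vol n (zon (r / real M) (map \<omega> [0..<M]) K)"
    and "vol n (zon (r / real M) (map \<omega> [0..<M]) K) \<le> vol n (parallel_body n K (r * (beta n + \<eta>)))"
proof -
  let ?us = "map \<omega> [0..<M]"
  let ?s = "r / real M"
  let ?Z = "zon ?s ?us K"
  have us: "set ?us \<subseteq> Rn n" using o by auto
  have Z: "body n ?Z" by (rule body_zon[OF us K])
  have s: "0 \<le> ?s" using r by simp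
  define a where "a = (?s / 2) *\<^sub>R (\<Sum>l<M. \<omega> l)"
  have a: "a \<in> Rn n" unfolding a_def using o by (intro Rn_scale Rn_sum) auto
  define Y where "Y = (\<lambda>x. x - a) ` ?Z"
  note T = body_translate[OF Z a, folded Y_def]
  have hY: "hs n Y w = hs n K w + (r / 2) * ((\<Sum>l<M. \<bar>ip n (\<omega> l) w\<bar>) / real M)" for w
  proof -
    have m: "max 0 x = (\<bar>x\<bar> + x) / 2" for x :: real by simp
    have "hs n Y w = hs n K w + ?s * (\<Sum>l<M. max 0 (ip n (\<omega> l) w)) - ip n a w"
      unfolding T(3) hs_zon[OF us K s] by (simp add: comp_def sum_list_sum_nth atLeast0LessThan)
    also have "ip n a w = ?s / 2 * (\<Sum>l<M. ip n (\<omega> l) w)" by (simp add: a_def ip_sum_left)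
    also have "(\<Sum>l<M. max 0 (ip n (\<omega> l) w)) = ((\<Sum>l<M. \<bar>ip n (\<omega> l) w\<bar>) + (\<Sum>l<M. ip n (\<omega> l) w)) / 2"
      unfolding m by (simp add: sum.distrib flip: sum_divide_distrib)
    finally have e: "hs n Y w = hs n K w + ?s * (((\<Sum>l<M. \<bar>ip n (\<omega> l) w\<bar>) + (\<Sum>l<M. ip n (\<omega> l) w)) / 2)
      - ?s / 2 * (\<Sum>l<M. ip n (\<omega> l) w)" .
    have "r / m * ((A + B) / 2) - r / m / 2 * B = (r / 2) * (A / m)" if "m \<noteq> 0" for A B m :: real
      using that by (simp add: field_simps)
    from this[of "real M"] M show ?thesis unfolding e by auto
  qed
  have gd: "(beta n - \<eta>) * nrm n w \<le> (\<Sum>l<M. \<bar>ip n (\<omega> l) w\<bar>) / real M / 2"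
    "(\<Sum>l<M. \<bar>ip n (\<omega> l) w\<bar>) / real M / 2 \<le> (beta n + \<eta>) * nrm n w" if "w \<in> Rn n" for w
  proof -
    have "\<bar>(\<Sum>l<M. \<bar>ip n (\<omega> l) w\<bar>) / real M - 2 * beta n * nrm n w\<bar> \<le> 2 * \<eta> * nrm n w"
      using g that unfolding good_def by blast
    then have "2 * (beta n * nrm n w) - 2 * (\<eta> * nrm n w) \<le> (\<Sum>l<M. \<bar>ip n (\<omega> l) w\<bar>) / real M"
      "(\<Sum>l<M. \<bar>ip n (\<omega> l) w\<bar>) / real M \<le> 2 * (beta n * nrm n w) + 2 * (\<eta> * nrm n w)"
      by linarith+
    then show "(beta n - \<eta>) * nrm n w \<le> (\<Sum>l<M. \<bar>ip n (\<omega> l) w\<bar>) / real M / 2"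
      "(\<Sum>l<M. \<bar>ip n (\<omega> l) w\<bar>) / real M / 2 \<le> (beta n + \<eta>) * nrm n w"
      by (simp_all add: left_diff_distrib distrib_right)
  qed
  have 1: "parallel_body n K (r * (beta n - \<eta>)) \<subseteq> Y"
  proof (rule hs_le_subset[OF body_par[OF K] T(1)])
    fix w assume w: "w \<in> Rn n"
    have "r * ((beta n - \<eta>) * nrm n w) \<le> r * ((\<Sum>l<M. \<bar>ip n (\<omega> l) w\<bar>) / real M / 2)"
      using r gd(1)[OF w] by (rule mult_left_mono[rotated])
    then show "hs n (parallel_body n K (r * (beta n - \<eta>))) w \<le> hs n Y w"
      unfolding hY using r e w by (subst hs_par[OF K]) (auto simp: mult_ac)
  qed
  have 2: "Y \<subseteq> parallel_body n K (r * (beta n + \<eta>))"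
  proof (rule hs_le_subset[OF T(1) body_par[OF K]])
    fix w assume w: "w \<in> Rn n"
    have "r * ((\<Sum>l<M. \<bar>ip n (\<omega> l) w\<bar>) / real M / 2) \<le> r * ((beta n + \<eta>) * nrm n w)"
      using r gd(2)[OF w] by (rule mult_left_mono[rotated])
    then show "hs n Y w \<le> hs n (parallel_body n K (r * (beta n + \<eta>))) w"
      unfolding hY using r e w by (subst hs_par[OF K]) (auto simp: mult_ac)
  qed
  show "vol n (parallel_body n K (r * (beta n - \<eta>))) \<le> vol n ?Z"
    using vol_mono[OF body_par[OF K] T(1) 1] T(2) by simp
  show "vol n ?Z \<le> vol n (parallel_body n K (r * (beta n + \<eta>)))"
    using vol_mono[OF T(1) body_par[OF K] 2] T(2) by simp
qed

section \<open>A uniform law of large numbers for random zonotopes\<close>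

lemma indep_PP:
  assumes "M \<ge> 1" shows "prob_space.indep_vars (PP n M) (\<lambda>_. U n) (\<lambda>k \<omega>. \<omega> k) {..<M}"
proof -
  interpret prob_space "PP n M" by (rule prob_PP)
  have rv: "(\<lambda>\<omega>. \<omega> k) \<in> PP n M \<rightarrow>\<^sub>M U n" if "k \<in> {..<M}" for k
    using that by (rule measurable_component_singleton)
  have ne: "{..<M} \<noteq> {}" using assms by (auto simp: lessThan_empty_iff)
  have L: "distr (PP n M) (PP n M) (\<lambda>x. \<lambda>i\<in>{..<M}. x i) = PP n M"
  proof -
    have "distr (PP n M) (PP n M) (\<lambda>x. \<lambda>i\<in>{..<M}. x i) = distr (PP n M) (PP n M) (\<lambda>x. x)"
      by (rule distr_cong) (auto simp: space_PiM PiE_def extensional_restrict)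
    then show ?thesis by simp
  qed
  have R: "PiM {..<M} (\<lambda>i. distr (PP n M) (U n) (\<lambda>\<omega>. \<omega> i)) = PP n M"
    by (rule PiM_cong[OF refl]) (rule distr_PiM_component[OF prob_U], simp)
  have "distr (PP n M) (PP n M) (\<lambda>x. \<lambda>i\<in>{..<M}. x i) = PiM {..<M} (\<lambda>i. distr (PP n M) (U n) (\<lambda>\<omega>. \<omega> i))"
    unfolding L R ..
  moreover have "indep_vars (\<lambda>_. U n) (\<lambda>k \<omega>. \<omega> k) {..<M} \<longleftrightarrow>
    distr (PP n M) (PP n M) (\<lambda>x. \<lambda>i\<in>{..<M}. x i) = PiM {..<M} (\<lambda>i. distr (PP n M) (U n) (\<lambda>\<omega>. \<omega> i))"
    by (rule indep_vars_iff_distr_eq_PiM'[OF ne]) (rule rv)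
  ultimately show ?thesis by (simp only:)
qed

lemma hoeffding_PP:
  assumes n: "n \<ge> 1" and M: "M \<ge> 1" and t: "t \<in> Rn n" "nrm n t = 1" and e: "\<eta> \<ge> 0"
  shows "measure (PP n M) {\<omega> \<in> space (PP n M). \<bar>(\<Sum>l<M. \<bar>ip n (\<omega> l) t\<bar>) - real M * (2 * beta n)\<bar> \<ge> real M * \<eta>}
    \<le> 2 * exp (- 2 * real M * \<eta>\<^sup>2)"
proof -
  interpret prob_space "PP n M" by (rule prob_PP)
  let ?X = "\<lambda>l \<omega>. \<bar>ip n (\<omega> l) t\<bar>"
  have ind: "indep_vars (\<lambda>_. borel) ?X {..<M}"
    by (rule indep_vars_compose2[OF indep_PP[OF M]]) (rule ip_U_measurable[OF t(1)])
  have ex: "expectation (?X l) = 2 * beta n" if l: "l \<in> {..<M}" for l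
  proof -
    have "(\<integral>u. \<bar>ip n u t\<bar> \<partial>U n) = (\<integral>u. \<bar>ip n u t\<bar> \<partial>distr (PP n M) (U n) (\<lambda>\<omega>. \<omega> l))"
      using distr_PiM_component[of "{..<M}" "\<lambda>_. U n" l] prob_U l by simp
    also have "\<dots> = expectation (?X l)"
      using l by (intro integral_distr ip_U_measurable t measurable_component_singleton) auto
    finally show ?thesis using beta_unit[OF n t] by simp
  qed
  interpret I: indep_interval_bounded_random_variables "PP n M" "{..<M}" ?X "\<lambda>_. 0" "\<lambda>_. 1"
  proof
    show "indep_vars (\<lambda>_. borel) ?X {..<M}" by (rule ind)
    show "AE x in PP n M. \<bar>ip n (x i) t\<bar> \<in> {0..1}" if "i \<in> {..<M}" for i
      using AE_PP
    proof (rule AE_mp, intro AE_I2 impI)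
      fix \<omega> assume "\<forall>k<M. \<omega> k \<in> cb n 1"
      then have "nrm n (\<omega> i) \<le> 1" using that by (auto simp: cb_def)
      then show "\<bar>ip n (\<omega> i) t\<bar> \<in> {0..1}" using ip_cauchy_abs[of n "\<omega> i" t] t by simp
    qed
  qed simp
  interpret H: Hoeffding_ineq "PP n M" "{..<M}" ?X "\<lambda>_. 0" "\<lambda>_. 1" "real M * (2 * beta n)"
    by unfold_locales (rule eq_reflection, simp add: ex)
  have "prob {\<omega> \<in> space (PP n M). \<bar>(\<Sum>l<M. ?X l \<omega>) - real M * (2 * beta n)\<bar> \<ge> real M * \<eta>}
      \<le> 2 * exp (- 2 * (real M * \<eta>)\<^sup>2 / (\<Sum>i<M. (1 - 0)\<^sup>2))"
    by (rule H.Hoeffding_ineq_abs_ge) (use e M in auto)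
  also have "- 2 * (real M * \<eta>)\<^sup>2 / (\<Sum>i<M. (1 - 0)\<^sup>2) = - 2 * real M * \<eta>\<^sup>2"
    using M by (simp add: power2_eq_square)
  finally show ?thesis .
qed

text \<open>The compact sphere is totally bounded in the metric of the type, which dominates
  \<open>nrm\<close>.\<close>

lemma sphere_net:
  assumes e: "\<eta> > 0"
  obtains T where "finite T" "T \<subseteq> {x \<in> Rn n. nrm n x = 1}" "\<And>w. w \<in> Rn n \<Longrightarrow> nrm n w = 1 \<Longrightarrow> \<exists>t\<in>T. nrm n (w - t) \<le> \<eta>"
proof -
  let ?S = "{x \<in> Rn n. nrm n x = 1}"
  have "?S = Rn n \<inter> {x. nrm n x = 1}" by auto
  moreover have "closed {x. nrm n x = 1}" by (intro closed_Collect_eq continuous_intros)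
  ultimately have "closed ?S" by (metis closed_Int closed_Rn)
  then have "compact ?S" by (rule compact_Rn[of _ n 1]) auto
  then have "\<exists>k. finite k \<and> k \<subseteq> ?S \<and> ?S \<subseteq> (\<Union>x\<in>k. ball x \<eta>)"
    using seq_compact_imp_totally_bounded[of ?S] e unfolding compact_eq_seq_compact_metric by blast
  then obtain T where T: "finite T" "T \<subseteq> ?S" "?S \<subseteq> (\<Union>x\<in>T. ball x \<eta>)" by blast
  have "\<exists>t\<in>T. nrm n (w - t) \<le> \<eta>" if wS: "w \<in> Rn n" "nrm n w = 1" for w
  proof -
    obtain t where t: "t \<in> T" "dist t w < \<eta>"
    proof -
      have "w \<in> ?S" using wS by simp
      then have "w \<in> (\<Union>x\<in>T. ball x \<eta>)" using T(3) by blast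
      then show ?thesis using that by (auto simp: mem_ball)
    qed
    have "nrm n (w - t) \<le> norm (w - t)" by (rule nrm_le_norm)
    also have "\<dots> < \<eta>" using t by (simp add: dist_norm norm_minus_commute)
    finally show ?thesis using t by (intro bexI[of _ t]) auto
  qed
  then show ?thesis using that T by blast
qed

text \<open>The mean of \<open>\<bar>ip n (\<omega> l) w\<bar>\<close> is homogeneous and
  1-Lipschitz in \<open>w\<close>, so an error below \<open>\<eta>\<close> on an
  \<open>\<eta>\<close>-net grows to at most \<open>2 * \<eta>\<close> on the sphere.\<close>

lemma good_from_net:
  assumes M: "M \<ge> 1" and o: "\<And>l. l < M \<Longrightarrow> \<omega> l \<in> cb n 1" and e: "\<eta> > 0"
    and T: "T \<subseteq> {x \<in> Rn n. nrm n x = 1}" "\<And>w. w \<in> Rn n \<Longrightarrow> nrm n w = 1 \<Longrightarrow> \<exists>t\<in>T. nrm n (w - t) \<le> \<eta>"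
    and b: "\<And>t. t \<in> T \<Longrightarrow> \<bar>(\<Sum>l<M. \<bar>ip n (\<omega> l) t\<bar>) - real M * (2 * beta n)\<bar> < real M * \<eta>"
  shows "good n M \<eta> \<omega>"
  unfolding good_def
proof
  fix w assume w: "w \<in> Rn n"
  define f where "f w = (\<Sum>l<M. \<bar>ip n (\<omega> l) w\<bar>) / real M" for w
  show "\<bar>(\<Sum>l<M. \<bar>ip n (\<omega> l) w\<bar>) / real M - 2 * beta n * nrm n w\<bar> \<le> 2 * \<eta> * nrm n w"
  proof (cases "w = 0")
    case False
    then have nw: "nrm n w > 0" using w by (simp add: nrm_pos)
    define v where "v = (1 / nrm n w) *\<^sub>R w"
    have v: "v \<in> Rn n" "nrm n v = 1" "w = nrm n w *\<^sub>R v" using w nw by (auto simp: v_def)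
    obtain t where t: "t \<in> T" "nrm n (v - t) \<le> \<eta>" using T(2) v by blast
    have "\<bar>(\<Sum>l<M. \<bar>ip n (\<omega> l) v\<bar>) - (\<Sum>l<M. \<bar>ip n (\<omega> l) t\<bar>)\<bar> \<le> (\<Sum>l<M. \<eta>)"
      unfolding sum_subtractf[symmetric]
    proof (rule order_trans[OF sum_abs], rule sum_mono)
      fix l assume "l \<in> {..<M}"
      then have "nrm n (\<omega> l) \<le> 1" using o by (auto simp: cb_def)
      have "\<bar>\<bar>ip n (\<omega> l) v\<bar> - \<bar>ip n (\<omega> l) t\<bar>\<bar> \<le> \<bar>ip n (\<omega> l) (v - t)\<bar>" unfolding ip_diff_right by linarith
      also have "\<dots> \<le> nrm n (\<omega> l) * nrm n (v - t)" by (rule ip_cauchy_abs)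
      also have "\<dots> \<le> 1 * \<eta>" using \<open>nrm n (\<omega> l) \<le> 1\<close> t by (intro mult_mono) auto
      finally show "\<bar>\<bar>ip n (\<omega> l) v\<bar> - \<bar>ip n (\<omega> l) t\<bar>\<bar> \<le> \<eta>" by simp
    qed
    then have "\<bar>(\<Sum>l<M. \<bar>ip n (\<omega> l) v\<bar>) - real M * (2 * beta n)\<bar> \<le> real M * (2 * \<eta>)"
      using b[OF t(1)] by simp
    moreover have "(\<Sum>l<M. \<bar>ip n (\<omega> l) v\<bar>) - real M * (2 * beta n) = real M * (f v - 2 * beta n)"
      using M by (simp add: f_def algebra_simps)
    ultimately have fv: "\<bar>f v - 2 * beta n\<bar> \<le> 2 * \<eta>" using M by (simp add: abs_mult)
    have "(\<Sum>l<M. \<bar>ip n (\<omega> l) w\<bar>) = nrm n w * (\<Sum>l<M. \<bar>ip n (\<omega> l) v\<bar>)"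
      by (subst v(3)) (simp add: abs_mult sum_distrib_left)
    then have "(\<Sum>l<M. \<bar>ip n (\<omega> l) w\<bar>) / real M - 2 * beta n * nrm n w = nrm n w * (f v - 2 * beta n)"
      by (simp add: f_def algebra_simps)
    then have "\<bar>(\<Sum>l<M. \<bar>ip n (\<omega> l) w\<bar>) / real M - 2 * beta n * nrm n w\<bar> = nrm n w * \<bar>f v - 2 * beta n\<bar>"
      by (simp add: abs_mult)
    also have "\<dots> \<le> nrm n w * (2 * \<eta>)" using fv nw by (intro mult_left_mono) auto
    finally show ?thesis by (simp add: mult_ac)
  qed simp
qed

text \<open>For a fixed net Hoeffding's bound and a union bound suffice. The bad outcomes are
  enclosed in an event \<open>B\<close>, which avoids asking whether \<open>good\<close> is
  measurable.\<close>

lemma lln: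
  assumes n: "n \<ge> 1" and e: "\<eta> > 0" and d: "\<delta> > 0"
  shows "\<forall>\<^sub>F M in sequentially. \<exists>B\<in>sets (PP n M). measure (PP n M) B \<le> \<delta> \<and>
     (\<forall>\<omega>\<in>space (PP n M) - B. (\<forall>l<M. \<omega> l \<in> cb n 1) \<longrightarrow> good n M \<eta> \<omega>)"
proof -
  obtain T where T: "finite T" "T \<subseteq> {x \<in> Rn n. nrm n x = 1}" "\<And>w. w \<in> Rn n \<Longrightarrow> nrm n w = 1 \<Longrightarrow> \<exists>t\<in>T. nrm n (w - t) \<le> \<eta>"
    using sphere_net[OF e, of n] by blast
  have "(\<lambda>M. real (card T) * (2 * exp (- 2 * real M * \<eta>\<^sup>2))) \<longlonglongrightarrow> real (card T) * (2 * 0)"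
  proof (intro tendsto_intros)
    have "filterlim (\<lambda>M. 2 * \<eta>\<^sup>2 * real M) at_top sequentially"
      using e by (intro filterlim_tendsto_pos_mult_at_top[OF tendsto_const] filterlim_real_sequentially) auto
    then have "((\<lambda>M. exp (- (2 * \<eta>\<^sup>2 * real M))) \<longlonglongrightarrow> 0)"
      by (intro filterlim_compose[OF exp_at_bot] filterlim_uminus_at_top[THEN iffD1]) 
    then show "(\<lambda>M. exp (- 2 * real M * \<eta>\<^sup>2)) \<longlonglongrightarrow> 0" by (simp add: mult_ac)
  qed
  then have "\<forall>\<^sub>F M in sequentially. real (card T) * (2 * exp (- 2 * real M * \<eta>\<^sup>2)) < \<delta>"
    using d by (intro order_tendstoD(2)) auto
  moreover have "\<forall>\<^sub>F M in sequentially. M \<ge> (1::nat)" by (rule eventually_ge_at_top)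
  ultimately show ?thesis
  proof eventually_elim
    case (elim M)
    interpret prob_space "PP n M" by (rule prob_PP)
    let ?B = "\<lambda>t. {\<omega> \<in> space (PP n M). \<bar>(\<Sum>l<M. \<bar>ip n (\<omega> l) t\<bar>) - real M * (2 * beta n)\<bar> \<ge> real M * \<eta>}"
    have Bs: "?B t \<in> sets (PP n M)" if "t \<in> T" for t
      using T(2) that
      by (intro borel_measurable_le borel_measurable_const borel_measurable_abs borel_measurable_diff borel_measurable_sum
          ip_measurable PP_component const_measurable_rb) auto
    let ?U = "\<Union>t\<in>T. ?B t"
    have "prob ?U \<le> (\<Sum>t\<in>T. prob (?B t))"
      using T(1) Bs by (intro finite_measure_subadditive_finite) auto
    also have "\<dots> \<le> (\<Sum>t\<in>T. 2 * exp (- 2 * real M * \<eta>\<^sup>2))"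
      using T(2) e elim n by (intro sum_mono hoeffding_PP) auto
    also have "\<dots> \<le> \<delta>" using elim by simp
    finally have 1: "prob ?U \<le> \<delta>" .
    have 2: "?U \<in> sets (PP n M)" using T(1) Bs by (intro sets.finite_UN) auto
    have 3: "good n M \<eta> \<omega>" if "\<omega> \<in> space (PP n M) - ?U" "\<forall>l<M. \<omega> l \<in> cb n 1" for \<omega>
    proof (rule good_from_net[OF elim(2) _ e T(2,3)])
      fix l assume "l < M" then show "\<omega> l \<in> cb n 1" using that(2) by blast
    next
      fix t assume "t \<in> T"
      then show "\<bar>(\<Sum>l<M. \<bar>ip n (\<omega> l) t\<bar>) - real M * (2 * beta n)\<bar> < real M * \<eta>"
        using that(1) by auto
    qed
    show ?case using 1 2 3 by (intro bexI[of _ ?U]) auto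
  qed
qed

section \<open>Passage to the limit: the volume of parallel bodies\<close>

lemma choose_over_power_limit: "(\<lambda>M. real (M choose i) / real M ^ i) \<longlonglongrightarrow> 1 / fact i"
proof -
  have one: "(\<lambda>M. (real M - real l) / real M) \<longlonglongrightarrow> 1" for l
  proof -
    have "(\<lambda>M. 1 - real l * inverse (real M)) \<longlonglongrightarrow> 1 - real l * 0"
      by (intro tendsto_intros LIMSEQ_inverse_real_of_nat[THEN LIMSEQ_imp_Suc] lim_inverse_n)
    moreover have "\<forall>\<^sub>F M in sequentially. 1 - real l * inverse (real M) = (real M - real l) / real M"
      using eventually_gt_at_top[of 0] by eventually_elim (simp add: field_simps)
    ultimately show ?thesis using Lim_transform_eventually by fastforce
  qed
  have "(\<lambda>M. (\<Prod>l=0..<i. (real M - real l) / real M) / fact i) \<longlonglongrightarrow> (\<Prod>l=0..<i. 1) / fact i"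
    by (intro tendsto_divide tendsto_prod tendsto_const one) auto
  moreover have "(\<Prod>l=0..<i. (real M - real l) / real M) / fact i = real (M choose i) / real M ^ i" for M
    by (simp add: binomial_gbinomial gbinomial_prod_rev prod_dividef)
  ultimately show ?thesis by simp
qed

text \<open>The limit of the expected volumes. It turns out to be the Steiner polynomial of
  \<open>K\<close> at the radius \<open>r * beta n\<close>.\<close>

definition pS :: "nat \<Rightarrow> vec set \<Rightarrow> real \<Rightarrow> real" where
  "pS n K r = (\<Sum>i\<le>n. r ^ i * Phi n i K / fact i)"

text \<open>\<open>Phi n i K\<close> vanishes for \<open>i > n\<close>, so the number of terms stays
  fixed as \<open>M\<close> grows and the limit is taken term by term.\<close>

lemma expect_limit:
  assumes K: "body n K" and r: "0 \<le> r"
  shows "(\<lambda>M. \<integral>\<omega>. vol n (zon (r / real M) (map \<omega> [0..<M]) K) \<partial>PP n M) \<longlonglongrightarrow> pS n K r"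
proof -
  have "(\<lambda>M. \<Sum>i\<le>n. real (M choose i) / real M ^ i * (r ^ i * Phi n i K)) \<longlonglongrightarrow> (\<Sum>i\<le>n. 1 / fact i * (r ^ i * Phi n i K))"
    by (intro tendsto_sum tendsto_mult tendsto_const choose_over_power_limit)
  moreover have "\<forall>\<^sub>F M in sequentially. (\<Sum>i\<le>n. real (M choose i) / real M ^ i * (r ^ i * Phi n i K)) =
     (\<integral>\<omega>. vol n (zon (r / real M) (map \<omega> [0..<M]) K) \<partial>PP n M)"
    using eventually_ge_at_top[of n]
  proof eventually_elim
    case (elim M)
    have "(\<integral>\<omega>. vol n (zon (r / real M) (map \<omega> [0..<M]) K) \<partial>PP n M) = (\<Sum>i\<le>M. real (M choose i) * ((r / real M) ^ i * Phi n i K))"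
      using r by (intro expect_zon(2)[OF K]) simp
    also have "\<dots> = (\<Sum>i\<le>n. real (M choose i) * ((r / real M) ^ i * Phi n i K))"
      using elim by (intro sum.mono_neutral_right) (auto simp: Phi_vanish[OF K])
    also have "\<dots> = (\<Sum>i\<le>n. real (M choose i) / real M ^ i * (r ^ i * Phi n i K))"
      by (intro sum.cong) (auto simp: power_divide)
    finally show ?case ..
  qed
  ultimately have "(\<lambda>M. \<integral>\<omega>. vol n (zon (r / real M) (map \<omega> [0..<M]) K) \<partial>PP n M) \<longlonglongrightarrow> (\<Sum>i\<le>n. 1 / fact i * (r ^ i * Phi n i K))"
    by (rule Lim_transform_eventually)
  then show ?thesis by (simp add: pS_def)
qed

text \<open>Off an event of probability at most \<open>\<delta>\<close> the random volume lies
  between those of two parallel bodies; on it the volume lies between 0 and \<open>C\<close>. First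
  \<open>M\<close> tends to infinity, then \<open>\<delta>\<close> to 0.\<close>

lemma pS_sandwich:
  assumes n: "n \<ge> 1" and K: "body n K" and r: "0 \<le> r" and e: "0 < \<eta>" "\<eta> < beta n"
  shows "vol n (parallel_body n K (r * (beta n - \<eta>))) \<le> pS n K r"
    and "pS n K r \<le> vol n (parallel_body n K (r * (beta n + \<eta>)))"
proof -
  let ?lo = "vol n (parallel_body n K (r * (beta n - \<eta>)))"
  let ?hi = "vol n (parallel_body n K (r * (beta n + \<eta>)))"
  let ?f = "\<lambda>M \<omega>. vol n (zon (r / real M) (map \<omega> [0..<M]) K)"
  obtain R where R: "R > 0" "K \<subseteq> cb n R" using K compact_in_cb[of K n] by (auto simp: body_def)
  define C where "C = vol n (cb n (R + r))"
  have C: "C \<ge> 0" by (simp add: C_def)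
  have fC: "?f M \<omega> \<le> C" if o: "\<forall>l<M. \<omega> l \<in> cb n 1" and M: "M \<ge> 1" for M \<omega>
  proof -
    let ?us = "map \<omega> [0..<M]"
    have us: "set ?us \<subseteq> Rn n" using o by (auto simp: cb_def)
    have "(\<Sum>u\<leftarrow>?us. nrm n u) = (\<Sum>l<M. nrm n (\<omega> l))" by (simp add: comp_def sum_list_sum_nth atLeast0LessThan)
    also have "\<dots> \<le> (\<Sum>l<M. 1)" using o by (intro sum_mono) (auto simp: cb_def)
    finally have "(r / real M) * (\<Sum>u\<leftarrow>?us. nrm n u) \<le> (r / real M) * real M" using r by (intro mult_left_mono) auto
    then have "R + r / real M * (\<Sum>u\<leftarrow>?us. nrm n u) \<le> R + r" using M by simp
    then have "zon (r / real M) ?us K \<subseteq> cb n (R + r)"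
      using zon_cb[OF _ us R(2), of "r / real M"] cb_mono r by (meson divide_nonneg_nonneg of_nat_0_le_iff order_trans)
    then show ?thesis unfolding C_def using R r
      by (intro vol_mono body_zon[OF us K] body_cb) auto
  qed
  have key: "\<forall>\<^sub>F M in sequentially. ?lo * (1 - \<delta>) \<le> (\<integral>\<omega>. ?f M \<omega> \<partial>PP n M) \<and> (\<integral>\<omega>. ?f M \<omega> \<partial>PP n M) \<le> ?hi + C * \<delta>"
    if d: "\<delta> > 0" for \<delta>
    using lln[OF n e(1) d] eventually_ge_at_top[of 1]
  proof eventually_elim
    case (elim M)
    interpret prob_space "PP n M" by (rule prob_PP)
    obtain B where B: "B \<in> events" "prob B \<le> \<delta>"
      "\<And>\<omega>. \<omega> \<in> space (PP n M) - B \<Longrightarrow> \<forall>l<M. \<omega> l \<in> cb n 1 \<Longrightarrow> good n M \<eta> \<omega>"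
      using elim(1) by blast
    have intf: "integrable (PP n M) (?f M)" using r by (intro expect_zon(1)[OF K]) simp
    have intB: "integrable (PP n M) (indicator B :: _ \<Rightarrow> real)"
      using B(1) by (intro integrable_real_indicator) (auto simp: emeasure_eq_measure)
    have EB: "(\<integral>\<omega>. indicator B \<omega> \<partial>PP n M) = prob B" using B(1) by simp
    have up: "AE \<omega> in PP n M. ?f M \<omega> \<le> ?hi + C * indicator B \<omega>"
      using AE_PP
    proof (rule AE_mp, intro AE_I2 impI)
      fix \<omega> assume o: "\<omega> \<in> space (PP n M)" "\<forall>l<M. \<omega> l \<in> cb n 1"
      show "?f M \<omega> \<le> ?hi + C * indicator B \<omega>"
      proof (cases "\<omega> \<in> B")
        case True then show ?thesis using fC[OF o(2) elim(2)] by (simp add: add_increasing)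
      next
        case False
        then have "good n M \<eta> \<omega>" using B(3) o by blast
        from good_sandwich(2)[OF K _ elim(2) this r e] show ?thesis using False space_PP[OF o(1)] by simp
      qed
    qed
    have lo: "AE \<omega> in PP n M. ?lo * (1 - indicator B \<omega>) \<le> ?f M \<omega>"
      using AE_PP
    proof (rule AE_mp, intro AE_I2 impI)
      fix \<omega> assume o: "\<omega> \<in> space (PP n M)" "\<forall>l<M. \<omega> l \<in> cb n 1"
      show "?lo * (1 - indicator B \<omega>) \<le> ?f M \<omega>"
      proof (cases "\<omega> \<in> B")
        case False
        then have "good n M \<eta> \<omega>" using B(3) o by blast
        from good_sandwich(1)[OF K _ elim(2) this r e] show ?thesis using False space_PP[OF o(1)] by simp
      qed simp
    qed
    have "(\<integral>\<omega>. ?f M \<omega> \<partial>PP n M) \<le> (\<integral>\<omega>. ?hi + C * indicator B \<omega> \<partial>PP n M)"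
      by (intro integral_mono_AE intf up Bochner_Integration.integrable_add integrable_mult_right intB integrable_const)
    also have "\<dots> = ?hi + C * prob B" using intB EB by (simp add: prob_space)
    also have "\<dots> \<le> ?hi + C * \<delta>" using B(2) C by (intro add_left_mono mult_left_mono) auto
    finally have 1: "(\<integral>\<omega>. ?f M \<omega> \<partial>PP n M) \<le> ?hi + C * \<delta>" .
    have "?lo * (1 - \<delta>) \<le> ?lo * (1 - prob B)" using B(2) by (intro mult_left_mono) auto
    also have "\<dots> = (\<integral>\<omega>. ?lo * (1 - indicator B \<omega>) \<partial>PP n M)" using intB EB by (simp add: prob_space)
    also have "\<dots> \<le> (\<integral>\<omega>. ?f M \<omega> \<partial>PP n M)"
      by (intro integral_mono_AE intf lo Bochner_Integration.integrable_diff integrable_mult_right intB integrable_const)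
    finally show ?case using 1 by simp
  qed
  have lim: "?lo * (1 - \<delta>) \<le> pS n K r" "pS n K r \<le> ?hi + C * \<delta>" if d: "\<delta> > 0" for \<delta>
    using tendsto_lowerbound[OF expect_limit[OF K r] eventually_mono[OF key[OF d]]]
      tendsto_upperbound[OF expect_limit[OF K r] eventually_mono[OF key[OF d]]] by auto
  have t0: "(\<lambda>k. ?lo * (1 - inverse (real (Suc k)))) \<longlonglongrightarrow> ?lo * (1 - 0)" "(\<lambda>k. ?hi + C * inverse (real (Suc k))) \<longlonglongrightarrow> ?hi + C * 0"
    by (intro tendsto_intros LIMSEQ_inverse_real_of_nat)+
  show "?lo \<le> pS n K r"
    using LIMSEQ_le_const2[OF t0(1), of "pS n K r"] lim(1)[of "inverse (real (Suc _))"] by auto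
  show "pS n K r \<le> ?hi"
    using LIMSEQ_le_const[OF t0(2), of "pS n K r"] lim(2)[of "inverse (real (Suc _))"] by auto
qed

text \<open>The sandwich is applied at the radii \<open>r / (beta n + e)\<close> and
  \<open>r / (beta n - e)\<close>, so that in both cases the body in the middle is the parallel body
  of radius \<open>r\<close>. Continuity of the polynomial then replaces continuity of the volume in
  the radius.\<close>

theorem vol_parallel_body:
  assumes n: "n \<ge> 1" and K: "body n K" and r: "0 \<le> r"
  shows "vol n (parallel_body n K r) = (\<Sum>i\<le>n. (r / beta n) ^ i * Phi n i K / fact i)"
proof -
  let ?G = "vol n (parallel_body n K r)"
  let ?b = "beta n"
  have b: "?b > 0" by (rule beta_pos[OF n])
  have lo: "pS n K (r / (?b + e)) \<le> ?G" if e: "0 < e" "e < ?b" for e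
  proof -
    define r' where "r' = r / (?b + e)"
    have r': "0 \<le> r'" "r' * (?b + e) = r" using r b e by (auto simp: r'_def)
    show ?thesis using pS_sandwich(2)[OF n K r'(1) e] unfolding r'(2) by (simp add: r'_def)
  qed
  have hi: "?G \<le> pS n K (r / (?b - e))" if e: "0 < e" "e < ?b" for e
  proof -
    define r' where "r' = r / (?b - e)"
    have r': "0 \<le> r'" "r' * (?b - e) = r" using r b e by (auto simp: r'_def)
    show ?thesis using pS_sandwich(1)[OF n K r'(1) e] unfolding r'(2) by (simp add: r'_def)
  qed
  have t: "((\<lambda>e. e) \<longlongrightarrow> (0::real)) (at_right 0)" by (rule tendsto_ident_at)
  have e1: "((\<lambda>e. pS n K (r / (?b + e))) \<longlongrightarrow> pS n K (r / (?b + 0))) (at_right 0)"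
    unfolding pS_def using b by (intro tendsto_intros t) auto
  have e2: "((\<lambda>e. pS n K (r / (?b - e))) \<longlongrightarrow> pS n K (r / (?b - 0))) (at_right 0)"
    unfolding pS_def using b by (intro tendsto_intros t) auto
  have ev: "\<forall>\<^sub>F e in at_right 0. 0 < e \<and> e < ?b"
    using b by (auto simp: eventually_at_right intro!: exI[of _ ?b])
  have "pS n K (r / (?b + 0)) \<le> ?G"
    by (rule tendsto_upperbound[OF e1 eventually_mono[OF ev]]) (use lo in auto)
  moreover have "?G \<le> pS n K (r / (?b - 0))"
    by (rule tendsto_lowerbound[OF e2 eventually_mono[OF ev]]) (use hi in auto)
  ultimately have "?G = pS n K (r / ?b)" by simp
  then show ?thesis by (simp add: pS_def)
qed

lemma poly_zero_coeffs:
  fixes c :: "nat \<Rightarrow> real"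
  assumes "\<And>r. 0 \<le> r \<Longrightarrow> (\<Sum>i\<le>n. c i * r ^ i) = 0" and "i \<le> n"
  shows "c i = 0"
proof (rule ccontr)
  assume "c i \<noteq> 0"
  then have "finite {z. (\<Sum>i\<le>n. c i * z ^ i) = 0}" using assms(2) Transcendental.polyfun_rootbound[of c i n] by blast
  moreover have "{0::real..} \<subseteq> {z. (\<Sum>i\<le>n. c i * z ^ i) = 0}" using assms(1) by auto
  ultimately have "finite {0::real..}" by (rule finite_subset[rotated])
  then show False using infinite_Ici by blast
qed

section \<open>Intrinsic volumes as multiples of \<open>Phi\<close>\<close>

lemma volume_unit_ball: "volume i (unit_ball i) = unit_ball_vol (real i)"
  unfolding unit_ball_cb by (subst volume_leb[OF cb_sets]) (simp add: vol_cb)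

lemma steiner_unique:
  assumes "steiner n K V" "steiner n K V'" "j \<le> n" shows "V j = V' j"
proof -
  let ?c = "\<lambda>i. unit_ball_vol (real i) * (V (n - i) - V' (n - i))"
  have z: "(\<Sum>i\<le>n. ?c i * r ^ i) = 0" if "0 \<le> r" for r
  proof -
    have "(\<Sum>i=0..n. r ^ i * volume i (unit_ball i) * V (n - i)) = (\<Sum>i=0..n. r ^ i * volume i (unit_ball i) * V' (n - i))"
      using assms(1,2)[unfolded steiner_def, rule_format, OF that] by simp
    then have "(\<Sum>i=0..n. r ^ i * volume i (unit_ball i) * V (n - i) - r ^ i * volume i (unit_ball i) * V' (n - i)) = 0"
      by (simp add: sum_subtractf)
    then show ?thesis by (simp add: volume_unit_ball algebra_simps atLeast0AtMost)
  qed
  have "?c (n - j) = 0" by (rule poly_zero_coeffs[where c="?c", OF z]) simp_all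
  moreover have "unit_ball_vol (real (n - j)) \<noteq> 0" by (metis less_irrefl of_nat_0_le_iff unit_ball_vol_pos)
  ultimately have "V (n - (n - j)) - V' (n - (n - j)) = 0" by (metis mult_eq_0_iff)
  then show ?thesis using assms(3) by simp
qed

lemma intrinsic_volume_eqI:
  assumes "steiner n K V" "j \<le> n" shows "intrinsic_volume n j K = V j"
  unfolding intrinsic_volume_def
  by (rule the_equality) (use assms steiner_unique in blast)+

text \<open>The factor from comparing the coefficients of \<open>r ^ i\<close> in
  \<open>vol_parallel_body\<close> and in Steiner's formula.\<close>

definition gam :: "nat \<Rightarrow> nat \<Rightarrow> real" where
  "gam n i = 1 / (fact i * beta n ^ i * unit_ball_vol (real i))"

lemma gam_pos: "n \<ge> 1 \<Longrightarrow> gam n i > 0"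
  using beta_pos[of n] by (simp add: gam_def)

lemma intrinsic_volume_Phi:
  assumes n: "n \<ge> 1" and K: "body n K" and j: "j \<le> n"
  shows "intrinsic_volume n j K = gam n (n - j) * Phi n (n - j) K"
proof -
  define V where "V j = gam n (n - j) * Phi n (n - j) K" for j
  have "steiner n K V"
    unfolding steiner_def
  proof (intro allI impI)
    fix r :: real assume r: "0 \<le> r"
    have "volume n (parallel_body n K r) = vol n (parallel_body n K r)"
      by (rule volume_leb[OF body_sets[OF body_par[OF K]]])
    also have "\<dots> = (\<Sum>i\<le>n. (r / beta n) ^ i * Phi n i K / fact i)" by (rule vol_parallel_body[OF n K r])
    also have "\<dots> = (\<Sum>i\<le>n. r ^ i * volume i (unit_ball i) * V (n - i))"
    proof (intro sum.cong refl)
      fix i assume i: "i \<in> {..n}"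
      have "unit_ball_vol (real i) \<noteq> 0" by (metis less_irrefl of_nat_0_le_iff unit_ball_vol_pos)
      then show "(r / beta n) ^ i * Phi n i K / fact i = r ^ i * volume i (unit_ball i) * V (n - i)"
        using i by (simp add: V_def gam_def volume_unit_ball power_divide)
    qed
    finally show "volume n (parallel_body n K r) = (\<Sum>i=0..n. r ^ i * volume i (unit_ball i) * V (n - i))"
      by (simp add: atLeast0AtMost)
  qed
  from intrinsic_volume_eqI[OF this j] show ?thesis by (simp add: V_def)
qed

text \<open>The zero sequence satisfies Steiner's formula for the empty set. Its deficit is
  therefore that of a point of volume 0, which excludes the empty polytope once
  \<open>\<epsilon>\<close> is below the intrinsic volume of the ball.\<close>

lemma intrinsic_volume_empty: "j \<le> n \<Longrightarrow> intrinsic_volume n j {} = 0"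
proof -
  assume j: "j \<le> n"
  have "steiner n {} (\<lambda>_. 0)" by (simp add: steiner_def parallel_body_def volume_def)
  from intrinsic_volume_eqI[OF this j] show ?thesis .
qed

lemma par_cb: assumes "0 < r" "0 \<le> s" shows "parallel_body n (cb n r) s = cb n (r + s)"
proof (intro set_eqI iffI)
  fix z assume "z \<in> parallel_body n (cb n r) s"
  then obtain x y where z: "z = x + s *\<^sub>R y" "x \<in> cb n r" "y \<in> cb n 1" unfolding par_image by auto
  have "nrm n z \<le> nrm n x + s * nrm n y" unfolding z(1) using nrm_triangle[of n x "s *\<^sub>R y"] assms by simp
  also have "\<dots> \<le> r + s * 1" using z assms by (intro add_mono mult_left_mono) (auto simp: cb_def)
  finally show "z \<in> cb n (r + s)" using z by (simp add: cb_def)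
next
  fix z assume z: "z \<in> cb n (r + s)"
  let ?x = "(r / (r + s)) *\<^sub>R z" and ?y = "(1 / (r + s)) *\<^sub>R z"
  have zn: "z \<in> Rn n" "nrm n z \<le> r + s" using z by (auto simp: cb_def)
  have "?x \<in> cb n r" using zn assms mult_left_mono[OF zn(2), of r] by (simp add: cb_def divide_le_eq)
  moreover have "?y \<in> cb n 1" using zn assms by (simp add: cb_def divide_le_eq)
  moreover have "z = ?x + s *\<^sub>R ?y"
  proof -
    have "r / (r + s) + s * (1 / (r + s)) = 1" using assms by (simp flip: add_divide_distrib)
    then show ?thesis by (metis scaleR_left_distrib scaleR_one scaleR_scaleR)
  qed
  ultimately have "z = (case (?x, ?y) of (x, y) \<Rightarrow> x + s *\<^sub>R y)" "(?x, ?y) \<in> cb n r \<times> cb n 1" by (simp_all only: prod.case mem_Times_iff fst_conv snd_conv)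
  then show "z \<in> parallel_body n (cb n r) s" unfolding par_image by (rule image_eqI)
qed

text \<open>Parallel bodies of balls are balls, so the coefficients come from the binomial theorem.
  What is used later is positivity and homogeneity of degree \<open>n - i\<close>.\<close>

lemma Phi_cb:
  assumes n: "n \<ge> 1" and r: "r > 0" and i: "i \<le> n"
  shows "Phi n i (cb n r) = r ^ (n - i) * (real (n choose i) * unit_ball_vol (real n) * fact i * beta n ^ i)"
proof -
  have b: "beta n > 0" by (rule beta_pos[OF n])
  have K: "body n (cb n r)" using r by (intro body_cb) simp
  let ?c = "\<lambda>i. Phi n i (cb n r) / (fact i * beta n ^ i) - real (n choose i) * unit_ball_vol (real n) * r ^ (n - i)"
  have z: "(\<Sum>i\<le>n. ?c i * s ^ i) = 0" if s: "0 \<le> s" for s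
  proof -
    have "(\<Sum>i\<le>n. (s / beta n) ^ i * Phi n i (cb n r) / fact i) = vol n (cb n (r + s))"
      using vol_parallel_body[OF n K s] par_cb[OF r s] by simp
    also have "\<dots> = unit_ball_vol (real n) * (s + r) ^ n" using r s by (subst vol_cb) (auto simp: add.commute)
    also have "(s + r) ^ n = (\<Sum>i\<le>n. real (n choose i) * s ^ i * r ^ (n - i))" by (rule binomial_ring)
    finally have "(\<Sum>i\<le>n. (s / beta n) ^ i * Phi n i (cb n r) / fact i) - unit_ball_vol (real n) * (\<Sum>i\<le>n. real (n choose i) * s ^ i * r ^ (n - i)) = 0"
      by simp
    then show ?thesis by (simp add: sum_distrib_left sum_subtractf power_divide algebra_simps)
  qed
  have "?c i = 0" by (rule poly_zero_coeffs[where c="?c", OF z i])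
  then show ?thesis using b by (simp add: field_simps)
qed

lemma Phi_cb_scale: "n \<ge> 1 \<Longrightarrow> r > 0 \<Longrightarrow> i \<le> n \<Longrightarrow> Phi n i (cb n r) = r ^ (n - i) * Phi n i (cb n 1)"
  by (simp add: Phi_cb)

lemma Phi_cb1_pos: "n \<ge> 1 \<Longrightarrow> i \<le> n \<Longrightarrow> Phi n i (cb n 1) > 0"
  using beta_pos[of n] by (simp add: Phi_cb)

section \<open>The invariant measures behind the intrinsic volumes\<close>

lemma pj_add: "pj n us (x + y) = pj n us x + pj n us y"
proof (induction us arbitrary: x y rule: list_length_induct)
  case (Cons u us)
  show ?case unfolding pj.simps pr_add by (rule Cons.IH) simp
qed simp

lemma pj_scale: "pj n us (r *\<^sub>R x) = r *\<^sub>R pj n us x"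
proof (induction us arbitrary: x rule: list_length_induct)
  case (Cons u us)
  show ?case unfolding pj.simps pr_scale by (rule Cons.IH) simp
qed simp

lemma pj_fix: "(\<And>v. v \<in> set vs \<Longrightarrow> ip n v u = 0) \<Longrightarrow> pj n vs u = u"
proof (induction vs rule: list_length_induct)
  case (Cons v vs)
  have v: "pr n v u = u" using Cons.prems[of v] by (simp add: pr_orth ip_sym)
  show ?case unfolding pj.simps v
  proof (rule Cons.IH)
    fix w assume "w \<in> set (map (pr n v) vs)"
    then obtain x where x: "x \<in> set vs" "w = pr n v x" by auto
    show "ip n w u = 0" unfolding x(2) ip_pr_adj v using Cons.prems[of x] x(1) by simp
  qed simp
qed simp

text \<open>The projection along \<open>u\<close> commutes with projections along vectors orthogonal
  to \<open>u\<close>, hence the recursive \<open>pj\<close> is self-adjoint like a single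
  \<open>pr\<close>.\<close>

lemma pj_adj: "set us \<subseteq> Rn n \<Longrightarrow> ip n (pj n us x) y = ip n x (pj n us y)"
proof (induction us arbitrary: x y rule: list_length_induct)
  case (Cons u us)
  let ?vs = "map (pr n u) us"
  have u: "u \<in> Rn n" and vs: "set ?vs \<subseteq> Rn n" using Cons.prems by auto
  have adj: "ip n (pj n ?vs a) b = ip n a (pj n ?vs b)" for a b by (rule Cons.IH[OF _ vs]) simp
  have fx: "pj n ?vs u = u" by (rule pj_fix) (auto simp: ip_pr[OF u])
  have "pr n u (pj n ?vs y) = pj n ?vs y - (ip n (pj n ?vs y) u / ip n u u) *\<^sub>R u" by (simp add: pr_def)
  also have "ip n (pj n ?vs y) u = ip n y u" unfolding adj fx ..
  also have "pj n ?vs y - (ip n y u / ip n u u) *\<^sub>R u = pj n ?vs (y - (ip n y u / ip n u u) *\<^sub>R u)"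
    using pj_add[of n ?vs y "(- (ip n y u / ip n u u)) *\<^sub>R u"] pj_scale[of n ?vs "- (ip n y u / ip n u u)" u] fx by simp
  finally have "pr n u (pj n ?vs y) = pj n ?vs (pr n u y)" by (simp only: pr_def[of n u y])
  then show ?case unfolding pj.simps adj ip_pr_adj by simp
qed simp

lemma pj_idem: "set us \<subseteq> Rn n \<Longrightarrow> pj n us (pj n us x) = pj n us x"
proof (induction us arbitrary: x rule: list_length_induct)
  case (Cons u us)
  let ?vs = "map (pr n u) us"
  have u: "u \<in> Rn n" and vs: "set ?vs \<subseteq> Rn n" using Cons.prems by auto
  have fx: "pj n ?vs u = u" by (rule pj_fix) (auto simp: ip_pr[OF u])
  have "ip n (pj n ?vs (pr n u x)) u = ip n (pr n u x) (pj n ?vs u)" by (rule pj_adj[OF vs])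
  also have "\<dots> = 0" unfolding fx by (rule ip_pr[OF u])
  finally have "pr n u (pj n ?vs (pr n u x)) = pj n ?vs (pr n u x)" by (rule pr_orth)
  then show ?case unfolding pj.simps using Cons.IH[OF _ vs, of "pr n u x"] by simp
qed simp

lemma pj_nrm: "set us \<subseteq> Rn n \<Longrightarrow> nrm n (pj n us x) \<le> nrm n x"
proof (induction us arbitrary: x rule: list_length_induct)
  case (Cons u us)
  let ?vs = "map (pr n u) us"
  have u: "u \<in> Rn n" and vs: "set ?vs \<subseteq> Rn n" using Cons.prems by auto
  have "nrm n (pj n ?vs (pr n u x)) \<le> nrm n (pr n u x)" by (rule Cons.IH[OF _ vs]) simp
  also have "\<dots> \<le> nrm n x" by (rule nrm_pr_le[OF u])
  finally show ?case by simp
qed simp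

lemma cyl_bounded: "set us \<subseteq> Rn n \<Longrightarrow> A \<subseteq> cb n r \<Longrightarrow> cyl n us A \<subseteq> cb n (r + (\<Sum>u\<leftarrow>us. nrm n u))"
proof (induction us rule: list_length_induct)
  case Nil then show ?case by (auto simp: cyl_def)
next
  case (Cons u us)
  let ?vs = "map (pr n u) us"
  have u: "u \<in> Rn n" and vs: "set ?vs \<subseteq> Rn n" using Cons.prems by auto
  show ?case
  proof
    fix x assume x: "x \<in> cyl n (u # us) A"
    then have xn: "x \<in> Rn n" and sl: "0 \<le> ip n x u" "ip n x u < ip n u u" and c: "pr n u x \<in> cyl n ?vs A"
      using u by (auto simp: cyl_def)
    have u0: "u \<noteq> 0" using sl by auto
    have "nrm n (pr n u x) \<le> r + (\<Sum>u\<leftarrow>?vs. nrm n u)"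
      using Cons.IH[OF _ vs Cons.prems(2)] c by (auto simp: cb_def)
    also have "(\<Sum>u\<leftarrow>?vs. nrm n u) \<le> (\<Sum>u\<leftarrow>us. nrm n u)"
      unfolding map_map comp_def by (intro sum_list_mono nrm_pr_le u)
    finally have 1: "nrm n (pr n u x) \<le> r + (\<Sum>u\<leftarrow>us. nrm n u)" by simp
    have "\<bar>ip n x u / ip n u u\<bar> \<le> 1" using sl by (simp add: divide_le_eq)
    then have "nrm n ((ip n x u / ip n u u) *\<^sub>R u) \<le> 1 * nrm n u"
      unfolding nrm_scale by (intro mult_right_mono) auto
    then have "nrm n x \<le> r + (\<Sum>u\<leftarrow>us. nrm n u) + nrm n u"
      using slab_decomp[OF u u0, of x] nrm_triangle[of n "pr n u x" "(ip n x u / ip n u u) *\<^sub>R u"] 1 by simp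
    then show "x \<in> cb n (r + (\<Sum>u\<leftarrow>u # us. nrm n u))" using xn by (simp add: cb_def)
  qed
qed

text \<open>\<open>Phi n i K\<close> is the mean measure of the projections of \<open>K\<close>; here \<open>A\<close> is measured by its intersection with the
  orthogonal complements instead, so that \<open>LM n i\<close> is additive in \<open>A\<close>.\<close>

definition LM :: "nat \<Rightarrow> nat \<Rightarrow> vec measure" where
  "LM n i = distr (density (PP n i \<Otimes>\<^sub>M leb n) (indicator {z \<in> space (PP n i \<Otimes>\<^sub>M leb n). chi n (map (fst z) [0..<i]) (snd z)}))
     (rb n) (\<lambda>z. pj n (map (fst z) [0..<i]) (snd z))"

lemma sets_LM [simp]: "sets (LM n i) = sets (rb n)" by (simp add: LM_def)
lemma space_LM [simp]: "space (LM n i) = Rn n" by (simp add: LM_def)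

lemma sf_leb: "sigma_finite_measure (leb n)"
  by (rule tim.sigma_finite[OF tim_leb])

lemma snd_leb: "snd \<in> M \<Otimes>\<^sub>M leb n \<rightarrow>\<^sub>M rb n"
  using measurable_snd[of M "leb n"] by (simp only: measurable_cong_sets[OF refl sets_leb])

lemma cyl_pair:
  fixes n i :: nat
  assumes A: "A \<in> sets (rb n)"
  defines "X \<equiv> {z \<in> space (PP n i \<Otimes>\<^sub>M leb n). chi n (map (fst z) [0..<i]) (snd z) \<and> pj n (map (fst z) [0..<i]) (snd z) \<in> A}"
  shows cyl_pair_sets: "X \<in> sets (PP n i \<Otimes>\<^sub>M leb n)"
    and cyl_pair_slice: "\<And>\<omega>. \<omega> \<in> space (PP n i) \<Longrightarrow> Pair \<omega> -` X = cyl n (map \<omega> [0..<i]) A"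
proof -
  let ?N = "PP n i \<Otimes>\<^sub>M leb n"
  have F: "(\<lambda>z. fst z l) \<in> ?N \<rightarrow>\<^sub>M rb n" if "l \<in> set [0..<i]" for l
    using that by (intro measurable_compose[OF measurable_fst PP_component]) auto
  have 1: "(\<lambda>z. pj n (map (\<lambda>l. fst z l) [0..<i]) (snd z)) \<in> ?N \<rightarrow>\<^sub>M rb n"
    by (rule pj_measurable[where F="\<lambda>l z. fst z l"]) (rule F, assumption, rule snd_leb)
  have 2: "Measurable.pred ?N (\<lambda>z. chi n (map (\<lambda>l. fst z l) [0..<i]) (snd z))"
    by (rule chi_measurable[where F="\<lambda>l z. fst z l"]) (rule F, assumption, rule snd_leb)
  have "X = {z \<in> space ?N. chi n (map (\<lambda>l. fst z l) [0..<i]) (snd z)} \<inter> ((\<lambda>z. pj n (map (\<lambda>l. fst z l) [0..<i]) (snd z)) -` A \<inter> space ?N)"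
    by (auto simp: X_def)
  then show "X \<in> sets ?N" using 2 measurable_sets[OF 1 A] unfolding pred_def by simp
  fix \<omega> assume "\<omega> \<in> space (PP n i)"
  then show "Pair \<omega> -` X = cyl n (map \<omega> [0..<i]) A"
    by (auto simp: X_def cyl_def space_pair_measure)
qed

lemma chi_pair_sets: "{z \<in> space (PP n i \<Otimes>\<^sub>M leb n). chi n (map (fst z) [0..<i]) (snd z)} \<in> sets (PP n i \<Otimes>\<^sub>M leb n)"
proof -
  have F: "(\<lambda>z. fst z l) \<in> PP n i \<Otimes>\<^sub>M leb n \<rightarrow>\<^sub>M rb n" if "l \<in> set [0..<i]" for l
    using that by (intro measurable_compose[OF measurable_fst PP_component]) auto
  have "Measurable.pred (PP n i \<Otimes>\<^sub>M leb n) (\<lambda>z. chi n (map (\<lambda>l. fst z l) [0..<i]) (snd z))"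
    by (rule chi_measurable[where F="\<lambda>l z. fst z l"]) (rule F, assumption, rule snd_leb)
  then show ?thesis unfolding pred_def .
qed

lemma cyl_em_measurable:
  assumes A: "A \<in> sets (rb n)"
  shows "(\<lambda>\<omega>. emeasure (leb n) (cyl n (map \<omega> [0..<i]) A)) \<in> borel_measurable (PP n i)"
  using sigma_finite_measure.measurable_emeasure_Pair[OF sf_leb cyl_pair_sets[OF A, of i]]
  by (rule measurable_cong[THEN iffD1, rotated]) (simp only: cyl_pair_slice[OF A])

lemma emeasure_LM:
  assumes A: "A \<in> sets (rb n)"
  shows "emeasure (LM n i) A = (\<integral>\<^sup>+\<omega>. emeasure (leb n) (cyl n (map \<omega> [0..<i]) A) \<partial>PP n i)"
proof -
  let ?N = "PP n i \<Otimes>\<^sub>M leb n"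
  let ?C = "{z \<in> space ?N. chi n (map (fst z) [0..<i]) (snd z)}"
  let ?p = "\<lambda>z. pj n (map (fst z) [0..<i]) (snd z)"
  have F: "(\<lambda>z. fst z l) \<in> ?N \<rightarrow>\<^sub>M rb n" if "l \<in> set [0..<i]" for l
    using that by (intro measurable_compose[OF measurable_fst PP_component]) auto
  have p: "?p \<in> ?N \<rightarrow>\<^sub>M rb n"
    by (rule pj_measurable[where F="\<lambda>l z. fst z l"]) (rule F, assumption, rule snd_leb)
  have pd: "?p \<in> density ?N (indicator ?C) \<rightarrow>\<^sub>M rb n" using p by (simp only: measurable_density_eq1)
  have "emeasure (LM n i) A = emeasure (density ?N (indicator ?C)) (?p -` A \<inter> space ?N)"
    unfolding LM_def by (subst emeasure_distr[OF pd A]) (simp only: space_density)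
  also have "\<dots> = emeasure ?N (?C \<inter> (?p -` A \<inter> space ?N))"
    by (rule emeasure_restricted[OF chi_pair_sets measurable_sets[OF p A]])
  also have "?C \<inter> (?p -` A \<inter> space ?N) = {z \<in> space ?N. chi n (map (fst z) [0..<i]) (snd z) \<and> ?p z \<in> A}" by auto
  also have "emeasure ?N \<dots> = (\<integral>\<^sup>+\<omega>. emeasure (leb n) (Pair \<omega> -` {z \<in> space ?N. chi n (map (fst z) [0..<i]) (snd z) \<and> ?p z \<in> A}) \<partial>PP n i)"
    by (rule sigma_finite_measure.emeasure_pair_measure_alt[OF sf_leb cyl_pair_sets[OF A]])
  also have "\<dots> = (\<integral>\<^sup>+\<omega>. emeasure (leb n) (cyl n (map \<omega> [0..<i]) A) \<partial>PP n i)"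
    by (rule nn_integral_cong) (simp only: cyl_pair_slice[OF A])
  finally show ?thesis .
qed

lemma Phi_ennreal:
  assumes K: "body n K"
  shows "ennreal (Phi n i K) = (\<integral>\<^sup>+\<omega>. emeasure (leb n) (cyl n (map \<omega> [0..<i]) (pj n (map \<omega> [0..<i]) ` K)) \<partial>PP n i)"
proof -
  have xs: "set [0..<i] \<subseteq> {..<i}" by auto
  have "ennreal (Phi n i K) = (\<integral>\<^sup>+\<omega>. ennreal (W (leb n) (map \<omega> [0..<i]) K) \<partial>PP n i)"
    unfolding Phi_def
    by (rule nn_integral_eq_integral[symmetric, OF W_PP_integrable[OF K xs]]) (rule AE_I2, rule W_PP_nonneg[OF K xs])
  also have "\<dots> = (\<integral>\<^sup>+\<omega>. emeasure (leb n) (cyl n (map \<omega> [0..<i]) (pj n (map \<omega> [0..<i]) ` K)) \<partial>PP n i)"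
  proof (rule nn_integral_cong)
    fix \<omega> assume "\<omega> \<in> space (PP n i)"
    then have us: "set (map \<omega> [0..<i]) \<subseteq> Rn n" using space_PP by auto
    let ?us = "map \<omega> [0..<i]"
    have b: "body n (pj n ?us ` K)" by (rule body_pj[OF us K])
    obtain r where r: "r > 0" "pj n ?us ` K \<subseteq> cb n r" using b compact_in_cb[of "pj n ?us ` K" n] by (auto simp: body_def)
    have "emeasure (leb n) (cyl n ?us (pj n ?us ` K)) \<le> emeasure (leb n) (cb n (r + (\<Sum>u\<leftarrow>?us. nrm n u)))"
      by (rule emeasure_mono[OF cyl_bounded[OF us r(2)]]) (simp only: sets_leb cb_sets)
    also have "\<dots> < \<infinity>" by (rule tim.fin[OF tim_leb])
    finally have "emeasure (leb n) (cyl n ?us (pj n ?us ` K)) = ennreal (measure (leb n) (cyl n ?us (pj n ?us ` K)))"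
      by (intro emeasure_eq_ennreal_measure) simp
    then show "ennreal (W (leb n) ?us K) = emeasure (leb n) (cyl n ?us (pj n ?us ` K))"
      using W_formula[OF tim_leb us K] by simp
  qed
  finally show ?thesis .
qed

lemma cyl_mono: "A \<subseteq> B \<Longrightarrow> cyl n us A \<subseteq> cyl n us B" by (auto simp: cyl_def)

lemma cyl_sub_pj: assumes us: "set us \<subseteq> Rn n" shows "cyl n us K \<subseteq> cyl n us (pj n us ` K)"
proof
  fix x assume x: "x \<in> cyl n us K"
  then have "pj n us (pj n us x) \<in> pj n us ` K" by (auto simp: cyl_def)
  then show "x \<in> cyl n us (pj n us ` K)" using x pj_idem[OF us] by (simp add: cyl_def)
qed

lemma us_Rn: "\<omega> \<in> space (PP n i) \<Longrightarrow> set (map \<omega> [0..<i]) \<subseteq> Rn n"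
  using space_PP by auto

lemma cyl_pj_sets: "set us \<subseteq> Rn n \<Longrightarrow> body n K \<Longrightarrow> cyl n us (pj n us ` K) \<in> sets (leb n)"
  unfolding sets_leb by (intro cyl_sets body_sets body_pj)

lemma pj_cb:
  assumes us: "set us \<subseteq> Rn n" and P: "P \<subseteq> cb n r" shows "pj n us ` P \<subseteq> cb n r"
proof
  fix y assume "y \<in> pj n us ` P"
  then obtain x where x: "x \<in> P" "y = pj n us x" by auto
  then have "x \<in> Rn n" "nrm n x \<le> r" using P by (auto simp: cb_def)
  then show "y \<in> cb n r" using x pj_nrm[OF us, of x] pj_Rn[OF us, of x] by (simp add: cb_def)
qed

text \<open>A point of \<open>K\<close> in an orthogonal complement is its own projection: sections
  through the origin lie inside projections.\<close>

lemma LM_le_Phi: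
  assumes K: "body n K" shows "emeasure (LM n i) K \<le> ennreal (Phi n i K)"
  unfolding emeasure_LM[OF body_sets[OF K]] Phi_ennreal[OF K]
  by (intro nn_integral_mono emeasure_mono cyl_sub_pj us_Rn cyl_pj_sets K)

text \<open>For a centred ball, section and projection coincide because projections do not increase
  the norm.\<close>

lemma LM_cb:
  assumes r: "0 \<le> r" shows "emeasure (LM n i) (cb n r) = ennreal (Phi n i (cb n r))"
proof (rule antisym[OF LM_le_Phi[OF body_cb[OF r]]])
  show "ennreal (Phi n i (cb n r)) \<le> emeasure (LM n i) (cb n r)"
    unfolding emeasure_LM[OF cb_sets] Phi_ennreal[OF body_cb[OF r]]
  proof (rule nn_integral_mono)
    fix \<omega> assume "\<omega> \<in> space (PP n i)"
    note us = us_Rn[OF this]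
    have "pj n (map \<omega> [0..<i]) ` cb n r \<subseteq> cb n r" by (rule pj_cb[OF us order_refl])
    then show "emeasure (leb n) (cyl n (map \<omega> [0..<i]) (pj n (map \<omega> [0..<i]) ` cb n r)) \<le> emeasure (leb n) (cyl n (map \<omega> [0..<i]) (cb n r))"
      by (intro emeasure_mono cyl_mono) (auto simp only: sets_leb intro!: cyl_sets us cb_sets)
  qed
qed

text \<open>If \<open>y = pj n us p\<close> with \<open>p \<in> P\<close>, then
  \<open>ip n y y = ip n p y \<le> hs n P y\<close>, so \<open>y\<close> is not in \<open>A\<close>.
  The cylinders over the projection of \<open>P\<close> and over \<open>A\<close> are therefore
  disjoint parts of the cylinder over the ball.\<close>

lemma Phi_inscribed:
  assumes P: "body n P" "P \<subseteq> cb n 1" and A: "A \<in> sets (rb n)" "A \<subseteq> cb n 1"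
    and h: "\<And>x. x \<in> A \<Longrightarrow> hs n P x < ip n x x"
  shows "ennreal (Phi n i P) + emeasure (LM n i) A \<le> emeasure (LM n i) (cb n 1)"
proof -
  let ?P = "\<lambda>\<omega>. cyl n (map \<omega> [0..<i]) (pj n (map \<omega> [0..<i]) ` P)"
  have xs: "set [0..<i] \<subseteq> {..<i}" by auto
  have Pm: "(\<lambda>\<omega>. emeasure (leb n) (cyl n (map \<omega> [0..<i]) A)) \<in> borel_measurable (PP n i)"
    by (rule cyl_em_measurable[OF A(1)])
  have "ennreal (Phi n i P) + emeasure (LM n i) A = (\<integral>\<^sup>+\<omega>. emeasure (leb n) (?P \<omega>) \<partial>PP n i) + (\<integral>\<^sup>+\<omega>. emeasure (leb n) (cyl n (map \<omega> [0..<i]) A) \<partial>PP n i)"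
    unfolding emeasure_LM[OF A(1)] Phi_ennreal[OF P(1)] ..
  also have "\<dots> \<le> (\<integral>\<^sup>+\<omega>. emeasure (leb n) (?P \<omega>) + emeasure (leb n) (cyl n (map \<omega> [0..<i]) A) \<partial>PP n i)"
  proof -
    have Pm': "(\<lambda>\<omega>. emeasure (leb n) (?P \<omega>)) \<in> borel_measurable (PP n i)"
    proof (rule measurable_cong[THEN iffD1, rotated])
      show "(\<lambda>\<omega>. ennreal (W (leb n) (map \<omega> [0..<i]) P)) \<in> borel_measurable (PP n i)"
        using W_PP_measurable[OF P(1) xs] by simp
    next
      fix \<omega> assume o: "\<omega> \<in> space (PP n i)"
      note us = us_Rn[OF o]
      let ?us = "map \<omega> [0..<i]"
      have "pj n ?us ` P \<subseteq> cb n 1" by (rule pj_cb[OF us P(2)])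
      then have "emeasure (leb n) (?P \<omega>) \<le> emeasure (leb n) (cb n (1 + (\<Sum>u\<leftarrow>?us. nrm n u)))"
        by (intro emeasure_mono cyl_bounded us) (auto simp only: sets_leb cb_sets)
      also have "\<dots> < \<infinity>" by (rule tim.fin[OF tim_leb])
      finally have "emeasure (leb n) (?P \<omega>) = ennreal (measure (leb n) (?P \<omega>))"
        by (intro emeasure_eq_ennreal_measure) simp
      then show "ennreal (W (leb n) ?us P) = emeasure (leb n) (?P \<omega>)"
        using W_formula[OF tim_leb us P(1)] by simp
    qed
    show ?thesis by (simp only: nn_integral_add[OF Pm' Pm])
  qed
  also have "\<dots> \<le> (\<integral>\<^sup>+\<omega>. emeasure (leb n) (cyl n (map \<omega> [0..<i]) (cb n 1)) \<partial>PP n i)"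
  proof (rule nn_integral_mono)
    fix \<omega> assume "\<omega> \<in> space (PP n i)"
    note us = us_Rn[OF this]
    let ?us = "map \<omega> [0..<i]"
    have s1: "?P \<omega> \<in> sets (leb n)" "cyl n ?us A \<in> sets (leb n)"
      using cyl_pj_sets[OF us P(1)] cyl_sets[OF us A(1)] by (simp_all only: sets_leb)
    have dj: "?P \<omega> \<inter> cyl n ?us A = {}"
    proof (rule equals0I)
      fix x assume x: "x \<in> ?P \<omega> \<inter> cyl n ?us A"
      then obtain p where p: "p \<in> P" "pj n ?us x = pj n ?us p" by (auto simp: cyl_def)
      let ?y = "pj n ?us x"
      have "ip n ?y ?y = ip n (pj n ?us p) (pj n ?us x)" using p by simp
      also have "\<dots> = ip n p ?y" using pj_adj[OF us, of p ?y] pj_idem[OF us] by simp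
      also have "\<dots> \<le> hs n P ?y" by (rule hs_upper[OF P(1) p(1)])
      also have "\<dots> < ip n ?y ?y" using x by (intro h) (auto simp: cyl_def)
      finally show False by simp
    qed
    have "pj n ?us ` P \<subseteq> cb n 1" by (rule pj_cb[OF us P(2)])
    then have "?P \<omega> \<union> cyl n ?us A \<subseteq> cyl n ?us (cb n 1)" using A(2) by (auto simp: cyl_def)
    then have "emeasure (leb n) (?P \<omega> \<union> cyl n ?us A) \<le> emeasure (leb n) (cyl n ?us (cb n 1))"
      by (intro emeasure_mono) (auto simp only: sets_leb intro!: cyl_sets us cb_sets)
    then show "emeasure (leb n) (?P \<omega>) + emeasure (leb n) (cyl n ?us A) \<le> emeasure (leb n) (cyl n ?us (cb n 1))"
      by (simp only: plus_emeasure[OF s1 dj])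
  qed
  also have "\<dots> = emeasure (LM n i) (cb n 1)" by (rule emeasure_LM[OF cb_sets, symmetric])
  finally show ?thesis .
qed

text \<open>Here replacing projections by sections errs on the right side, since
  \<open>LM_le_Phi\<close> bounds \<open>Phi\<close> from below.\<close>

lemma Phi_circumscribed:
  assumes P: "body n P" "cb n 1 \<subseteq> P" and A: "A \<in> sets (rb n)" "A \<subseteq> P - cb n 1"
  shows "emeasure (LM n i) (cb n 1) + emeasure (LM n i) A \<le> ennreal (Phi n i P)"
proof -
  have "emeasure (LM n i) (cb n 1) + emeasure (LM n i) A = emeasure (LM n i) (cb n 1 \<union> A)"
    using A by (intro plus_emeasure) (auto simp only: sets_LM cb_sets)
  also have "\<dots> \<le> emeasure (LM n i) P"
    using A P by (intro emeasure_mono) (auto simp only: sets_LM intro!: body_sets)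
  also have "\<dots> \<le> ennreal (Phi n i P)" by (rule LM_le_Phi[OF P(1)])
  finally show ?thesis .
qed

section \<open>Reflection invariance of \<open>LM\<close>\<close>

lemma rf_pr: "v \<in> Rn n \<Longrightarrow> pr n (rf n v u) (rf n v x) = rf n v (pr n u x)"
  by (simp add: pr_def rf_ip rf_diff rf_scale)

lemma rf_chi: "v \<in> Rn n \<Longrightarrow> chi n (map (rf n v) us) (rf n v x) = chi n us x"
proof (induction us arbitrary: x rule: list_length_induct)
  case (Cons u us)
  have e: "map (pr n (rf n v u)) (map (rf n v) us) = map (rf n v) (map (pr n u) us)"
    using rf_pr[OF Cons.prems] by simp
  have "chi n (map (rf n v) (map (pr n u) us)) (rf n v (pr n u x)) = chi n (map (pr n u) us) (pr n u x)"
    by (rule Cons.IH[OF _ Cons.prems]) simp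
  then show ?case unfolding list.map(2) chi.simps e rf_pr[OF Cons.prems] rf_ip[OF Cons.prems] by simp
qed simp

lemma rf_pj: "v \<in> Rn n \<Longrightarrow> pj n (map (rf n v) us) (rf n v x) = rf n v (pj n us x)"
proof (induction us arbitrary: x rule: list_length_induct)
  case (Cons u us)
  have e: "map (pr n (rf n v u)) (map (rf n v) us) = map (rf n v) (map (pr n u) us)"
    using rf_pr[OF Cons.prems] by simp
  have "pj n (map (rf n v) (map (pr n u) us)) (rf n v (pr n u x)) = rf n v (pj n (map (pr n u) us) (pr n u x))"
    by (rule Cons.IH[OF _ Cons.prems]) simp
  then show ?case unfolding list.map(2) pj.simps e rf_pr[OF Cons.prems] .
qed simp

lemma PP_rf:
  assumes v: "v \<in> Rn n" shows "distr (PP n i) (PP n i) (compose {..<i} (rf n v)) = PP n i"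
proof -
  have m: "rf n v \<in> U n \<rightarrow>\<^sub>M U n"
    using rf_measurable[OF v measurable_U] by (simp only: measurable_cong_sets[OF refl sets_U])
  have "distr (PP n i) (PP n i) (compose {..<i} (rf n v)) = PiM {..<i} (\<lambda>_. distr (U n) (U n) (rf n v))"
    by (rule distr_PiM_finite_prob_space') (simp, rule prob_U, rule prob_U, rule m)
  then show ?thesis by (simp only: U_rf[OF v])
qed

text \<open>\<open>chi\<close> and \<open>pj\<close> are equivariant under reflecting the vectors
  together with the point, and the reflected random vectors have the same law.\<close>

lemma LM_rf:
  assumes v: "v \<in> Rn n" and A: "A \<in> sets (rb n)"
  shows "emeasure (LM n i) {x \<in> Rn n. rf n v x \<in> A} = emeasure (LM n i) A"
proof -
  let ?f = "compose {..<i} (rf n v)"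
  let ?F = "\<lambda>\<omega>. emeasure (leb n) (cyl n (map \<omega> [0..<i]) A)"
  have m: "rf n v \<in> U n \<rightarrow>\<^sub>M U n"
    using rf_measurable[OF v measurable_U] by (simp only: measurable_cong_sets[OF refl sets_U])
  have fm: "?f \<in> PP n i \<rightarrow>\<^sub>M PP n i"
    unfolding compose_def
  proof (rule measurable_restrict)
    fix l assume "l \<in> {..<i}"
    then have "(\<lambda>\<omega>. \<omega> l) \<in> PP n i \<rightarrow>\<^sub>M U n" by (rule measurable_component_singleton)
    then show "(\<lambda>\<omega>. rf n v (\<omega> l)) \<in> PP n i \<rightarrow>\<^sub>M U n" by (rule measurable_compose[OF _ m])
  qed
  have Fm: "?F \<in> borel_measurable (PP n i)" by (rule cyl_em_measurable[OF A])
  have "emeasure (LM n i) {x \<in> Rn n. rf n v x \<in> A} = (\<integral>\<^sup>+\<omega>. emeasure (leb n) (cyl n (map \<omega> [0..<i]) {x \<in> Rn n. rf n v x \<in> A}) \<partial>PP n i)"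
    by (rule emeasure_LM[OF rf_pre_sets[OF v A]])
  also have "\<dots> = (\<integral>\<^sup>+\<omega>. ?F (?f \<omega>) \<partial>PP n i)"
  proof (rule nn_integral_cong)
    fix \<omega> assume o: "\<omega> \<in> space (PP n i)"
    note us = us_Rn[OF o]
    let ?us = "map \<omega> [0..<i]"
    have e: "map (?f \<omega>) [0..<i] = map (rf n v) ?us" by (rule nth_equalityI) (auto simp: compose_def)
    have us': "set (map (rf n v) ?us) \<subseteq> Rn n" using us v by (auto simp: rf_Rn)
    have "cyl n ?us {x \<in> Rn n. rf n v x \<in> A} = {x \<in> Rn n. rf n v x \<in> cyl n (map (rf n v) ?us) A}"
      unfolding cyl_def using v us by (auto simp: rf_chi rf_pj rf_Rn pj_Rn simp del: map_map list.map)
    then have "emeasure (leb n) (cyl n ?us {x \<in> Rn n. rf n v x \<in> A}) = emeasure (leb n) (cyl n (map (rf n v) ?us) A)"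
      using leb_rf[OF v cyl_sets[OF us' A]] by simp
    then show "emeasure (leb n) (cyl n ?us {x \<in> Rn n. rf n v x \<in> A}) = ?F (?f \<omega>)" unfolding e .
  qed
  also have "\<dots> = (\<integral>\<^sup>+\<omega>. ?F \<omega> \<partial>distr (PP n i) (PP n i) ?f)"
    by (rule nn_integral_distr[OF fm, symmetric]) (simp only: measurable_distr_eq1 Fm)
  also have "\<dots> = emeasure (LM n i) A" unfolding PP_rf[OF v] by (rule emeasure_LM[OF A, symmetric])
  finally show ?thesis .
qed

section \<open>Caps and shells\<close>

text \<open>A cone: the points whose angle with \<open>y\<close> has cosine above
  \<open>1 - t\<close>. It does not depend on the lengths of \<open>x\<close> and \<open>y\<close>,
  so one set can be compared with shells of all radii.\<close>

definition cap :: "nat \<Rightarrow> vec \<Rightarrow> real \<Rightarrow> vec set" where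
  "cap n y t = {x \<in> Rn n. (1 - t) * (nrm n x * nrm n y) < ip n x y}"

lemma cap_sets: "y \<in> Rn n \<Longrightarrow> cap n y t \<in> sets (rb n)"
  unfolding cap_def
  by (intro Rn_Collect_sets pred_less_real borel_measurable_times borel_measurable_const nrm_measurable ip_measurable id_measurable_rb
      const_measurable_rb)

lemma cap_rf:
  assumes v: "v \<in> Rn n" and y: "y \<in> Rn n" shows "{x \<in> Rn n. rf n v x \<in> cap n y t} = cap n (rf n v y) t"
proof -
  have "ip n (rf n v x) y = ip n x (rf n v y)" for x
    using rf_ip[OF v, of x "rf n v y"] rf_rf[OF v] by simp
  then show ?thesis using v y by (auto simp: cap_def rf_nrm rf_Rn)
qed

lemma cap_scale: "c > 0 \<Longrightarrow> cap n (c *\<^sub>R y) t = cap n y t"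
proof -
  assume c: "c > 0"
  have "(1 - t) * (nrm n x * (c * nrm n y)) < c * ip n x y \<longleftrightarrow> (1 - t) * (nrm n x * nrm n y) < ip n x y" for x
    using mult_less_cancel_left_pos[OF c, of "(1 - t) * (nrm n x * nrm n y)" "ip n x y"] by (simp add: mult_ac)
  then show ?thesis using c by (simp add: cap_def)
qed

text \<open>A reflection carries the direction of \<open>y\<close> to that of \<open>z\<close>, and
  a cap depends only on the direction. \<open>N\<close> is general because both Lebesgue measure and
  \<open>LM\<close> are needed.\<close>

lemma inv_cap_const:
  assumes inv: "\<And>v A. v \<in> Rn n \<Longrightarrow> A \<in> sets (rb n) \<Longrightarrow> emeasure N {x \<in> Rn n. rf n v x \<in> A} = emeasure N A"
    and S: "S \<in> sets (rb n)" "\<And>v. v \<in> Rn n \<Longrightarrow> {x \<in> Rn n. rf n v x \<in> S} = S"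
    and y: "y \<in> Rn n" "y \<noteq> 0" and z: "z \<in> Rn n" "z \<noteq> 0"
  shows "emeasure N (S \<inter> cap n y t) = emeasure N (S \<inter> cap n z t)"
proof -
  let ?z = "(nrm n y / nrm n z) *\<^sub>R z"
  have zp: "nrm n z > 0" "nrm n y > 0" using y z by (auto simp: nrm_pos)
  have zn: "nrm n ?z = nrm n y" "?z \<in> Rn n" using zp z by auto
  let ?v = "y - ?z"
  have v: "?v \<in> Rn n" using y zn by auto
  have r: "rf n ?v y = ?z" by (rule rf_maps) (use y zn in auto)
  have "{x \<in> Rn n. rf n ?v x \<in> S \<inter> cap n y t} = S \<inter> cap n ?z t"
    using S(2)[OF v] cap_rf[OF v y(1), of t] unfolding r by auto
  then have "emeasure N (S \<inter> cap n ?z t) = emeasure N (S \<inter> cap n y t)"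
    using inv[OF v, of "S \<inter> cap n y t"] S(1) cap_sets[OF y(1)] by auto
  moreover have "cap n ?z t = cap n z t" using zp by (intro cap_scale) simp
  ultimately show ?thesis by simp
qed

lemma cb_rf: "v \<in> Rn n \<Longrightarrow> {x \<in> Rn n. rf n v x \<in> cb n r} = cb n r"
  by (auto simp: cb_def rf_nrm rf_Rn)

lemma leb_zero: assumes "n \<ge> 1" shows "emeasure (leb n) {0} = 0"
proof -
  have b: "emeasure (leb n) {0} \<le> ennreal (unit_ball_vol (real n) * r)" if r: "0 < r" "r \<le> 1" for r
  proof -
    have "emeasure (leb n) {0} \<le> emeasure (leb n) (cb n r)"
    proof (rule emeasure_mono)
      show "{0} \<subseteq> cb n r" using r by (simp add: cb_def)
    qed (simp only: sets_leb cb_sets)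
    also have "\<dots> = ennreal (unit_ball_vol (real n) * r ^ n)" using r by (intro emeasure_leb_cb) simp
    also have "\<dots> \<le> ennreal (unit_ball_vol (real n) * r)"
      using r assms power_decreasing[of 1 n r] by (intro ennreal_leI mult_left_mono) auto
    finally show ?thesis .
  qed
  show ?thesis
  proof (rule ccontr)
    assume n0: "emeasure (leb n) {0} \<noteq> 0"
    have fin: "emeasure (leb n) {0} < \<infinity>" using b[of 1] by (auto intro: le_less_trans)
    define m where "m = measure (leb n) {0}"
    have em: "emeasure (leb n) {0} = ennreal m" using fin unfolding m_def by (intro emeasure_eq_ennreal_measure) simp
    have m: "m > 0" using n0 em measure_nonneg[of "leb n" "{0}"] unfolding m_def[symmetric] by (cases "m = 0") auto
    let ?k = "unit_ball_vol (real n)"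
    have k: "?k > 0" by simp
    define r where "r = min 1 (m / (2 * ?k))"
    have r: "0 < r" "r \<le> 1" using m k unfolding r_def by auto
    have "ennreal m \<le> ennreal (?k * r)" using b[OF r] em by simp
    then have "m \<le> ?k * r" using k r by (simp add: ennreal_le_iff del: unit_ball_vol_pos)
    also have "\<dots> \<le> ?k * (m / (2 * ?k))" using k by (intro mult_left_mono) (auto simp: r_def)
    also have "\<dots> = m / 2" using less_imp_neq[OF k] by simp
    finally show False using m by simp
  qed
qed

text \<open>Double counting of the pairs \<open>(x, y)\<close> with \<open>x \<in> S\<close>, \<open>y\<close> in the ball and \<open>x\<close> in the cap around \<open>y\<close>.\<close>

lemma LM_cap:
  assumes n: "n \<ge> 1" and S: "S \<in> sets (rb n)" "\<And>v. v \<in> Rn n \<Longrightarrow> {x \<in> Rn n. rf n v x \<in> S} = S"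
    and S0: "0 \<notin> S" "S \<subseteq> cb n R" "0 \<le> R" and y: "y \<in> Rn n" "y \<noteq> 0"
  shows "emeasure (LM n i) (S \<inter> cap n y t) * emeasure (leb n) (cb n 1) = emeasure (LM n i) S * emeasure (leb n) (cb n 1 \<inter> cap n y t)"
proof -
  define N where "N = density (LM n i) (indicator S)"
  have Nem: "emeasure N A = emeasure (LM n i) (S \<inter> A)" if "A \<in> sets (rb n)" for A
    unfolding N_def using S(1) that by (intro emeasure_restricted) (simp_all only: sets_LM)
  have Ns: "sets N = sets (rb n)" by (simp add: N_def)
  have Nsp: "space N = Rn n" by (simp add: N_def)
  have LMS: "emeasure (LM n i) S < \<infinity>"
  proof -
    have "emeasure (LM n i) S \<le> emeasure (LM n i) (cb n R)"
      by (rule emeasure_mono[OF S0(2)]) (simp only: sets_LM cb_sets)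
    also have "\<dots> < \<infinity>" unfolding LM_cb[OF S0(3)] by simp
    finally show ?thesis .
  qed
  have Nfin: "finite_measure N"
  proof
    show "emeasure N (space N) \<noteq> \<infinity>"
      using Nem[OF Rn_sets_rb] LMS sets.sets_into_space[OF S(1)] unfolding Nsp by (simp add: Int_absorb2)
  qed
  interpret N: finite_measure N by (rule Nfin)
  interpret L: sigma_finite_measure "leb n" by (rule sf_leb)
  interpret pair_sigma_finite N "leb n" ..
  have fm: "fst \<in> N \<Otimes>\<^sub>M leb n \<rightarrow>\<^sub>M rb n"
    using measurable_fst[of N "leb n"] by (simp only: measurable_cong_sets[OF refl Ns])
  let ?T = "{z \<in> space (N \<Otimes>\<^sub>M leb n). (1 - t) * (nrm n (fst z) * nrm n (snd z)) < ip n (fst z) (snd z) \<and> nrm n (snd z) \<le> 1}"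
  have T: "?T \<in> sets (N \<Otimes>\<^sub>M leb n)"
    by (intro sets.sets_Collect borel_measurable_less borel_measurable_le borel_measurable_times borel_measurable_const nrm_measurable
        ip_measurable fm snd_leb)
  have sl1: "Pair x -` ?T = cb n 1 \<inter> cap n x t" if "x \<in> Rn n" for x
    using that by (auto simp: space_pair_measure Nsp cap_def cb_def ip_sym[of n x] mult.commute)
  have sl2: "(\<lambda>x. (x, w)) -` ?T = (if w \<in> cb n 1 then cap n w t else {})" if "w \<in> Rn n" for w
    using that by (auto simp: space_pair_measure Nsp cap_def cb_def)
  have "(\<integral>\<^sup>+x. emeasure (leb n) (Pair x -` ?T) \<partial>N) = (\<integral>\<^sup>+w. emeasure N ((\<lambda>x. (x, w)) -` ?T) \<partial>leb n)"
    using emeasure_pair_measure_alt2[OF T] L.emeasure_pair_measure_alt[OF T] by simp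
  also have "(\<integral>\<^sup>+x. emeasure (leb n) (Pair x -` ?T) \<partial>N) = (\<integral>\<^sup>+x. emeasure (leb n) (cb n 1 \<inter> cap n x t) \<partial>N)"
    by (rule nn_integral_cong) (simp only: Nsp sl1)
  also have "\<dots> = (\<integral>\<^sup>+x. emeasure (leb n) (cb n 1 \<inter> cap n y t) * indicator S x \<partial>N)"
  proof (rule nn_integral_cong_AE)
    have "AE x in N. x \<in> S"
    proof -
      have "(indicator S :: _ \<Rightarrow> ennreal) \<in> borel_measurable (LM n i)"
        using S(1) by (intro borel_measurable_indicator) (simp only: sets_LM)
      then show ?thesis unfolding N_def by (subst AE_density) (auto simp: indicator_def split: if_splits)
    qed
    then show "AE x in N. emeasure (leb n) (cb n 1 \<inter> cap n x t) = emeasure (leb n) (cb n 1 \<inter> cap n y t) * indicator S x"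
    proof (rule AE_mp, intro AE_I2 impI)
      fix x assume x: "x \<in> space N" "x \<in> S"
      then have "x \<noteq> 0" using S0 by auto
      then have "emeasure (leb n) (cb n 1 \<inter> cap n x t) = emeasure (leb n) (cb n 1 \<inter> cap n y t)"
        using x Nsp y by (intro inv_cap_const leb_rf cb_sets cb_rf) auto
      then show "emeasure (leb n) (cb n 1 \<inter> cap n x t) = emeasure (leb n) (cb n 1 \<inter> cap n y t) * indicator S x" using x by simp
    qed
  qed
  also have "\<dots> = emeasure (leb n) (cb n 1 \<inter> cap n y t) * emeasure N S"
    using S(1) by (subst nn_integral_cmult_indicator) (simp_all only: Ns)
  also have "emeasure N S = emeasure (LM n i) S" using Nem[OF S(1)] by simp
  also have "(\<integral>\<^sup>+w. emeasure N ((\<lambda>x. (x, w)) -` ?T) \<partial>leb n) = (\<integral>\<^sup>+w. emeasure (LM n i) (S \<inter> cap n y t) * indicator (cb n 1) w \<partial>leb n)"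
  proof (rule nn_integral_cong_AE)
    have "AE w in leb n. w \<notin> {0}" using leb_zero[OF n]
      by (intro AE_not_in null_setsI) (auto simp only: sets_leb intro!: sets_rb_closed closed_singleton, simp)
    then show "AE w in leb n. emeasure N ((\<lambda>x. (x, w)) -` ?T) = emeasure (LM n i) (S \<inter> cap n y t) * indicator (cb n 1) w"
    proof (rule AE_mp, intro AE_I2 impI)
      fix w assume w: "w \<in> space (leb n)" "w \<notin> {0}"
      then have wn: "w \<in> Rn n" "w \<noteq> 0" by auto
      have "emeasure N (cap n w t) = emeasure (LM n i) (S \<inter> cap n y t)"
        unfolding Nem[OF cap_sets[OF wn(1)]] by (rule inv_cap_const[OF LM_rf S wn y])
      then show "emeasure N ((\<lambda>x. (x, w)) -` ?T) = emeasure (LM n i) (S \<inter> cap n y t) * indicator (cb n 1) w"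
        unfolding sl2[OF wn(1)] by simp
    qed
  qed
  also have "\<dots> = emeasure (LM n i) (S \<inter> cap n y t) * emeasure (leb n) (cb n 1)"
    by (rule nn_integral_cmult_indicator) (simp only: sets_leb cb_sets)
  finally show ?thesis by (simp add: mult.commute)
qed

section \<open>The share of a cap in a ball and in a shell\<close>

lemma sqrt_measurable: "f \<in> borel_measurable M \<Longrightarrow> (\<lambda>x. sqrt (f x)) \<in> borel_measurable M"
  by measurable

text \<open>By Fubini in the last coordinate the slice at height \<open>s\<close> is a ball of
  radius \<open>T * s\<close>, and integrating \<open>s ^ (n - 1)\<close> over the unit interval
  gives \<open>1 / n\<close>.\<close>

lemma cone_volume:
  assumes n: "n \<ge> 2" and T: "T > 0"
  shows "emeasure (leb n) {x \<in> Rn n. 0 < lk x (n - 1) \<and> lk x (n - 1) \<le> 1 \<and> sqrt (\<Sum>i<n-1. (lk x i)\<^sup>2) \<le> T * lk x (n - 1)}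
    = ennreal (unit_ball_vol (real (n - 1)) * T ^ (n - 1) / real n)"
proof -
  let ?m = "n - 1"
  let ?P = "PiM {..<n} (\<lambda>_. lborel :: real measure)"
  let ?Q = "PiM {..<?m} (\<lambda>_. lborel :: real measure)"
  let ?A = "{x \<in> Rn n. 0 < lk x ?m \<and> lk x ?m \<le> 1 \<and> sqrt (\<Sum>i<?m. (lk x i)\<^sup>2) \<le> T * lk x ?m}"
  have A: "?A \<in> sets (rb n)"
    by (intro Rn_Collect_sets pred_intros_logic pred_less_real pred_le_real borel_measurable_times borel_measurable_const
        sqrt_measurable borel_measurable_sum borel_measurable_power lk_measurable_rb)
  have ins: "{..<n} = insert ?m {..<?m}" using n by auto
  let ?B = "emb n -` ?A \<inter> space ?P"
  have B: "?B \<in> sets ?P" by (rule measurable_sets[OF emb_measurable A])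
  have "emeasure (leb n) ?A = (\<integral>\<^sup>+f. indicator ?B f \<partial>?P)"
    unfolding emeasure_leb[OF A] by (rule nn_integral_indicator[OF B, symmetric])
  also have "\<dots> = (\<integral>\<^sup>+s. (\<integral>\<^sup>+f. indicator ?B (f(?m := s)) \<partial>?Q) \<partial>lborel)"
  proof -
    have "(indicator ?B :: _ \<Rightarrow> ennreal) \<in> borel_measurable (PiM (insert ?m {..<?m}) (\<lambda>_. lborel :: real measure))"
      using B unfolding ins by (rule borel_measurable_indicator)
    then have "integral\<^sup>N (PiM (insert ?m {..<?m}) (\<lambda>_. lborel)) (indicator ?B) =
       (\<integral>\<^sup>+s. (\<integral>\<^sup>+f. indicator ?B (f(?m := s)) \<partial>?Q) \<partial>lborel)"
      by (rule lp.product_nn_integral_insert_rev[rotated 2]) simp_all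
    then show ?thesis unfolding ins .
  qed
  also have "\<dots> = (\<integral>\<^sup>+s. ennreal (unit_ball_vol (real ?m) * T ^ ?m * s ^ ?m) * indicator {0..1} s \<partial>lborel)"
  proof (rule nn_integral_cong_AE)
    have "AE s in lborel. s \<noteq> (0::real)" by (rule AE_lborel_singleton)
    then show "AE s in lborel. (\<integral>\<^sup>+f. indicator ?B (f(?m := s)) \<partial>?Q) = ennreal (unit_ball_vol (real ?m) * T ^ ?m * s ^ ?m) * indicator {0..1} s"
    proof (rule AE_mp, intro AE_I2 impI)
      fix s :: real assume s0: "s \<noteq> 0"
      let ?C = "{f. sqrt (\<Sum>i\<in>{..<?m}. (f i)\<^sup>2) \<le> T * s} \<inter> space ?Q"
      have mem: "f(?m := s) \<in> ?B \<longleftrightarrow> 0 < s \<and> s \<le> 1 \<and> sqrt (\<Sum>i<?m. (f i)\<^sup>2) \<le> T * s" if "f \<in> space ?Q" for f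
      proof -
        have "f(?m := s) \<in> space ?P"
          using that n by (auto simp: space_PiM PiE_iff extensional_def)
        moreover have "(\<Sum>i<?m. (lk (emb n (f(?m := s))) i)\<^sup>2) = (\<Sum>i<?m. (f i)\<^sup>2)" by (intro sum.cong) auto
        moreover have "lk (emb n (f(?m := s))) ?m = s" using n by simp
        ultimately show ?thesis by simp
      qed
      show "(\<integral>\<^sup>+f. indicator ?B (f(?m := s)) \<partial>?Q) = ennreal (unit_ball_vol (real ?m) * T ^ ?m * s ^ ?m) * indicator {0..1} s"
      proof (cases "0 < s \<and> s \<le> 1")
        case True
        have Cs: "?C \<in> sets ?Q"
        proof -
          have "(\<lambda>f. sqrt (\<Sum>i\<in>{..<?m}. (f i)\<^sup>2)) \<in> borel_measurable ?Q"
            by (intro sqrt_measurable borel_measurable_sum borel_measurable_power) (auto intro!: measurable_component_singleton)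
          then have "{f \<in> space ?Q. sqrt (\<Sum>i\<in>{..<?m}. (f i)\<^sup>2) \<le> T * s} \<in> sets ?Q"
            by (intro borel_measurable_le borel_measurable_const)
          moreover have "?C = {f \<in> space ?Q. sqrt (\<Sum>i\<in>{..<?m}. (f i)\<^sup>2) \<le> T * s}" by auto
          ultimately show ?thesis by simp
        qed
        have "(\<integral>\<^sup>+f. indicator ?B (f(?m := s)) \<partial>?Q) = (\<integral>\<^sup>+f. indicator ?C f \<partial>?Q)"
          by (rule nn_integral_cong) (use mem True in \<open>auto simp: indicator_def\<close>)
        also have "\<dots> = emeasure ?Q ?C" by (rule nn_integral_indicator[OF Cs])
        also have "\<dots> = ennreal (unit_ball_vol (real (card {..<?m})) * (T * s) ^ card {..<?m})"
          using True T by (intro emeasure_cball_aux) auto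
        finally show ?thesis using True by (simp add: power_mult_distrib mult_ac)
      next
        case False
        have "(\<integral>\<^sup>+f. indicator ?B (f(?m := s)) \<partial>?Q) = (\<integral>\<^sup>+f. 0 \<partial>?Q)"
          by (rule nn_integral_cong) (use mem False in \<open>auto simp: indicator_def\<close>)
        then show ?thesis using False s0 by (auto simp: indicator_def)
      qed
    qed
  qed
  also have "\<dots> = ennreal (unit_ball_vol (real ?m) * T ^ ?m * (1 / real n))"
  proof -
    let ?c = "unit_ball_vol (real ?m) * T ^ ?m"
    have c: "?c \<ge> 0" using T by simp
    have n1: "Suc ?m = n" using n by simp
    have "(\<integral>\<^sup>+s. ennreal (?c * s ^ ?m) * indicator {0..1} s \<partial>lborel) = ennreal (?c * 1 ^ Suc ?m / real (Suc ?m) - ?c * 0 ^ Suc ?m / real (Suc ?m))"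
    proof (rule nn_integral_FTC_Icc[where F="\<lambda>s. ?c * s ^ Suc ?m / real (Suc ?m)"], goal_cases)
      case (2 s)
      have "((\<lambda>s. s ^ Suc ?m) has_real_derivative real (Suc ?m) * s ^ ?m) (at s)"
        using DERIV_pow[of "Suc ?m" s] by (simp only: diff_Suc_Suc diff_zero)
      then have d: "((\<lambda>s. ?c * s ^ Suc ?m / real (Suc ?m)) has_real_derivative ?c * (real (Suc ?m) * s ^ ?m) / real (Suc ?m)) (at s)"
        by (intro DERIV_cdivide DERIV_cmult)
      have e: "?c * (real (Suc ?m) * s ^ ?m) / real (Suc ?m) = ?c * s ^ ?m" by (simp del: of_nat_Suc)
      show ?case using d unfolding e by (auto intro: has_field_derivative_at_within)
    next
      case (3 s)
      then show ?case using c by auto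
    qed auto
    then show ?thesis unfolding n1 using n by (simp add: zero_power)
  qed
  finally show ?thesis by simp
qed

text \<open>With the axis moved to the last coordinate \<open>s\<close> and \<open>q\<close> the
  squared length of the rest, the cap says \<open>(1 - t)^2 * (s^2 + q) < s^2\<close>. Since
  \<open>1 - (1 - t)^2 \<le> 2 * t\<close>, the cap of the ball lies in a cone of height 1 and slope
  \<open>sqrt (2 * t) / (1 - t)\<close>.\<close>

lemma cap_volume:
  assumes n: "n \<ge> 2" and t: "0 < t" "t < 1" and y: "y \<in> Rn n" "y \<noteq> 0"
  shows "emeasure (leb n) (cb n 1 \<inter> cap n y t) \<le> ennreal (unit_ball_vol (real (n - 1)) / real n * (sqrt (2 * t) / (1 - t)) ^ (n - 1))"
proof -
  let ?m = "n - 1"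
  let ?b = "bas ?m"
  have b: "?b \<in> Rn n" "?b \<noteq> 0"
  proof -
    show "?b \<in> Rn n" using n by simp
    then show "?b \<noteq> 0" using nrm_bas[of ?m n] n by auto
  qed
  define T where "T = sqrt (2 * t) / (1 - t)"
  have T: "T > 0" using t by (simp add: T_def)
  have "emeasure (leb n) (cb n 1 \<inter> cap n y t) = emeasure (leb n) (cb n 1 \<inter> cap n ?b t)"
    by (rule inv_cap_const[OF leb_rf cb_sets cb_rf y b])
  also have "\<dots> \<le> emeasure (leb n) {x \<in> Rn n. 0 < lk x ?m \<and> lk x ?m \<le> 1 \<and> sqrt (\<Sum>i<?m. (lk x i)\<^sup>2) \<le> T * lk x ?m}"
  proof (rule emeasure_mono)
    show "cb n 1 \<inter> cap n ?b t \<subseteq> {x \<in> Rn n. 0 < lk x ?m \<and> lk x ?m \<le> 1 \<and> sqrt (\<Sum>i<?m. (lk x i)\<^sup>2) \<le> T * lk x ?m}"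
    proof
      fix x assume x: "x \<in> cb n 1 \<inter> cap n ?b t"
      have ml: "?m < n" using n by simp
      have xs: "x \<in> Rn n" "nrm n x \<le> 1" "(1 - t) * nrm n x < lk x ?m"
        using x nrm_bas[OF ml] ip_bas[OF ml, of x] by (auto simp: cb_def cap_def)
      let ?s = "lk x ?m" and ?q = "\<Sum>i<?m. (lk x i)\<^sup>2"
      have s0: "0 < ?s" using xs(3) t by (meson diff_gt_0_iff_gt le_less_trans less_imp_le mult_nonneg_nonneg nrm_ge0)
      have s1: "?s \<le> 1" using abs_lk_le_nrm[OF ml, of x] xs(2) by simp
      have ins: "{..<n} = insert ?m {..<?m}" using n by auto
      have "(nrm n x)\<^sup>2 = (\<Sum>i<n. (lk x i)\<^sup>2)" unfolding nrm_sq ip_def by (simp only: power2_eq_square)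
      also have "\<dots> = ?s\<^sup>2 + ?q" unfolding ins by (subst sum.insert) auto
      finally have nq: "(nrm n x)\<^sup>2 = ?s\<^sup>2 + ?q" .
      have "((1 - t) * nrm n x)\<^sup>2 \<le> ?s\<^sup>2" using xs(3) t by (intro power_mono) auto
      then have "(1 - t)\<^sup>2 * (?s\<^sup>2 + ?q) \<le> ?s\<^sup>2" by (simp add: power_mult_distrib nq)
      then have "(1 - t)\<^sup>2 * ?q \<le> (1 - (1 - t)\<^sup>2) * ?s\<^sup>2" by (simp add: algebra_simps)
      also have "\<dots> \<le> (2 * t) * ?s\<^sup>2" by (intro mult_right_mono) (auto simp: power2_eq_square algebra_simps)
      finally have "?q \<le> (2 * t) * ?s\<^sup>2 / (1 - t)\<^sup>2" using t by (simp add: pos_le_divide_eq mult.commute)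
      also have "\<dots> = (T * ?s)\<^sup>2" using t by (simp add: T_def power_mult_distrib power_divide)
      finally have "sqrt ?q \<le> T * ?s" using T s0 by (intro real_le_lsqrt) (auto simp: sum_nonneg)
      then show "x \<in> {x \<in> Rn n. 0 < lk x ?m \<and> lk x ?m \<le> 1 \<and> sqrt (\<Sum>i<?m. (lk x i)\<^sup>2) \<le> T * lk x ?m}"
        using xs s0 s1 by simp
    qed
    show "{x \<in> Rn n. 0 < lk x ?m \<and> lk x ?m \<le> 1 \<and> sqrt (\<Sum>i<?m. (lk x i)\<^sup>2) \<le> T * lk x ?m} \<in> sets (leb n)"
      unfolding sets_leb
      by (intro Rn_Collect_sets pred_intros_logic pred_less_real pred_le_real borel_measurable_times borel_measurable_const
        sqrt_measurable borel_measurable_sum borel_measurable_power lk_measurable_rb)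
  qed
  also have "\<dots> = ennreal (unit_ball_vol (real ?m) * T ^ ?m / real n)" by (rule cone_volume[OF n T])
  finally show ?thesis by (simp add: T_def)
qed

text \<open>Volume of a cone of height 1 and slope 1, relative to the ball. A cap of depth
  \<open>t\<close> takes a share of at most \<open>cn n\<close> times a power of its slope.\<close>

definition cn :: "nat \<Rightarrow> real" where
  "cn n = unit_ball_vol (real (n - 1)) / (real n * unit_ball_vol (real n))"

definition shell :: "nat \<Rightarrow> real \<Rightarrow> real \<Rightarrow> vec set" where
  "shell n a b = cb n b - cb n a"

lemma shell_sets: "shell n a b \<in> sets (rb n)" unfolding shell_def by (intro sets.Diff cb_sets)

lemma LM_fin: "A \<subseteq> cb n R \<Longrightarrow> 0 \<le> R \<Longrightarrow> emeasure (LM n i) A \<noteq> \<infinity>"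
proof -
  assume a: "A \<subseteq> cb n R" "0 \<le> R"
  have "emeasure (LM n i) A \<le> emeasure (LM n i) (cb n R)"
    by (rule emeasure_mono[OF a(1)]) (simp only: sets_LM cb_sets)
  also have "\<dots> < \<infinity>" unfolding LM_cb[OF a(2)] by simp
  finally show ?thesis by simp
qed

lemma LM_shell:
  assumes n: "n \<ge> 1" and i: "i \<le> n" and ab: "0 < a" "a \<le> b"
  shows "measure (LM n i) (shell n a b) = Phi n i (cb n 1) * (b ^ (n - i) - a ^ (n - i))"
proof -
  have m: "measure (LM n i) (cb n r) = Phi n i (cb n 1) * r ^ (n - i)" if "r > 0" for r
  proof -
    have p: "0 \<le> Phi n i (cb n r)" using that by (intro Phi_nonneg body_cb) simp
    have "measure (LM n i) (cb n r) = Phi n i (cb n r)"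
      using LM_cb[of r n i] that p by (simp add: measure_def)
    then show ?thesis unfolding Phi_cb_scale[OF n that i] by (simp only: mult.commute)
  qed
  have "measure (LM n i) (shell n a b) = measure (LM n i) (cb n b) - measure (LM n i) (cb n a)"
    unfolding shell_def
  proof (rule measure_Diff)
    show "emeasure (LM n i) (cb n b) \<noteq> \<infinity>" using ab by (intro LM_fin[of _ n b]) auto
    show "cb n a \<subseteq> cb n b" by (rule cb_mono[OF ab(2)])
  qed (simp_all only: sets_LM cb_sets)
  then show ?thesis using ab m[of a] m[of b] by (simp add: right_diff_distrib)
qed

text \<open>Union bound; by \<open>LM_cap\<close> each cap takes the same share of the shell under
  \<open>LM\<close> as of the ball under volume.\<close>

lemma LM_shell_caps:
  assumes n: "n \<ge> 2" and i: "i \<le> n" and ab: "0 < a" "a \<le> b" and t: "0 < t" "t < 1"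
    and V: "finite V" "V \<subseteq> Rn n - {0}"
  shows "Phi n i (cb n 1) * (b ^ (n - i) - a ^ (n - i)) * (1 - real (card V) * (cn n * (sqrt (2 * t) / (1 - t)) ^ (n - 1)))
    \<le> measure (LM n i) (shell n a b - (\<Union>v\<in>V. cap n v t))"
proof -
  have n1: "n \<ge> 1" using n by simp
  let ?S = "shell n a b" and ?q = "cn n * (sqrt (2 * t) / (1 - t)) ^ (n - 1)"
  let ?k = "unit_ball_vol (real n)"
  have kp: "?k > 0" by simp
  have q0: "?q \<ge> 0" using t by (simp add: cn_def)
  have Ssub: "?S \<subseteq> cb n b" by (auto simp: shell_def)
  have S0: "0 \<notin> ?S" using ab by (auto simp: shell_def cb_def)
  have Sinv: "{x \<in> Rn n. rf n v x \<in> ?S} = ?S" if "v \<in> Rn n" for v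
    using cb_rf[OF that, of a] cb_rf[OF that, of b] by (auto simp: shell_def)
  have mS: "emeasure (LM n i) ?S = ennreal (measure (LM n i) ?S)"
    using LM_fin[OF Ssub] ab by (intro emeasure_eq_ennreal_measure) simp
  have capb: "measure (LM n i) (?S \<inter> cap n v t) \<le> measure (LM n i) ?S * ?q" if v: "v \<in> V" for v
  proof -
    have vv: "v \<in> Rn n" "v \<noteq> 0" using V v by auto
    have f: "emeasure (LM n i) (?S \<inter> cap n v t) = ennreal (measure (LM n i) (?S \<inter> cap n v t))"
      using LM_fin[of "?S \<inter> cap n v t" n b i] Ssub ab by (intro emeasure_eq_ennreal_measure) auto
    have "emeasure (LM n i) (?S \<inter> cap n v t) * emeasure (leb n) (cb n 1) = emeasure (LM n i) ?S * emeasure (leb n) (cb n 1 \<inter> cap n v t)"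
      by (rule LM_cap[OF n1 shell_sets Sinv S0 Ssub _ vv]) (use ab in auto)
    also have "\<dots> \<le> emeasure (LM n i) ?S * ennreal (unit_ball_vol (real (n - 1)) / real n * (sqrt (2 * t) / (1 - t)) ^ (n - 1))"
      by (intro mult_left_mono cap_volume[OF n t vv]) simp
    also have "\<dots> = ennreal (measure (LM n i) ?S * (unit_ball_vol (real (n - 1)) / real n * (sqrt (2 * t) / (1 - t)) ^ (n - 1)))"
      unfolding mS by (rule ennreal_mult''[symmetric]) (use t in \<open>auto intro!: mult_nonneg_nonneg\<close>)
    finally have "ennreal (measure (LM n i) (?S \<inter> cap n v t) * ?k) \<le> ennreal (measure (LM n i) ?S * (unit_ball_vol (real (n - 1)) / real n * (sqrt (2 * t) / (1 - t)) ^ (n - 1)))"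
      unfolding f cb1_em by (subst ennreal_mult'') simp_all
    then have "measure (LM n i) (?S \<inter> cap n v t) * ?k \<le> measure (LM n i) ?S * (unit_ball_vol (real (n - 1)) / real n * (sqrt (2 * t) / (1 - t)) ^ (n - 1))"
      using t by (subst (asm) ennreal_le_iff) (auto intro!: mult_nonneg_nonneg)
    also have "\<dots> = measure (LM n i) ?S * ?q * ?k"
      using less_imp_neq[OF kp] by (simp add: cn_def)
    finally show ?thesis using kp by (simp del: unit_ball_vol_pos)
  qed
  let ?U = "\<Union>v\<in>V. ?S \<inter> cap n v t"
  have Us: "?S \<inter> cap n v t \<in> sets (LM n i)" if "v \<in> V" for v
    unfolding sets_LM using V(2) that by (intro sets.Int shell_sets cap_sets) auto
  have UsU: "?U \<in> sets (LM n i)" using V(1) Us by (intro sets.finite_UN) auto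
  have "measure (LM n i) ?U \<le> (\<Sum>v\<in>V. measure (LM n i) (?S \<inter> cap n v t))"
    using LM_fin[of "?S \<inter> cap n _ t" n b i] Ssub ab
    by (intro measure_UNION_le V) (use Us in auto)
  also have "\<dots> \<le> (\<Sum>v\<in>V. measure (LM n i) ?S * ?q)" by (intro sum_mono capb)
  finally have Ule: "measure (LM n i) ?U \<le> real (card V) * (measure (LM n i) ?S * ?q)" by simp
  have "measure (LM n i) (?S - (\<Union>v\<in>V. cap n v t)) = measure (LM n i) (?S - ?U)"
    by (rule arg_cong[where f="measure _"]) auto
  also have "\<dots> = measure (LM n i) ?S - measure (LM n i) ?U"
    using LM_fin[OF Ssub, of i] ab UsU by (intro measure_Diff) (auto simp only: sets_LM shell_sets)
  finally have "measure (LM n i) (?S - (\<Union>v\<in>V. cap n v t)) \<ge> measure (LM n i) ?S - real (card V) * (measure (LM n i) ?S * ?q)"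
    using Ule by simp
  then show ?thesis unfolding LM_shell[OF n1 i ab] by (simp add: algebra_simps)
qed

text \<open>With the squares of \<open>a\<close> and \<open>b\<close> as limits, this bounds the
  integral of \<open>x^(k/2)\<close> from below by the length of the interval times the value at its
  left end.\<close>

lemma pow_diff_ge:
  fixes a b :: real
  assumes "0 \<le> a" "a \<le> b"
  shows "real (k + 2) * (b\<^sup>2 - a\<^sup>2) * a ^ k \<le> 2 * (b ^ (k + 2) - a ^ (k + 2))"
proof (induction k)
  case 0 show ?case by (simp add: power2_eq_square)
next
  case (Suc k)
  have "0 \<le> (b - a) * a ^ k * ((real k + 2) * (a + b) * (b - a) - a * (b - a) + 0)"
  proof -
    have "(real k + 2) * (a + b) * (b - a) - a * (b - a) = (b - a) * ((real k + 1) * a + (real k + 2) * b)"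
      by (simp add: algebra_simps)
    also have "\<dots> \<ge> 0" using assms by (intro mult_nonneg_nonneg add_nonneg_nonneg) auto
    finally show ?thesis using assms by (intro mult_nonneg_nonneg) auto
  qed
  then have 1: "real (Suc k + 2) * (b\<^sup>2 - a\<^sup>2) * a ^ Suc k \<le> b * (real (k + 2) * (b\<^sup>2 - a\<^sup>2) * a ^ k) + 2 * (a ^ (k + 2) * (b - a))"
    by (simp add: algebra_simps power2_eq_square)
  have "b * (real (k + 2) * (b\<^sup>2 - a\<^sup>2) * a ^ k) \<le> b * (2 * (b ^ (k + 2) - a ^ (k + 2)))"
    using Suc assms by (intro mult_left_mono) auto
  also have "b * (2 * (b ^ (k + 2) - a ^ (k + 2))) + 2 * (a ^ (k + 2) * (b - a)) = 2 * (b ^ (Suc k + 2) - a ^ (Suc k + 2))"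
    by (simp add: algebra_simps)
  finally show ?case using 1 by linarith
qed

text \<open>A left Riemann sum of the increasing function \<open>x^(k/2)\<close>, at most its
  integral \<open>2 / (k + 2)\<close>, plus the last term.\<close>

lemma sum_sqrt_pow:
  assumes M: "M \<ge> 1"
  shows "(\<Sum>l=1..M. (sqrt (real l / real M)) ^ k) \<le> real M * (2 / (real k + 2) + 1 / real M)"
proof -
  let ?f = "\<lambda>l. sqrt (real l / real M)"
  have step: "(1 / real M) * ?f l ^ k \<le> (2 / (real k + 2)) * (?f (Suc l) ^ (k + 2) - ?f l ^ (k + 2))" for l
  proof -
    have "real (k + 2) * ((?f (Suc l))\<^sup>2 - (?f l)\<^sup>2) * ?f l ^ k \<le> 2 * (?f (Suc l) ^ (k + 2) - ?f l ^ (k + 2))"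
      by (rule pow_diff_ge) (auto intro: divide_right_mono)
    moreover have "(?f (Suc l))\<^sup>2 - (?f l)\<^sup>2 = 1 / real M" by (simp flip: diff_divide_distrib)
    ultimately have "(real k + 2) * (1 / real M * ?f l ^ k) \<le> 2 * (?f (Suc l) ^ (k + 2) - ?f l ^ (k + 2))"
      by (simp only: of_nat_add of_nat_numeral mult.assoc)
    then have "1 / real M * ?f l ^ k \<le> 2 * (?f (Suc l) ^ (k + 2) - ?f l ^ (k + 2)) / (real k + 2)"
      by (subst pos_le_divide_eq) (auto simp: mult.commute)
    then show ?thesis by simp
  qed
  have tele: "(\<Sum>l<m. (1 / real M) * ?f l ^ k) \<le> (2 / (real k + 2)) * ?f m ^ (k + 2)" for m
  proof (induction m)
    case (Suc m)
    then show ?case using step[of m] by (simp add: right_diff_distrib)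
  qed simp
  have "(\<Sum>l=1..M. (1 / real M) * ?f l ^ k) = (\<Sum>l=1..<M. (1 / real M) * ?f l ^ k) + (1 / real M) * ?f M ^ k"
  proof -
    have "{1..M} = insert M {1..<M}" using M by auto
    then show ?thesis by (simp add: add.commute)
  qed
  also have "(\<Sum>l=1..<M. (1 / real M) * ?f l ^ k) \<le> (\<Sum>l<M. (1 / real M) * ?f l ^ k)"
    by (rule sum_mono2) auto
  also have "\<dots> \<le> (2 / (real k + 2)) * ?f M ^ (k + 2)" by (rule tele)
  also have "?f M = 1" using M by simp
  finally have "(\<Sum>l=1..M. (1 / real M) * ?f l ^ k) \<le> 2 / (real k + 2) + 1 / real M" by simp
  then have "(1 / real M) * (\<Sum>l=1..M. ?f l ^ k) \<le> 2 / (real k + 2) + 1 / real M" by (simp only: sum_distrib_left)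
  then show ?thesis using M by (simp add: field_simps)
qed

text \<open>The bound of \<open>sum_sqrt_pow\<close> for \<open>k = n - 1\<close> and
  \<open>M = 6 * n\<close>: \<open>2 / (n + 1)\<close> from the integral and
  \<open>1 / (6 * n)\<close> from the last term. It bounds the share of the shells that is lost to
  the caps.\<close>

definition yM :: "nat \<Rightarrow> real" where "yM n = 2 / (real n + 1) + 1 / (6 * real n)"

text \<open>At depth \<open>t0 * l / M\<close> the slope is at most \<open>sqrt (l / M)\<close>
  times the slope at \<open>t0\<close>, because \<open>1 - t \<ge> 1 - t0\<close>. If the bounds at
  \<open>t0\<close> add up to at most 1, the caps take at most \<open>sqrt (l / M) ^ (n - 1)\<close>
  of shell \<open>l\<close>.\<close>

lemma shell_sum:
  assumes n: "n \<ge> 2" and t0: "0 < t0" "t0 < 1" and M: "M = 6 * n"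
    and Q: "N * (cn n * (sqrt (2 * t0) / (1 - t0)) ^ (n - 1)) \<le> 1" and N: "0 \<le> N"
    and D: "0 \<le> D" "\<And>l. l \<in> {1..M} \<Longrightarrow> D \<le> d l"
  shows "D * real M * (1 - yM n) \<le> (\<Sum>l=1..M. d l * (1 - N * (cn n * (sqrt (2 * (t0 * real l / real M)) / (1 - t0 * real l / real M)) ^ (n - 1))))"
proof -
  have M1: "M \<ge> 1" using M n by simp
  have cn0: "cn n \<ge> 0" by (simp add: cn_def)
  let ?f = "\<lambda>l. (sqrt (real l / real M)) ^ (n - 1)"
  have b: "N * (cn n * (sqrt (2 * (t0 * real l / real M)) / (1 - t0 * real l / real M)) ^ (n - 1)) \<le> ?f l" if l: "l \<in> {1..M}" for l
  proof -
    have lM: "real l / real M \<le> 1" "0 \<le> real l / real M" using l M1 by auto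
    have tl: "t0 * real l / real M \<le> t0" using mult_left_mono[OF lM(1), of t0] t0 by simp
    have e: "sqrt (2 * (t0 * real l / real M)) = sqrt (2 * t0) * sqrt (real l / real M)"
      by (simp flip: real_sqrt_mult)
    have "sqrt (2 * (t0 * real l / real M)) / (1 - t0 * real l / real M) \<le> sqrt (2 * t0) * sqrt (real l / real M) / (1 - t0)"
      unfolding e using tl t0 lM by (intro divide_left_mono mult_pos_pos mult_nonneg_nonneg) auto
    then have "(sqrt (2 * (t0 * real l / real M)) / (1 - t0 * real l / real M)) ^ (n - 1) \<le> (sqrt (2 * t0) * sqrt (real l / real M) / (1 - t0)) ^ (n - 1)"
      using tl t0 by (intro power_mono) (auto intro!: divide_nonneg_pos)
    also have "\<dots> = (sqrt (2 * t0) / (1 - t0)) ^ (n - 1) * ?f l" by (simp add: power_mult_distrib power_divide)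
    finally have "N * (cn n * (sqrt (2 * (t0 * real l / real M)) / (1 - t0 * real l / real M)) ^ (n - 1)) \<le> N * (cn n * ((sqrt (2 * t0) / (1 - t0)) ^ (n - 1) * ?f l))"
      using N cn0 by (intro mult_left_mono) auto
    also have "\<dots> = N * (cn n * (sqrt (2 * t0) / (1 - t0)) ^ (n - 1)) * ?f l" by (simp add: mult_ac)
    also have "\<dots> \<le> 1 * ?f l" using Q by (intro mult_right_mono) auto
    finally show ?thesis by simp
  qed
  have f1: "?f l \<le> 1" if "l \<in> {1..M}" for l
    using that M1 by (intro power_le_one) auto
  have k2: "real (n - 1) + 2 = real n + 1" using n by simp
  have "D * real M * (1 - yM n) = D * (real M - real M * (2 / (real (n - 1) + 2) + 1 / real M))"
    unfolding yM_def k2 M by (simp add: algebra_simps)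
  also have "\<dots> \<le> D * (real M - (\<Sum>l=1..M. ?f l))"
    using sum_sqrt_pow[OF M1, of "n - 1"] D(1) by (intro mult_left_mono) auto
  also have "\<dots> = (\<Sum>l=1..M. D * (1 - ?f l))" by (simp add: sum_subtractf right_diff_distrib flip: sum_distrib_left)
  also have "\<dots> \<le> (\<Sum>l=1..M. d l * (1 - N * (cn n * (sqrt (2 * (t0 * real l / real M)) / (1 - t0 * real l / real M)) ^ (n - 1))))"
  proof (rule sum_mono)
    fix l assume l: "l \<in> {1..M}"
    show "D * (1 - ?f l) \<le> d l * (1 - N * (cn n * (sqrt (2 * (t0 * real l / real M)) / (1 - t0 * real l / real M)) ^ (n - 1)))"
      using D l b[OF l] f1[OF l] order_trans[OF D(1) D(2)[OF l]] by (intro mult_mono) auto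
  qed
  finally show ?thesis .
qed

section \<open>Lower bounds for the deficit when there are few caps\<close>

lemma pow_diff_lower:
  fixes a b :: real
  assumes "0 \<le> a" "a \<le> b"
  shows "real j * a ^ (j - 1) * (b - a) \<le> b ^ j - a ^ j"
proof (induction j)
  case (Suc j)
  have "real (Suc j) * a ^ j * (b - a) = a * (real j * a ^ (j - 1) * (b - a)) + a ^ j * (b - a)"
    by (cases j) (simp_all add: algebra_simps)
  also have "\<dots> \<le> a * (b ^ j - a ^ j) + a ^ j * (b - a)"
    using Suc assms by (intro add_right_mono mult_left_mono) auto
  also have "\<dots> \<le> b * (b ^ j - a ^ j) + a ^ j * (b - a)"
    using assms by (intro add_right_mono mult_right_mono) (auto intro: power_mono)
  also have "\<dots> = b ^ Suc j - a ^ Suc j" by (simp add: algebra_simps)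
  finally show ?case by simp
qed simp

context
  fixes n j M :: nat and t0 :: real and t :: "nat \<Rightarrow> real"
  assumes n: "n \<ge> 2" and j: "1 \<le> j" "j \<le> n - 1" and t0: "0 < t0" "t0 < 1" and M: "M = 6 * n"
  defines "t \<equiv> \<lambda>l. t0 * real l / real M"
begin

lemma M_pos: "real M > 0" using M n by simp

lemma t_bounds: "l \<in> {1..M} \<Longrightarrow> 0 < t l \<and> t l \<le> t0"
proof -
  assume l: "l \<in> {1..M}"
  have "real l / real M \<le> 1" using l M_pos by simp
  from mult_left_mono[OF this, of t0] show ?thesis using l M_pos t0 by (simp add: t_def)
qed

lemma t_step: "l \<in> {1..M} \<Longrightarrow> t l - t (l - 1) = t0 / real M"
proof -
  assume "l \<in> {1..M}"
  then have "real (l - 1) = real l - 1" by (simp add: of_nat_diff)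
  then show ?thesis by (simp add: t_def algebra_simps flip: diff_divide_distrib)
qed

lemma t_mono: "l \<le> l' \<Longrightarrow> t l \<le> t l'"
  unfolding t_def using t0 M_pos by (intro divide_right_mono mult_left_mono) auto

lemma t_ge0: "0 \<le> t l" using t0 by (simp add: t_def)

text \<open>Relative deficit: homogeneity of degree \<open>j\<close> gives all shells together a
  mass of at least \<open>j * t0\<close>, up to a power of the radius that
  \<open>(1 - t0) ^ n\<close> covers, and the caps leave the share \<open>1 - yM n\<close>.\<close>

abbreviation "gain \<equiv> real j * t0 * (1 - t0) ^ n * (1 - yM n)"

lemma gain_sum:
  assumes V: "finite V" and Q: "real (card V) * (cn n * (sqrt (2 * t0) / (1 - t0)) ^ (n - 1)) \<le> 1"
    and L: "0 \<le> L" and d: "\<And>l. l \<in> {1..M} \<Longrightarrow> L * (real j * (1 - t0) ^ n * (t0 / real M)) \<le> d l"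
    and A: "\<And>l. l \<in> {1..M} \<Longrightarrow> d l * (1 - real (card V) * (cn n * (sqrt (2 * t l) / (1 - t l)) ^ (n - 1))) \<le> measure N (A l)"
    and As: "\<And>l. l \<in> {1..M} \<Longrightarrow> A l \<in> sets N" "disjoint_family_on A {1..M}" "\<And>l. l \<in> {1..M} \<Longrightarrow> emeasure N (A l) \<noteq> \<infinity>"
  shows "L * gain \<le> measure N (\<Union>l\<in>{1..M}. A l)"
proof -
  let ?D = "L * (real j * (1 - t0) ^ n * (t0 / real M))"
  have D: "0 \<le> ?D" using L t0 by (intro mult_nonneg_nonneg) auto
  have "L * gain = ?D * real M * (1 - yM n)" using M_pos by simp
  also have "\<dots> \<le> (\<Sum>l=1..M. d l * (1 - real (card V) * (cn n * (sqrt (2 * (t0 * real l / real M)) / (1 - t0 * real l / real M)) ^ (n - 1))))"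
    by (rule shell_sum[OF n t0 M Q _ D d]) auto
  also have "\<dots> \<le> (\<Sum>l=1..M. measure N (A l))"
    by (rule sum_mono) (use A in \<open>simp add: t_def\<close>)
  also have "\<dots> = measure N (\<Union>l\<in>{1..M}. A l)"
    by (rule measure_finite_Union[symmetric]) (use As in auto)
  finally show ?thesis .
qed

lemma gain_pow: "(1 - t0) ^ n \<le> (1 - t0) ^ (j - 1)"
  using t0 j by (intro power_decreasing) auto

text \<open>Shell \<open>l\<close> is paired with caps of depth \<open>t l\<close>, where
  \<open>1 - t l\<close> is its inner radius. A point \<open>x\<close> of it outside the caps
  satisfies \<open>ip n x s \<le> (1 - t l) * nrm n x < ip n x x\<close> for all generators, hence
  for all of \<open>P\<close>, as \<open>Phi_inscribed\<close> requires.\<close>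

lemma deficit_inscribed:
  assumes S: "finite S" "S \<subseteq> cb n 1" "S \<noteq> {}"
    and Q: "real (card S) * (cn n * (sqrt (2 * t0) / (1 - t0)) ^ (n - 1)) \<le> 1"
  shows "intrinsic_volume n j (unit_ball n) * gain \<le> intrinsic_volume n j (unit_ball n) - intrinsic_volume n j (convex hull S)"
proof -
  let ?i = "n - j"
  have n1: "n \<ge> 1" and jn: "j \<le> n" and i: "?i \<le> n" and nij: "n - ?i = j" using n j by auto
  let ?P = "convex hull S"
  have Pc: "?P \<subseteq> cb n 1" by (intro hull_minimal S(2) convex_cb)
  have P: "body n ?P" unfolding body_def
    using S Pc cb_sub[of n 1] by (auto intro: finite_imp_compact_convex_hull)
  define L where "L = Phi n ?i (cb n 1)"
  have L: "L > 0" unfolding L_def by (rule Phi_cb1_pos[OF n1 i])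
  \<comment> \<open>A generator at the origin has no direction and needs no cap, since
    \<open>ip n 0 x\<close> is below \<open>ip n x x\<close> anyway.\<close>
  let ?V = "S - {0}"
  have V: "finite ?V" "?V \<subseteq> Rn n - {0}" using S cb_sub[of n 1] by auto
  have cn0: "0 \<le> cn n * (sqrt (2 * t0) / (1 - t0)) ^ (n - 1)" using t0 by (simp add: cn_def)
  have QV: "real (card ?V) * (cn n * (sqrt (2 * t0) / (1 - t0)) ^ (n - 1)) \<le> 1"
  proof -
    have "card ?V \<le> card S" using S(1) by (intro card_mono) auto
    then have "real (card ?V) * (cn n * (sqrt (2 * t0) / (1 - t0)) ^ (n - 1)) \<le> real (card S) * (cn n * (sqrt (2 * t0) / (1 - t0)) ^ (n - 1))"
      using cn0 by (intro mult_right_mono) auto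
    then show ?thesis using Q by simp
  qed
  define A where "A l = shell n (1 - t l) (1 - t (l - 1)) - (\<Union>v\<in>?V. cap n v (t l))" for l
  let ?A = "\<Union>l\<in>{1..M}. A l"
  have tl: "0 < t l" "t l \<le> t0" "t l < 1" "0 < 1 - t l" "1 - t l \<le> 1 - t (l - 1)" if "l \<in> {1..M}" for l
    using t_bounds[OF that] t0 t_mono[of "l - 1" l] by auto
  have As: "A l \<in> sets (rb n)" for l
    unfolding A_def using V by (intro sets.Diff shell_sets sets.finite_UN cap_sets) auto
  have Asub: "A l \<subseteq> cb n 1" for l
    using t_ge0[of "l - 1"] by (auto simp: A_def shell_def cb_def)
  have ge: "L * gain \<le> measure (LM n ?i) ?A"
  proof (rule gain_sum[OF V(1) QV, where d="\<lambda>l. L * ((1 - t (l - 1)) ^ j - (1 - t l) ^ j)"])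
    fix l assume l: "l \<in> {1..M}"
    have "real j * (1 - t0) ^ n * (t0 / real M) \<le> real j * (1 - t l) ^ (j - 1) * (t0 / real M)"
    proof (intro mult_right_mono mult_left_mono)
      have "(1 - t0) ^ (j - 1) \<le> (1 - t l) ^ (j - 1)" using tl[OF l] t0 by (intro power_mono) auto
      then show "(1 - t0) ^ n \<le> (1 - t l) ^ (j - 1)" using gain_pow by simp
    qed (use t0 M_pos in auto)
    also have "\<dots> = real j * (1 - t l) ^ (j - 1) * ((1 - t (l - 1)) - (1 - t l))" using t_step[OF l] by simp
    also have "\<dots> \<le> (1 - t (l - 1)) ^ j - (1 - t l) ^ j" using tl[OF l] by (intro pow_diff_lower) auto
    finally show "L * (real j * (1 - t0) ^ n * (t0 / real M)) \<le> L * ((1 - t (l - 1)) ^ j - (1 - t l) ^ j)"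
      using L by (intro mult_left_mono) auto
    show "L * ((1 - t (l - 1)) ^ j - (1 - t l) ^ j) * (1 - real (card ?V) * (cn n * (sqrt (2 * t l) / (1 - t l)) ^ (n - 1))) \<le> measure (LM n ?i) (A l)"
      using LM_shell_caps[OF n i tl(4,5)[OF l] tl(1,3)[OF l] V] unfolding A_def L_def nij .
    show "A l \<in> sets (LM n ?i)" using As by (simp only: sets_LM)
    show "emeasure (LM n ?i) (A l) \<noteq> \<infinity>" by (rule LM_fin[OF Asub]) simp
  next
    show "disjoint_family_on A {1..M}"
      unfolding disjoint_family_on_def
    proof (intro ballI impI)
      have *: "A l \<inter> A l' = {}" if "l < l'" for l l' :: nat
      proof -
        have "t l \<le> t (l' - 1)" using that by (intro t_mono) auto
        then show ?thesis by (auto simp: A_def shell_def cb_def)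
      qed
      fix l l' :: nat assume "l \<noteq> l'"
      then show "A l \<inter> A l' = {}" using *[of l l'] *[of l' l] by (cases "l < l'") auto
    qed
  qed (use L in simp)
  have U: "?A \<in> sets (rb n)" using As by (intro sets.finite_UN) auto
  have hsA: "hs n ?P x < ip n x x" if x: "x \<in> ?A" for x
  proof -
    obtain l where l: "l \<in> {1..M}" "x \<in> A l" using x by auto
    have xs: "x \<in> Rn n" "1 - t l < nrm n x" "nrm n x \<le> 1" using l(2) Asub[of l] by (auto simp: A_def shell_def cb_def)
    have np: "nrm n x > 0" using xs tl[OF l(1)] by simp
    have "ip n s x < ip n x x" if s: "s \<in> S" for s
    proof (cases "s = 0")
      case True then show ?thesis using np by (simp add: ip_self_eq)
    next
      case False
      then have "x \<notin> cap n s (t l)" using l(2) s by (auto simp: A_def)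
      then have "ip n x s \<le> (1 - t l) * (nrm n x * nrm n s)" using xs by (auto simp: cap_def)
      also have "\<dots> \<le> (1 - t l) * (nrm n x * 1)" using S(2) s tl[OF l(1)] by (intro mult_left_mono) (auto simp: cb_def)
      also have "\<dots> < nrm n x * nrm n x" using xs np by simp
      finally show ?thesis by (simp add: ip_self_eq power2_eq_square ip_sym[of n s x])
    qed
    then have "S \<subseteq> {y. ip n y x < ip n x x}" by auto
    moreover have "convex {y. ip n y x < ip n x x}"
    proof (rule convexI)
      fix a b u v assume h: "a \<in> {y. ip n y x < ip n x x}" "b \<in> {y. ip n y x < ip n x x}" "(0::real) \<le> u" "0 \<le> v" "u + v = 1"
      have "u * ip n a x + v * ip n b x < ip n x x"
        by (rule convex_bound_lt) (use h in auto)
      then show "u *\<^sub>R a + v *\<^sub>R b \<in> {y. ip n y x < ip n x x}" by simp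
    qed
    ultimately have sub: "?P \<subseteq> {y. ip n y x < ip n x x}" by (rule hull_minimal)
    obtain k where "k \<in> ?P" "hs n ?P x = ip n k x" using hs_attained[OF P, of x] by metis
    then show ?thesis using sub by auto
  qed
  have UA: "?A \<subseteq> cb n 1" using Asub by blast
  have "ennreal (Phi n ?i ?P) + emeasure (LM n ?i) ?A \<le> emeasure (LM n ?i) (cb n 1)"
    by (rule Phi_inscribed[OF P Pc U UA hsA])
  also have "emeasure (LM n ?i) (cb n 1) = ennreal L" unfolding L_def by (rule LM_cb) simp
  also have "emeasure (LM n ?i) ?A = ennreal (measure (LM n ?i) ?A)"
    using LM_fin[OF UA, of ?i] by (intro emeasure_eq_ennreal_measure) simp
  finally have "ennreal (Phi n ?i ?P + measure (LM n ?i) ?A) \<le> ennreal L"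
    using Phi_nonneg[OF P] by (subst ennreal_plus) auto
  then have "Phi n ?i ?P + measure (LM n ?i) ?A \<le> L" using L by (subst (asm) ennreal_le_iff) auto
  then have "L * gain \<le> L - Phi n ?i ?P" using ge by simp
  then have "gam n ?i * (L * gain) \<le> gam n ?i * (L - Phi n ?i ?P)"
    using gam_pos[OF n1, of ?i] by (intro mult_left_mono) auto
  moreover have "intrinsic_volume n j (unit_ball n) = gam n ?i * L"
    unfolding unit_ball_cb L_def by (rule intrinsic_volume_Phi[OF n1 body_cb jn]) simp
  moreover have "intrinsic_volume n j ?P = gam n ?i * Phi n ?i ?P"
    by (rule intrinsic_volume_Phi[OF n1 P jn])
  ultimately show ?thesis by (simp add: right_diff_distrib mult.assoc)
qed

text \<open>For \<open>x\<close> with norm at most \<open>1 + t l\<close> outside the caps,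
  \<open>ip n x v \<le> (1 - t l) * (1 + t l) \<le> 1\<close>, so \<open>x\<close> satisfies all
  facet inequalities and belongs to \<open>P\<close>.\<close>

lemma deficit_circumscribed:
  assumes P: "body n P" "cb n 1 \<subseteq> P"
    and V: "finite V" "V \<subseteq> cb n 1 - {0}" "\<And>x. x \<in> Rn n \<Longrightarrow> (\<And>v. v \<in> V \<Longrightarrow> ip n x v \<le> 1) \<Longrightarrow> x \<in> P"
    and Q: "real (card V) * (cn n * (sqrt (2 * t0) / (1 - t0)) ^ (n - 1)) \<le> 1"
  shows "intrinsic_volume n j (unit_ball n) * gain \<le> intrinsic_volume n j P - intrinsic_volume n j (unit_ball n)"
proof -
  let ?i = "n - j"
  have n1: "n \<ge> 1" and jn: "j \<le> n" and i: "?i \<le> n" and nij: "n - ?i = j" using n j by auto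
  define L where "L = Phi n ?i (cb n 1)"
  have L: "L > 0" unfolding L_def by (rule Phi_cb1_pos[OF n1 i])
  have V': "V \<subseteq> Rn n - {0}" using V(2) cb_sub[of n 1] by auto
  define A where "A l = shell n (1 + t (l - 1)) (1 + t l) - (\<Union>v\<in>V. cap n v (t l))" for l
  let ?A = "\<Union>l\<in>{1..M}. A l"
  have tl: "0 < t l" "t l \<le> t0" "t l < 1" "0 < 1 + t (l - 1)" "1 + t (l - 1) \<le> 1 + t l" if "l \<in> {1..M}" for l
    using t_bounds[OF that] t0 t_mono[of "l - 1" l] t_ge0[of "l - 1"] by auto
  have As: "A l \<in> sets (rb n)" for l
    unfolding A_def using V V' by (intro sets.Diff shell_sets sets.finite_UN cap_sets) auto
  have Asub: "A l \<subseteq> cb n 2" if "l \<in> {1..M}" for l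
    using tl[OF that] by (auto simp: A_def shell_def cb_def)
  have ge: "L * gain \<le> measure (LM n ?i) ?A"
  proof (rule gain_sum[OF V(1) Q, where d="\<lambda>l. L * ((1 + t l) ^ j - (1 + t (l - 1)) ^ j)"])
    fix l assume l: "l \<in> {1..M}"
    have "real j * (1 - t0) ^ n * (t0 / real M) \<le> real j * (1 + t (l - 1)) ^ (j - 1) * (t0 / real M)"
    proof (intro mult_right_mono mult_left_mono)
      have "(1 - t0) ^ n \<le> 1" using t0 by (intro power_le_one) auto
      also have "1 \<le> (1 + t (l - 1)) ^ (j - 1)" using t_ge0[of "l - 1"] by (intro one_le_power) simp
      finally show "(1 - t0) ^ n \<le> (1 + t (l - 1)) ^ (j - 1)" .
    qed (use t0 M_pos in auto)
    also have "\<dots> = real j * (1 + t (l - 1)) ^ (j - 1) * ((1 + t l) - (1 + t (l - 1)))" using t_step[OF l] by simp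
    also have "\<dots> \<le> (1 + t l) ^ j - (1 + t (l - 1)) ^ j" using tl[OF l] by (intro pow_diff_lower) auto
    finally show "L * (real j * (1 - t0) ^ n * (t0 / real M)) \<le> L * ((1 + t l) ^ j - (1 + t (l - 1)) ^ j)"
      using L by (intro mult_left_mono) auto
    show "L * ((1 + t l) ^ j - (1 + t (l - 1)) ^ j) * (1 - real (card V) * (cn n * (sqrt (2 * t l) / (1 - t l)) ^ (n - 1))) \<le> measure (LM n ?i) (A l)"
      using LM_shell_caps[OF n i tl(4,5)[OF l] tl(1,3)[OF l] V(1) V'] unfolding A_def L_def nij .
    show "A l \<in> sets (LM n ?i)" using As by (simp only: sets_LM)
    show "emeasure (LM n ?i) (A l) \<noteq> \<infinity>" by (rule LM_fin[OF Asub[OF l]]) simp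
  next
    show "disjoint_family_on A {1..M}"
      unfolding disjoint_family_on_def
    proof (intro ballI impI)
      have *: "A l \<inter> A l' = {}" if "l < l'" for l l' :: nat
      proof -
        have "t l \<le> t (l' - 1)" using that by (intro t_mono) auto
        then show ?thesis by (auto simp: A_def shell_def cb_def)
      qed
      fix l l' :: nat assume "l \<noteq> l'"
      then show "A l \<inter> A l' = {}" using *[of l l'] *[of l' l] by (cases "l < l'") auto
    qed
  qed (use L in simp)
  have U: "?A \<in> sets (rb n)" using As by (intro sets.finite_UN) auto
  have UA: "?A \<subseteq> P - cb n 1"
  proof
    fix x assume "x \<in> ?A"
    then obtain l where l: "l \<in> {1..M}" "x \<in> A l" by auto
    have xs: "x \<in> Rn n" "1 + t (l - 1) < nrm n x" "nrm n x \<le> 1 + t l" using l(2) by (auto simp: A_def shell_def cb_def)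
    have "ip n x v \<le> 1" if v: "v \<in> V" for v
    proof -
      have "x \<notin> cap n v (t l)" using l(2) v by (auto simp: A_def)
      then have "ip n x v \<le> (1 - t l) * (nrm n x * nrm n v)" using xs by (auto simp: cap_def)
      also have "\<dots> \<le> (1 - t l) * ((1 + t l) * 1)"
        using V(2) v xs tl[OF l(1)] by (intro mult_left_mono mult_mono) (auto simp: cb_def)
      also have "\<dots> = 1 - (t l)\<^sup>2" by (simp add: algebra_simps power2_eq_square)
      also have "\<dots> \<le> 1" by simp
      finally show ?thesis .
    qed
    then have "x \<in> P" using V(3) xs by blast
    then show "x \<in> P - cb n 1" using xs t_ge0[of "l - 1"] by (auto simp: cb_def)
  qed
  have UA2: "?A \<subseteq> cb n 2" using Asub by blast
  have "emeasure (LM n ?i) (cb n 1) + emeasure (LM n ?i) ?A \<le> ennreal (Phi n ?i P)"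
    by (rule Phi_circumscribed[OF P U UA])
  moreover have "emeasure (LM n ?i) (cb n 1) = ennreal L" unfolding L_def by (rule LM_cb) simp
  moreover have "emeasure (LM n ?i) ?A = ennreal (measure (LM n ?i) ?A)"
    using LM_fin[OF UA2, of ?i] by (intro emeasure_eq_ennreal_measure) simp
  ultimately have "ennreal (L + measure (LM n ?i) ?A) \<le> ennreal (Phi n ?i P)"
    using L by (subst ennreal_plus) auto
  then have "L + measure (LM n ?i) ?A \<le> Phi n ?i P" using Phi_nonneg[OF P(1)] by (subst (asm) ennreal_le_iff) auto
  then have "L * gain \<le> Phi n ?i P - L" using ge by simp
  then have "gam n ?i * (L * gain) \<le> gam n ?i * (Phi n ?i P - L)"
    using gam_pos[OF n1, of ?i] by (intro mult_left_mono) auto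
  moreover have "intrinsic_volume n j (unit_ball n) = gam n ?i * L"
    unfolding unit_ball_cb L_def by (rule intrinsic_volume_Phi[OF n1 body_cb jn]) simp
  moreover have "intrinsic_volume n j P = gam n ?i * Phi n ?i P"
    by (rule intrinsic_volume_Phi[OF n1 P(1) jn])
  ultimately show ?thesis by (simp add: right_diff_distrib mult.assoc)
qed

end

section \<open>From the deficit to the number of caps: constants\<close>

lemma unit_ball_vol_ratio:
  assumes "n \<ge> 2" shows "unit_ball_vol (real (n - 1)) \<le> sqrt (real n) * unit_ball_vol (real n)"
proof -
  \<comment> \<open>\<open>n / 2 + 1\<close> is the midpoint of \<open>x\<close> and
    \<open>x + 1\<close>, so log-convexity of \<open>Gamma\<close> yields
    \<open>Gamma (n / 2 + 1) \<le> sqrt x * Gamma x\<close>, where \<open>Gamma x\<close> belongs to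
    dimension \<open>n - 1\<close>.\<close>
  define x where "x = real n / 2 + 1 / 2"
  have x: "x > 0" by (simp add: x_def add_nonneg_pos)
  have cv: "convex_on {0<..} (ln \<circ> Gamma :: real \<Rightarrow> real)" by (rule log_convex_Gamma_real)
  have "(ln \<circ> Gamma) ((1 - 1/2) *\<^sub>R x + (1/2) *\<^sub>R (x + 1)) \<le> (1 - 1/2) * (ln \<circ> Gamma) x + (1/2) * (ln \<circ> Gamma) (x + 1)"
    by (rule convex_onD[OF cv]) (use x in auto)
  moreover have "(1 - 1/2) *\<^sub>R x + (1/2) *\<^sub>R (x + 1) = real n / 2 + 1" by (simp add: x_def field_simps)
  ultimately have "ln (Gamma (real n / 2 + 1)) \<le> (ln (Gamma x) + ln (Gamma (x + 1))) / 2" by simp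
  moreover have G: "Gamma (x + 1) = x * Gamma x" by (rule Gamma_plus1) (use x nonpos_Ints_nonpos[of x] in auto)
  have Gp: "Gamma x > 0" "Gamma (real n / 2 + 1) > 0" using x by (auto intro!: Gamma_real_pos add_nonneg_pos)
  ultimately have "ln (Gamma (real n / 2 + 1)) \<le> (ln (Gamma x) + ln (x * Gamma x)) / 2" by (simp only: G)
  also have "\<dots> = ln (Gamma x) + ln x / 2"
    using ln_mult[of x "Gamma x"] x Gp by (simp add: field_simps)
  also have "\<dots> = ln (sqrt x * Gamma x)"
    using ln_mult[of "sqrt x" "Gamma x"] x Gp by (simp add: ln_sqrt)
  finally have "ln (Gamma (real n / 2 + 1)) \<le> ln (sqrt x * Gamma x)" .
  then have g: "Gamma (real n / 2 + 1) \<le> sqrt x * Gamma x"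
    using x Gp by (subst (asm) ln_le_cancel_iff) (auto intro!: mult_pos_pos)
  have "1 + real n \<le> 2 * real n" using assms by simp
  have pi1: "pi \<ge> 1" using pi_ge_two by linarith
  have "x / pi \<le> real n"
  proof -
    have "x \<le> real n" using assms by (simp add: x_def)
    also have "\<dots> \<le> real n * pi" using pi1 by (simp add: mult_le_cancel_left1)
    finally show ?thesis by (simp add: field_simps)
  qed
  then have s: "sqrt x \<le> sqrt (real n) * sqrt pi"
    using pi_gt_zero by (simp add: field_simps flip: real_sqrt_mult)
  have e: "real (n - 1) / 2 + 1 = x" using assms by (simp add: x_def field_simps)
  have p: "pi powr (real n / 2) = sqrt pi * pi powr (real (n - 1) / 2)"
    using assms by (simp add: powr_half_sqrt[symmetric] powr_add[symmetric] add_divide_distrib[symmetric] of_nat_diff)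
  have "unit_ball_vol (real (n - 1)) * Gamma (real n / 2 + 1) = pi powr (real (n - 1) / 2) / Gamma x * Gamma (real n / 2 + 1)"
    by (simp only: unit_ball_vol_def e)
  also have "\<dots> \<le> pi powr (real (n - 1) / 2) / Gamma x * (sqrt (real n) * sqrt pi * Gamma x)"
  proof (rule mult_left_mono)
    have "sqrt x * Gamma x \<le> (sqrt (real n) * sqrt pi) * Gamma x" using s Gp by (intro mult_right_mono) auto
    then show "Gamma (real n / 2 + 1) \<le> sqrt (real n) * sqrt pi * Gamma x" using g by linarith
  qed (use Gp in \<open>auto intro!: divide_nonneg_pos\<close>)
  also have "\<dots> = sqrt (real n) * pi powr (real n / 2)" using less_imp_neq[OF Gp(1)] by (simp add: p)
  also have "\<dots> = sqrt (real n) * unit_ball_vol (real n) * Gamma (real n / 2 + 1)"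
    using less_imp_neq[OF Gp(2)] by (simp add: unit_ball_vol_def)
  finally show ?thesis using Gp by simp
qed

text \<open>\<open>cn n\<close> is at most \<open>1 / sqrt n\<close>, while
  \<open>ln n = 2 * ln (sqrt n) \<le> 2 * sqrt n\<close>. This is where the logarithmic factor is
  paid for.\<close>

lemma cn_ln: assumes "n \<ge> 2" shows "cn n * ln (real n) \<le> 2"
proof -
  have k: "unit_ball_vol (real n) > 0" by simp
  have "unit_ball_vol (real (n - 1)) / (real n * unit_ball_vol (real n)) \<le> (sqrt (real n) * unit_ball_vol (real n)) / (real n * unit_ball_vol (real n))"
    by (intro divide_right_mono unit_ball_vol_ratio assms) simp
  also have "\<dots> = sqrt (real n) / real n" using less_imp_neq[OF k] by simp
  also have "\<dots> = 1 / sqrt (real n)" using assms by (simp add: field_simps)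
  finally have c: "cn n \<le> 1 / sqrt (real n)" by (simp add: cn_def)
  have "ln (real n) = 2 * ln (sqrt (real n))" using assms by (simp add: ln_sqrt)
  also have "\<dots> \<le> 2 * sqrt (real n)" using ln_le_minus_one[of "sqrt (real n)"] assms by simp
  finally have "cn n * ln (real n) \<le> 1 / sqrt (real n) * (2 * sqrt (real n))"
    using c assms by (intro mult_mono) (auto simp: cn_def)
  then show ?thesis using assms by simp
qed

lemma yM_bounds:
  assumes "n \<ge> 2" shows "0 < yM n" "yM n \<le> 3/4" "(real n - 1) * yM n \<le> 13 / 6"
proof -
  have n: "real n \<ge> 2" using assms by simp
  show "0 < yM n" unfolding yM_def by (intro add_pos_pos divide_pos_pos) (use n in auto)
  have a: "2 / (real n + 1) \<le> 2 / 3" using n by (simp add: field_simps)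
  have b: "1 / (6 * real n) \<le> 1 / 12" using n by (simp add: field_simps)
  show "yM n \<le> 3/4" using a b by (simp add: yM_def)
  have "(real n - 1) * (2 / (real n + 1)) \<le> 2" using n by (simp add: field_simps)
  moreover have "(real n - 1) * (1 / (6 * real n)) \<le> 1 / 6" using n by (simp add: field_simps)
  ultimately show "(real n - 1) * yM n \<le> 13 / 6" unfolding yM_def distrib_left by linarith
qed

text \<open>\<open>ln lam\<close> is at most \<open>1 / n + 4 * yM n\<close>, and multiplying by
  \<open>(n - 1) / 2\<close> leaves at most \<open>1/2 + 13/3\<close>, which is below 6. This is the
  origin of \<open>exp (- 6)\<close>.\<close>

lemma lam_powr:
  assumes n: "n \<ge> 2" and lam: "lam = (1 + 1 / real n) / (1 - yM n)"
  shows "0 < lam" "lam \<le> 6" "lam powr ((real n - 1) / 2) \<le> exp 6"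
proof -
  note y = yM_bounds[OF n]
  have d: "1 - yM n \<ge> 1/4" using y by simp
  show l0: "0 < lam" unfolding lam using d by (intro divide_pos_pos) (auto simp: add_pos_nonneg)
  have "1 + 1 / real n \<le> 3 / 2" using n by (simp add: field_simps)
  then have "lam \<le> (3/2) / (1/4)" unfolding lam using d by (intro frac_le) auto
  then show "lam \<le> 6" by simp
  have "ln (1 / (1 - yM n)) \<le> 1 / (1 - yM n) - 1" using d by (intro ln_le_minus_one) auto
  also have "\<dots> = yM n / (1 - yM n)" using d by (simp add: field_simps)
  also have "\<dots> \<le> yM n / (1/4)" using d y by (intro divide_left_mono) auto
  finally have b: "- ln (1 - yM n) \<le> 4 * yM n" using d by (simp add: ln_div)
  have a: "ln (1 + 1 / real n) \<le> 1 / real n" by (rule ln_add_one_self_le_self) simp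
  have pn: "1 + 1 / real n > 0" by (simp add: add_pos_nonneg)
  have "ln lam = ln (1 + 1 / real n) - ln (1 - yM n)" unfolding lam using d pn by (simp add: ln_div)
  then have "ln lam \<le> 1 / real n + 4 * yM n" using a b by simp
  then have "(real n - 1) / 2 * ln lam \<le> (real n - 1) / 2 * (1 / real n + 4 * yM n)"
    using n by (intro mult_left_mono) auto
  also have "\<dots> = (real n - 1) / real n / 2 + 2 * ((real n - 1) * yM n)" using n by (simp add: field_simps)
  also have "\<dots> \<le> 1 / 2 + 2 * (13 / 6)" using y n by (intro add_mono mult_left_mono) (auto simp: field_simps)
  finally have "(real n - 1) / 2 * ln lam \<le> 6" by linarith
  then show "lam powr ((real n - 1) / 2) \<le> exp 6" using l0 by (simp add: powr_def)
qed

text \<open>If \<open>N\<close> were smaller, the caps could be taken so deep that the deficit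
  forced by \<open>D\<close> exceeds \<open>\<epsilon>\<close>. The hypothesis on
  \<open>12 * n^2 * \<epsilon>\<close> makes this depth at most \<open>1 / (2 * n^2)\<close>, so
  that powers of \<open>1 - t0\<close> hardly matter.\<close>

lemma count_bound:
  fixes V \<epsilon> N :: real
  assumes n: "n \<ge> 2" and j: "1 \<le> j" and V: "V > 0" and e: "\<epsilon> > 0" "12 * (real n)\<^sup>2 * \<epsilon> \<le> real j * V" and N: "0 \<le> N"
    and D: "\<And>t0. 0 < t0 \<Longrightarrow> t0 < 1 \<Longrightarrow> N * (cn n * (sqrt (2 * t0) / (1 - t0)) ^ (n - 1)) \<le> 1 \<Longrightarrow>
        V * (real j * t0 * (1 - t0) ^ n * (1 - yM n)) \<le> \<epsilon>"
  shows "exp (- 6) / 4 * (real j * V / (2 * \<epsilon>)) powr ((real n - 1) / 2) * ln (real n) \<le> N"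
proof (rule ccontr)
  define X where "X = real j * V / (2 * \<epsilon>)"
  define m where "m = (real n - 1) / 2"
  define lam where "lam = (1 + 1 / real n) / (1 - yM n)"
  \<comment> \<open>That is \<open>lam * \<epsilon> / (j * V)\<close>. The denominator of
    \<open>lam\<close> cancels the loss \<open>1 - yM n\<close>; its numerator leaves the surplus
    \<open>1 + 1/n\<close>, which outweighs
    \<open>(1 - t0) ^ n \<ge> 1 - 1 / (2 * n)\<close>.\<close>
  define t0 where "t0 = lam / (2 * X)"
  assume "\<not> ?thesis"
  then have N1: "N < exp (- 6) / 4 * X powr m * ln (real n)" by (simp add: X_def m_def)
  note l = lam_powr[OF n lam_def]
  have jV: "real j * V > 0" using j V by simp
  have X: "X > 0" unfolding X_def using jV e by simp
  have X6: "6 * (real n)\<^sup>2 \<le> X" unfolding X_def using e by (simp add: field_simps)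
  have t0p: "0 < t0" unfolding t0_def using l X by simp
  have n2: "(real n)\<^sup>2 \<ge> 2 * real n" using n by (simp add: power2_eq_square)
  have "t0 \<le> 6 / (2 * (6 * (real n)\<^sup>2))" unfolding t0_def using l X X6 n by (intro frac_le) auto
  then have t0n: "t0 \<le> 1 / (2 * (real n)\<^sup>2)" by simp
  have t0m: "real n * t0 \<le> 1 / (2 * real n)"
    using mult_left_mono[OF t0n, of "real n"] n by (simp add: power2_eq_square)
  also have "\<dots> \<le> 1 / 4" using n by (simp add: field_simps)
  finally have nt: "real n * t0 \<le> 1 / 4" .
  have "1 * t0 \<le> real n * t0" using n t0p by (intro mult_right_mono) auto
  then have t1: "t0 < 1" using nt by simp
  have bern: "1 - real k * t0 \<le> (1 - t0) ^ k" for k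
    using Bernoulli_inequality[of "- t0" k] t1 by simp
  have "real (n - 1) * t0 \<le> real n * t0" using t0p by (intro mult_right_mono) auto
  then have h: "(1 - t0) ^ (n - 1) \<ge> 1 / 2" using bern[of "n - 1"] nt by linarith
  have sq: "sqrt (2 * t0) ^ (n - 1) = lam powr m / X powr m"
  proof -
    have "2 * t0 = lam / X" unfolding t0_def using X by simp
    then have "sqrt (2 * t0) ^ (n - 1) = sqrt (lam / X) powr real (n - 1)"
      using l X by (subst powr_realpow) auto
    also have "\<dots> = (lam / X) powr (1/2 * real (n - 1))"
      using l X by (subst powr_half_sqrt[symmetric]) (auto simp: powr_powr)
    also have "1/2 * real (n - 1) = m" using n by (simp add: m_def of_nat_diff)
    also have "(lam / X) powr m = lam powr m / X powr m" using l X by (simp add: powr_divide)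
    finally show ?thesis .
  qed
  have cn0: "0 \<le> cn n" by (simp add: cn_def)
  have lnn: "0 \<le> ln (real n)" using n by simp
  have Xm: "X powr m > 0" using X by simp
  \<comment> \<open>The factor \<open>1/4\<close> in the claim pays for
    \<open>(1 - t0) ^ (n - 1) \<ge> 1/2\<close> here and for the constant 2 of \<open>cn_ln\<close>;
    \<open>exp (- 6)\<close> pays for the power of \<open>lam\<close>.\<close>
  have "N * (cn n * (sqrt (2 * t0) / (1 - t0)) ^ (n - 1)) = N * cn n * (lam powr m / X powr m) / (1 - t0) ^ (n - 1)"
    by (simp only: power_divide sq) simp
  also have "\<dots> \<le> N * cn n * (lam powr m / X powr m) / (1 / 2)"
    using h N cn0 Xm by (intro divide_left_mono mult_nonneg_nonneg) auto
  also have "\<dots> \<le> (exp (- 6) / 4 * X powr m * ln (real n)) * cn n * (exp 6 / X powr m) / (1 / 2)"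
    using N1 N cn0 Xm l(3) by (intro divide_right_mono mult_mono mult_right_mono) (auto simp: m_def intro!: mult_nonneg_nonneg lnn)
  also have "\<dots> = cn n * ln (real n) / 2" using Xm by (simp add: exp_minus field_simps)
  also have "\<dots> \<le> 1" using cn_ln[OF n] by simp
  finally have "V * (real j * t0 * (1 - t0) ^ n * (1 - yM n)) \<le> \<epsilon>" by (rule D[OF t0p t1])
  moreover have "V * (real j * t0 * (1 - t0) ^ n * (1 - yM n)) = \<epsilon> * (1 + 1 / real n) * (1 - t0) ^ n"
  proof -
    have "1 - yM n \<noteq> 0" using yM_bounds[OF n] by simp
    then have "lam * (1 - yM n) = 1 + 1 / real n" by (simp add: lam_def)
    moreover have "V * real j * t0 = \<epsilon> * lam" unfolding t0_def X_def using V j e(1) by (simp add: field_simps)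
    ultimately show ?thesis by (metis (no_types, opaque_lifting) mult.assoc mult.commute)
  qed
  ultimately have "\<epsilon> * ((1 + 1 / real n) * (1 - t0) ^ n) \<le> \<epsilon> * 1" by (simp only: mult.assoc mult_1_right)
  then have le1: "(1 + 1 / real n) * (1 - t0) ^ n \<le> 1" using e by (subst (asm) mult_le_cancel_left_pos) auto
  have "1 - 1 / (2 * real n) \<le> (1 - t0) ^ n" using bern[of n] t0m by linarith
  then have "(1 + 1 / real n) * (1 - 1 / (2 * real n)) \<le> (1 + 1 / real n) * (1 - t0) ^ n"
    by (intro mult_left_mono) auto
  moreover have "(1 + 1 / real n) * (1 - 1 / (2 * real n)) = 1 + (real n - 1) / (2 * (real n)\<^sup>2)"
    using n by (simp add: field_simps power2_eq_square)
  moreover have "(real n - 1) / (2 * (real n)\<^sup>2) > 0" using n by (intro divide_pos_pos) auto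
  ultimately show False using le1 by linarith
qed

section \<open>A small deficit forces the origin into the interior\<close>

lemma cap_ball_pos:
  assumes n: "n \<ge> 1" shows "emeasure (leb n) (cb n 1 \<inter> cap n (bas 0) (1/8)) > 0"
proof -
  \<comment> \<open>A ball of radius \<open>1/32\<close> about half a unit vector just fits into the
    cap: \<open>7/8 * (1/2 + 1/32) = 119/256\<close>, while
    \<open>1/2 - 1/32 = 120/256\<close>.\<close>
  let ?b = "bas 0" and ?r = "1/32 :: real" and ?a = "(1/2::real) *\<^sub>R bas 0"
  have b: "?b \<in> Rn n" "nrm n ?b = 1" using n by (auto simp: nrm_def)
  let ?B = "{x \<in> Rn n. x + (- ?a) \<in> cb n ?r}"
  have "?B \<subseteq> cb n 1 \<inter> cap n ?b (1/8)"
  proof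
    fix x assume x: "x \<in> ?B"
    define z where "z = x - ?a"
    have z: "nrm n z \<le> ?r" using x by (simp add: z_def cb_def)
    have xe: "x = ?a + z" by (simp add: z_def)
    have nx: "nrm n x \<le> 1/2 + ?r" using nrm_triangle[of n ?a z] z b by (simp add: xe)
    have "\<bar>ip n z ?b\<bar> \<le> ?r" using ip_cauchy_abs[of n z ?b] z b by simp
    moreover have "ip n x ?b = 1/2 + ip n z ?b" using b by (simp add: xe ip_self_eq)
    ultimately have "ip n x ?b \<ge> 1/2 - ?r" by simp
    then have "(1 - 1/8) * (nrm n x * nrm n ?b) < ip n x ?b" using nx b by simp
    then show "x \<in> cb n 1 \<inter> cap n ?b (1/8)" using x nx by (simp add: cb_def cap_def)
  qed
  then have "emeasure (leb n) ?B \<le> emeasure (leb n) (cb n 1 \<inter> cap n ?b (1/8))"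
    using b by (intro emeasure_mono) (auto simp only: sets_leb intro!: sets.Int cb_sets cap_sets)
  moreover have "emeasure (leb n) ?B = emeasure (leb n) (cb n ?r)"
    using b by (intro leb_translate cb_sets) simp
  moreover have "emeasure (leb n) (cb n ?r) > 0" by (subst emeasure_leb_cb) (auto intro!: mult_pos_pos)
  ultimately show ?thesis by (metis less_le_trans)
qed

text \<open>Suppose \<open>P\<close> lies in the half-space \<open>ip n p w \<le> 0\<close>. A point
  \<open>x\<close> with norm above \<open>1/2\<close> in the cap of depth \<open>1/8\<close> about
  \<open>w\<close> is a positive multiple of \<open>w\<close> plus some \<open>z\<close> with
  \<open>nrm n z \<le> nrm n x / 2\<close>, because \<open>1 - (7/8)^2 < 1/4\<close>. So
  \<open>ip n p x \<le> nrm n x / 2 < ip n x x\<close> on \<open>P\<close>, and the deficit is at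
  least a positive number that depends only on \<open>n\<close> and \<open>j\<close>.\<close>

lemma origin_interior:
  assumes n: "n \<ge> 2" and j: "1 \<le> j" "j \<le> n - 1"
  obtains e0 where "e0 > 0" "\<And>P w. body n P \<Longrightarrow> P \<subseteq> cb n 1 \<Longrightarrow>
    intrinsic_volume n j (unit_ball n) - intrinsic_volume n j P < e0 \<Longrightarrow> w \<in> Rn n \<Longrightarrow> w \<noteq> 0 \<Longrightarrow> \<exists>p\<in>P. ip n p w > 0"
proof -
  let ?i = "n - j"
  have n1: "n \<ge> 1" and jn: "j \<le> n" and i: "?i \<le> n" and nij: "n - ?i = j" using n j by auto
  let ?S = "shell n (1/2) 1" and ?b = "bas 0"
  have b: "?b \<in> Rn n" "?b \<noteq> 0" using n by (auto simp: poly_mapping_eq_iff fun_eq_iff intro!: exI[of _ 0])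
  have Ssub: "?S \<subseteq> cb n 1" by (auto simp: shell_def)
  have S0: "0 \<notin> ?S" by (auto simp: shell_def cb_def)
  have Sinv: "{x \<in> Rn n. rf n v x \<in> ?S} = ?S" if "v \<in> Rn n" for v
    using cb_rf[OF that, of "1/2"] cb_rf[OF that, of 1] by (auto simp: shell_def)
  define L where "L = Phi n ?i (cb n 1)"
  have L: "L > 0" unfolding L_def by (rule Phi_cb1_pos[OF n1 i])
  define k where "k = emeasure (LM n ?i) (?S \<inter> cap n ?b (1/8))"
  have "k * emeasure (leb n) (cb n 1) = emeasure (LM n ?i) ?S * emeasure (leb n) (cb n 1 \<inter> cap n ?b (1/8))"
    unfolding k_def by (rule LM_cap[OF n1 shell_sets Sinv S0 Ssub _ b]) auto
  moreover have "emeasure (LM n ?i) ?S > 0"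
  proof -
    have "measure (LM n ?i) ?S = L * (1 ^ j - (1/2) ^ j)" unfolding L_def using LM_shell[OF n1 i, of "1/2" 1] by (simp add: nij)
    moreover have "(1/2::real) ^ j < 1" using j power_strict_decreasing[of 0 j "1/2::real"] by simp
    ultimately have "measure (LM n ?i) ?S > 0" using L by simp
    then show ?thesis by (metis measure_def enn2real_0 zero_less_iff_neq_zero less_irrefl)
  qed
  ultimately have kp: "k > 0" using cap_ball_pos[OF n1]
    by (metis ennreal_zero_less_mult_iff)
  have kf: "k \<noteq> \<infinity>" unfolding k_def by (rule LM_fin[of _ n 1]) (use Ssub in auto)
  obtain k' where k': "k = ennreal k'" "k' > 0" using kp kf by (cases k) auto
  show ?thesis
  proof (rule that[of "gam n ?i * k'"])
    show "gam n ?i * k' > 0" using gam_pos[OF n1, of ?i] k' by simp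
    fix P w assume P: "body n P" "P \<subseteq> cb n 1"
      and d: "intrinsic_volume n j (unit_ball n) - intrinsic_volume n j P < gam n ?i * k'" and w: "w \<in> Rn n" "w \<noteq> 0"
    show "\<exists>p\<in>P. ip n p w > 0"
    proof (rule ccontr)
      assume "\<not> ?thesis"
      then have neg: "ip n p w \<le> 0" if "p \<in> P" for p using that by (meson not_le)
      let ?A = "?S \<inter> cap n w (1/8)"
      have A: "?A \<in> sets (rb n)" using w by (intro sets.Int shell_sets cap_sets)
      have hsA: "hs n P x < ip n x x" if x: "x \<in> ?A" for x
      proof -
        define u where "u = (1 / nrm n w) *\<^sub>R w"
        have wp: "nrm n w > 0" by (rule nrm_pos[OF w])
        have u: "u \<in> Rn n" "nrm n u = 1" unfolding u_def using w wp by auto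
        have uu: "ip n u u = 1" using u by (simp add: ip_self_eq)
        have x1: "x \<in> Rn n" "1/2 < nrm n x" "nrm n x \<le> 1" using x by (auto simp: shell_def cb_def)
        define c where "c = ip n x u"
        have "(1 - 1/8) * (nrm n x * nrm n w) < ip n x w" using x by (simp add: cap_def)
        then have c: "c > 7/8 * nrm n x" unfolding c_def u_def using wp by (simp add: field_simps)
        have c0: "c > 0" using c x1 by simp
        define z where "z = x - c *\<^sub>R u"
        have "(nrm n z)\<^sup>2 = (nrm n x)\<^sup>2 - c\<^sup>2"
          unfolding nrm_sq z_def using uu by (simp add: ip_sym[of n u x] c_def[symmetric] power2_eq_square)
        moreover have "c\<^sup>2 \<ge> (7/8 * nrm n x)\<^sup>2" using c by (intro power_mono) auto
        then have "49/64 * (nrm n x)\<^sup>2 \<le> c\<^sup>2" by (simp add: power_mult_distrib power_divide)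
        ultimately have "(nrm n z)\<^sup>2 \<le> (nrm n x)\<^sup>2 * (15/64)" by linarith
        also have "\<dots> \<le> (nrm n x / 2)\<^sup>2" by (simp add: power2_eq_square)
        finally have zx: "nrm n z \<le> nrm n x / 2" by (rule power2_le_imp_le) simp
        obtain p where p: "p \<in> P" "hs n P x = ip n p x" using hs_attained[OF P(1), of x] by blast
        have "x = c *\<^sub>R u + z" by (simp add: z_def)
        then have "ip n p x = ip n p (c *\<^sub>R u + z)" by (rule arg_cong)
        then have "ip n p x = c * ip n p u + ip n p z" by simp
        moreover have "ip n p u \<le> 0" unfolding u_def using neg[OF p(1)] wp by (simp add: field_simps)
        moreover have "ip n p z \<le> nrm n p * nrm n z" by (rule ip_cauchy)
        moreover have "nrm n p * nrm n z \<le> 1 * nrm n z" using p P(2) by (intro mult_right_mono) (auto simp: cb_def)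
        ultimately have "ip n p x \<le> nrm n x / 2" using zx c0 mult_nonneg_nonpos[of c "ip n p u"] by linarith
        also have "\<dots> < nrm n x * nrm n x" using x1 by simp
        finally show ?thesis using p by (simp add: ip_self_eq power2_eq_square)
      qed
      have "ennreal (Phi n ?i P) + emeasure (LM n ?i) ?A \<le> emeasure (LM n ?i) (cb n 1)"
        by (rule Phi_inscribed[OF P A _ hsA]) (use Ssub in auto)
      also have "emeasure (LM n ?i) (cb n 1) = ennreal L" unfolding L_def by (rule LM_cb) simp
      also have "emeasure (LM n ?i) ?A = ennreal k'" unfolding k'(1)[symmetric] k_def
        by (rule inv_cap_const[OF LM_rf shell_sets Sinv w b])
      finally have "ennreal (Phi n ?i P + k') \<le> ennreal L"
        using Phi_nonneg[OF P(1)] k' by (subst ennreal_plus) auto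
      then have "k' \<le> L - Phi n ?i P" using L by (subst (asm) ennreal_le_iff) auto
      then have "gam n ?i * k' \<le> gam n ?i * (L - Phi n ?i P)"
        using gam_pos[OF n1, of ?i] by (intro mult_left_mono) auto
      moreover have "intrinsic_volume n j (unit_ball n) = gam n ?i * L"
        unfolding unit_ball_cb L_def by (rule intrinsic_volume_Phi[OF n1 body_cb jn]) simp
      moreover have "intrinsic_volume n j P = gam n ?i * Phi n ?i P"
        by (rule intrinsic_volume_Phi[OF n1 P(1) jn])
      ultimately show False using d by (simp add: right_diff_distrib)
    qed
  qed
qed

section \<open>Orthogonality and spanning sets in \<open>Rn n\<close>\<close>

lemma ip_span_0: "x \<in> span B \<Longrightarrow> (\<And>b. b \<in> B \<Longrightarrow> ip n b w = 0) \<Longrightarrow> ip n x w = 0"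
proof -
  assume x: "x \<in> span B" and b: "\<And>b. b \<in> B \<Longrightarrow> ip n b w = 0"
  have "subspace {x. ip n x w = 0}" by (simp add: subspace_def)
  then have "span B \<subseteq> {x. ip n x w = 0}" using b by (intro span_minimal) auto
  then show ?thesis using x by auto
qed

lemma span_Rn: "B \<subseteq> Rn n \<Longrightarrow> span B \<subseteq> Rn n"
  by (intro span_minimal) auto

text \<open>Gram-Schmidt: a new vector \<open>b\<close> is first made orthogonal to the span of
  \<open>B\<close>, and the projection is corrected along the result \<open>e\<close>.\<close>

lemma orth_proj_ex:
  "finite B \<Longrightarrow> B \<subseteq> Rn n \<Longrightarrow> \<forall>y\<in>Rn n. \<exists>v\<in>span B. \<forall>b\<in>B. ip n b (y - v) = 0"
proof (induction B rule: finite_induct)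
  case empty
  show ?case by (auto intro: span_zero)
next
  case (insert b B)
  have B: "B \<subseteq> Rn n" and b: "b \<in> Rn n" using insert.prems by auto
  note IH = insert.IH[OF B]
  show ?case
  proof
    fix y assume y: "y \<in> Rn n"
    obtain p where p: "p \<in> span B" "\<And>c. c \<in> B \<Longrightarrow> ip n c (b - p) = 0" using IH b by blast
    obtain v where v: "v \<in> span B" "\<And>c. c \<in> B \<Longrightarrow> ip n c (y - v) = 0" using IH y by blast
    have mono: "span B \<subseteq> span (insert b B)" by (intro span_mono) auto
    show "\<exists>v\<in>span (insert b B). \<forall>c\<in>insert b B. ip n c (y - v) = 0"
    proof (cases "b - p = 0")
      case True
      then have "ip n b (y - v) = 0" using ip_span_0[OF p(1), of n "y - v"] v(2) by simp
      then show ?thesis using v mono by blast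
    next
      case False
      define e where "e = b - p"
      have eR: "e \<in> Rn n" unfolding e_def using b p span_Rn[OF B] by blast
      have ee: "ip n e e > 0" using ip_self_pos[OF eR] False by (simp add: e_def)
      define r where "r = ip n e (y - v) / ip n e e"
      define v' where "v' = v + r *\<^sub>R e"
      have d: "y - v' = (y - v) - r *\<^sub>R e" by (simp add: v'_def)
      have c0: "ip n c (y - v') = 0" if "c \<in> B" for c
        unfolding d ip_diff_right[of n c "y - v"] ip_scale_right v(2)[OF that] p(2)[OF that, folded e_def] by simp
      have e0: "ip n e (y - v') = 0" unfolding d ip_diff_right[of n e "y - v"] ip_scale_right r_def using ee by simp
      have "ip n (e + p) (y - v') = 0" unfolding ip_add_left using e0 ip_span_0[OF p(1), of n "y - v'"] c0 by simp
      then have b0: "ip n b (y - v') = 0" by (simp add: e_def)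
      have "e \<in> span (insert b B)" unfolding e_def using p mono by (intro span_diff) (auto intro: span_base)
      then have "v' \<in> span (insert b B)" unfolding v'_def using v mono by (intro span_add span_scale) auto
      then show ?thesis using c0 b0 by blast
    qed
  qed
qed

section \<open>Edges and facets\<close>

text \<open>Spanning, expressed by a trivial orthogonal complement: the failure supplies a direction
  \<open>w\<close> in which a point of the polar body can be moved.\<close>

definition total :: "nat \<Rightarrow> vec set \<Rightarrow> bool" where
  "total n T \<longleftrightarrow> (\<forall>w\<in>Rn n. (\<forall>s\<in>T. ip n s w = 0) \<longrightarrow> w = 0)"

lemma total_spans:
  assumes "finite T" "T \<subseteq> Rn n" "total n T" shows "Rn n \<subseteq> span T"
proof
  fix y assume y: "y \<in> Rn n"
  obtain v where v: "v \<in> span T" "\<forall>b\<in>T. ip n b (y - v) = 0" using orth_proj_ex[OF assms(1,2)] y by blast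
  have "y - v \<in> Rn n" using y v span_Rn[OF assms(2)] by blast
  then have "y - v = 0" using assms(3) v unfolding total_def by blast
  then show "y \<in> span T" using v by simp
qed

lemma bas_inj: "inj bas" by (rule injI) (metis lk_bas zero_neq_one)

lemma bas_basis: "independent (bas ` {..<n})" "Rn n \<subseteq> span (bas ` {..<n})" "card (bas ` {..<n}) = n"
proof -
  have inj: "inj_on bas {..<n}" using bas_inj by (rule inj_on_subset) simp
  show "card (bas ` {..<n}) = n" using card_image[OF inj] by simp
  show "Rn n \<subseteq> span (bas ` {..<n})"
  proof
    fix x assume "x \<in> Rn n"
    then have "x = (\<Sum>i<n. lk x i *\<^sub>R bas i)" using emb_lk[of x n] by (simp add: emb_def)
    also have "\<dots> \<in> span (bas ` {..<n})" by (intro span_sum span_scale span_base) auto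
    finally show "x \<in> span (bas ` {..<n})" .
  qed
  show "independent (bas ` {..<n})"
  proof (rule independent_if_scalars_zero)
    fix f x assume s: "(\<Sum>x\<in>bas ` {..<n}. f x *\<^sub>R x) = 0" and "x \<in> bas ` {..<n}"
    then obtain i where i: "i < n" "x = bas i" by auto
    have "(\<Sum>i<n. f (bas i) *\<^sub>R bas i) = 0" using s by (simp add: sum.reindex[OF inj])
    then have "lk (emb n (\<lambda>i. f (bas i))) i = 0" by (simp only: emb_def lookup_zero)
    then show "f x = 0" using i by simp
  qed simp
qed

lemma independent_card_le: "independent B \<Longrightarrow> B \<subseteq> Rn n \<Longrightarrow> finite B \<and> card B \<le> n"
  using independent_span_bound[of "bas ` {..<n}" B] bas_basis[of n] by auto

lemma basis_card: "independent B \<Longrightarrow> B \<subseteq> Rn n \<Longrightarrow> Rn n \<subseteq> span B \<Longrightarrow> card B = n"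
  using independent_span_bound[of B "bas ` {..<n}"] bas_basis[of n] independent_card_le[of B n]
  by (metis antisym bas_Rn image_subsetI lessThan_iff subset_trans)

lemma total_card:
  assumes "finite T" "T \<subseteq> Rn n" "total n T" shows "n \<le> card T"
  using independent_span_bound[OF assms(1) bas_basis(1)[of n]] total_spans[OF assms] bas_basis(3)[of n]
  by (metis bas_Rn image_subsetI lessThan_iff subset_trans)

lemma has_aff_dim_hull_indep: "\<not> affine_dependent C \<Longrightarrow> card C = k + 1 \<Longrightarrow> has_aff_dim (convex hull C) k"
  unfolding has_aff_dim_def by (intro exI[of _ C]) (simp add: affine_hull_convex_hull)

text \<open>On a hyperplane \<open>ip n x a = 1\<close> every linear combination has coefficients
  with sum 1. Affine dimensions of faces thereby become sizes of linearly independent sets, shifted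
  by one.\<close>

lemma mem_affine_hull_of_span:
  assumes B: "finite B" and x: "x \<in> span B" "ip n x a = 1" and h: "\<And>b. b \<in> B \<Longrightarrow> ip n b a = 1"
  shows "x \<in> affine hull B"
proof -
  obtain u where u: "x = (\<Sum>v\<in>B. u v *\<^sub>R v)" using x(1) span_finite[OF B] by auto
  have "ip n x a = (\<Sum>v\<in>B. u v * ip n v a)" unfolding u ip_sum_left by simp
  also have "\<dots> = sum u B" using h by (intro sum.cong) auto
  finally show ?thesis using u x affine_hull_finite[OF B] by auto
qed

lemma has_aff_dim_hyperplane:
  assumes B: "finite B" "B \<subseteq> G" "independent B" "card B = k + 1" and G: "G \<subseteq> span B" "\<And>g. g \<in> G \<Longrightarrow> ip n g a = 1"
  shows "has_aff_dim (convex hull G) k"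
  unfolding has_aff_dim_def
proof (intro exI conjI)
  show "affine hull B = affine hull (convex hull G)"
    unfolding affine_hull_convex_hull
  proof
    show "affine hull B \<subseteq> affine hull G" by (rule hull_mono[OF B(2)])
    have "G \<subseteq> affine hull B" using G B by (auto intro!: mem_affine_hull_of_span[where n=n and a=a])
    then show "affine hull G \<subseteq> affine hull B" by (intro hull_minimal) auto
  qed
  show "\<not> affine_dependent B" using affine_dependent_imp_dependent B(3) by blast
qed (rule B(4))

text \<open>Finitely many hyperplanes do not cover the space: \<open>u\<close> is corrected along
  the new \<open>d\<close> by an amount that avoids finitely many values.\<close>

lemma generic_vector:
  assumes "finite D" "D \<subseteq> Rn n - {0}"
  obtains u where "u \<in> Rn n" "\<And>d. d \<in> D \<Longrightarrow> ip n d u \<noteq> 0"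
proof -
  have "\<exists>u\<in>Rn n. \<forall>d\<in>D. ip n d u \<noteq> 0" using assms
  proof (induction D rule: finite_induct)
    case empty then show ?case by (auto intro: bexI[of _ 0])
  next
    case (insert d D)
    then obtain u where u: "u \<in> Rn n" "\<And>e. e \<in> D \<Longrightarrow> ip n e u \<noteq> 0" by auto
    have d: "d \<in> Rn n" "d \<noteq> 0" using insert.prems by auto
    show ?case
    proof (cases "ip n d u = 0")
      case True
      let ?bad = "insert 0 ((\<lambda>e. - ip n e u / ip n e d) ` D)"
      have "finite ?bad" using insert.hyps by simp
      then obtain r :: real where r: "r \<notin> ?bad" using ex_new_if_finite[OF infinite_UNIV_char_0] by blast
      have "ip n e (u + r *\<^sub>R d) \<noteq> 0" if e: "e \<in> insert d D" for e
      proof (cases "e = d")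
        case True
        then show ?thesis using \<open>ip n d u = 0\<close> r ip_self_pos[OF d] by simp
      next
        case False
        then have eD: "e \<in> D" using e by simp
        show ?thesis
        proof (cases "ip n e d = 0")
          case True then show ?thesis using u(2)[OF eD] by simp
        next
          case False
          have "r \<noteq> - ip n e u / ip n e d" using r eD by blast
          then show ?thesis using False by (simp add: field_simps eq_neg_iff_add_eq_0 add.commute)
        qed
      qed
      moreover have "u + r *\<^sub>R d \<in> Rn n" using u d by simp
      ultimately show ?thesis by blast
    qed (use u in auto)
  qed
  then show thesis using that by blast
qed

definition exposed :: "nat \<Rightarrow> vec set \<Rightarrow> bool" where
  "exposed n A \<longleftrightarrow> (\<forall>a\<in>A. \<exists>x\<in>Rn n. \<forall>b\<in>A - {a}. ip n b x < ip n a x)"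

text \<open>Kept as pairs of points so that it serves both the vertices of the polytope and the
  facet normals, whose edges correspond to ridges.\<close>

definition edges :: "nat \<Rightarrow> vec set \<Rightarrow> vec set set" where
  "edges n A = {{a, a'} | a a'. a \<in> A \<and> a' \<in> A \<and> a \<noteq> a' \<and>
     (\<exists>x\<in>Rn n. ip n a' x = ip n a x \<and> (\<forall>b\<in>A - {a, a'}. ip n b x < ip n a x))}"

text \<open>The middle one of three collinear points is never the strict maximiser of a linear
  function; the cases tell which one is in the middle.\<close>

lemma exposed_not_collinear:
  assumes E: "exposed n A" and abc: "a \<in> A" "b \<in> A" "c \<in> A" "a \<noteq> b" "b \<noteq> c" "a \<noteq> c" and r: "c - a = r *\<^sub>R (b - a)"
  shows False
proof -
  have i: "ip n c x - ip n a x = r * (ip n b x - ip n a x)" for x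
  proof -
    have "ip n (c - a) x = ip n (r *\<^sub>R (b - a)) x" by (simp only: r)
    then show ?thesis by simp
  qed
  have ex: "\<exists>x. \<forall>b\<in>A - {a}. ip n b x < ip n a x" if "a \<in> A" for a using E that unfolding exposed_def by blast
  have "r \<noteq> 0" "r \<noteq> 1" using r abc by auto
  then consider "r < 0" | "0 < r" "r < 1" | "r > 1" by linarith
  then show False
  proof cases
    case 1
    obtain x where "ip n b x < ip n a x" "ip n c x < ip n a x" using ex[OF abc(1)] abc by auto
    then show False using i[of x] mult_neg_neg[OF 1, of "ip n b x - ip n a x"] by linarith
  next
    case 2
    obtain x where x: "ip n b x < ip n c x" "ip n a x < ip n c x" using ex[OF abc(3)] abc by auto
    have "r * ip n b x < r * ip n c x" "(1 - r) * ip n a x < (1 - r) * ip n c x" using 2 x by simp_all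
    then show False using i[of x] by (simp add: algebra_simps)
  next
    case 3
    obtain x where x: "ip n a x < ip n b x" "ip n c x < ip n b x" using ex[OF abc(2)] abc by auto
    have "ip n b x - ip n a x < ip n c x - ip n a x"
      unfolding i using mult_strict_right_mono[OF 3, of "ip n b x - ip n a x"] x(1) by simp
    then show False using x(2) by simp
  qed
qed

text \<open>A vertex figure: the differences \<open>b - a\<close> are scaled to points
  \<open>d b\<close> of the hyperplane where \<open>x\<close> takes the value -1. They are distinct,
  as no three points are collinear, so a generic \<open>y\<close> has a unique maximiser
  \<open>a'\<close> there, with value \<open>\<rho>\<close>. Then
  \<open>y + \<rho> *\<^sub>R x\<close> is maximal exactly at \<open>a\<close> and
  \<open>a'\<close>.\<close>

lemma edge_partner:
  assumes A: "finite A" "A \<subseteq> Rn n" and E: "exposed n A" and a: "a \<in> A" "A - {a} \<noteq> {}"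
  shows "\<exists>a'. {a, a'} \<in> edges n A"
proof -
  obtain x where x: "x \<in> Rn n" "\<And>b. b \<in> A - {a} \<Longrightarrow> ip n b x < ip n a x" using E a unfolding exposed_def by blast
  define g where "g b = ip n a x - ip n b x" for b
  have g: "g b > 0" if "b \<in> A - {a}" for b using x(2)[OF that] by (simp add: g_def)
  define d where "d b = (1 / g b) *\<^sub>R (b - a)" for b
  have dne: "d b \<noteq> d c" if "b \<in> A - {a}" "c \<in> A - {a}" "b \<noteq> c" for b c
  proof
    assume "d b = d c"
    then have "g c *\<^sub>R d b = g c *\<^sub>R d c" by simp
    then have "c - a = (g c / g b) *\<^sub>R (b - a)" using g[OF that(1)] g[OF that(2)] by (simp add: d_def)
    then show False using exposed_not_collinear[OF E a(1), of b c] that by auto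
  qed
  let ?D = "(\<lambda>(b, c). d b - d c) ` {(b, c). b \<in> A - {a} \<and> c \<in> A - {a} \<and> b \<noteq> c}"
  have dR: "d b \<in> Rn n" if "b \<in> A" for b unfolding d_def using that A a by blast
  have "finite ?D"
    by (rule finite_imageI, rule finite_subset[of _ "A \<times> A"]) (use A in auto)
  moreover have "?D \<subseteq> Rn n - {0}"
  proof
    fix z assume "z \<in> ?D"
    then obtain q where q: "z = (\<lambda>(b, c). d b - d c) q" "q \<in> {(b, c). b \<in> A - {a} \<and> c \<in> A - {a} \<and> b \<noteq> c}" by (rule imageE)
    obtain b c where qq: "q = (b, c)" by (cases q)
    have bc: "b \<in> A - {a}" "c \<in> A - {a}" "b \<noteq> c" and z: "z = d b - d c" using q unfolding qq by auto
    have "z \<in> Rn n" unfolding z using bc dR by (intro Rn_diff) auto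
    moreover have "z \<noteq> 0" unfolding z using dne[OF bc] by simp
    ultimately show "z \<in> Rn n - {0}" by simp
  qed
  ultimately obtain y where y: "y \<in> Rn n" "\<And>z. z \<in> ?D \<Longrightarrow> ip n z y \<noteq> 0" by (rule generic_vector) blast
  have yne: "ip n (d b) y \<noteq> ip n (d c) y" if "b \<in> A - {a}" "c \<in> A - {a}" "b \<noteq> c" for b c
  proof -
    have "d b - d c \<in> ?D" by (rule image_eqI[of _ _ "(b, c)"]) (use that in auto)
    then show ?thesis using y(2)[of "d b - d c"] by simp
  qed
  let ?F = "(\<lambda>b. ip n (d b) y) ` (A - {a})"
  have F: "finite ?F" "?F \<noteq> {}" using A a by auto
  from Max_in[OF F] obtain a' where "Max ?F = ip n (d a') y" "a' \<in> A - {a}" by (rule imageE)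
  then have a': "a' \<in> A - {a}" "ip n (d a') y = Max ?F" by simp_all
  define \<rho> where "\<rho> = ip n (d a') y"
  have lt: "ip n (d b) y < \<rho>" if b: "b \<in> A - {a, a'}" for b
  proof -
    have "ip n (d b) y \<le> \<rho>" unfolding \<rho>_def a'(2) using F b by (intro Max_ge) auto
    moreover have "ip n (d b) y \<noteq> \<rho>" unfolding \<rho>_def using yne[of b a'] a' b by auto
    ultimately show ?thesis by simp
  qed
  define x' where "x' = y + \<rho> *\<^sub>R x"
  have val: "ip n b x' = ip n a x' + g b * (ip n (d b) y - \<rho>)" if "b \<in> A - {a}" for b
  proof -
    have "g b * ip n (d b) y = ip n b y - ip n a y" using g[OF that] by (simp add: d_def)
    then show ?thesis by (simp add: x'_def right_diff_distrib) (simp add: g_def algebra_simps)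
  qed
  have "ip n a' x' = ip n a x'" using val[OF a'(1)] by (simp add: \<rho>_def)
  moreover have "ip n b x' < ip n a x'" if b: "b \<in> A - {a, a'}" for b
  proof -
    have "g b * (ip n (d b) y - \<rho>) < 0" using g[of b] lt[OF b] b by (intro mult_pos_neg) auto
    then show ?thesis using val[of b] b by auto
  qed
  moreover have "x' \<in> Rn n" unfolding x'_def using x y by simp
  ultimately have "{a, a'} \<in> edges n A" unfolding edges_def using a a' by blast
  then show ?thesis ..
qed

lemma card_edges:
  assumes A: "finite A" "A \<subseteq> Rn n" and E: "exposed n A" and c: "card A \<ge> 2"
  shows "card A \<le> 2 * card (edges n A)"
proof -
  have sub: "edges n A \<subseteq> Pow A" by (auto simp: edges_def)
  have fin: "finite (edges n A)" using sub A(1) by (meson finite_Pow_iff finite_subset)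
  have "A \<subseteq> \<Union> (edges n A)"
  proof
    fix a assume a: "a \<in> A"
    have "A - {a} \<noteq> {}" using c a A(1) card_mono[of "{a}" A] by auto
    then show "a \<in> \<Union> (edges n A)" using edge_partner[OF A E a] by blast
  qed
  then have "A = \<Union> (edges n A)" using sub by blast
  then have "card A = card (\<Union> (edges n A))" by (rule arg_cong)
  also have "\<dots> \<le> sum card (edges n A)" by (rule card_Union_le_sum_card)
  also have "\<dots> = (\<Sum>e\<in>edges n A. 2)" by (intro sum.cong) (auto simp: edges_def)
  finally show ?thesis by simp
qed

section \<open>Faces and vertices of the convex hull of a finite set\<close>

lemma face_of_hull_eq:
  fixes S :: "'a::real_vector set"
  assumes S: "finite S" and F: "F face_of convex hull S"
  shows "F = convex hull (S \<inter> F)"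
proof
  have cF: "convex F" using F face_of_imp_convex by blast
  show "convex hull (S \<inter> F) \<subseteq> F" by (rule hull_minimal) (use cF in auto)
  show "F \<subseteq> convex hull (S \<inter> F)"
  proof
    fix x assume x: "x \<in> F"
    then have "x \<in> convex hull S" using F face_of_imp_subset by blast
    then obtain u where u: "\<And>s. s \<in> S \<Longrightarrow> 0 \<le> u s" "sum u S = 1" "(\<Sum>s\<in>S. u s *\<^sub>R s) = x"
      using convex_hull_finite[OF S] by auto
    \<comment> \<open>With positive weight on some \<open>s\<close> outside \<open>F\<close>, the
      point \<open>x\<close> would be \<open>s\<close> itself or lie strictly between
      \<open>s\<close> and a point of the hull, which puts \<open>s\<close> into the face.\<close>
    have z: "u s = 0" if s: "s \<in> S" "s \<notin> F" for s
    proof (rule ccontr)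
      assume "u s \<noteq> 0"
      then have us: "u s > 0" using u(1)[OF s(1)] by simp
      let ?R = "S - {s}"
      have sumR: "sum u ?R = 1 - u s" using u(2) sum.remove[OF S s(1), of u] by simp
      have xs: "x = u s *\<^sub>R s + (\<Sum>s\<in>?R. u s *\<^sub>R s)" using u(3) sum.remove[OF S s(1), of "\<lambda>s. u s *\<^sub>R s"] by simp
      have Rge: "sum u ?R \<ge> 0" using u(1) by (intro sum_nonneg) auto
      show False
      proof (cases "u s = 1")
        case True
        then have "sum u ?R = 0" using sumR by simp
        then have "\<forall>r\<in>?R. u r = 0" using u(1) S by (subst (asm) sum_nonneg_eq_0_iff) auto
        then have "x = s" using xs True by simp
        then show False using x s by simp
      next
        case False
        then have l1: "1 - u s > 0" using Rge sumR by simp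
        define y where "y = (\<Sum>r\<in>?R. (u r / (1 - u s)) *\<^sub>R r)"
        have yS: "y \<in> convex hull S" unfolding y_def
        proof (rule convex_sum)
          show "(\<Sum>r\<in>?R. u r / (1 - u s)) = 1" using sumR l1 by (simp flip: sum_divide_distrib)
        qed (use S u(1) l1 in \<open>auto intro: hull_inc\<close>)
        have "(1 - u s) *\<^sub>R y = (\<Sum>r\<in>?R. u r *\<^sub>R r)" unfolding y_def scaleR_sum_right using l1 by simp
        then have x2: "x = (1 - (1 - u s)) *\<^sub>R s + (1 - u s) *\<^sub>R y" using xs by simp
        have "s \<noteq> y" using x2 x s by (auto simp flip: scaleR_add_left)
        then have "x \<in> open_segment s y" unfolding in_segment using x2 l1 us by (intro conjI exI[of _ "1 - u s"]) auto
        then show False using F x yS s hull_inc[of s S convex] unfolding face_of_def by blast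
      qed
    qed
    have SF: "S \<inter> F \<subseteq> S" "finite (S \<inter> F)" using S by auto
    have "sum u (S \<inter> F) = 1" using sum.mono_neutral_left[OF S SF(1), of u] z u(2) by auto
    moreover have "(\<Sum>s\<in>S \<inter> F. u s *\<^sub>R s) = x"
      using sum.mono_neutral_left[OF S SF(1), of "\<lambda>s. u s *\<^sub>R s"] z u(3) by auto
    ultimately show "x \<in> convex hull (S \<inter> F)" unfolding convex_hull_finite[OF SF(2)] using u(1) by auto
  qed
qed

lemma finite_faces: fixes S :: "'a::real_vector set" assumes "finite S" shows "finite {F. F face_of convex hull S}"
proof (rule finite_subset)
  show "{F. F face_of convex hull S} \<subseteq> (hull) convex ` Pow S" using face_of_hull_eq[OF assms] by blast
qed (use assms in simp)

lemma card_le_face_number: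
  fixes S :: "'a::real_vector set"
  assumes "finite S" "\<And>F. F \<in> C \<Longrightarrow> F face_of convex hull S \<and> has_aff_dim F k"
  shows "card C \<le> face_number k (convex hull S)"
proof -
  have "finite {F. F face_of convex hull S \<and> has_aff_dim F k}"
    by (rule finite_subset[OF _ finite_faces[OF assms(1)]]) auto
  moreover have "C \<subseteq> {F. F face_of convex hull S \<and> has_aff_dim F k}" using assms(2) by blast
  ultimately show ?thesis unfolding face_number_def by (rule card_mono)
qed

lemma ip_face:
  assumes S: "finite S" and M: "\<And>s. s \<in> S \<Longrightarrow> ip n s x \<le> M"
  shows "convex hull {s \<in> S. ip n s x = M} face_of convex hull S" "convex hull {s \<in> S. ip n s x = M} = {p \<in> convex hull S. ip n p x = M}"
proof -
  have cv: "convex {p. ip n p x \<le> M}" "convex {p. ip n p x = M}"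
  proof -
    show "convex {p. ip n p x \<le> M}" by (rule convexI) (auto intro: convex_bound_le)
    show "convex {p. ip n p x = M}" by (rule convexI) (simp flip: distrib_right)
  qed
  have le: "ip n p x \<le> M" if "p \<in> convex hull S" for p
    using hull_minimal[where S=convex, of S "{p. ip n p x \<le> M}"] cv(1) M that by auto
  let ?F = "{p \<in> convex hull S. ip n p x = M}"
  have "?F = convex hull S \<inter> {p. ip n p x = M}" by auto
  then have cF: "convex ?F" using cv(2) by (simp add: convex_Int)
  have F: "?F face_of convex hull S"
    unfolding face_of_def
  proof (intro conjI ballI impI cF)
    fix a b q assume a: "a \<in> convex hull S" and b: "b \<in> convex hull S" and q: "q \<in> ?F" "q \<in> open_segment a b"
    obtain u where u: "0 < u" "u < 1" "q = (1 - u) *\<^sub>R a + u *\<^sub>R b" using q(2) unfolding in_segment by auto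
    have e: "(1 - u) * ip n a x + u * ip n b x = M" using q(1) u(3) by simp
    have la: "(1 - u) * ip n a x \<le> (1 - u) * M" and lb: "u * ip n b x \<le> u * M"
      using le[OF a] le[OF b] u by (auto intro!: mult_left_mono)
    have "(1 - u) * M + u * M = M" by (simp add: algebra_simps)
    then have "(1 - u) * ip n a x = (1 - u) * M" "u * ip n b x = u * M" using e la lb by linarith+
    then show "a \<in> ?F" "b \<in> ?F" using u a b by auto
  qed auto
  have "?F = convex hull (S \<inter> ?F)" by (rule face_of_hull_eq[OF S F])
  also have "S \<inter> ?F = {s \<in> S. ip n s x = M}" by (auto intro: hull_inc)
  finally show eq: "convex hull {s \<in> S. ip n s x = M} = ?F" by simp
  show "convex hull {s \<in> S. ip n s x = M} face_of convex hull S" unfolding eq by (rule F)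
qed

lemma extreme_hull_Int:
  fixes S :: "'a::real_vector set"
  assumes "\<And>s. s \<in> S \<Longrightarrow> s extreme_point_of convex hull S" "C \<subseteq> S"
  shows "S \<inter> convex hull C = C"
proof
  show "S \<inter> convex hull C \<subseteq> C"
  proof
    fix s assume s: "s \<in> S \<inter> convex hull C"
    have sub: "convex hull C \<subseteq> convex hull S" by (rule hull_mono[OF assms(2)])
    have "s extreme_point_of convex hull C"
      using assms(1)[of s] s sub unfolding extreme_point_of_def by blast
    then show "s \<in> C" by (rule extreme_point_of_convex_hull)
  qed
  show "C \<subseteq> S \<inter> convex hull C" using assms(2) by (auto intro: hull_inc)
qed

lemma hull_inj_on:
  fixes S :: "'a::real_vector set"
  assumes "\<And>s. s \<in> S \<Longrightarrow> s extreme_point_of convex hull S"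
  shows "inj_on ((hull) convex) (Pow S)"
proof (rule inj_onI)
  fix C D assume CD: "C \<in> Pow S" "D \<in> Pow S" "convex hull C = convex hull D"
  have "S \<inter> convex hull C = C" by (rule extreme_hull_Int) (use assms CD in auto)
  moreover have "S \<inter> convex hull D = D" by (rule extreme_hull_Int) (use assms CD in auto)
  ultimately show "C = D" using CD(3) by argo
qed

text \<open>A generating set of least cardinality contains no redundant point, so it is the set of
  vertices.\<close>

lemma minimal_generators:
  fixes P :: "'a::real_vector set"
  assumes "polytope P"
  obtains S where "finite S" "P = convex hull S" "\<And>s. s \<in> S \<Longrightarrow> s \<notin> convex hull (S - {s})"
    "\<And>s. s \<in> S \<Longrightarrow> s extreme_point_of convex hull S"
proof -
  let ?Q = "\<lambda>S. finite S \<and> P = convex hull S"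
  have "\<exists>S. ?Q S" using assms unfolding polytope_def by blast
  then obtain S where S: "?Q S" "\<And>T. ?Q T \<Longrightarrow> card S \<le> card T"
    using ex_has_least_nat[of ?Q _ card] by blast
  have not: "s \<notin> convex hull (S - {s})" if s: "s \<in> S" for s
  proof
    assume "s \<in> convex hull (S - {s})"
    then have "convex hull (insert s (S - {s})) = convex hull (S - {s})" by (rule hull_redundant)
    then have "?Q (S - {s})" using S s by (simp add: insert_absorb)
    then have "card S \<le> card (S - {s})" by (rule S(2))
    then show False using card_Diff1_less[of S s] S s by simp
  qed
  have "s extreme_point_of convex hull S" if s: "s \<in> S" for s
    using extreme_point_of_convex_hull_insert[of "S - {s}" s] not[OF s] S s by (simp add: insert_absorb)
  then show thesis using that[of S] S not by blast
qed

lemma generators_exposed: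
  assumes S: "finite S" "S \<subseteq> Rn n" and not: "\<And>s. s \<in> S \<Longrightarrow> s \<notin> convex hull (S - {s})"
  shows "exposed n S"
  unfolding exposed_def
proof
  fix s assume s: "s \<in> S"
  show "\<exists>x\<in>Rn n. \<forall>b\<in>S - {s}. ip n b x < ip n s x"
  proof (cases "S - {s} = {}")
    case True then show ?thesis by (intro bexI[of _ 0]) auto
  next
    case False
    let ?C = "convex hull (S - {s})"
    have "compact ?C" using S by (intro finite_imp_compact_convex_hull) auto
    moreover have "?C \<subseteq> Rn n" by (rule hull_minimal) (use S in auto)
    moreover have "?C \<noteq> {}" using False by simp
    moreover have "s \<in> Rn n" using S s by auto
    ultimately obtain w b where w: "w \<in> Rn n" "\<And>y. y \<in> ?C \<Longrightarrow> ip n y w \<le> b" "b < ip n s w"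
      using separation[of ?C n s] not[OF s] convex_convex_hull by metis
    have "ip n c w < ip n s w" if "c \<in> S - {s}" for c using w(2)[of c] w(3) hull_inc[OF that, of convex] by simp
    then show ?thesis using w(1) by blast
  qed
qed

section \<open>The polar body and the facets\<close>

lemma mean_eq_1: fixes x y :: real assumes "x \<le> 1" "y \<le> 1" shows "(x + y) / 2 = 1 \<longleftrightarrow> x = 1 \<and> y = 1"
  using assms by auto

text \<open>\<open>zi\<close> says that the origin is interior to the hull, in the form needed for
  the polar body: every ray from 0 meets some constraint.\<close>

locale zero_interior =
  fixes n :: nat and S :: "vec set"
  assumes n: "n \<ge> 1" and S: "finite S" "S \<subseteq> Rn n"
    and zi: "\<And>w. w \<in> Rn n \<Longrightarrow> w \<noteq> 0 \<Longrightarrow> \<exists>s\<in>S. ip n s w > 0"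
begin

definition polar :: "vec set" where
  "polar = {a \<in> Rn n. \<forall>s\<in>S. ip n s a \<le> 1}"

text \<open>The constraints active at \<open>a\<close>; if \<open>a\<close> is a vertex of the polar
  body, they are the vertices of the facet with normal \<open>a\<close>.\<close>

definition tight :: "vec \<Rightarrow> vec set" where
  "tight a = {s \<in> S. ip n s a = 1}"

text \<open>The vertices of the polar body; they are the outer normals of the facets of the polytope.\<close>

definition normals :: "vec set" where
  "normals = {a \<in> polar. total n (tight a)}"

abbreviation "P \<equiv> convex hull S"

lemma P_Rn: "P \<subseteq> Rn n" by (rule hull_minimal) (use S in auto)

lemma tight_S: "tight a \<subseteq> S" "finite (tight a)" "tight a \<subseteq> Rn n"
  using S by (auto simp: tight_def)

lemma polar_le: assumes a: "a \<in> polar" and p: "p \<in> P" shows "ip n p a \<le> 1"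
proof -
  have "convex {p. ip n p a \<le> 1}" by (rule convexI) (auto intro: convex_bound_le)
  then have "P \<subseteq> {p. ip n p a \<le> 1}" using a by (intro hull_minimal) (auto simp: polar_def)
  then show ?thesis using p by auto
qed

lemma zero_polar: "0 \<in> polar" by (simp add: polar_def)

text \<open>The support function \<open>g\<close> of \<open>S\<close> has a positive minimum on the
  unit sphere, and \<open>g (a / \<bar>a\<bar>) \<le> 1 / \<bar>a\<bar>\<close> for nonzero
  \<open>a\<close> in the polar body.\<close>

lemma compact_polar: "compact polar"
proof -
  have b0: "bas 0 \<in> Rn n" "nrm n (bas 0) = 1" using n by (auto simp: nrm_def)
  have "bas 0 \<noteq> 0" using b0 by auto
  then have S0: "S \<noteq> {}" using zi[OF b0(1)] by auto
  define g where "g w = Max ((\<lambda>s. ip n s w) ` S)" for w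
  have cont: "finite T \<Longrightarrow> T \<noteq> {} \<Longrightarrow> continuous_on X (\<lambda>w. Max ((\<lambda>s. ip n s w) ` T))" for T X
  proof (induction T rule: finite_ne_induct)
    case (singleton s) then show ?case by (simp add: continuous_on_ip)
  next
    case (insert s T)
    have "(\<lambda>w. Max ((\<lambda>s. ip n s w) ` insert s T)) = (\<lambda>w. max (ip n s w) (Max ((\<lambda>s. ip n s w) ` T)))"
      using insert.hyps by (simp add: fun_eq_iff)
    moreover have "continuous_on X (\<lambda>w. max (ip n s w) (Max ((\<lambda>s. ip n s w) ` T)))"
      by (intro continuous_intros insert.IH)
    ultimately show ?case by (simp only:)
  qed
  let ?U = "{w \<in> Rn n. nrm n w = 1}"
  have "?U = Rn n \<inter> {w. nrm n w = 1}" by auto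
  moreover have "closed {w. nrm n w = 1}" by (intro closed_Collect_eq continuous_intros)
  ultimately have "closed ?U" by (simp add: closed_Int)
  then have "compact ?U" by (rule compact_Rn[of _ n 1]) auto
  moreover have "?U \<noteq> {}" using b0 by auto
  moreover have "continuous_on ?U g" unfolding g_def by (rule cont[OF S(1) S0])
  ultimately have "\<exists>x\<in>?U. \<forall>y\<in>?U. g x \<le> g y" by (rule continuous_attains_inf)
  then obtain w0 where w0: "w0 \<in> ?U" "\<And>w. w \<in> ?U \<Longrightarrow> g w0 \<le> g w" by blast
  have "w0 \<noteq> 0" using w0 by auto
  then obtain s0 where s0: "s0 \<in> S" "ip n s0 w0 > 0" using zi w0 by blast
  have "ip n s0 w0 \<le> g w0" unfolding g_def using S s0 by (intro Max_ge) auto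
  then have gp: "g w0 > 0" using s0 by simp
  show ?thesis
  proof (rule compact_Rn[of _ n "1 / g w0"])
    have "polar = Rn n \<inter> (\<Inter>s\<in>S. {a. ip n s a \<le> 1})" by (auto simp: polar_def)
    moreover have "closed {a. ip n s a \<le> 1}" for s by (intro closed_Collect_le continuous_intros)
    ultimately show "closed polar" by (auto intro!: closed_Int closed_INT)
    show "polar \<subseteq> Rn n" by (auto simp: polar_def)
    fix a assume a: "a \<in> polar"
    show "nrm n a \<le> 1 / g w0"
    proof (cases "a = 0")
      case True then show ?thesis using gp by simp
    next
      case False
      have aR: "a \<in> Rn n" using a by (simp add: polar_def)
      have na: "nrm n a > 0" by (rule nrm_pos[OF aR False])
      let ?w = "(1 / nrm n a) *\<^sub>R a"
      have w: "?w \<in> ?U" using aR na by simp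
      have "g ?w \<in> (\<lambda>s. ip n s ?w) ` S" unfolding g_def using S S0 by (intro Max_in) auto
      then obtain s where s: "s \<in> S" "g ?w = ip n s ?w" by blast
      have "g w0 \<le> ip n s ?w" using w0(2)[OF w] s by simp
      also have "\<dots> = ip n s a / nrm n a" by simp
      also have "\<dots> \<le> 1 / nrm n a" using a s na by (intro divide_right_mono) (auto simp: polar_def)
      finally show ?thesis using gp na by (simp add: field_simps)
    qed
  qed
qed

text \<open>The ratio test of linear programming: go along \<open>w\<close>, which keeps the active
  constraints active, until the first new one is met.\<close>

lemma moving:
  assumes a: "a \<in> polar" and w: "w \<in> Rn n" "w \<noteq> 0" "\<And>s. s \<in> tight a \<Longrightarrow> ip n s w = 0"
  obtains t where "t > 0" "a + t *\<^sub>R w \<in> polar" "tight a \<subset> tight (a + t *\<^sub>R w)"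
proof -
  let ?S = "{s \<in> S. ip n s w > 0}"
  let ?f = "\<lambda>s. (1 - ip n s a) / ip n s w"
  have fin: "finite (?f ` ?S)" "?f ` ?S \<noteq> {}" using S zi[OF w(1,2)] by auto
  define t where "t = Min (?f ` ?S)"
  obtain s0 where s0: "s0 \<in> ?S" "t = ?f s0" using Min_in[OF fin] unfolding t_def by blast
  have pos: "?f s > 0" if "s \<in> ?S" for s
  proof -
    have "s \<notin> tight a" using w(3)[of s] that by auto
    then have "ip n s a < 1" using a that by (auto simp: polar_def tight_def order_less_le)
    then show ?thesis using that by simp
  qed
  have t: "t > 0" unfolding s0(2) by (rule pos[OF s0(1)])
  have aR: "a \<in> Rn n" using a by (simp add: polar_def)
  have "ip n s (a + t *\<^sub>R w) \<le> 1" if s: "s \<in> S" for s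
  proof (cases "ip n s w > 0")
    case True
    then have "t \<le> ?f s" unfolding t_def using fin s by (intro Min_le) auto
    then show ?thesis using True by (simp add: field_simps)
  next
    case False
    then have "t * ip n s w \<le> 0" using t by (simp add: mult_le_0_iff)
    moreover have "ip n s a \<le> 1" using a s by (simp add: polar_def)
    ultimately show ?thesis by simp
  qed
  then have "a + t *\<^sub>R w \<in> polar" using aR w by (simp add: polar_def)
  moreover have "tight a \<subseteq> tight (a + t *\<^sub>R w)" using w(3) by (auto simp: tight_def)
  moreover have "s0 \<in> tight (a + t *\<^sub>R w)" using s0 by (simp add: tight_def)
  moreover have "s0 \<notin> tight a" using w(3)[of s0] s0(1) by auto
  ultimately show thesis using that[OF t] by blast
qed

text \<open>Among the lexicographic maximisers take one with the most active constraints. If it were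
  no vertex, \<open>moving\<close> along \<open>w\<close> or \<open>- w\<close>, whichever does not
  decrease the objectives, would give another with more. The second objective distinguishes the ends
  of an edge from other points of the same maximal face.\<close>

lemma vertex_lex:
  assumes y: "y \<in> Rn n" and z: "z \<in> Rn n"
  obtains a where "a \<in> normals" "\<And>q. q \<in> polar \<Longrightarrow> ip n q y \<le> ip n a y"
    "\<And>q. q \<in> polar \<Longrightarrow> ip n q y = ip n a y \<Longrightarrow> ip n q z \<le> ip n a z"
proof -
  have "continuous_on polar (\<lambda>q. ip n q y)" by (intro continuous_intros)
  then obtain q1 where q1: "q1 \<in> polar" "\<And>q. q \<in> polar \<Longrightarrow> ip n q y \<le> ip n q1 y"
    using continuous_attains_sup[OF compact_polar, of "\<lambda>q. ip n q y"] zero_polar by blast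
  let ?M = "polar \<inter> {q. ip n q y = ip n q1 y}"
  have "closed {q. ip n q y = ip n q1 y}" by (intro closed_Collect_eq continuous_intros)
  then have "compact ?M" using compact_polar by (rule compact_Int_closed[rotated])
  moreover have "continuous_on ?M (\<lambda>q. ip n q z)" by (intro continuous_intros)
  ultimately obtain q2 where q2: "q2 \<in> ?M" "\<And>q. q \<in> ?M \<Longrightarrow> ip n q z \<le> ip n q2 z"
    using continuous_attains_sup[of ?M "\<lambda>q. ip n q z"] q1(1) by blast
  let ?X = "\<lambda>q. q \<in> ?M \<and> ip n q z = ip n q2 z"
  have "\<exists>a. ?X a \<and> (\<forall>q. ?X q \<longrightarrow> card (tight q) \<le> card (tight a))"
    by (rule ex_has_greatest_nat[of _ q2 _ "card S + 1"])
      (use q2 card_mono[OF S(1) tight_S(1)] in \<open>auto simp: less_Suc_eq_le\<close>)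
  then obtain a where a: "?X a" "\<And>q. ?X q \<Longrightarrow> card (tight q) \<le> card (tight a)" by blast
  have "total n (tight a)" unfolding total_def
  proof (intro ballI impI, rule ccontr)
    fix w assume w: "w \<in> Rn n" "\<forall>s\<in>tight a. ip n s w = 0" "w \<noteq> 0"
    obtain w' where w': "w' \<in> Rn n" "\<And>s. s \<in> tight a \<Longrightarrow> ip n s w' = 0" "w' \<noteq> 0"
      and sg: "ip n w' y > 0 \<or> (ip n w' y = 0 \<and> ip n w' z \<ge> 0)"
    proof (cases "ip n w y > 0 \<or> (ip n w y = 0 \<and> ip n w z \<ge> 0)")
      case True then show ?thesis using that[of w] w by blast
    next
      case False
      then have "ip n w y < 0 \<or> (ip n w y = 0 \<and> ip n w z < 0)" by linarith
      then show ?thesis using that[of "- w"] w by auto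
    qed
    obtain t where t: "t > 0" "a + t *\<^sub>R w' \<in> polar" "tight a \<subset> tight (a + t *\<^sub>R w')"
      using moving[of a w'] a(1) w' by blast
    have "ip n (a + t *\<^sub>R w') y \<le> ip n a y" using q1(2)[OF t(2)] a(1) by simp
    then have "ip n w' y \<le> 0" using t(1) by (simp add: mult_le_0_iff)
    then have e: "ip n w' y = 0" "ip n w' z \<ge> 0" using sg by auto
    then have M: "a + t *\<^sub>R w' \<in> ?M" using t(2) a(1) by simp
    have "ip n (a + t *\<^sub>R w') z \<le> ip n q2 z" by (rule q2(2)[OF M])
    moreover have "ip n (a + t *\<^sub>R w') z \<ge> ip n q2 z" using e t(1) a(1) by simp
    ultimately have "?X (a + t *\<^sub>R w')" using M by simp
    then have "card (tight (a + t *\<^sub>R w')) \<le> card (tight a)" by (rule a(2))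
    moreover have "card (tight a) < card (tight (a + t *\<^sub>R w'))" by (rule psubset_card_mono[OF tight_S(2) t(3)])
    ultimately show False by simp
  qed
  then have "a \<in> normals" using a(1) by (simp add: normals_def)
  then show thesis using that[of a] a(1) q1(2) q2(2) by auto
qed

lemma normals_polar: "normals \<subseteq> polar" by (auto simp: normals_def)

lemma normals_Rn: "normals \<subseteq> Rn n" by (auto simp: normals_def polar_def)

lemma tight_subset_eq: "a \<in> normals \<Longrightarrow> b \<in> Rn n \<Longrightarrow> tight a \<subseteq> tight b \<Longrightarrow> b = a"
proof -
  assume a: "a \<in> normals" and b: "b \<in> Rn n" and s: "tight a \<subseteq> tight b"
  have "\<forall>s\<in>tight a. ip n s (b - a) = 0" using s by (auto simp: tight_def)
  moreover have "b - a \<in> Rn n" using a b normals_Rn by auto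
  ultimately have "b - a = 0" using a unfolding normals_def total_def by blast
  then show ?thesis by simp
qed

lemma finite_normals: "finite normals"
proof (rule finite_imageD)
  show "inj_on tight normals" using tight_subset_eq normals_Rn by (intro inj_onI) (metis order_refl subsetD)
  show "finite (tight ` normals)" by (rule finite_subset[of _ "Pow S"]) (use tight_S S in auto)
qed

text \<open>The bipolar theorem with vertices only: a functional separating \<open>x\<close> from
  \<open>P\<close>, scaled to be at most 1 on \<open>P\<close>, lies in the polar body and exceeds 1
  at \<open>x\<close>, hence some vertex of the polar body does too.\<close>

lemma mem_if_normals_le:
  assumes x: "x \<in> Rn n" and le: "\<And>a. a \<in> normals \<Longrightarrow> ip n x a \<le> 1" shows "x \<in> P"
proof (rule ccontr)
  assume "x \<notin> P"
  have b0: "bas 0 \<in> Rn n" "nrm n (bas 0) = 1" using n by (auto simp: nrm_def)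
  then have "bas 0 \<noteq> 0" by auto
  then have "P \<noteq> {}" using zi[OF b0(1)] by auto
  moreover have "compact P" using S(1) by (rule finite_imp_compact_convex_hull)
  ultimately obtain w b where w: "w \<in> Rn n" "w \<noteq> 0" "\<And>y. y \<in> P \<Longrightarrow> ip n y w \<le> b" "b < ip n x w"
    using separation[of P n x] P_Rn x \<open>x \<notin> P\<close> convex_convex_hull by metis
  obtain s where s: "s \<in> S" "ip n s w > 0" using zi w by blast
  have "b > 0" using w(3)[of s] s hull_inc[of s S convex] by simp
  let ?q = "(1 / b) *\<^sub>R w"
  have q: "?q \<in> polar" unfolding polar_def using w(1) w(3) \<open>b > 0\<close> hull_inc[of _ S convex] by auto
  obtain a where a: "a \<in> normals" "ip n ?q x \<le> ip n a x" using vertex_lex[OF x x] q by metis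
  have "1 < ip n ?q x" using w(4) \<open>b > 0\<close> by (simp add: ip_sym[of n w x])
  then show False using a le[OF a(1)] by (simp add: ip_sym[of n a x])
qed

lemma zero_P: "0 \<in> P" by (rule mem_if_normals_le) auto

lemma tight_nonempty: "a \<in> normals \<Longrightarrow> tight a \<noteq> {}"
proof
  assume a: "a \<in> normals" "tight a = {}"
  have "bas 0 \<in> Rn n" using n by simp
  then have "bas 0 = 0" using a unfolding normals_def total_def by auto
  then have "lk (bas 0) 0 = 0" by simp
  then show False by simp
qed

lemma normals_nonzero: "a \<in> normals \<Longrightarrow> a \<noteq> 0"
  using tight_nonempty[of a] by (auto simp: tight_def)

text \<open>The polar body contains a negative multiple of \<open>a\<close>, so a vertex maximising
  the direction \<open>- a\<close> is not \<open>a\<close>.\<close>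

lemma card_normals: "card normals \<ge> 2"
proof -
  obtain a where a: "a \<in> normals" using vertex_lex[of 0 0] by auto
  have aR: "a \<in> Rn n" "a \<noteq> 0" using a normals_Rn normals_nonzero by auto
  have "tight 0 = {}" by (simp add: tight_def)
  then have m0: "\<And>s. s \<in> tight 0 \<Longrightarrow> ip n s (- a) = 0" by simp
  have "- a \<noteq> 0" using aR by simp
  then obtain t where t: "t > 0" "0 + t *\<^sub>R (- a) \<in> polar" "tight 0 \<subset> tight (0 + t *\<^sub>R (- a))"
    by (rule moving[OF zero_polar Rn_minus[OF aR(1)] _ m0])
  obtain a' where a': "a' \<in> normals" "\<And>q. q \<in> polar \<Longrightarrow> ip n q (- a) \<le> ip n a' (- a)"
    using vertex_lex[of "- a" 0] aR by auto
  have p: "ip n a a > 0" by (rule ip_self_pos[OF aR])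
  have "ip n (0 + t *\<^sub>R (- a)) (- a) \<le> ip n a' (- a)" by (rule a'(2)[OF t(2)])
  then have "t * ip n a a \<le> - ip n a' a" by simp
  moreover have "t * ip n a a > 0" using t p by simp
  ultimately have "a' \<noteq> a" using p by auto
  then have "card {a, a'} = 2" by simp
  then show ?thesis using card_mono[OF finite_normals, of "{a, a'}"] a a'(1) by simp
qed

text \<open>The sum of the vertices of the facet is a functional that attains its maximum over the
  normals only at \<open>a\<close>.\<close>

lemma exposed_normals: "exposed n normals"
  unfolding exposed_def
proof
  fix a assume a: "a \<in> normals"
  let ?x = "\<Sum>s\<in>tight a. s"
  have val: "ip n b ?x = (\<Sum>s\<in>tight a. ip n s b)" for b unfolding ip_sum_right by (intro sum.cong refl ip_sym)
  have "ip n b ?x < ip n a ?x" if b: "b \<in> normals - {a}" for b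
  proof -
    have le: "ip n s b \<le> 1" if "s \<in> tight a" for s using b that normals_polar by (auto simp: polar_def tight_def)
    have "\<not> tight a \<subseteq> tight b" using tight_subset_eq[OF a, of b] b normals_Rn by auto
    then obtain s where s: "s \<in> tight a" "s \<notin> tight b" by blast
    then have "ip n s b \<noteq> 1" by (simp add: tight_def)
    then have lt: "ip n s b < 1" using le[OF s(1)] by simp
    have "(\<Sum>s\<in>tight a. ip n s b) < (\<Sum>s\<in>tight a. 1)"
      by (rule sum_strict_mono_ex1[OF tight_S(2)]) (use le lt s(1) in auto)
    also have "\<dots> = (\<Sum>s\<in>tight a. ip n s a)" by (intro sum.cong) (auto simp: tight_def)
    finally show ?thesis unfolding val .
  qed
  moreover have "?x \<in> Rn n" by (intro Rn_sum) (use tight_S(3)[of a] in blast)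
  ultimately show "\<exists>x\<in>Rn n. \<forall>b\<in>normals - {a}. ip n b x < ip n a x" by blast
qed

lemma facet:
  assumes a: "a \<in> polar"
  shows "convex hull (tight a) face_of P" "convex hull (tight a) = {p \<in> P. ip n p a = 1}"
proof -
  have M: "\<And>s. s \<in> S \<Longrightarrow> ip n s a \<le> 1" using a by (simp add: polar_def)
  show "convex hull (tight a) face_of P" unfolding tight_def by (rule ip_face(1)[OF S(1) M])
  show "convex hull (tight a) = {p \<in> P. ip n p a = 1}" unfolding tight_def by (rule ip_face(2)[OF S(1) M])
qed

lemma tight_eq_Int: "a \<in> polar \<Longrightarrow> S \<inter> convex hull (tight a) = tight a"
  unfolding facet(2) by (auto simp: tight_def hull_inc)

lemma tight_basis:
  assumes a: "a \<in> normals"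
  obtains B where "B \<subseteq> tight a" "finite B" "independent B" "card B = n" "tight a \<subseteq> span B" "Rn n \<subseteq> span B"
proof -
  obtain B where B: "B \<subseteq> tight a" "independent B" "tight a \<subseteq> span B" by (rule maximal_independent_subset)
  have "span (tight a) \<subseteq> span B" using B(3) by (intro span_minimal) auto
  moreover have "Rn n \<subseteq> span (tight a)" using a by (intro total_spans tight_S) (simp add: normals_def)
  ultimately have sp: "Rn n \<subseteq> span B" by blast
  have "B \<subseteq> Rn n" using B(1) tight_S(3) by blast
  then have "card B = n" "finite B" using basis_card[OF B(2) _ sp] independent_card_le[OF B(2)] by auto
  then show thesis using that B sp by blast
qed

lemma facet_dim:
  assumes a: "a \<in> normals" shows "has_aff_dim (convex hull (tight a)) (n - 1)"
proof -
  obtain B where B: "B \<subseteq> tight a" "finite B" "independent B" "card B = n" "tight a \<subseteq> span B" "Rn n \<subseteq> span B"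
    by (rule tight_basis[OF a])
  show ?thesis
  proof (rule has_aff_dim_hyperplane[OF B(2,1,3) _ B(5)])
    show "card B = n - 1 + 1" using B(4) n by simp
    show "ip n g a = 1" if "g \<in> tight a" for g using that by (simp add: tight_def)
  qed
qed

lemma facet_count: "card normals \<le> face_number (n - 1) P"
proof -
  have "inj_on (\<lambda>a. convex hull (tight a)) normals"
  proof (rule inj_onI)
    fix a b assume ab: "a \<in> normals" "b \<in> normals" "convex hull (tight a) = convex hull (tight b)"
    then have "tight a = tight b" using tight_eq_Int normals_polar by (metis subsetD)
    then show "a = b" using tight_subset_eq[OF ab(2), of a] ab normals_Rn by auto
  qed
  then have "card normals = card ((\<lambda>a. convex hull (tight a)) ` normals)" by (simp add: card_image)
  also have "\<dots> \<le> face_number (n - 1) P"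
    by (rule card_le_face_number[OF S(1)]) (use facet facet_dim normals_polar in auto)
  finally show ?thesis .
qed

lemma mid_polar:
  assumes "a \<in> polar" "a' \<in> polar"
  shows "(1/2) *\<^sub>R (a + a') \<in> polar" "tight ((1/2) *\<^sub>R (a + a')) = tight a \<inter> tight a'"
proof -
  have le: "ip n s a \<le> 1" "ip n s a' \<le> 1" if "s \<in> S" for s using assms that by (auto simp: polar_def)
  have mid: "ip n s ((1/2) *\<^sub>R (a + a')) = (ip n s a + ip n s a') / 2" for s by simp
  have "(1/2) *\<^sub>R (a + a') \<in> Rn n" using assms unfolding polar_def by blast
  moreover have "ip n s ((1/2) *\<^sub>R (a + a')) \<le> 1" if "s \<in> S" for s
    unfolding mid using add_mono[OF le[OF that]] by simp
  ultimately show "(1/2) *\<^sub>R (a + a') \<in> polar" unfolding polar_def by blast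
  have "s \<in> tight ((1/2) *\<^sub>R (a + a')) \<longleftrightarrow> s \<in> tight a \<inter> tight a'" for s
  proof -
    have "(ip n s a + ip n s a') / 2 = 1 \<longleftrightarrow> ip n s a = 1 \<and> ip n s a' = 1" if "s \<in> S" by (rule mean_eq_1[OF le[OF that]])
    then show ?thesis unfolding tight_def mem_Collect_eq Int_iff mid by blast
  qed
  then show "tight ((1/2) *\<^sub>R (a + a')) = tight a \<inter> tight a'" by blast
qed

text \<open>Let \<open>v\<close> be the part of \<open>w\<close> orthogonal to the edge and
  \<open>c\<close> its midpoint, where only the common constraints are active. If \<open>v\<close>
  is nonzero, \<open>c\<close> can be moved both ways along \<open>v\<close>, so \<open>v\<close> is
  orthogonal to \<open>x\<close> and the moved points still maximise \<open>x\<close>. But the best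
  vertex for \<open>x\<close>, then \<open>v\<close>, is an end of the edge and has the same
  \<open>v\<close>-value as \<open>c\<close>.\<close>

lemma ridge_direction:
  assumes aa: "a \<in> normals" "a' \<in> normals" "a \<noteq> a'"
    and x: "x \<in> Rn n" "ip n a' x = ip n a x" "\<And>b. b \<in> normals - {a, a'} \<Longrightarrow> ip n b x < ip n a x"
    and w: "w \<in> Rn n" "\<And>s. s \<in> tight a \<inter> tight a' \<Longrightarrow> ip n s w = 0"
  obtains r where "w = r *\<^sub>R (a' - a)"
proof -
  define d where "d = a' - a"
  have d: "d \<in> Rn n" "d \<noteq> 0" unfolding d_def using aa normals_Rn by auto
  have dd: "ip n d d > 0" by (rule ip_self_pos[OF d])
  define r where "r = ip n w d / ip n d d"
  define v where "v = w - r *\<^sub>R d"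
  have v: "v \<in> Rn n" unfolding v_def using w d by simp
  have vd: "ip n v d = 0" unfolding v_def r_def using dd by simp
  have vG: "ip n s v = 0" if "s \<in> tight a \<inter> tight a'" for s
    unfolding v_def using w(2)[OF that] that by (simp add: d_def tight_def)
  have "v = 0"
  proof (rule ccontr)
    assume v0: "v \<noteq> 0"
    define c where "c = (1/2) *\<^sub>R (a + a')"
    have pol: "a \<in> polar" "a' \<in> polar" using aa normals_polar by auto
    have c: "c \<in> polar" "tight c = tight a \<inter> tight a'" unfolding c_def using mid_polar[OF pol] by auto
    obtain t1 where t1: "t1 > 0" "c + t1 *\<^sub>R v \<in> polar" using moving[OF c(1) v v0] vG c(2) by metis
    have "- v \<in> Rn n" "- v \<noteq> 0" "\<And>s. s \<in> tight c \<Longrightarrow> ip n s (- v) = 0" using v v0 vG c(2) by auto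
    then obtain t2 where t2: "t2 > 0" "c + t2 *\<^sub>R (- v) \<in> polar" using moving[OF c(1), of "- v"] by metis
    obtain b where b: "b \<in> normals" "\<And>q. q \<in> polar \<Longrightarrow> ip n q x \<le> ip n b x"
      "\<And>q. q \<in> polar \<Longrightarrow> ip n q x = ip n b x \<Longrightarrow> ip n q v \<le> ip n b v" using vertex_lex[OF x(1) v] by blast
    have "ip n a x \<le> ip n b x" by (rule b(2)[OF pol(1)])
    then have ba: "b = a \<or> b = a'" using x(3)[of b] b(1) by force
    have bx: "ip n b x = ip n a x" using ba x(2) by auto
    have cx: "ip n c x = ip n a x" unfolding c_def using x(2) by simp
    have "ip n (c + t1 *\<^sub>R v) x \<le> ip n b x" by (rule b(2)[OF t1(2)])
    then have 1: "ip n v x \<le> 0" using t1(1) cx bx by (simp add: mult_le_0_iff)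
    have "ip n (c + t2 *\<^sub>R (- v)) x \<le> ip n b x" by (rule b(2)[OF t2(2)])
    then have 2: "ip n v x \<ge> 0" using t2(1) cx bx by (simp add: zero_le_mult_iff)
    have "ip n (c + t1 *\<^sub>R v) x = ip n b x" using 1 2 cx bx by simp
    then have "ip n (c + t1 *\<^sub>R v) v \<le> ip n b v" by (rule b(3)[OF t1(2)])
    moreover have "ip n a' v = ip n a v" using vd by (simp add: d_def ip_sym[of n v])
    moreover have "ip n b v = ip n a v" using ba calculation(2) by auto
    moreover have "ip n c v = ip n a v" unfolding c_def using calculation(2) by simp
    ultimately have "t1 * ip n v v \<le> 0" by simp
    then show False using t1(1) ip_self_pos[OF v v0] by (simp add: mult_le_0_iff)
  qed
  then have "w = r *\<^sub>R (a' - a)" by (simp add: v_def d_def)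
  then show thesis by (rule that)
qed

text \<open>By \<open>ridge_direction\<close> a basis of the span of the ridge together with the
  edge direction spans everything, so that basis has \<open>n - 1\<close> elements.\<close>

lemma ridge_dim:
  assumes n2: "n \<ge> 2" and aa: "a \<in> normals" "a' \<in> normals" "a \<noteq> a'"
    and x: "x \<in> Rn n" "ip n a' x = ip n a x" "\<And>b. b \<in> normals - {a, a'} \<Longrightarrow> ip n b x < ip n a x"
  shows "has_aff_dim (convex hull (tight a \<inter> tight a')) (n - 2)"
proof -
  let ?G = "tight a \<inter> tight a'" and ?d = "a' - a"
  have d: "?d \<in> Rn n" "?d \<noteq> 0" using aa normals_Rn by auto
  have dd: "ip n ?d ?d > 0" by (rule ip_self_pos[OF d])
  obtain B where B: "B \<subseteq> ?G" "independent B" "?G \<subseteq> span B" by (rule maximal_independent_subset)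
  have BR: "B \<subseteq> Rn n" using B(1) tight_S(3) by blast
  have fB: "finite B" using independent_card_le[OF B(2) BR] by simp
  have Bd: "ip n b ?d = 0" if "b \<in> B" for b
  proof -
    have "b \<in> tight a" "b \<in> tight a'" using B(1) that by auto
    then show ?thesis by (simp add: tight_def)
  qed
  have dB: "?d \<notin> span B" using ip_span_0[of ?d B n ?d] Bd dd by auto
  then have dnB: "?d \<notin> B" using span_base by blast
  have ind: "independent (insert ?d B)" using B(2) dB dnB by (simp add: independent_insert)
  have "total n (insert ?d B)" unfolding total_def
  proof (intro ballI impI)
    fix w assume w: "w \<in> Rn n" "\<forall>s\<in>insert ?d B. ip n s w = 0"
    have "ip n s w = 0" if "s \<in> ?G" for s using ip_span_0[of s B n w] B(3) that w by blast
    then obtain r where r: "w = r *\<^sub>R ?d" using ridge_direction[OF aa x w(1)] by blast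
    have "ip n ?d w = 0" using w(2) by blast
    then have "r * ip n ?d ?d = 0" unfolding r ip_scale_right .
    then have "r = 0" using dd by (simp del: ip_diff_left ip_diff_right)
    then show "w = 0" using r by simp
  qed
  then have "Rn n \<subseteq> span (insert ?d B)" using fB BR d by (intro total_spans) auto
  then have "card (insert ?d B) = n" using BR d by (intro basis_card ind) auto
  then have "card B + 1 = n" using fB dnB by simp
  then have cB: "card B = n - 2 + 1" using n2 by simp
  show ?thesis
    by (rule has_aff_dim_hyperplane[of B ?G "n - 2" n a]) (use B fB cB in \<open>auto simp: tight_def\<close>)
qed

text \<open>Edges of the polar body give distinct ridges: a third normal active on the same ridge
  would be collinear with the ends of the edge.\<close>

lemma ridge_count:
  assumes n2: "n \<ge> 2" shows "card normals \<le> 2 * face_number (n - 2) P"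
proof -
  define G where "G E = {s \<in> S. \<forall>a\<in>E. ip n s a = 1}" for E
  have G2: "G {a, a'} = tight a \<inter> tight a'" for a a' by (auto simp: G_def tight_def)
  have ed: "\<exists>a a' x. E = {a, a'} \<and> a \<in> normals \<and> a' \<in> normals \<and> a \<noteq> a' \<and> x \<in> Rn n \<and> ip n a' x = ip n a x
      \<and> (\<forall>b\<in>normals - {a, a'}. ip n b x < ip n a x)" if "E \<in> edges n normals" for E
    using that unfolding edges_def by blast
  have face: "convex hull (G E) face_of P \<and> has_aff_dim (convex hull (G E)) (n - 2) \<and> S \<inter> convex hull (G E) = G E" if E: "E \<in> edges n normals" for E
  proof -
    obtain a a' x where e: "E = {a, a'}" "a \<in> normals" "a' \<in> normals" "a \<noteq> a'" "x \<in> Rn n" "ip n a' x = ip n a x"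
      "\<forall>b\<in>normals - {a, a'}. ip n b x < ip n a x" using ed[OF E] by blast
    have pol: "a \<in> polar" "a' \<in> polar" using e normals_polar by auto
    note m = mid_polar[OF pol]
    show ?thesis unfolding e(1) G2
      using facet(1)[OF m(1)] tight_eq_Int[OF m(1)] ridge_dim[OF n2 e(2-6)] e(7) unfolding m(2) by blast
  qed
  have inj: "inj_on (\<lambda>E. convex hull (G E)) (edges n normals)"
  proof (rule inj_onI)
    fix E E' assume E: "E \<in> edges n normals" and E': "E' \<in> edges n normals" and eq: "convex hull (G E) = convex hull (G E')"
    have GG: "G E = G E'" using face[OF E] face[OF E'] eq by metis
    obtain a a' x where e: "E = {a, a'}" "a \<in> normals" "a' \<in> normals" "a \<noteq> a'" "x \<in> Rn n" "ip n a' x = ip n a x"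
      "\<forall>b\<in>normals - {a, a'}. ip n b x < ip n a x" using ed[OF E] by blast
    obtain b b' where e': "E' = {b, b'}" "b \<in> normals" "b' \<in> normals" "b \<noteq> b'" using ed[OF E'] by blast
    have sub: "f \<in> E" if f: "f \<in> E'" for f
    proof (rule ccontr)
      assume fE: "f \<notin> E"
      have fn: "f \<in> normals" using f e' by auto
      have fa: "f - a \<in> Rn n" using fn e normals_Rn by auto
      have "ip n s (f - a) = 0" if "s \<in> tight a \<inter> tight a'" for s
      proof -
        have "s \<in> G E" "s \<in> G E'" using that GG G2 e(1) by auto
        then have "ip n s f = 1" "ip n s a = 1" using f e(1) by (auto simp: G_def)
        then show ?thesis by simp
      qed
      then obtain r where "f - a = r *\<^sub>R (a' - a)" using ridge_direction[OF e(2-6) _ fa] e(7) by blast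
      then show False using exposed_not_collinear[OF exposed_normals e(2,3) fn e(4)] fE e(1) by auto
    qed
    then show "E = E'" using e(1,4) e'(1,4) by auto
  qed
  have "card normals \<le> 2 * card (edges n normals)"
    by (rule card_edges[OF finite_normals normals_Rn exposed_normals card_normals])
  also have "card (edges n normals) = card ((\<lambda>E. convex hull (G E)) ` edges n normals)" using inj by (simp add: card_image)
  also have "\<dots> \<le> face_number (n - 2) P" by (rule card_le_face_number[OF S(1)]) (use face in auto)
  finally show ?thesis by simp
qed

end

text \<open>A common point would give a linear relation whose coefficients on \<open>G\<close> have
  sum 1. This disjointness makes the hull of \<open>G\<close> a face of the hull of
  \<open>T\<close>.\<close>

lemma affine_convex_hull_disjoint:
  fixes T :: "'a::real_vector set"
  assumes T: "finite T" "independent T" and G: "G \<subseteq> T"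
  shows "affine hull G \<inter> convex hull (T - G) = {}"
proof (rule ccontr)
  assume "\<not> ?thesis"
  then obtain x where x: "x \<in> affine hull G" "x \<in> convex hull (T - G)" by blast
  have fG: "finite G" "finite (T - G)" using T(1) G finite_subset by auto
  obtain u where u: "sum u G = 1" "(\<Sum>v\<in>G. u v *\<^sub>R v) = x" using x(1) unfolding affine_hull_finite[OF fG(1)] by blast
  obtain v where v: "(\<Sum>t\<in>T - G. v t *\<^sub>R t) = x" using x(2) unfolding convex_hull_finite[OF fG(2)] by blast
  define w where "w t = (if t \<in> G then u t else - v t)" for t
  have "(\<Sum>t\<in>T. w t *\<^sub>R t) = (\<Sum>t\<in>T - G. w t *\<^sub>R t) + (\<Sum>t\<in>G. w t *\<^sub>R t)" by (rule sum.subset_diff[OF G T(1)])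
  also have "(\<Sum>t\<in>T - G. w t *\<^sub>R t) = - x" unfolding v[symmetric] sum_negf[symmetric] by (intro sum.cong) (auto simp: w_def)
  also have "(\<Sum>t\<in>G. w t *\<^sub>R t) = x" unfolding u(2)[symmetric] by (intro sum.cong) (auto simp: w_def)
  finally have 0: "(\<Sum>t\<in>T. w t *\<^sub>R t) = 0" by simp
  have "u g = 0" if g: "g \<in> G" for g
  proof -
    have "w g = 0" using independentD[OF T(2,1) subset_refl 0, of g] g G by blast
    then show ?thesis using g by (simp add: w_def)
  qed
  then have "sum u G = 0" by simp
  then show False using u(1) by simp
qed

section \<open>Simplicial polytopes\<close>

locale simplicial_zero_interior = zero_interior +
  assumes ext: "\<And>s. s \<in> S \<Longrightarrow> s extreme_point_of convex hull S"
    and sim: "simplicial (convex hull S)"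
begin

text \<open>A facet is a proper face because it misses the origin, so it is some simplex; its
  vertices \<open>tight a\<close> are extreme points, hence among the vertices of that
  simplex.\<close>

lemma tight_affine_indep: assumes a: "a \<in> normals" shows "\<not> affine_dependent (tight a)"
proof -
  have pa: "a \<in> polar" using a normals_polar by blast
  note F = facet[OF pa]
  have "0 \<notin> convex hull (tight a)" unfolding F(2) by simp
  then have "convex hull (tight a) \<noteq> P" using zero_P by blast
  then obtain C where C: "finite C" "\<not> affine_dependent C" "convex hull (tight a) = convex hull C"
    using sim F(1) unfolding simplicial_def by blast
  have "s \<in> C" if s: "s \<in> tight a" for s
  proof -
    have "s \<in> convex hull (tight a)" using s by (rule hull_inc)
    moreover have "s extreme_point_of P" using ext[of s] s tight_S(1)[of a] by blast
    ultimately have "s extreme_point_of convex hull (tight a)" using extreme_point_of_face[OF F(1), of s] by blast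
    then have "s extreme_point_of convex hull C" unfolding C(3) .
    then show ?thesis by (rule extreme_point_of_convex_hull)
  qed
  then show ?thesis using affine_independent_subset[OF C(2), of "tight a"] by blast
qed

text \<open>A vertex beyond a basis contained in \<open>tight a\<close> would lie in the affine hull
  of the others, as all lie in the hyperplane \<open>ip n s a = 1\<close>.\<close>

lemma tight_indep: assumes a: "a \<in> normals" shows "independent (tight a)" "card (tight a) = n"
proof -
  obtain B where B: "B \<subseteq> tight a" "finite B" "independent B" "card B = n" "tight a \<subseteq> span B" "Rn n \<subseteq> span B"
    by (rule tight_basis[OF a])
  have one: "ip n s a = 1" if "s \<in> tight a" for s using that by (simp add: tight_def)
  have "tight a \<subseteq> B"
  proof (rule ccontr)
    assume "\<not> tight a \<subseteq> B"
    then obtain s where s: "s \<in> tight a" "s \<notin> B" by blast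
    have "s \<in> span B" using B(5) s(1) by blast
    then have "s \<in> affine hull B"
      by (rule mem_affine_hull_of_span[OF B(2) _ one[OF s(1)]]) (use B(1) one in blast)
    moreover have "affine hull B \<subseteq> affine hull (tight a - {s})" by (rule hull_mono) (use B(1) s(2) in blast)
    ultimately have "affine_dependent (tight a)" unfolding affine_dependent_def using s(1) by blast
    then show False using tight_affine_indep[OF a] by blast
  qed
  then have "tight a = B" using B(1) by blast
  then show "independent (tight a)" "card (tight a) = n" using B(3,4) by simp_all
qed

lemma subface:
  assumes a: "a \<in> normals" and G: "G \<subseteq> tight a"
  shows "convex hull G face_of P" "\<not> affine_dependent G"
proof -
  have "convex hull G face_of convex hull (tight a)"
    by (rule face_of_convex_hulls[OF tight_S(2) G affine_convex_hull_disjoint[OF tight_S(2) tight_indep(1)[OF a] G]])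
  moreover have "convex hull (tight a) face_of P" using a normals_polar facet(1) by blast
  ultimately show "convex hull G face_of P" by (rule face_of_trans)
  show "\<not> affine_dependent G" by (rule affine_independent_subset[OF tight_affine_indep[OF a] G])
qed

text \<open>A face through the interior point 0 contains every \<open>s \<in> S\<close>, since 0
  lies between \<open>s\<close> and a small negative multiple of \<open>s\<close> in
  \<open>P\<close>. Fewer than \<open>n\<close> points do not span, so some \<open>s\<close> is
  outside their span.\<close>

lemma small_face_not_zero:
  assumes C: "C \<subseteq> S" "convex hull C face_of P" "card C < n"
  shows "0 \<notin> convex hull C"
proof
  assume z: "0 \<in> convex hull C"
  have fC: "finite C" using C(1) S(1) finite_subset by blast
  have CR: "C \<subseteq> Rn n" using C(1) S(2) by blast
  have "\<not> total n C" using total_card[OF fC CR] C(3) by auto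
  then obtain w where w: "w \<in> Rn n" "w \<noteq> 0" "\<And>c. c \<in> C \<Longrightarrow> ip n c w = 0" unfolding total_def by blast
  obtain s where s: "s \<in> S" "ip n s w > 0" using zi[OF w(1,2)] by blast
  have s0: "s \<noteq> 0" using s(2) by auto
  have sR: "s \<in> Rn n" using s(1) S(2) by blast
  define M where "M = (\<Sum>a\<in>normals. \<bar>ip n s a\<bar>)"
  have M: "M \<ge> 0" unfolding M_def by (intro sum_nonneg) simp
  define h where "h = 1 / (1 + M)"
  have h: "h > 0" unfolding h_def using M by simp
  have "(- h) *\<^sub>R s \<in> P"
  proof (rule mem_if_normals_le)
    show "(- h) *\<^sub>R s \<in> Rn n" using sR by (rule Rn_scale)
    fix a assume a: "a \<in> normals"
    have "- ip n s a \<le> M" unfolding M_def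
      using member_le_sum[OF a, of "\<lambda>a. \<bar>ip n s a\<bar>"] finite_normals by fastforce
    then have "h * (- ip n s a) \<le> h * M" using h by (intro mult_left_mono) auto
    also have "\<dots> \<le> 1" unfolding h_def using M by (simp add: field_simps)
    finally show "ip n ((- h) *\<^sub>R s) a \<le> 1" by simp
  qed
  moreover have "s \<in> P" using s(1) by (rule hull_inc)
  moreover have "0 \<in> open_segment s ((- h) *\<^sub>R s)" unfolding in_segment
  proof (intro conjI exI[of _ "1 / (1 + h)"])
    show "s \<noteq> (- h) *\<^sub>R s"
    proof
      assume "s = (- h) *\<^sub>R s"
      then have "ip n s w = ip n ((- h) *\<^sub>R s) w" by (rule arg_cong)
      then have "ip n s w = - h * ip n s w" by simp
      moreover have "h * ip n s w > 0" using h s(2) by simp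
      ultimately show False using s(2) by simp
    qed
    have "(1 - 1 / (1 + h)) + 1 / (1 + h) * (- h) = 0" using h by (simp add: field_simps)
    then show "0 = (1 - 1 / (1 + h)) *\<^sub>R s + (1 / (1 + h)) *\<^sub>R (- h) *\<^sub>R s"
      unfolding scaleR_scaleR scaleR_add_left[symmetric] by (simp only: scaleR_zero_left)
  qed (use h in auto)
  ultimately have "s \<in> convex hull C" using C(2) z unfolding face_of_def by blast
  then have "s \<in> span C" using convex_hull_subset_span by blast
  then have "ip n s w = 0" using w(3) by (rule ip_span_0)
  then show False using s(2) by simp
qed

text \<open>Some facet inequality is an equality at the barycentre \<open>x\<close>; otherwise
  \<open>x\<close> could be enlarged within \<open>P\<close> and would lie between 0 and a point of
  \<open>P\<close>, forcing 0 into the face. An inequality that is tight at the barycentre is tight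
  at all points of \<open>C\<close>.\<close>

lemma small_face_in_facet:
  assumes C: "C \<subseteq> S" "convex hull C face_of P" "card C < n" "C \<noteq> {}"
  obtains a where "a \<in> normals" "C \<subseteq> tight a"
proof -
  have fC: "finite C" using C(1) S(1) finite_subset by blast
  have CR: "C \<subseteq> Rn n" using C(1) S(2) by blast
  have cp: "real (card C) > 0" using fC C(4) by (simp add: card_gt_0_iff)
  define x where "x = (\<Sum>c\<in>C. (1 / real (card C)) *\<^sub>R c)"
  have xC: "x \<in> convex hull C" unfolding x_def
    by (rule convex_sum[OF fC convex_convex_hull]) (use cp in \<open>auto intro: hull_inc\<close>)
  have xP: "x \<in> P" using xC C(2) face_of_imp_subset by blast
  have xR: "x \<in> Rn n" using xP P_Rn by blast
  have x0: "x \<noteq> 0" using xC small_face_not_zero[OF C(1-3)] by metis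
  have "\<exists>a\<in>normals. ip n x a \<ge> 1"
  proof (rule ccontr)
    assume "\<not> ?thesis"
    then have lt: "ip n x a < 1" if "a \<in> normals" for a using that by (meson not_le)
    let ?X = "(\<lambda>a. 1 - ip n x a) ` normals"
    have ne: "normals \<noteq> {}" using card_normals by auto
    have X: "finite ?X" "?X \<noteq> {}" using finite_normals ne by auto
    define h where "h = Min ?X"
    have h: "h > 0" unfolding h_def using X lt by (subst Min_gr_iff) auto
    have "(1 + h) *\<^sub>R x \<in> P"
    proof (rule mem_if_normals_le)
      show "(1 + h) *\<^sub>R x \<in> Rn n" using xR by (rule Rn_scale)
      fix a assume a: "a \<in> normals"
      have hl: "h \<le> 1 - ip n x a" unfolding h_def using X a by (intro Min_le) auto
      have "h * ip n x a \<le> h * 1" using h lt[OF a] by (intro mult_left_mono) auto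
      then show "ip n ((1 + h) *\<^sub>R x) a \<le> 1" using hl by (simp add: distrib_right)
    qed
    moreover have "x \<in> open_segment 0 ((1 + h) *\<^sub>R x)" unfolding in_segment
      by (intro conjI exI[of _ "1 / (1 + h)"]) (use h x0 in auto)
    ultimately have "0 \<in> convex hull C" using C(2) xC zero_P unfolding face_of_def by blast
    then show False using small_face_not_zero[OF C(1-3)] by blast
  qed
  then obtain a where a: "a \<in> normals" "ip n x a \<ge> 1" by blast
  have le: "ip n c a \<le> 1" if "c \<in> C" for c
    using polar_le[of a c] that C(1) hull_inc[of c S convex] a(1) normals_polar by blast
  have "C \<subseteq> tight a"
  proof (rule ccontr)
    assume "\<not> C \<subseteq> tight a"
    then obtain c where c: "c \<in> C" "c \<notin> tight a" by blast
    then have "ip n c a \<noteq> 1" using C(1) by (auto simp: tight_def)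
    then have cl: "ip n c a < 1" using le[OF c(1)] by simp
    have "(\<Sum>c\<in>C. ip n c a) < (\<Sum>c\<in>C. 1)" by (rule sum_strict_mono_ex1[OF fC]) (use le c(1) cl in auto)
    then have "(\<Sum>c\<in>C. ip n c a) < real (card C)" by simp
    moreover have "ip n x a = (\<Sum>c\<in>C. ip n c a) / real (card C)" unfolding x_def ip_sum_left by (simp flip: sum_divide_distrib)
    ultimately have "ip n x a < 1" using cp by simp
    then show False using a(2) by simp
  qed
  then show thesis by (rule that[OF a(1)])
qed

text \<open>Faces given by their vertex sets; \<open>i\<close> counts vertices, so the dimension is
  \<open>i - 1\<close>.\<close>

definition simp_faces :: "nat \<Rightarrow> vec set set" where
  "simp_faces i = {C. C \<subseteq> S \<and> card C = i \<and> \<not> affine_dependent C \<and> convex hull C face_of P}"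

lemma finite_simp_faces: "finite (simp_faces i)"
  by (rule finite_subset[of _ "Pow S"]) (auto simp: simp_faces_def S)

lemma card_le_face_number_generators:
  assumes "X \<subseteq> simp_faces (k + 1)" shows "card X \<le> face_number k P"
proof -
  have sub: "X \<subseteq> Pow S" using assms by (auto simp: simp_faces_def)
  have "inj_on ((hull) convex) X" by (rule inj_on_subset[OF hull_inj_on[OF ext] sub])
  then have "card X = card ((hull) convex ` X)" by (simp add: card_image)
  also have "\<dots> \<le> face_number k P"
  proof (rule card_le_face_number[OF S(1)])
    fix F assume "F \<in> (hull) convex ` X"
    then obtain C where C: "F = convex hull C" "C \<in> X" by (rule imageE)
    have "card C = k + 1" "\<not> affine_dependent C" "convex hull C face_of P" using C(2) assms by (auto simp: simp_faces_def)
    then show "F face_of P \<and> has_aff_dim F k" unfolding C(1) using has_aff_dim_hull_indep by blast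
  qed
  finally show ?thesis .
qed

lemma simp_faces_step:
  assumes i: "1 \<le> i" "i < n"
  shows "(n - i) * card (simp_faces i) \<le> (i + 1) * card (simp_faces (i + 1))"
proof -
  let ?A = "simp_faces i" and ?B = "simp_faces (i + 1)"
  have low: "n - i \<le> card {D \<in> ?B. C \<subseteq> D}" if C: "C \<in> ?A" for C
  proof -
    have CS: "C \<subseteq> S" "convex hull C face_of P" "card C = i" using C by (auto simp: simp_faces_def)
    have fC: "finite C" using CS(1) S(1) finite_subset by blast
    have "C \<noteq> {}" using CS(3) i by auto
    then obtain a where a: "a \<in> normals" "C \<subseteq> tight a" using small_face_in_facet[OF CS(1,2)] CS(3) i by blast
    let ?f = "\<lambda>t. insert t C"
    have inj: "inj_on ?f (tight a - C)" by (rule inj_onI) blast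
    have sub: "?f ` (tight a - C) \<subseteq> {D \<in> ?B. C \<subseteq> D}"
    proof
      fix D assume "D \<in> ?f ` (tight a - C)"
      then obtain t where t: "D = insert t C" "t \<in> tight a - C" by (rule imageE)
      have D: "D \<subseteq> tight a" using t a(2) by blast
      have "card D = i + 1" using t CS(3) fC by simp
      then show "D \<in> {D \<in> ?B. C \<subseteq> D}" using subface[OF a(1) D] D tight_S(1)[of a] t(1) by (auto simp: simp_faces_def)
    qed
    have "n - i = card (tight a - C)" using tight_indep(2)[OF a(1)] CS(3) a(2) fC by (simp add: card_Diff_subset)
    also have "\<dots> = card (?f ` (tight a - C))" using inj by (simp add: card_image)
    also have "\<dots> \<le> card {D \<in> ?B. C \<subseteq> D}" using finite_simp_faces by (intro card_mono sub) auto
    finally show ?thesis .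
  qed
  have up: "card {C \<in> ?A. C \<subseteq> D} \<le> i + 1" if D: "D \<in> ?B" for D
  proof -
    have "D \<subseteq> S" and cD: "card D = i + 1" using D by (auto simp: simp_faces_def)
    then have fD: "finite D" using S(1) finite_subset by blast
    have "card {C \<in> ?A. C \<subseteq> D} \<le> card {C. C \<subseteq> D \<and> card C = i}"
      using fD by (intro card_mono) (auto simp: simp_faces_def)
    also have "\<dots> = (i + 1) choose i" using n_subsets[OF fD, of i] cD by simp
    finally show ?thesis by simp
  qed
  have "(n - i) * card ?A = (\<Sum>C\<in>?A. n - i)" by simp
  also have "\<dots> \<le> (\<Sum>C\<in>?A. card {D \<in> ?B. C \<subseteq> D})" by (intro sum_mono low)
  also have "\<dots> = (\<Sum>D\<in>?B. card {C \<in> ?A. C \<subseteq> D})"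
    by (rule sum_multicount_gen) (use finite_simp_faces in auto)
  also have "\<dots> \<le> (\<Sum>D\<in>?B. i + 1)" by (intro sum_mono up)
  finally show ?thesis by (simp add: algebra_simps)
qed

lemma simp_faces_one: "card S \<le> card (simp_faces 1)"
proof -
  have "card S = card ((\<lambda>s. {s}) ` S)" by (simp add: card_image inj_on_def)
  also have "\<dots> \<le> card (simp_faces 1)"
    using ext by (intro card_mono finite_simp_faces) (auto simp: simp_faces_def face_of_singleton)
  finally show ?thesis .
qed

lemma simp_faces_lower: "1 \<le> i \<Longrightarrow> 2 * i \<le> n + 1 \<Longrightarrow> card S \<le> card (simp_faces i)"
proof (induction i rule: dec_induct)
  case base show ?case by (rule simp_faces_one)
next
  case (step i)
  \<comment> \<open>The bound \<open>2 * (i + 1) \<le> n + 1\<close> says precisely that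
    \<open>i + 1 \<le> n - i\<close>.\<close>
  have "(i + 1) * card (simp_faces i) \<le> (n - i) * card (simp_faces i)" using step by (intro mult_right_mono) auto
  also have "\<dots> \<le> (i + 1) * card (simp_faces (i + 1))" using step by (intro simp_faces_step) auto
  finally have "card (simp_faces i) \<le> card (simp_faces (i + 1))" by (simp only: mult_le_cancel1)
  then show ?case using step by simp
qed

lemma lower_face_count:
  assumes k: "k \<le> n div 2" shows "card S \<le> 2 * face_number k P"
proof -
  have "card S \<le> 2 * card (simp_faces (k + 1))"
  proof (cases "2 * (k + 1) \<le> n + 1")
    case True then show ?thesis using simp_faces_lower[of "k + 1"] by simp
  next
    case False
    \<comment> \<open>In this middle dimension the last step from \<open>k\<close> to
      \<open>k + 1\<close> vertices may lose a factor \<open>(k + 1) / k\<close>, which is at most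
      2.\<close>
    then have nk: "n = 2 * k" using k by presburger
    have k1: "1 \<le> k" using n nk by simp
    have "card S \<le> card (simp_faces k)" using k1 nk by (intro simp_faces_lower) auto
    moreover have "card (simp_faces k) \<le> 2 * card (simp_faces (k + 1))"
    proof -
      have nkk: "n - k = k" using nk by simp
      have "(n - k) * card (simp_faces k) \<le> (k + 1) * card (simp_faces (k + 1))" using k1 nk by (intro simp_faces_step) auto
      also have "\<dots> \<le> (k * 2) * card (simp_faces (k + 1))" using k1 by (intro mult_right_mono) auto
      finally have "k * card (simp_faces k) \<le> k * (2 * card (simp_faces (k + 1)))" unfolding nkk by (simp only: mult.assoc)
      then show ?thesis using k1 by simp
    qed
    ultimately show ?thesis by (rule order_trans)
  qed
  then show ?thesis using card_le_face_number_generators[of "simp_faces (k + 1)" k] by simp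
qed

text \<open>If \<open>G\<close> contains all vertices of the facet \<open>a\<close> with positive coefficient and lies in another facet \<open>b\<close>, then \<open>\<langle>a, u\<rangle> < \<langle>b, u\<rangle>\<close>;
  hence \<open>G\<close> cannot have this property for both facets.\<close>

lemma sign_count:
  assumes u: "\<And>a. a \<in> normals \<Longrightarrow> u = (\<Sum>v\<in>tight a. c a v *\<^sub>R v)"
    and c: "\<And>a v. a \<in> normals \<Longrightarrow> v \<in> tight a \<Longrightarrow> c a v \<noteq> 0" and k: "k + 1 \<le> n"
  shows "card {a \<in> normals. card {v \<in> tight a. 0 < c a v} \<le> k + 1} \<le> face_number k P"
proof -
  let ?A = "{a \<in> normals. card {v \<in> tight a. 0 < c a v} \<le> k + 1}"
  let ?G = "\<lambda>a G. {v \<in> tight a. 0 < c a v} \<subseteq> G \<and> G \<subseteq> tight a \<and> card G = k + 1"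
  have exG: "\<exists>G. ?G a G" if a: "a \<in> ?A" for a
  proof (rule exists_subset_between)
    show "card {v \<in> tight a. 0 < c a v} \<le> k + 1" using a by simp
    show "k + 1 \<le> card (tight a)" using a k tight_indep(2)[of a] by simp
  qed (use tight_S in auto)
  define G where "G a = (SOME G. ?G a G)" for a
  have G: "?G a (G a)" if "a \<in> ?A" for a unfolding G_def by (rule someI_ex[OF exG[OF that]])
  have key: "ip n a u < ip n b u" if a: "a \<in> ?A" and b: "b \<in> normals" "a \<noteq> b" "G a \<subseteq> tight b" for a b
  proof -
    have an: "a \<in> normals" using a by simp
    note Ga = G[OF a]
    have val: "ip n d u = (\<Sum>v\<in>tight a. c a v * ip n v d)" for d
    proof -
      have "ip n d u = ip n d (\<Sum>v\<in>tight a. c a v *\<^sub>R v)" using u[OF an] by (rule arg_cong)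
      also have "\<dots> = (\<Sum>v\<in>tight a. c a v * ip n d v)" unfolding ip_sum_right ip_scale_right ..
      finally show ?thesis by (simp only: ip_sym[of n d])
    qed
    have "\<not> tight a \<subseteq> tight b" using tight_subset_eq[OF an, of b] b normals_Rn by auto
    then obtain v0 where v0: "v0 \<in> tight a" "v0 \<notin> tight b" by blast
    have le: "ip n v b \<le> 1" if "v \<in> tight a" for v using that b(1) normals_polar by (auto simp: polar_def tight_def)
    have neg: "c a v < 0" if "v \<in> tight a" "v \<notin> tight b" for v
    proof -
      have "\<not> 0 < c a v" using that Ga b(3) by blast
      then show ?thesis using c[OF an that(1)] by simp
    qed
    have lt0: "ip n v0 b < 1" using le[OF v0(1)] v0 by (auto simp: tight_def order_less_le)
    have "(\<Sum>v\<in>tight a. c a v * 1) < (\<Sum>v\<in>tight a. c a v * ip n v b)"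
    proof (rule sum_strict_mono_ex1[OF tight_S(2)])
      show "\<forall>v\<in>tight a. c a v * 1 \<le> c a v * ip n v b"
      proof
        fix v assume v: "v \<in> tight a"
        show "c a v * 1 \<le> c a v * ip n v b"
        proof (cases "v \<in> tight b")
          case True then show ?thesis by (simp add: tight_def)
        next
          case False
          then show ?thesis using neg[OF v False] le[OF v] by (intro mult_left_mono_neg) auto
        qed
      qed
      show "\<exists>v\<in>tight a. c a v * 1 < c a v * ip n v b"
        using v0(1) mult_strict_left_mono_neg[OF lt0 neg[OF v0]] by blast
    qed
    also have "(\<Sum>v\<in>tight a. c a v * 1) = (\<Sum>v\<in>tight a. c a v * ip n v a)" by (intro sum.cong) (auto simp: tight_def)
    finally show ?thesis unfolding val .
  qed
  have inj: "inj_on G ?A"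
  proof (rule inj_onI, rule ccontr)
    fix a b assume ab: "a \<in> ?A" "b \<in> ?A" "G a = G b" "a \<noteq> b"
    have bn: "a \<in> normals" "b \<in> normals" using ab(1,2) by auto
    have "G a \<subseteq> tight b" "G b \<subseteq> tight a" using G[OF ab(1)] G[OF ab(2)] ab(3) by auto
    then show False using key[OF ab(1) bn(2) ab(4)] key[OF ab(2) bn(1)] ab(4) by force
  qed
  have "G ` ?A \<subseteq> simp_faces (k + 1)"
  proof
    fix X assume "X \<in> G ` ?A"
    then obtain a where a: "X = G a" "a \<in> ?A" by (rule imageE)
    have an: "a \<in> normals" using a(2) by simp
    have X: "X \<subseteq> tight a" "card X = k + 1" using G[OF a(2)] a(1) by auto
    show "X \<in> simp_faces (k + 1)" unfolding simp_faces_def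
      using subface[OF an X(1)] X tight_S(1)[of a] by blast
  qed
  then have "card (G ` ?A) \<le> face_number k P" by (rule card_le_face_number_generators)
  then show ?thesis using inj by (simp add: card_image)
qed

text \<open>The part \<open>e\<close> of \<open>v\<close> orthogonal to the other vertices of the
  facet: pairing with it reads off the coefficient of \<open>v\<close> up to a nonzero
  factor.\<close>

lemma dual_vector:
  assumes a: "a \<in> normals" and v: "v \<in> tight a"
  obtains e where "e \<in> Rn n" "\<And>t. t \<in> tight a - {v} \<Longrightarrow> ip n t e = 0" "ip n v e \<noteq> 0"
proof -
  have T: "finite (tight a - {v})" "tight a - {v} \<subseteq> Rn n" using tight_S(2,3)[of a] by blast+
  have vR: "v \<in> Rn n" using v tight_S(3)[of a] by blast
  obtain p where p: "p \<in> span (tight a - {v})" "\<And>t. t \<in> tight a - {v} \<Longrightarrow> ip n t (v - p) = 0"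
    using orth_proj_ex[OF T] vR by blast
  define e where "e = v - p"
  have "v \<notin> span (tight a - {v})" using tight_indep(1)[OF a] v unfolding dependent_def by blast
  then have e0: "e \<noteq> 0" unfolding e_def using p(1) by auto
  have eR: "e \<in> Rn n" unfolding e_def using vR p(1) span_Rn[OF T(2)] by blast
  have pe: "ip n p e = 0" using p(1) by (rule ip_span_0) (use p(2) in \<open>simp only: e_def\<close>)
  have "ip n (e + p) e = ip n e e" using pe by simp
  then have "ip n v e = ip n e e" by (simp add: e_def)
  then have "ip n v e \<noteq> 0" using ip_self_pos[OF eR e0] by simp
  then show thesis using that[OF eR] p(2) unfolding e_def by blast
qed

text \<open>For generic \<open>u\<close> all coefficients at all facets are nonzero. A facet has
  \<open>n \<le> 2 * (k + 1)\<close> vertices, so at most \<open>k + 1\<close> coefficients are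
  positive or at most \<open>k + 1\<close> are negative; \<open>sign_count\<close> is used for
  \<open>u\<close> and for \<open>- u\<close>, hence the factor 2.\<close>

lemma upper_face_count:
  assumes k: "k + 1 \<le> n" "n \<le> 2 * (k + 1)" shows "card normals \<le> 2 * face_number k P"
proof -
  let ?E = "\<lambda>a v e. e \<in> Rn n \<and> (\<forall>t\<in>tight a - {v}. ip n t e = 0) \<and> ip n v e \<noteq> 0"
  define e where "e a v = (SOME e. ?E a v e)" for a v
  have e: "?E a v (e a v)" if "a \<in> normals" "v \<in> tight a" for a v
  proof -
    have "\<exists>e. ?E a v e" using dual_vector[OF that] by metis
    then show ?thesis unfolding e_def by (rule someI_ex)
  qed
  let ?D = "(\<lambda>(a, v). e a v) ` Sigma normals tight"
  have "finite ?D" using finite_normals tight_S(2) by (intro finite_imageI finite_SigmaI)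
  moreover have "?D \<subseteq> Rn n - {0}"
  proof
    fix x assume "x \<in> ?D"
    then obtain q where q: "x = (\<lambda>(a, v). e a v) q" "q \<in> Sigma normals tight" by (rule imageE)
    obtain a v where av: "q = (a, v)" by (cases q)
    have m: "a \<in> normals" "v \<in> tight a" using q(2) av by auto
    have x: "x = e a v" using q(1) av by simp
    show "x \<in> Rn n - {0}" using e[OF m] unfolding x by auto
  qed
  ultimately obtain u where u: "u \<in> Rn n" "\<And>d. d \<in> ?D \<Longrightarrow> ip n d u \<noteq> 0" by (rule generic_vector) blast
  have "\<exists>c. u = (\<Sum>v\<in>tight a. c v *\<^sub>R v)" if a: "a \<in> normals" for a
  proof -
    have "total n (tight a)" using a by (simp add: normals_def)
    then have "u \<in> span (tight a)" using total_spans[OF tight_S(2,3)] u(1) by blast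
    then show ?thesis unfolding span_finite[OF tight_S(2)] by blast
  qed
  then obtain c where c: "\<And>a. a \<in> normals \<Longrightarrow> u = (\<Sum>v\<in>tight a. c a v *\<^sub>R v)" by metis
  have c0: "c a v \<noteq> 0" if a: "a \<in> normals" and v: "v \<in> tight a" for a v
  proof
    assume z: "c a v = 0"
    note E = e[OF a v]
    have "ip n u (e a v) = ip n (\<Sum>t\<in>tight a. c a t *\<^sub>R t) (e a v)" using c[OF a] by (rule arg_cong)
    also have "\<dots> = (\<Sum>t\<in>tight a. c a t * ip n t (e a v))" unfolding ip_sum_left ip_scale_left ..
    also have "\<dots> = 0"
    proof (rule sum.neutral, rule ballI)
      fix t assume "t \<in> tight a"
      then show "c a t * ip n t (e a v) = 0" using E z by (cases "t = v") auto
    qed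
    finally have "ip n (e a v) u = 0" by (simp only: ip_sym[of n u])
    moreover have "e a v \<in> ?D" by (rule image_eqI[of _ _ "(a, v)"]) (use a v in auto)
    ultimately show False using u(2) by blast
  qed
  let ?A1 = "{a \<in> normals. card {v \<in> tight a. 0 < c a v} \<le> k + 1}"
  let ?A2 = "{a \<in> normals. card {v \<in> tight a. 0 < - c a v} \<le> k + 1}"
  have A1: "card ?A1 \<le> face_number k P" by (rule sign_count[OF c c0 k(1)])
  have A2: "card ?A2 \<le> face_number k P"
  proof (rule sign_count[where u="- u"])
    show "- u = (\<Sum>v\<in>tight a. (- c a v) *\<^sub>R v)" if "a \<in> normals" for a
      unfolding scaleR_minus_left sum_negf using c[OF that] by (rule arg_cong)
  qed (use c0 k in auto)
  have "normals \<subseteq> ?A1 \<union> ?A2"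
  proof
    fix a assume a: "a \<in> normals"
    let ?p = "{v \<in> tight a. 0 < c a v}" and ?q = "{v \<in> tight a. 0 < - c a v}"
    have "card ?p + card ?q = card (?p \<union> ?q)" using tight_S(2)[of a] by (intro card_Un_disjoint[symmetric]) auto
    also have "\<dots> \<le> card (tight a)" using tight_S(2) by (intro card_mono) auto
    finally have "card ?p + card ?q \<le> 2 * (k + 1)" using tight_indep(2)[OF a] k(2) by simp
    then show "a \<in> ?A1 \<union> ?A2" using a by auto
  qed
  then have "card normals \<le> card (?A1 \<union> ?A2)" using finite_normals by (intro card_mono) auto
  also have "\<dots> \<le> card ?A1 + card ?A2" by (rule card_Un_le)
  finally show ?thesis using A1 A2 by simp
qed

end

section \<open>Combining the cap counts with the face counts\<close>

lemma zero_interiorI: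
  assumes n: "n \<ge> 1" and S: "finite S" "S \<subseteq> Rn n"
    and p: "\<And>w. w \<in> Rn n \<Longrightarrow> w \<noteq> 0 \<Longrightarrow> \<exists>p\<in>convex hull S. ip n p w > 0"
  shows "zero_interior n S"
proof
  fix w assume w: "w \<in> Rn n" "w \<noteq> 0"
  show "\<exists>s\<in>S. ip n s w > 0"
  proof (rule ccontr)
    assume "\<not> ?thesis"
    then have "S \<subseteq> {p. ip n p w \<le> 0}" by (auto simp: not_less)
    moreover have "convex {p. ip n p w \<le> 0}" by (rule convexI) (auto intro!: convex_bound_le)
    ultimately have "convex hull S \<subseteq> {p. ip n p w \<le> 0}" by (rule hull_minimal)
    then show False using p[OF w] by auto
  qed
qed (use assms in auto)

lemma intrinsic_volume_ball_pos:
  assumes "n \<ge> 2" "j \<le> n" shows "intrinsic_volume n j (unit_ball n) > 0"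
proof -
  have n1: "n \<ge> 1" using assms by simp
  have "intrinsic_volume n j (unit_ball n) = gam n (n - j) * Phi n (n - j) (cb n 1)"
    unfolding unit_ball_cb by (rule intrinsic_volume_Phi[OF n1 body_cb assms(2)]) simp
  then show ?thesis using gam_pos[OF n1] Phi_cb1_pos[OF n1, of "n - j"] by simp
qed

lemma card_generators_bound:
  assumes n: "n \<ge> 2" and j: "1 \<le> j" "j \<le> n - 1" and S: "finite S" "S \<subseteq> cb n 1" "S \<noteq> {}"
    and e: "\<epsilon> > 0" "12 * (real n)\<^sup>2 * \<epsilon> \<le> real j * intrinsic_volume n j (unit_ball n)"
    and d: "intrinsic_volume n j (unit_ball n) - intrinsic_volume n j (convex hull S) \<le> \<epsilon>"
  shows "exp (- 6) / 4 * (real j * intrinsic_volume n j (unit_ball n) / (2 * \<epsilon>)) powr ((real n - 1) / 2) * ln (real n) \<le> real (card S)"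
proof (rule count_bound[OF n j(1) intrinsic_volume_ball_pos[OF n] e])
  show "j \<le> n" using j by simp
  fix t0 :: real
  assume t: "0 < t0" "t0 < 1" "real (card S) * (cn n * (sqrt (2 * t0) / (1 - t0)) ^ (n - 1)) \<le> 1"
  show "intrinsic_volume n j (unit_ball n) * (real j * t0 * (1 - t0) ^ n * (1 - yM n)) \<le> \<epsilon>"
    using deficit_inscribed[OF n j t(1,2) refl S t(3)] d by linarith
qed simp

lemma card_normals_bound:
  assumes n: "n \<ge> 2" and j: "1 \<le> j" "j \<le> n - 1" and P: "body n P" "cb n 1 \<subseteq> P"
    and V: "finite V" "V \<subseteq> cb n 1 - {0}" "\<And>x. x \<in> Rn n \<Longrightarrow> (\<And>v. v \<in> V \<Longrightarrow> ip n x v \<le> 1) \<Longrightarrow> x \<in> P"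
    and e: "\<epsilon> > 0" "12 * (real n)\<^sup>2 * \<epsilon> \<le> real j * intrinsic_volume n j (unit_ball n)"
    and d: "intrinsic_volume n j P - intrinsic_volume n j (unit_ball n) \<le> \<epsilon>"
  shows "exp (- 6) / 4 * (real j * intrinsic_volume n j (unit_ball n) / (2 * \<epsilon>)) powr ((real n - 1) / 2) * ln (real n) \<le> real (card V)"
proof (rule count_bound[OF n j(1) intrinsic_volume_ball_pos[OF n] e])
  show "j \<le> n" using j by simp
  fix t0 :: real
  assume t: "0 < t0" "t0 < 1" "real (card V) * (cn n * (sqrt (2 * t0) / (1 - t0)) ^ (n - 1)) \<le> 1"
  show "intrinsic_volume n j (unit_ball n) * (real j * t0 * (1 - t0) ^ n * (1 - yM n)) \<le> \<epsilon>"
  proof (rule order_trans[OF _ d])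
    show "intrinsic_volume n j (unit_ball n) * (real j * t0 * (1 - t0) ^ n * (1 - yM n)) \<le> intrinsic_volume n j P - intrinsic_volume n j (unit_ball n)"
      by (rule deficit_circumscribed[OF n j t(1,2) refl P V(1,2) _ t(3)]) (rule V(3))
  qed
qed simp

lemma vertex_count:
  fixes S :: "'a::real_vector set"
  assumes S: "finite S" and ext: "\<And>s. s \<in> S \<Longrightarrow> s extreme_point_of convex hull S"
  shows "card S \<le> face_number 0 (convex hull S)"
proof -
  have "card S = card ((\<lambda>s. {s}) ` S)" by (simp add: card_image inj_on_def)
  also have "\<dots> \<le> face_number 0 (convex hull S)"
  proof (rule card_le_face_number[OF S])
    fix F assume "F \<in> (\<lambda>s. {s}) ` S"
    then obtain s where s: "F = {s}" "s \<in> S" by (rule imageE)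
    have "has_aff_dim (convex hull {s}) 0" by (rule has_aff_dim_hull_indep) (simp_all add: affine_independent_1)
    then show "F face_of convex hull S \<and> has_aff_dim F 0" using s ext by (simp add: face_of_singleton)
  qed
  finally show ?thesis .
qed

lemma edge_count:
  assumes S: "finite S" "S \<subseteq> Rn n" "card S \<ge> 2" and E: "exposed n S"
    and ext: "\<And>s. s \<in> S \<Longrightarrow> s extreme_point_of convex hull S"
  shows "card S \<le> 2 * face_number 1 (convex hull S)"
proof -
  have sub: "edges n S \<subseteq> Pow S" by (auto simp: edges_def)
  have "inj_on ((hull) convex) (edges n S)" by (rule inj_on_subset[OF hull_inj_on[OF ext] sub])
  then have "card (edges n S) = card ((hull) convex ` edges n S)" by (simp add: card_image)
  also have "\<dots> \<le> face_number 1 (convex hull S)"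
  proof (rule card_le_face_number[OF S(1)])
    fix F assume "F \<in> (hull) convex ` edges n S"
    then obtain e where e: "F = convex hull e" "e \<in> edges n S" by (rule imageE)
    obtain a a' x where a: "e = {a, a'}" "a \<in> S" "a' \<in> S" "a \<noteq> a'" "ip n a' x = ip n a x"
      "\<And>b. b \<in> S - {a, a'} \<Longrightarrow> ip n b x < ip n a x" using e(2) unfolding edges_def by blast
    have le: "ip n s x \<le> ip n a x" if "s \<in> S" for s using a(5) a(6)[of s] that by force
    have "{s \<in> S. ip n s x = ip n a x} = e" unfolding a(1) using a(2,3,5,6) by force
    then have "convex hull e face_of convex hull S" using ip_face(1)[OF S(1) le] by simp
    moreover have "has_aff_dim (convex hull e) 1"
      unfolding a(1) by (rule has_aff_dim_hull_indep) (use a(4) in \<open>simp_all add: affine_independent_2\<close>)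
    ultimately show "F face_of convex hull S \<and> has_aff_dim F 1" unfolding e(1) by blast
  qed
  finally show ?thesis using card_edges[OF S(1,2) E S(3)] by simp
qed

lemma inscribed_faces:
  assumes n2: "n \<ge> 2" and j: "1 \<le> j" "j \<le> n - 1"
    and P: "polytope P" "P \<subseteq> unit_ball n" "P \<noteq> {}"
    and int: "\<And>w. w \<in> Rn n \<Longrightarrow> w \<noteq> 0 \<Longrightarrow> \<exists>p\<in>P. ip n p w > 0"
    and e: "\<epsilon> > 0" "12 * (real n)\<^sup>2 * \<epsilon> \<le> real j * intrinsic_volume n j (unit_ball n)"
    and d: "intrinsic_volume n j (unit_ball n) - intrinsic_volume n j P \<le> \<epsilon>"
    and k: "k \<le> 1 \<or> (simplicial P \<and> k \<le> n div 2)"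
  shows "real (face_number k P) \<ge> exp (- 6) / 8 * (real j * intrinsic_volume n j (unit_ball n) / (2 * \<epsilon>)) powr ((real n - 1) / 2) * ln (real n)"
proof -
  have n1: "n \<ge> 1" using n2 by simp
  obtain S where gen: "finite S" "P = convex hull S" and not: "\<And>s. s \<in> S \<Longrightarrow> s \<notin> convex hull (S - {s})"
    and ext: "\<And>s. s \<in> S \<Longrightarrow> s extreme_point_of convex hull S" using minimal_generators[OF P(1)] by metis
  have Sc: "S \<subseteq> cb n 1" using P(2) hull_subset[of S convex] unfolding gen(2) unit_ball_cb by blast
  have SR: "S \<subseteq> Rn n" using Sc cb_sub[of n 1] by blast
  have S0: "S \<noteq> {}" using P(3) gen(2) by auto
  interpret zero_interior n S
    by (rule zero_interiorI[OF n1 gen(1) SR int[unfolded gen(2)]])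
  have "total n S" unfolding total_def
  proof (intro ballI impI, rule ccontr)
    fix w assume "w \<in> Rn n" "\<forall>s\<in>S. ip n s w = 0" "w \<noteq> 0"
    then show False using zi[of w] by force
  qed
  then have c2: "card S \<ge> 2" using total_card[OF gen(1) SR] n2 by simp
  have "card S \<le> 2 * face_number k P"
  proof -
    consider "k = 0" | "k = 1" | "simplicial P" "k \<le> n div 2" using k by linarith
    then show ?thesis
    proof cases
      case 1 then show ?thesis using vertex_count[OF gen(1) ext] gen(2) by simp
    next
      case 2 then show ?thesis using edge_count[OF gen(1) SR c2 generators_exposed[OF gen(1) SR not] ext] gen(2) by simp
    next
      case 3
      interpret simplicial_zero_interior n S by unfold_locales (use ext 3(1) gen(2) in auto)
      show ?thesis using lower_face_count[OF 3(2)] gen(2) by simp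
    qed
  qed
  then have "real (card S) \<le> 2 * real (face_number k P)" by linarith
  moreover have "exp (- 6) / 4 * (real j * intrinsic_volume n j (unit_ball n) / (2 * \<epsilon>)) powr ((real n - 1) / 2) * ln (real n) \<le> real (card S)"
    by (rule card_generators_bound[OF n2 j gen(1) Sc S0 e]) (use d gen(2) in simp)
  ultimately show ?thesis by simp
qed

lemma circumscribed_faces:
  assumes n2: "n \<ge> 2" and j: "1 \<le> j" "j \<le> n - 1"
    and P: "polytope P" "P \<subseteq> Rn n" "unit_ball n \<subseteq> P"
    and e: "\<epsilon> > 0" "12 * (real n)\<^sup>2 * \<epsilon> \<le> real j * intrinsic_volume n j (unit_ball n)"
    and d: "intrinsic_volume n j P - intrinsic_volume n j (unit_ball n) \<le> \<epsilon>"
    and k: "k = n - 2 \<or> k = n - 1 \<or> (simplicial P \<and> k + 1 \<le> n \<and> n \<le> 2 * (k + 1))"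
  shows "real (face_number k P) \<ge> exp (- 6) / 8 * (real j * intrinsic_volume n j (unit_ball n) / (2 * \<epsilon>)) powr ((real n - 1) / 2) * ln (real n)"
proof -
  have n1: "n \<ge> 1" using n2 by simp
  obtain S where gen: "finite S" "P = convex hull S"
    and ext: "\<And>s. s \<in> S \<Longrightarrow> s extreme_point_of convex hull S" using minimal_generators[OF P(1)] by metis
  have SR: "S \<subseteq> Rn n" using P(2) hull_subset[of S convex] unfolding gen(2) by blast
  have cbP: "cb n 1 \<subseteq> P" using P(3) unfolding unit_ball_cb .
  have dir: "(1 / nrm n w) *\<^sub>R w \<in> P" "nrm n w > 0" if "w \<in> Rn n" "w \<noteq> 0" for w
  proof -
    show np: "nrm n w > 0" by (rule nrm_pos[OF that])
    have "(1 / nrm n w) *\<^sub>R w \<in> cb n 1" using that(1) np by (simp add: cb_def)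
    then show "(1 / nrm n w) *\<^sub>R w \<in> P" using cbP by blast
  qed
  interpret zero_interior n S
  proof (rule zero_interiorI[OF n1 gen(1) SR])
    fix w assume w: "w \<in> Rn n" "w \<noteq> 0"
    have "ip n ((1 / nrm n w) *\<^sub>R w) w > 0" using dir(2)[OF w] ip_self_pos[OF w] by simp
    then show "\<exists>p\<in>convex hull S. ip n p w > 0" using dir(1)[OF w] unfolding gen(2) by blast
  qed
  \<comment> \<open>The unit vector in the direction of \<open>a\<close> lies in the ball, hence in
    \<open>P\<close>, and its inner product with \<open>a\<close> is \<open>nrm n a\<close>.\<close>
  have nc: "normals \<subseteq> cb n 1 - {0}"
  proof
    fix a assume a: "a \<in> normals"
    have aR: "a \<in> Rn n" "a \<noteq> 0" using a normals_Rn normals_nonzero by auto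
    have ap: "a \<in> polar" using a normals_polar by blast
    have "ip n ((1 / nrm n a) *\<^sub>R a) a \<le> 1" using dir(1)[OF aR] unfolding gen(2) by (rule polar_le[OF ap])
    moreover have "ip n ((1 / nrm n a) *\<^sub>R a) a = nrm n a" using dir(2)[OF aR] by (simp add: ip_self_eq power2_eq_square)
    ultimately show "a \<in> cb n 1 - {0}" using aR by (simp add: cb_def)
  qed
  have "P \<noteq> {}" using zero_P gen(2) by auto
  then have body: "body n P" unfolding body_def using gen P(2) by (auto intro: finite_imp_compact_convex_hull)
  have "card normals \<le> 2 * face_number k P"
  proof -
    consider "k = n - 2" | "k = n - 1" | "simplicial P" "k + 1 \<le> n" "n \<le> 2 * (k + 1)" using k by blast
    then show ?thesis
    proof cases
      case 1 then show ?thesis using ridge_count[OF n2] gen(2) by simp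
    next
      case 2 then show ?thesis using facet_count gen(2) by simp
    next
      case 3
      interpret simplicial_zero_interior n S by unfold_locales (use ext 3(1) gen(2) in auto)
      show ?thesis using upper_face_count[OF 3(2,3)] gen(2) by simp
    qed
  qed
  then have "real (card normals) \<le> 2 * real (face_number k P)" by linarith
  moreover have "exp (- 6) / 4 * (real j * intrinsic_volume n j (unit_ball n) / (2 * \<epsilon>)) powr ((real n - 1) / 2) * ln (real n) \<le> real (card normals)"
    by (rule card_normals_bound[OF n2 j body cbP finite_normals nc _ e d]) (use mem_if_normals_le gen(2) in simp)
  ultimately show ?thesis by simp
qed

theorem corollary3:
  shows "\<exists>c5 > (0::real). \<exists>c6 > (0::real). \<forall>n::nat. \<forall>j::nat. n \<ge> 2 \<longrightarrow> j \<in> {1..n - 1} \<longrightarrow>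
    (\<forall>\<^sub>F \<epsilon>::real in at_right 0.
      (\<forall>P. polytope P \<and> P \<subseteq> Rn n \<and> P \<subseteq> unit_ball n \<and>
           intrinsic_volume n j (unit_ball n) - intrinsic_volume n j P \<le> \<epsilon> \<longrightarrow>
         (simplicial P \<longrightarrow> (\<forall>k \<in> {0..n div 2}. real (face_number k P) \<ge>
            c5 * (real j * intrinsic_volume n j (unit_ball n) / (2 * \<epsilon>)) powr ((real n - 1) / 2) * ln (real n))) \<and>
         (\<forall>k \<in> {0, 1}. real (face_number k P) \<ge>
            c5 * (real j * intrinsic_volume n j (unit_ball n) / (2 * \<epsilon>)) powr ((real n - 1) / 2) * ln (real n))) \<and>
      (\<forall>P. polytope P \<and> P \<subseteq> Rn n \<and> unit_ball n \<subseteq> P \<and>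
           intrinsic_volume n j P - intrinsic_volume n j (unit_ball n) \<le> \<epsilon> \<longrightarrow>
         (simplicial P \<longrightarrow> (\<forall>k \<in> {(3 * (n - 1)) div 4..n - 1}. real (face_number k P) \<ge>
            c6 * (real j * intrinsic_volume n j (unit_ball n) / (2 * \<epsilon>)) powr ((real n - 1) / 2) * ln (real n))) \<and>
         (\<forall>k \<in> {n - 2, n - 1}. real (face_number k P) \<ge>
            c6 * (real j * intrinsic_volume n j (unit_ball n) / (2 * \<epsilon>)) powr ((real n - 1) / 2) * ln (real n))))"
\<comment> \<open>Half of the constant in \<open>count_bound\<close>, because every face comparison
  loses a factor of at most 2.\<close>
proof (rule exI[of _ "exp (- 6) / 8"], rule conjI, simp, rule exI[of _ "exp (- 6) / 8"], rule conjI, simp, intro allI impI)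
  fix n j :: nat
  assume n: "n \<ge> 2" and j': "j \<in> {1..n - 1}"
  have j: "1 \<le> j" "j \<le> n - 1" using j' by auto
  let ?V = "intrinsic_volume n j (unit_ball n)"
  have V: "?V > 0" using j by (intro intrinsic_volume_ball_pos[OF n]) simp
  obtain e0 where e0: "e0 > 0" "\<And>P w. body n P \<Longrightarrow> P \<subseteq> cb n 1 \<Longrightarrow> ?V - intrinsic_volume n j P < e0 \<Longrightarrow>
      w \<in> Rn n \<Longrightarrow> w \<noteq> 0 \<Longrightarrow> \<exists>p\<in>P. ip n p w > 0"
  proof (rule origin_interior[OF n j], goal_cases)
    case (1 e0)
    show thesis by (rule 1(1)[OF 1(2) 1(3)])
  qed
  \<comment> \<open>The three terms keep the origin interior, exclude the empty polytope, and give
    the smallness required by \<open>count_bound\<close>.\<close>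
  define b where "b = min (min e0 ?V) (real j * ?V / (12 * (real n)\<^sup>2))"
  have b: "b > 0" unfolding b_def using e0(1) V n j by simp
  have small: "\<epsilon> < e0 \<and> \<epsilon> < ?V \<and> 12 * (real n)\<^sup>2 * \<epsilon> \<le> real j * ?V" if "\<epsilon> < b" for \<epsilon>
  proof -
    have "\<epsilon> < real j * ?V / (12 * (real n)\<^sup>2)" "\<epsilon> < e0" "\<epsilon> < ?V" using that by (simp_all add: b_def)
    then show ?thesis using n by (simp add: field_simps)
  qed
  have inscribed: "real (face_number k P) \<ge>
      exp (- 6) / 8 * (real j * ?V / (2 * \<epsilon>)) powr ((real n - 1) / 2) * ln (real n)"
    if \<epsilon>: "\<epsilon> > 0" "\<epsilon> < b" and P: "polytope P \<and> P \<subseteq> Rn n \<and> P \<subseteq> unit_ball n \<and> ?V - intrinsic_volume n j P \<le> \<epsilon>"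
      and k: "k \<le> 1 \<or> (simplicial P \<and> k \<le> n div 2)" for \<epsilon> P k
  proof -
    note sm = small[OF \<epsilon>(2)]
    \<comment> \<open>The empty set is a polytope in the ball, so it has to be excluded by its
      deficit.\<close>
    have "intrinsic_volume n j {} = 0" using j by (intro intrinsic_volume_empty) simp
    then have P0: "P \<noteq> {}" using P sm by force
    have Pp: "polytope P" "P \<subseteq> Rn n" "P \<subseteq> unit_ball n" "?V - intrinsic_volume n j P \<le> \<epsilon>" using P by auto
    have body: "body n P" unfolding body_def using Pp P0 by (auto intro: polytope_imp_compact polytope_imp_convex)
    have lt: "?V - intrinsic_volume n j P < e0" using Pp(4) sm by linarith
    have cb: "P \<subseteq> cb n 1" using Pp(3) unfolding unit_ball_cb .
    have e12: "12 * (real n)\<^sup>2 * \<epsilon> \<le> real j * ?V" using sm by blast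
    show ?thesis by (rule inscribed_faces[OF n j Pp(1,3) P0 e0(2)[OF body cb lt] \<epsilon>(1) e12 Pp(4) k])
  qed
  have circumscribed: "real (face_number k P) \<ge>
      exp (- 6) / 8 * (real j * ?V / (2 * \<epsilon>)) powr ((real n - 1) / 2) * ln (real n)"
    if \<epsilon>: "\<epsilon> > 0" "\<epsilon> < b" and P: "polytope P \<and> P \<subseteq> Rn n \<and> unit_ball n \<subseteq> P \<and> intrinsic_volume n j P - ?V \<le> \<epsilon>"
      and k: "k = n - 2 \<or> k = n - 1 \<or> (simplicial P \<and> k + 1 \<le> n \<and> n \<le> 2 * (k + 1))" for \<epsilon> P k
  proof -
    have Pp: "polytope P" "P \<subseteq> Rn n" "unit_ball n \<subseteq> P" "intrinsic_volume n j P - ?V \<le> \<epsilon>" using P by auto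
    have e12: "12 * (real n)\<^sup>2 * \<epsilon> \<le> real j * ?V" using small[OF \<epsilon>(2)] by blast
    show ?thesis by (rule circumscribed_faces[OF n j Pp(1-3) \<epsilon>(1) e12 Pp(4) k])
  qed
  show "\<forall>\<^sub>F \<epsilon>::real in at_right 0.
      (\<forall>P. polytope P \<and> P \<subseteq> Rn n \<and> P \<subseteq> unit_ball n \<and> ?V - intrinsic_volume n j P \<le> \<epsilon> \<longrightarrow>
         (simplicial P \<longrightarrow> (\<forall>k \<in> {0..n div 2}. real (face_number k P) \<ge>
            exp (- 6) / 8 * (real j * ?V / (2 * \<epsilon>)) powr ((real n - 1) / 2) * ln (real n))) \<and>
         (\<forall>k \<in> {0, 1}. real (face_number k P) \<ge>
            exp (- 6) / 8 * (real j * ?V / (2 * \<epsilon>)) powr ((real n - 1) / 2) * ln (real n))) \<and>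
      (\<forall>P. polytope P \<and> P \<subseteq> Rn n \<and> unit_ball n \<subseteq> P \<and> intrinsic_volume n j P - ?V \<le> \<epsilon> \<longrightarrow>
         (simplicial P \<longrightarrow> (\<forall>k \<in> {(3 * (n - 1)) div 4..n - 1}. real (face_number k P) \<ge>
            exp (- 6) / 8 * (real j * ?V / (2 * \<epsilon>)) powr ((real n - 1) / 2) * ln (real n))) \<and>
         (\<forall>k \<in> {n - 2, n - 1}. real (face_number k P) \<ge>
            exp (- 6) / 8 * (real j * ?V / (2 * \<epsilon>)) powr ((real n - 1) / 2) * ln (real n)))"
    unfolding eventually_at_right_field
  proof (intro exI[of _ b] conjI b allI impI ballI, goal_cases)
    case (1 \<epsilon> P k)
    then show ?case by (intro inscribed) auto
  next
    case (2 \<epsilon> P k)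
    then show ?case by (intro inscribed) auto
  next
    case (3 \<epsilon> P k)
    then have "3 * (n - 1) div 4 \<le> k" "k \<le> n - 1" by auto
    \<comment> \<open>The floor gives \<open>3 * (n - 1) \<le> 4 * k + 3\<close>; together with
      \<open>k \<ge> 0\<close> this implies \<open>n \<le> 2 * (k + 1)\<close>.\<close>
    moreover from this have "3 * n \<le> 4 * k + 6" using n by linarith
    ultimately have "k + 1 \<le> n" "n \<le> 2 * (k + 1)" using n by simp_all
    then show ?case using 3 by (intro circumscribed) auto
  next
    case (4 \<epsilon> P k)
    then show ?case by (intro circumscribed) auto
  qed
qed

end
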